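(* Let $p$ be a prime, $\alpha>0$, and let $(\mathfrak D^\alpha,\mathcal D)$ be the operator of $p$-adic fractional derivative of order $\alpha$ on $\mathbb Q_p$. For any $1\le q<\infty$, the operator $\mathfrak D^\alpha$ admits a closed extension $\mathfrak D^\alpha_q$ in $L^q=L^q(\mathbb Q_p,m)$. The closed operator $-\mathfrak D^\alpha_q$ coincides with the infinitesimal generator of a translation invariant Markov semigroup acting in $L^q$. Moreover, for all $1\le q<\infty$, $$\mathsf{Spec}(\mathfrak D^\alpha_q)=\mathsf{Spec}(\mathfrak D^\alpha_2).$$
   Context: $\mathbb Q_p$ carries the $p$-adic norm $\|\cdot\|_p$ and the Haar measure $m$ with $m(\mathbb Z_p)=1$. $\mathcal D$ is the set of locally constant functions on $\mathbb Q_p$ with compact support. With $\widetilde u$ denoting the Fourier transform on $\mathbb Q_p$ (with the standard character $x\mapsto e^{2\pi i\{x\}_p}$), which maps $\mathcal D$ onto $\mathcal D$, the operator $\mathfrak D^\alpha$ is defined on $\mathcal D$ by $\widetilde{\mathfrak D^\alpha u}(\xi)=\|\xi\|_p^\alpha\,\widetilde u(\xi)$. It is essentially self-adjoint and non-negative definite in $L^2$; $\mathfrak D^\alpha_2$ is its self-adjoint extension. The semigroup $\exp(-t\mathfrak D_2^\alpha)$ is symmetric and Markovian and so extends to a continuous contraction semigroup on every $L^q$, $1\le q<\infty$; the closed extension $\mathfrak D^\alpha_q$ in the statement is the operator such that $-\mathfrak D^\alpha_q$ is the infinitesimal generator of this extended semigroup on $L^q$. *)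

theory Defs
  imports "HOL-Analysis.Analysis" "HOL-Computational_Algebra.Primes"
begin

section \<open>The field of p-adic numbers\<close>

text \<open>
  Conventions: functions are complex-valued, an
  element of a space of functions is an almost-everywhere class, and an unbounded operator is
  its graph.

  The prime p enters as the cardinality of a type variable \<open>'p\<close> of class \<open>prime_card\<close>, so that
  the p-adic numbers form a type and a statement about \<open>'p padic\<close> is a statement about every
  prime (take a numeral type, whose cardinality is that numeral, for \<open>'p\<close>).
\<close>

class prime_card = finite +
  assumes prime_card: "prime CARD('a)"

instance bool :: prime_card
  by standard simp

definition padic_abs :: "nat \<Rightarrow> rat \<Rightarrow> real" where
  "padic_abs p x = (if x = 0 then 0 else
     real p powi (int (multiplicity (int p) (snd (quotient_of x)))
                - int (multiplicity (int p) (fst (quotient_of x)))))"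

lemma padic_abs_Fract:
  assumes p: "prime p" and ab: "a \<noteq> 0" "b \<noteq> 0"
  shows "padic_abs p (Fract a b) =
    real p powi (int (multiplicity (int p) b) - int (multiplicity (int p) a))"
proof -
  obtain c d where cd: "quotient_of (Fract a b) = (c, d)" by force
  have d: "d > 0" using cd quotient_of_denom_pos by blast
  have eq: "Fract a b = Fract c d"
    using cd quotient_of_div[OF cd] by (simp add: Fract_of_int_quotient)
  have nz: "Fract a b \<noteq> 0" using ab by (simp add: Fract_of_int_quotient)
  have c: "c \<noteq> 0" using eq nz by (auto simp: rat_number_collapse)
  have "a * d = c * b" using eq ab d by (simp add: eq_rat)
  hence "multiplicity (int p) (a * d) = multiplicity (int p) (c * b)" by simp
  hence "multiplicity (int p) a + multiplicity (int p) d = multiplicity (int p) c + multiplicity (int p) b"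
    using p ab c d by (simp add: prime_elem_multiplicity_mult_distrib)
  hence "int (multiplicity (int p) d) - int (multiplicity (int p) c)
       = int (multiplicity (int p) b) - int (multiplicity (int p) a)" by linarith
  thus ?thesis using nz cd by (simp add: padic_abs_def)
qed

lemma padic_abs_0 [simp]: "padic_abs p 0 = 0"
  by (simp add: padic_abs_def)

lemma padic_abs_nonneg [simp]: "padic_abs p x \<ge> 0"
  by (simp add: padic_abs_def)

lemma padic_abs_eq_0_iff: "prime p \<Longrightarrow> padic_abs p x = 0 \<longleftrightarrow> x = 0"
  by (auto simp: padic_abs_def dest: prime_gt_0_nat)

lemma padic_abs_minus [simp]: "padic_abs p (- x) = padic_abs p x"
proof -
  have "multiplicity (int p) (- a) = multiplicity (int p) a" for a
    by (simp add: multiplicity_def)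
  thus ?thesis by (auto simp: padic_abs_def rat_uminus_code Let_def split: prod.splits)
qed

lemma padic_abs_minus_commute: "padic_abs p (x - y) = padic_abs p (y - x)"
  by (metis minus_diff_eq padic_abs_minus)

lemma padic_abs_1 [simp]: "padic_abs p 1 = 1"
  by (simp add: padic_abs_def)

lemma padic_abs_mult:
  assumes p: "prime p"
  shows "padic_abs p (x * y) = padic_abs p x * padic_abs p y"
proof (cases "x = 0 \<or> y = 0")
  case False
  obtain a b where x: "x = Fract a b" "b > 0" by (cases x) auto
  obtain c d where y: "y = Fract c d" "d > 0" by (cases y) auto
  have nz: "a \<noteq> 0" "c \<noteq> 0" "b \<noteq> 0" "d \<noteq> 0"
    using False x y by (auto simp: rat_number_collapse)
  show ?thesis
    using p nz prime_gt_0_nat[OF p]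
    by (simp add: x y padic_abs_Fract prime_elem_multiplicity_mult_distrib
          power_int_diff power_int_add divide_simps)
qed auto

lemma padic_abs_ultra:
  assumes p: "prime p"
  shows "padic_abs p (x + y) \<le> max (padic_abs p x) (padic_abs p y)"
proof (cases "x = 0 \<or> y = 0 \<or> x + y = 0")
  case True
  thus ?thesis by (auto simp: max_def)
next
  case False
  obtain a b where x: "x = Fract a b" "b > 0" by (cases x) auto
  obtain c d where y: "y = Fract c d" "d > 0" by (cases y) auto
  have nz: "a \<noteq> 0" "c \<noteq> 0" "b \<noteq> 0" "d \<noteq> 0"
    using False x y by (auto simp: rat_number_collapse)
  have xy: "x + y = Fract (a * d + c * b) (b * d)" using x y by simp
  have nz': "a * d + c * b \<noteq> 0" using False xy by (auto simp: rat_number_collapse)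
  let ?v = "multiplicity (int p)"
  have nu: "\<not> is_unit (int p)" using p by (auto dest: prime_gt_1_nat)
  let ?k = "min (?v (a * d)) (?v (c * b))"
  have "int p ^ ?k dvd a * d" "int p ^ ?k dvd c * b"
    by (auto intro: multiplicity_dvd')
  hence "int p ^ ?k dvd a * d + c * b" by (rule dvd_add)
  hence "?k \<le> ?v (a * d + c * b)"
    using nz' nu by (intro multiplicity_geI) auto
  hence "?v a + ?v d \<le> ?v (a * d + c * b) \<or> ?v c + ?v b \<le> ?v (a * d + c * b)"
    using p nz by (auto simp: prime_elem_multiplicity_mult_distrib min_def split: if_splits)
  moreover have "?v (b * d) = ?v b + ?v d"
    using p nz by (simp add: prime_elem_multiplicity_mult_distrib)
  moreover have p1: "real p \<ge> 1" using prime_ge_1_nat[OF p] by simp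
  ultimately have "padic_abs p (x + y) \<le> padic_abs p x \<or> padic_abs p (x + y) \<le> padic_abs p y"
    unfolding xy using nz nz' p
    by (auto simp: x y padic_abs_Fract intro!: power_int_increasing)
  thus ?thesis by auto
qed

lemma padic_abs_triangle: "prime p \<Longrightarrow> padic_abs p (x + y) \<le> padic_abs p x + padic_abs p y"
  using padic_abs_ultra[of p x y] padic_abs_nonneg[of p x] padic_abs_nonneg[of p y] by linarith

lemma padic_abs_diff_ge:
  assumes "prime p"
  shows "\<bar>padic_abs p x - padic_abs p y\<bar> \<le> padic_abs p (x - y)"
  using padic_abs_triangle[OF assms, of "x - y" y] padic_abs_triangle[OF assms, of "y - x" x]
    padic_abs_minus_commute[of p x y] by simp

lemma padic_abs_inverse: "prime p \<Longrightarrow> padic_abs p (inverse x) = inverse (padic_abs p x)"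
  by (cases "x = 0")
     (auto simp: padic_abs_mult[symmetric] padic_abs_eq_0_iff intro!: inverse_unique[symmetric])

definition padic_Cauchy :: "nat \<Rightarrow> (nat \<Rightarrow> rat) \<Rightarrow> bool" where
  "padic_Cauchy p X \<longleftrightarrow> (\<forall>e>0. \<exists>N. \<forall>m\<ge>N. \<forall>n\<ge>N. padic_abs p (X m - X n) < e)"

definition padic_rel :: "nat \<Rightarrow> (nat \<Rightarrow> rat) \<Rightarrow> (nat \<Rightarrow> rat) \<Rightarrow> bool" where
  "padic_rel p X Y \<longleftrightarrow> padic_Cauchy p X \<and> padic_Cauchy p Y \<and>
     (\<lambda>n. padic_abs p (X n - Y n)) \<longlonglongrightarrow> 0"

lemma padic_CauchyD:
  "padic_Cauchy p X \<Longrightarrow> e > 0 \<Longrightarrow> \<exists>N. \<forall>m\<ge>N. \<forall>n\<ge>N. padic_abs p (X m - X n) < e"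
  by (auto simp: padic_Cauchy_def)

lemma padic_Cauchy_const [simp]: "padic_Cauchy p (\<lambda>_. c)"
  by (simp add: padic_Cauchy_def)

lemma padic_Cauchy_convergent:
  assumes p: "prime p" and X: "padic_Cauchy p X"
  shows "convergent (\<lambda>n. padic_abs p (X n))"
proof -
  have "Cauchy (\<lambda>n. padic_abs p (X n))"
  proof (rule metric_CauchyI)
    fix e :: real assume "e > 0"
    then obtain N where "\<forall>m\<ge>N. \<forall>n\<ge>N. padic_abs p (X m - X n) < e"
      using padic_CauchyD[OF X] by blast
    thus "\<exists>M. \<forall>m\<ge>M. \<forall>n\<ge>M. dist (padic_abs p (X m)) (padic_abs p (X n)) < e"
      using padic_abs_diff_ge[OF p] unfolding dist_real_def by (meson le_less_trans)
  qed
  thus ?thesis by (simp add: Cauchy_convergent_iff)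
qed

lemma padic_Cauchy_add:
  assumes p: "prime p" and X: "padic_Cauchy p X" and Y: "padic_Cauchy p Y"
  shows "padic_Cauchy p (\<lambda>n. X n + Y n)"
  unfolding padic_Cauchy_def
proof (intro allI impI)
  fix e :: real assume e: "e > 0"
  obtain M where M: "\<forall>m\<ge>M. \<forall>n\<ge>M. padic_abs p (X m - X n) < e" using padic_CauchyD[OF X e] by blast
  obtain N where N: "\<forall>m\<ge>N. \<forall>n\<ge>N. padic_abs p (Y m - Y n) < e" using padic_CauchyD[OF Y e] by blast
  show "\<exists>N. \<forall>m\<ge>N. \<forall>n\<ge>N. padic_abs p ((X m + Y m) - (X n + Y n)) < e"
  proof (intro exI[of _ "max M N"] allI impI)
    fix m n assume "m \<ge> max M N" "n \<ge> max M N"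
    hence "padic_abs p (X m - X n) < e" "padic_abs p (Y m - Y n) < e" using M N by auto
    thus "padic_abs p ((X m + Y m) - (X n + Y n)) < e"
      using padic_abs_ultra[OF p, of "X m - X n" "Y m - Y n"] by (simp add: add_diff_add)
  qed
qed

lemma padic_Cauchy_uminus: "padic_Cauchy p X \<Longrightarrow> padic_Cauchy p (\<lambda>n. - X n)"
  unfolding padic_Cauchy_def by (simp add: padic_abs_minus_commute)

lemma padic_Cauchy_bounded:
  assumes "prime p" "padic_Cauchy p X"
  obtains B where "B > 0" "\<And>n. padic_abs p (X n) \<le> B"
proof -
  have "Bseq (\<lambda>n. padic_abs p (X n))"
    using padic_Cauchy_convergent[OF assms] by (rule convergent_imp_Bseq)
  thus ?thesis using that by (auto simp: Bseq_def)
qed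

lemma padic_Cauchy_mult:
  assumes p: "prime p" and X: "padic_Cauchy p X" and Y: "padic_Cauchy p Y"
  shows "padic_Cauchy p (\<lambda>n. X n * Y n)"
  unfolding padic_Cauchy_def
proof (intro allI impI)
  fix e :: real assume e: "e > 0"
  obtain A where A: "A > 0" "\<And>n. padic_abs p (X n) \<le> A" using padic_Cauchy_bounded[OF p X] by metis
  obtain B where B: "B > 0" "\<And>n. padic_abs p (Y n) \<le> B" using padic_Cauchy_bounded[OF p Y] by metis
  obtain M where M: "\<forall>m\<ge>M. \<forall>n\<ge>M. padic_abs p (X m - X n) < e / B"
    using padic_CauchyD[OF X, of "e / B"] e B by auto
  obtain N where N: "\<forall>m\<ge>N. \<forall>n\<ge>N. padic_abs p (Y m - Y n) < e / A"
    using padic_CauchyD[OF Y, of "e / A"] e A by auto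
  show "\<exists>N. \<forall>m\<ge>N. \<forall>n\<ge>N. padic_abs p (X m * Y m - X n * Y n) < e"
  proof (intro exI[of _ "max M N"] allI impI)
    fix m n assume "m \<ge> max M N" "n \<ge> max M N"
    hence X': "padic_abs p (X m - X n) < e / B" and Y': "padic_abs p (Y m - Y n) < e / A"
      using M N by auto
    have "padic_abs p (X m - X n) * padic_abs p (Y m) \<le> padic_abs p (X m - X n) * B"
      using B by (intro mult_left_mono) auto
    also have "\<dots> < e" using X' B by (simp add: field_simps)
    finally have 1: "padic_abs p ((X m - X n) * Y m) < e" by (simp add: padic_abs_mult[OF p])
    have "padic_abs p (X n) * padic_abs p (Y m - Y n) \<le> A * padic_abs p (Y m - Y n)"
      using A by (intro mult_right_mono) auto
    also have "\<dots> < e" using Y' A by (simp add: field_simps)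
    finally have 2: "padic_abs p (X n * (Y m - Y n)) < e" by (simp add: padic_abs_mult[OF p])
    have "X m * Y m - X n * Y n = (X m - X n) * Y m + X n * (Y m - Y n)"
      by (simp add: algebra_simps)
    thus "padic_abs p (X m * Y m - X n * Y n) < e"
      using padic_abs_ultra[OF p, of "(X m - X n) * Y m" "X n * (Y m - Y n)"] 1 2 by simp
  qed
qed

lemma padic_Cauchy_lower_bound:
  assumes p: "prime p" and X: "padic_Cauchy p X"
    and nz: "\<not> (\<lambda>n. padic_abs p (X n)) \<longlonglongrightarrow> 0"
  obtains b where "b > 0" "\<forall>\<^sub>F n in sequentially. b < padic_abs p (X n)"
proof -
  obtain L where L: "(\<lambda>n. padic_abs p (X n)) \<longlonglongrightarrow> L"
    using padic_Cauchy_convergent[OF p X] by (auto simp: convergent_def)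
  have "L \<ge> 0" by (rule LIMSEQ_le_const[OF L]) auto
  hence "L > 0" using L nz by (cases "L = 0") auto
  thus ?thesis
    using that[of "L / 2"] order_tendstoD(1)[OF L, of "L / 2"] by simp
qed

lemma padic_Cauchy_inverse:
  assumes p: "prime p" and X: "padic_Cauchy p X"
    and nz: "\<not> (\<lambda>n. padic_abs p (X n)) \<longlonglongrightarrow> 0"
  shows "padic_Cauchy p (\<lambda>n. inverse (X n))"
  unfolding padic_Cauchy_def
proof (intro allI impI)
  fix e :: real assume e: "e > 0"
  obtain b where b: "b > 0" "\<forall>\<^sub>F n in sequentially. b < padic_abs p (X n)"
    using padic_Cauchy_lower_bound[OF assms] by blast
  obtain M where M: "\<forall>n\<ge>M. b < padic_abs p (X n)"
    using b(2) by (auto simp: eventually_sequentially)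
  obtain N where N: "\<forall>m\<ge>N. \<forall>n\<ge>N. padic_abs p (X m - X n) < e * b * b"
    using padic_CauchyD[OF X, of "e * b * b"] e b by auto
  show "\<exists>N. \<forall>m\<ge>N. \<forall>n\<ge>N. padic_abs p (inverse (X m) - inverse (X n)) < e"
  proof (intro exI[of _ "max M N"] allI impI)
    fix m n assume mn: "m \<ge> max M N" "n \<ge> max M N"
    hence bm: "b < padic_abs p (X m)" and bn: "b < padic_abs p (X n)"
      and d: "padic_abs p (X m - X n) < e * b * b" using M N by auto
    have nz: "X m \<noteq> 0" "X n \<noteq> 0" using bm bn b(1) by auto
    have "padic_abs p (inverse (X m) - inverse (X n))
        = padic_abs p (X m - X n) / (padic_abs p (X m) * padic_abs p (X n))"
      using nz padic_abs_minus_commute[of p "X n" "X m"]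
      by (simp add: inverse_diff_inverse padic_abs_mult[OF p] padic_abs_inverse[OF p]
            divide_inverse mult_ac)
    also have "\<dots> \<le> padic_abs p (X m - X n) / (b * b)"
      using bm bn b(1) by (intro divide_left_mono mult_mono mult_pos_pos) auto
    also have "\<dots> < e" using d b(1) by (simp add: field_simps)
    finally show "padic_abs p (inverse (X m) - inverse (X n)) < e" .
  qed
qed

lemma padic_null_cong:
  assumes p: "prime p" and "(\<lambda>n. padic_abs p (X n - Y n)) \<longlonglongrightarrow> 0"
  shows "(\<lambda>n. padic_abs p (X n) - padic_abs p (Y n)) \<longlonglongrightarrow> 0"
  by (rule Lim_null_comparison[OF _ assms(2)]) (simp add: padic_abs_diff_ge[OF p])

lemma padic_null_add:
  assumes p: "prime p"
    and X: "(\<lambda>n. padic_abs p (X n)) \<longlonglongrightarrow> 0" and Y: "(\<lambda>n. padic_abs p (Y n)) \<longlonglongrightarrow> 0"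
  shows "(\<lambda>n. padic_abs p (X n + Y n)) \<longlonglongrightarrow> 0"
  by (rule Lim_null_comparison[where g = "\<lambda>n. padic_abs p (X n) + padic_abs p (Y n)"])
     (use padic_abs_triangle[OF p] tendsto_add[OF X Y] in auto)

lemma padic_null_mult:
  assumes p: "prime p"
    and X: "(\<lambda>n. padic_abs p (X n)) \<longlonglongrightarrow> 0" and Y: "padic_Cauchy p Y"
  shows "(\<lambda>n. padic_abs p (X n * Y n)) \<longlonglongrightarrow> 0"
proof -
  obtain L where "(\<lambda>n. padic_abs p (Y n)) \<longlonglongrightarrow> L"
    using padic_Cauchy_convergent[OF p Y] by (auto simp: convergent_def)
  from tendsto_mult[OF X this] show ?thesis by (simp add: padic_abs_mult[OF p])
qed

lemma padic_rel_inverse: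
  assumes p: "prime p" and rel: "padic_rel p X Y"
    and X0: "\<not> (\<lambda>n. padic_abs p (X n)) \<longlonglongrightarrow> 0" and Y0: "\<not> (\<lambda>n. padic_abs p (Y n)) \<longlonglongrightarrow> 0"
  shows "padic_rel p (\<lambda>n. inverse (X n)) (\<lambda>n. inverse (Y n))"
proof -
  have X: "padic_Cauchy p X" and Y: "padic_Cauchy p Y"
    and d: "(\<lambda>n. padic_abs p (X n - Y n)) \<longlonglongrightarrow> 0" using rel by (auto simp: padic_rel_def)
  note X' = padic_Cauchy_inverse[OF p X X0] and Y' = padic_Cauchy_inverse[OF p Y Y0]
  obtain b where b: "b > 0" "\<forall>\<^sub>F n in sequentially. b < padic_abs p (X n)"
    using padic_Cauchy_lower_bound[OF p X X0] by blast
  obtain c where c: "c > 0" "\<forall>\<^sub>F n in sequentially. c < padic_abs p (Y n)"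
    using padic_Cauchy_lower_bound[OF p Y Y0] by blast
  have "(\<lambda>n. padic_abs p ((X n - Y n) * (- (inverse (X n) * inverse (Y n))))) \<longlonglongrightarrow> 0"
    by (intro padic_null_mult p d padic_Cauchy_uminus padic_Cauchy_mult X' Y')
  moreover have "\<forall>\<^sub>F n in sequentially.
      padic_abs p ((X n - Y n) * (- (inverse (X n) * inverse (Y n))))
      = padic_abs p (inverse (X n) - inverse (Y n))"
    using b(2) c(2)
  proof eventually_elim
    case (elim n)
    hence "X n \<noteq> 0" "Y n \<noteq> 0" using b(1) c(1) by auto
    hence "(X n - Y n) * (- (inverse (X n) * inverse (Y n))) = inverse (X n) - inverse (Y n)"
      by (simp add: field_simps)
    thus ?case by simp
  qed
  ultimately have "(\<lambda>n. padic_abs p (inverse (X n) - inverse (Y n))) \<longlonglongrightarrow> 0"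
    by (rule Lim_transform_eventually)
  thus ?thesis using X' Y' by (simp add: padic_rel_def)
qed

lemma padic_rel_refl: "padic_Cauchy p X \<Longrightarrow> padic_rel p X X"
  by (simp add: padic_rel_def)

lemma part_equivp_padic_rel: "prime p \<Longrightarrow> part_equivp (padic_rel p)"
proof (intro part_equivpI)
  show "\<exists>X. padic_rel p X X" by (rule exI[of _ "\<lambda>_. 0"]) (simp add: padic_rel_refl)
  show "symp (padic_rel p)" by (auto simp: symp_def padic_rel_def padic_abs_minus_commute)
  assume p: "prime p"
  show "transp (padic_rel p)"
  proof (rule transpI)
    fix X Y Z assume "padic_rel p X Y" "padic_rel p Y Z"
    thus "padic_rel p X Z"
      using padic_null_add[OF p, of "\<lambda>n. X n - Y n" "\<lambda>n. Y n - Z n"]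
      by (auto simp: padic_rel_def)
  qed
qed

text \<open>
  The completion of the rationals with respect to \<open>padic_abs\<close>.  The type is the quotient of the
  Cauchy sequences by \<open>padic_rel\<close>; it is introduced by \<open>typedef\<close> since \<open>quotient_type\<close>
  does not accept the phantom parameter \<open>'p\<close>.
\<close>

typedef (overloaded) ('p::prime_card) padic =
  "{X. padic_Cauchy CARD('p) X} // {(X, Y). padic_rel CARD('p) X Y}"
  by (rule exI[of _ "{(X, Y). padic_rel CARD('p) X Y} `` {\<lambda>_. 0}"], rule quotientI) simp

definition abs_padic :: "(nat \<Rightarrow> rat) \<Rightarrow> 'p::prime_card padic" where
  "abs_padic X = Abs_padic {Y. padic_rel CARD('p) X Y}"

definition rep_padic :: "'p::prime_card padic \<Rightarrow> nat \<Rightarrow> rat" where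
  "rep_padic x = (SOME X. X \<in> Rep_padic x)"

definition cr_padic :: "(nat \<Rightarrow> rat) \<Rightarrow> 'p::prime_card padic \<Rightarrow> bool" where
  "cr_padic = (\<lambda>X x. padic_rel CARD('p) X X \<and> abs_padic X = x)"

lemma Quotient_padic:
  "Quotient (padic_rel CARD('p::prime_card)) abs_padic (rep_padic :: 'p padic \<Rightarrow> _) cr_padic"
proof -
  let ?R = "padic_rel CARD('p)"
  have pe: "part_equivp ?R" by (rule part_equivp_padic_rel[OF prime_card])
  have sym: "?R X Y \<Longrightarrow> ?R Y X" and trans: "?R X Y \<Longrightarrow> ?R Y Z \<Longrightarrow> ?R X Z" for X Y Z
    by (rule part_equivp_symp[OF pe], assumption) (rule part_equivp_transp[OF pe], assumption+)
  have cls: "{Y. ?R X Y} = {(X, Y). ?R X Y} `` {X}" for X by auto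
  have C: "?R X X \<longleftrightarrow> padic_Cauchy CARD('p) X" for X by (auto simp: padic_rel_def)
  have Rep_abs: "Rep_padic (abs_padic X :: 'p padic) = {Y. ?R X Y}" if "?R X X" for X
    unfolding abs_padic_def
  proof (rule Abs_padic_inverse)
    show "{Y. ?R X Y} \<in> {X. padic_Cauchy CARD('p) X} // {(X, Y). ?R X Y}"
      unfolding cls by (rule quotientI) (use that C in simp)
  qed
  have Rep: "\<exists>X. ?R X X \<and> Rep_padic x = {Y. ?R X Y}" for x :: "'p padic"
  proof -
    obtain X where "padic_Cauchy CARD('p) X" "Rep_padic x = {(X, Y). ?R X Y} `` {X}"
      using Rep_padic[of x] by (auto elim: quotientE)
    thus ?thesis by (intro exI[of _ X]) (simp add: C)
  qed
  have rep: "?R (rep_padic x) (rep_padic x) \<and> Rep_padic x = {Y. ?R (rep_padic x) Y}"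
    for x :: "'p padic"
  proof -
    obtain X where X: "?R X X" "Rep_padic x = {Y. ?R X Y}" using Rep by blast
    hence "X \<in> Rep_padic x" by simp
    hence "\<exists>X. X \<in> Rep_padic x" by blast
    hence "rep_padic x \<in> Rep_padic x" unfolding rep_padic_def by (rule someI_ex)
    hence "?R X (rep_padic x)" using X by simp
    thus ?thesis using X(2) sym trans by blast
  qed
  have abs_rep: "abs_padic (rep_padic x) = x" for x :: "'p padic"
    using rep[of x] by (metis Rep_padic_inverse abs_padic_def)
  have eq: "?R X Y \<longleftrightarrow> ?R X X \<and> ?R Y Y \<and> (abs_padic X :: 'p padic) = abs_padic Y" for X Y
  proof
    assume R: "?R X Y"
    hence "{Z. ?R X Z} = {Z. ?R Y Z}" using sym trans by blast
    thus "?R X X \<and> ?R Y Y \<and> (abs_padic X :: 'p padic) = abs_padic Y"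
      using R sym trans by (metis abs_padic_def)
  next
    assume "?R X X \<and> ?R Y Y \<and> (abs_padic X :: 'p padic) = abs_padic Y"
    hence "{Z. ?R X Z} = {Z. ?R Y Z}" "?R Y Y" using Rep_abs by metis+
    thus "?R X Y" by blast
  qed
  show ?thesis
    unfolding Quotient_def
  proof (intro conjI allI)
    show "abs_padic (rep_padic x) = x" for x :: "'p padic" by (rule abs_rep)
    show "?R (rep_padic x) (rep_padic x)" for x :: "'p padic" using rep by blast
    show "?R X Y \<longleftrightarrow> ?R X X \<and> ?R Y Y \<and> (abs_padic X :: 'p padic) = abs_padic Y" for X Y
      by (rule eq)
    show "(cr_padic :: _ \<Rightarrow> 'p padic \<Rightarrow> _) = (\<lambda>X x. ?R X X \<and> abs_padic X = x)"
      unfolding cr_padic_def by (rule refl)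
  qed
qed

setup_lifting Quotient_padic

instantiation padic :: (prime_card) field
begin

lift_definition zero_padic :: "'a padic" is "\<lambda>_. 0" by (simp add: padic_rel_refl)

lift_definition one_padic :: "'a padic" is "\<lambda>_. 1" by (simp add: padic_rel_refl)

lift_definition plus_padic :: "'a padic \<Rightarrow> 'a padic \<Rightarrow> 'a padic" is "\<lambda>X Y n. X n + Y n"
  by (auto simp: padic_rel_def add_diff_add intro: padic_Cauchy_add padic_null_add prime_card)

lift_definition uminus_padic :: "'a padic \<Rightarrow> 'a padic" is "\<lambda>X n. - X n"
  by (auto simp: padic_rel_def padic_abs_minus_commute intro: padic_Cauchy_uminus)

lift_definition times_padic :: "'a padic \<Rightarrow> 'a padic \<Rightarrow> 'a padic" is "\<lambda>X Y n. X n * Y n"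
proof -
  fix X X' Y Y' :: "nat \<Rightarrow> rat"
  let ?p = "CARD('a)"
  assume X: "padic_rel ?p X X'" and Y: "padic_rel ?p Y Y'"
  have "(\<lambda>n. padic_abs ?p ((X n - X' n) * Y n + (Y n - Y' n) * X' n)) \<longlonglongrightarrow> 0"
    using X Y by (intro padic_null_add padic_null_mult prime_card) (auto simp: padic_rel_def)
  moreover have "(\<lambda>n. (X n - X' n) * Y n + (Y n - Y' n) * X' n) = (\<lambda>n. X n * Y n - X' n * Y' n)"
    by (simp add: algebra_simps)
  ultimately have "(\<lambda>n. padic_abs ?p (X n * Y n - X' n * Y' n)) \<longlonglongrightarrow> 0"
    by (simp add: fun_eq_iff)
  thus "padic_rel ?p (\<lambda>n. X n * Y n) (\<lambda>n. X' n * Y' n)"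
    using X Y by (auto simp: padic_rel_def intro: padic_Cauchy_mult prime_card)
qed

lift_definition inverse_padic :: "'a padic \<Rightarrow> 'a padic" is
  "\<lambda>X. if (\<lambda>n. padic_abs CARD('a) (X n)) \<longlonglongrightarrow> 0 then (\<lambda>n. 0) else (\<lambda>n. inverse (X n))"
proof -
  fix X Y :: "nat \<Rightarrow> rat"
  let ?p = "CARD('a)"
  assume rel: "padic_rel ?p X Y"
  hence "(\<lambda>n. padic_abs ?p (X n) - padic_abs ?p (Y n)) \<longlonglongrightarrow> 0"
    by (auto simp: padic_rel_def intro: padic_null_cong prime_card)
  hence "(\<lambda>n. padic_abs ?p (X n)) \<longlonglongrightarrow> 0 \<longleftrightarrow> (\<lambda>n. padic_abs ?p (Y n)) \<longlonglongrightarrow> 0"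
    by (rule Lim_transform_eq)
  thus "padic_rel ?p
      (if (\<lambda>n. padic_abs ?p (X n)) \<longlonglongrightarrow> 0 then (\<lambda>n. 0) else (\<lambda>n. inverse (X n)))
      (if (\<lambda>n. padic_abs ?p (Y n)) \<longlonglongrightarrow> 0 then (\<lambda>n. 0) else (\<lambda>n. inverse (Y n)))"
    using rel by (auto intro: padic_rel_refl padic_rel_inverse prime_card)
qed

definition "x - y = x + - y" for x y :: "'a padic"

definition "x div y = x * inverse y" for x y :: "'a padic"

instance
proof
  fix a b c :: "'a padic"
  note [simp] = padic_rel_refl padic_Cauchy_add padic_Cauchy_mult padic_Cauchy_uminus prime_card
  show "a * b * c = a * (b * c)" by transfer (auto simp: padic_rel_def mult.assoc)
  show "a * b = b * a" by transfer (auto simp: padic_rel_def mult.commute)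
  show "1 * a = a" by transfer (auto simp: padic_rel_def)
  show "a + b + c = a + (b + c)" by transfer (auto simp: padic_rel_def add.assoc)
  show "a + b = b + a" by transfer (auto simp: padic_rel_def add.commute)
  show "0 + a = a" by transfer (auto simp: padic_rel_def)
  show "- a + a = 0" by transfer (auto simp: padic_rel_def)
  show "a - b = a + - b" by (rule minus_padic_def)
  show "(a + b) * c = a * c + b * c" by transfer (auto simp: padic_rel_def distrib_right)
  show "(0::'a padic) \<noteq> 1" by transfer (simp add: padic_rel_def LIMSEQ_const_iff)
  show "inverse (0::'a padic) = 0" by transfer (auto simp: padic_rel_def)
  show "a div b = a * inverse b" by (rule divide_padic_def)
  show "inverse a * a = 1" if "a \<noteq> 0"
    using that
  proof transfer
    fix X :: "nat \<Rightarrow> rat"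
    let ?p = "CARD('a)"
    assume X: "padic_rel ?p X X" and "\<not> padic_rel ?p X (\<lambda>_. 0)"
    hence C: "padic_Cauchy ?p X" and nz: "\<not> (\<lambda>n. padic_abs ?p (X n)) \<longlonglongrightarrow> 0"
      by (auto simp: padic_rel_def)
    obtain b where b: "b > 0" "\<forall>\<^sub>F n in sequentially. b < padic_abs ?p (X n)"
      using padic_Cauchy_lower_bound[OF prime_card C nz] by blast
    have "\<forall>\<^sub>F n in sequentially. 0 = padic_abs ?p (inverse (X n) * X n - 1)"
      using b(2)
    proof eventually_elim
      case (elim n)
      hence "X n \<noteq> 0" using b(1) by auto
      thus ?case by simp
    qed
    hence "(\<lambda>n. padic_abs ?p (inverse (X n) * X n - 1)) \<longlonglongrightarrow> 0"
      by (rule Lim_transform_eventually[OF tendsto_const])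
    thus "padic_rel ?p
        (\<lambda>n. (if (\<lambda>n. padic_abs ?p (X n)) \<longlonglongrightarrow> 0 then (\<lambda>n. 0) else (\<lambda>n. inverse (X n))) n * X n)
        (\<lambda>_. 1)"
      using nz C padic_Cauchy_mult[OF prime_card padic_Cauchy_inverse[OF prime_card C nz] C]
      by (simp add: padic_rel_def)
  qed
qed

end

lift_definition padic_norm :: "'p::prime_card padic \<Rightarrow> real" is "\<lambda>X. lim (\<lambda>n. padic_abs CARD('p) (X n))"
proof -
  fix X Y :: "nat \<Rightarrow> rat"
  let ?p = "CARD('p)"
  assume rel: "padic_rel ?p X Y"
  then obtain L where L: "(\<lambda>n. padic_abs ?p (Y n)) \<longlonglongrightarrow> L"
    using padic_Cauchy_convergent[OF prime_card] by (auto simp: padic_rel_def convergent_def)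
  have "(\<lambda>n. padic_abs ?p (X n) - padic_abs ?p (Y n)) \<longlonglongrightarrow> 0"
    using rel by (auto simp: padic_rel_def intro: padic_null_cong prime_card)
  from tendsto_add[OF this L] have "(\<lambda>n. padic_abs ?p (X n)) \<longlonglongrightarrow> L" by simp
  thus "lim (\<lambda>n. padic_abs ?p (X n)) = lim (\<lambda>n. padic_abs ?p (Y n))"
    using L by (simp add: limI)
qed

instantiation padic :: (prime_card) metric_space
begin

definition dist_padic :: "'a padic \<Rightarrow> 'a padic \<Rightarrow> real" where
  "dist_padic x y = padic_norm (x - y)"

definition uniformity_padic :: "('a padic \<times> 'a padic) filter" where
  "uniformity_padic = (INF e\<in>{0<..}. principal {(x, y). dist x y < e})"

definition open_padic :: "'a padic set \<Rightarrow> bool" where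
  "open_padic U \<longleftrightarrow> (\<forall>x\<in>U. \<forall>\<^sub>F (x', y) in uniformity. x' = x \<longrightarrow> y \<in> U)"

instance
proof
  have lim: "(\<lambda>n. padic_abs CARD('a) (X n)) \<longlonglongrightarrow> lim (\<lambda>n. padic_abs CARD('a) (X n))"
    if "padic_rel CARD('a) X X" for X
  proof -
    have "padic_Cauchy CARD('a) X" using that by (simp add: padic_rel_def)
    from padic_Cauchy_convergent[OF prime_card this] show ?thesis
      by (simp only: convergent_LIMSEQ_iff)
  qed
  have norm0: "padic_norm x = 0 \<longleftrightarrow> x = 0" for x :: "'a padic"
  proof transfer
    fix X assume X: "padic_rel CARD('a) X X"
    show "lim (\<lambda>n. padic_abs CARD('a) (X n)) = 0 \<longleftrightarrow> padic_rel CARD('a) X (\<lambda>_. 0)"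
    proof
      assume "lim (\<lambda>n. padic_abs CARD('a) (X n)) = 0"
      with lim[OF X] have "(\<lambda>n. padic_abs CARD('a) (X n)) \<longlonglongrightarrow> 0" by (simp only:)
      thus "padic_rel CARD('a) X (\<lambda>_. 0)" using X by (simp add: padic_rel_def)
    next
      assume "padic_rel CARD('a) X (\<lambda>_. 0)"
      hence "(\<lambda>n. padic_abs CARD('a) (X n)) \<longlonglongrightarrow> 0" by (simp add: padic_rel_def)
      thus "lim (\<lambda>n. padic_abs CARD('a) (X n)) = 0" by (rule limI)
    qed
  qed
  have normm: "padic_norm (- x) = padic_norm x" for x :: "'a padic"
    by transfer simp
  have normt: "padic_norm (x + y) \<le> padic_norm x + padic_norm y" for x y :: "'a padic"
  proof transfer
    fix X Y assume X: "padic_rel CARD('a) X X" and Y: "padic_rel CARD('a) Y Y"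
    hence XY: "padic_rel CARD('a) (\<lambda>n. X n + Y n) (\<lambda>n. X n + Y n)"
      by (auto simp: padic_rel_def intro: padic_Cauchy_add prime_card)
    show "lim (\<lambda>n. padic_abs CARD('a) (X n + Y n))
        \<le> lim (\<lambda>n. padic_abs CARD('a) (X n)) + lim (\<lambda>n. padic_abs CARD('a) (Y n))"
      by (rule LIMSEQ_le[OF lim[OF XY] tendsto_add[OF lim[OF X] lim[OF Y]]])
         (auto intro: padic_abs_triangle prime_card)
  qed
  fix x y z :: "'a padic"
  show "dist x y = 0 \<longleftrightarrow> x = y" by (simp add: dist_padic_def norm0)
  show "dist x y \<le> dist x z + dist y z"
    using normt[of "x - z" "z - y"] normm[of "z - y"] by (simp add: dist_padic_def)
  show "uniformity = (INF e\<in>{0<..}. principal {(x, y :: 'a padic). dist x y < e})"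
    by (rule uniformity_padic_def)
  show "open U \<longleftrightarrow> (\<forall>x\<in>U. \<forall>\<^sub>F (x', y) in uniformity. x' = x \<longrightarrow> y \<in> U)" for U :: "'a padic set"
    by (rule open_padic_def)
qed

end

lemma of_nat_padic: "(of_nat n :: 'p::prime_card padic) = abs_padic (\<lambda>_. of_nat n)"
  by (induction n)
     (simp_all add: zero_padic_def one_padic_def plus_padic.abs_eq padic_rel_refl add.commute)

instance padic :: (prime_card) field_char_0
proof
  show "inj (of_nat :: nat \<Rightarrow> 'a padic)"
  proof (rule injI)
    fix m n assume "of_nat m = (of_nat n :: 'a padic)"
    hence "abs_padic (\<lambda>_. of_nat m) = (abs_padic (\<lambda>_. of_nat n) :: 'a padic)"
      by (simp only: of_nat_padic)
    hence "padic_rel CARD('a) (\<lambda>_. of_nat m) (\<lambda>_. of_nat n)"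
      using Quotient_rel[OF Quotient_padic[where 'p = 'a], of "\<lambda>_. of_nat m" "\<lambda>_. of_nat n"]
        padic_rel_refl[OF padic_Cauchy_const] by blast
    hence "padic_abs CARD('a) (of_nat m - of_nat n) = 0"
      by (simp add: padic_rel_def LIMSEQ_const_iff)
    thus "m = n" by (simp add: padic_abs_eq_0_iff prime_card)
  qed
qed

section \<open>Haar measure and the Fourier transform\<close>

definition haar :: "'p::prime_card padic measure" where
  "haar = (THE M. sets M = sets borel
     \<and> (\<forall>a. \<forall>A\<in>sets borel. emeasure M ((+) a ` A) = emeasure M A)
     \<and> emeasure M {x. padic_norm x \<le> 1} = 1)"

text \<open>The fractional part: the part of the p-adic expansion with negative powers of p.\<close>

definition padic_frac :: "'p::prime_card padic \<Rightarrow> rat" where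
  "padic_frac x = (THE r. 0 \<le> r \<and> r < 1 \<and> (\<exists>k n. r = of_int k / of_nat CARD('p) ^ n)
     \<and> padic_norm (x - of_rat r) \<le> 1)"

definition padic_char :: "'p::prime_card padic \<Rightarrow> complex" where
  "padic_char x = cis (2 * pi * of_rat (padic_frac x))"

definition fourier :: "('p::prime_card padic \<Rightarrow> complex) \<Rightarrow> 'p padic \<Rightarrow> complex" where
  "fourier u \<xi> = (\<integral>x. padic_char (\<xi> * x) * u x \<partial>haar)"

definition test_functions :: "('p::prime_card padic \<Rightarrow> complex) set" where
  "test_functions =
     {u. (\<forall>x. \<forall>\<^sub>F y in nhds x. u y = u x) \<and> compact (closure {x. u x \<noteq> 0})}"


section \<open>The spaces of q-integrable functions\<close>

definition ae_rel :: "('p::prime_card padic \<Rightarrow> complex) \<Rightarrow> ('p padic \<Rightarrow> complex) \<Rightarrow> bool" where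
  "ae_rel f g \<longleftrightarrow> f \<in> borel_measurable haar \<and> g \<in> borel_measurable haar \<and>
     (AE x in haar. f x = g x)"

lemma part_equivp_ae_rel: "part_equivp ae_rel"
proof (intro part_equivpI)
  show "\<exists>f. ae_rel f f" by (rule exI[of _ "\<lambda>_. 0"]) (simp add: ae_rel_def)
  show "symp ae_rel" by (auto simp: symp_def ae_rel_def eq_commute)
  show "transp ae_rel" by (auto simp: transp_def ae_rel_def)
qed

quotient_type 'p L0 = "'p::prime_card padic \<Rightarrow> complex" / partial: ae_rel
  by (rule part_equivp_ae_rel)

instantiation L0 :: (prime_card) ab_group_add
begin

lift_definition zero_L0 :: "'a L0" is "\<lambda>_. 0" by (simp add: ae_rel_def)

lift_definition plus_L0 :: "'a L0 \<Rightarrow> 'a L0 \<Rightarrow> 'a L0" is "\<lambda>f g x. f x + g x"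
  by (auto simp: ae_rel_def)

lift_definition minus_L0 :: "'a L0 \<Rightarrow> 'a L0 \<Rightarrow> 'a L0" is "\<lambda>f g x. f x - g x"
  by (auto simp: ae_rel_def)

lift_definition uminus_L0 :: "'a L0 \<Rightarrow> 'a L0" is "\<lambda>f x. - f x"
  by (auto simp: ae_rel_def)

instance
proof
  fix f g h :: "'a L0"
  show "f + g + h = f + (g + h)" by transfer (simp add: ae_rel_def add.assoc)
  show "f + g = g + f" by transfer (simp add: ae_rel_def add.commute)
  show "0 + f = f" by transfer (simp add: ae_rel_def)
  show "- f + f = 0" by transfer (simp add: ae_rel_def)
  show "f - g = f + - g" by transfer (simp add: ae_rel_def)
qed

end

lift_definition scale_L0 :: "complex \<Rightarrow> 'p::prime_card L0 \<Rightarrow> 'p L0" (infixr "*\<^sub>C" 75)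
  is "\<lambda>c f x. c * f x"
  by (auto simp: ae_rel_def)

lift_definition in_Lq :: "real \<Rightarrow> 'p::prime_card L0 \<Rightarrow> bool"
  is "\<lambda>q f. integrable haar (\<lambda>x. norm (f x) powr q)"
proof -
  fix q :: real and f g :: "'p padic \<Rightarrow> complex"
  assume "ae_rel f g"
  thus "integrable haar (\<lambda>x. norm (f x) powr q) = integrable haar (\<lambda>x. norm (g x) powr q)"
    by (intro integrable_cong_AE) (auto simp: ae_rel_def)
qed

definition Lq :: "real \<Rightarrow> 'p::prime_card L0 set" where
  "Lq q = {f. in_Lq q f}"

lift_definition Lq_norm :: "real \<Rightarrow> 'p::prime_card L0 \<Rightarrow> real"
  is "\<lambda>q f. (\<integral>x. norm (f x) powr q \<partial>haar) powr (1 / q)"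
proof -
  fix q :: real and f g :: "'p padic \<Rightarrow> complex"
  assume "ae_rel f g"
  hence "(\<integral>x. norm (f x) powr q \<partial>haar) = (\<integral>x. norm (g x) powr q \<partial>haar)"
    by (intro integral_cong_AE) (auto simp: ae_rel_def)
  thus "(\<integral>x. norm (f x) powr q \<partial>haar) powr (1 / q) = (\<integral>x. norm (g x) powr q \<partial>haar) powr (1 / q)"
    by simp
qed

lift_definition L2_inner :: "'p::prime_card L0 \<Rightarrow> 'p L0 \<Rightarrow> complex"
  is "\<lambda>f g. \<integral>x. f x * cnj (g x) \<partial>haar"
proof -
  fix f f' g g' :: "'p padic \<Rightarrow> complex"
  assume f: "ae_rel f f'" and g: "ae_rel g g'"
  have [measurable]: "cnj \<in> borel_measurable borel"
    by (intro borel_measurable_continuous_onI continuous_intros)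
  have [measurable]: "f \<in> borel_measurable haar" "f' \<in> borel_measurable haar"
      "g \<in> borel_measurable haar" "g' \<in> borel_measurable haar"
    and ae: "AE x in haar. f x = f' x" "AE x in haar. g x = g' x"
    using f g by (simp_all add: ae_rel_def)
  show "(\<integral>x. f x * cnj (g x) \<partial>haar) = (\<integral>x. f' x * cnj (g' x) \<partial>haar)"
  proof (rule integral_cong_AE)
    show "AE x in haar. f x * cnj (g x) = f' x * cnj (g' x)"
      using ae by eventually_elim simp
  qed measurable
qed

definition Lq_tendsto :: "real \<Rightarrow> (nat \<Rightarrow> 'p::prime_card L0) \<Rightarrow> 'p L0 \<Rightarrow> bool" where
  "Lq_tendsto q F f \<longleftrightarrow> (\<lambda>n. Lq_norm q (F n - f)) \<longlonglongrightarrow> 0"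


section \<open>Linear operators\<close>

type_synonym 'p graph = "('p L0 \<times> 'p L0) set"

definition linear_operator :: "real \<Rightarrow> 'p::prime_card graph \<Rightarrow> bool" where
  "linear_operator q A \<longleftrightarrow> A \<subseteq> Lq q \<times> Lq q \<and> (0, 0) \<in> A
     \<and> (\<forall>(f, g)\<in>A. \<forall>(f', g')\<in>A. (f + f', g + g') \<in> A)
     \<and> (\<forall>c. \<forall>(f, g)\<in>A. (c *\<^sub>C f, c *\<^sub>C g) \<in> A)
     \<and> (\<forall>f g g'. (f, g) \<in> A \<longrightarrow> (f, g') \<in> A \<longrightarrow> g = g')"

definition closed_operator :: "real \<Rightarrow> 'p::prime_card graph \<Rightarrow> bool" where
  "closed_operator q A \<longleftrightarrow> linear_operator q A
     \<and> (\<forall>F G. \<forall>f\<in>Lq q. \<forall>g\<in>Lq q. (\<forall>n. (F n, G n) \<in> A) \<longrightarrow>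
          Lq_tendsto q F f \<longrightarrow> Lq_tendsto q G g \<longrightarrow> (f, g) \<in> A)"

definition neg_operator :: "'p::prime_card graph \<Rightarrow> 'p graph" where
  "neg_operator A = {(f, - g) |f g. (f, g) \<in> A}"

definition bounded_operator ::
    "real \<Rightarrow> ('p::prime_card L0 \<Rightarrow> 'p L0) \<Rightarrow> bool" where
  "bounded_operator q S \<longleftrightarrow> (\<forall>f\<in>Lq q. S f \<in> Lq q)
     \<and> (\<forall>f\<in>Lq q. \<forall>g\<in>Lq q. S (f + g) = S f + S g)
     \<and> (\<forall>c. \<forall>f\<in>Lq q. S (c *\<^sub>C f) = c *\<^sub>C S f)
     \<and> (\<exists>C. \<forall>f\<in>Lq q. Lq_norm q (S f) \<le> C * Lq_norm q f)"

definition resolvent_set :: "real \<Rightarrow> 'p::prime_card graph \<Rightarrow> complex set" where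
  "resolvent_set q A = {z. \<exists>R. bounded_operator q R
     \<and> (\<forall>g\<in>Lq q. (R g, g + z *\<^sub>C R g) \<in> A)
     \<and> (\<forall>(f, h)\<in>A. R (h - z *\<^sub>C f) = f)}"

definition Spec :: "real \<Rightarrow> 'p::prime_card graph \<Rightarrow> complex set" where
  "Spec q A = - resolvent_set q A"

definition adjoint_L2 :: "'p::prime_card graph \<Rightarrow> 'p graph" where
  "adjoint_L2 A =
     {(f, g). f \<in> Lq 2 \<and> g \<in> Lq 2 \<and> (\<forall>(u, v)\<in>A. L2_inner v f = L2_inner u g)}"

definition self_adjoint :: "'p::prime_card graph \<Rightarrow> bool" where
  "self_adjoint A \<longleftrightarrow> linear_operator 2 A
     \<and> (\<forall>f\<in>Lq 2. \<exists>U. (\<forall>n. U n \<in> Domain A) \<and> Lq_tendsto 2 U f)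
     \<and> adjoint_L2 A = A"


section \<open>Semigroups\<close>

text \<open>Only the restriction of T to non-negative times and to \<open>Lq q\<close> is relevant.\<close>

definition contraction_semigroup ::
    "real \<Rightarrow> (real \<Rightarrow> 'p::prime_card L0 \<Rightarrow> 'p L0) \<Rightarrow> bool" where
  "contraction_semigroup q T \<longleftrightarrow>
     (\<forall>t\<ge>0. bounded_operator q (T t))
     \<and> (\<forall>t\<ge>0. \<forall>f\<in>Lq q. Lq_norm q (T t f) \<le> Lq_norm q f)
     \<and> (\<forall>f\<in>Lq q. T 0 f = f)
     \<and> (\<forall>s\<ge>0. \<forall>t\<ge>0. \<forall>f\<in>Lq q. T (s + t) f = T s (T t f))
     \<and> (\<forall>f\<in>Lq q. ((\<lambda>t. Lq_norm q (T t f - f)) \<longlongrightarrow> 0) (at_right 0))"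

definition generator ::
    "real \<Rightarrow> (real \<Rightarrow> 'p::prime_card L0 \<Rightarrow> 'p L0) \<Rightarrow> 'p graph" where
  "generator q T = {(f, g). f \<in> Lq q \<and> g \<in> Lq q \<and>
     ((\<lambda>t. Lq_norm q (complex_of_real (1 / t) *\<^sub>C (T t f - f) - g)) \<longlongrightarrow> 0) (at_right 0)}"

lift_definition between_0_1 :: "'p::prime_card L0 \<Rightarrow> bool"
  is "\<lambda>f. AE x in haar. \<exists>r\<in>{0..1}. f x = complex_of_real r"
proof -
  fix f g :: "'p padic \<Rightarrow> complex"
  assume "ae_rel f g"
  hence ae: "AE x in haar. f x = g x" by (simp add: ae_rel_def)
  show "(AE x in haar. \<exists>r\<in>{0..1}. f x = complex_of_real r) =
        (AE x in haar. \<exists>r\<in>{0..1}. g x = complex_of_real r)"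
    by (rule eventually_cong[OF ae]) simp
qed

text \<open>
  Positivity preserving and conservative.  As 1 does not lie in \<open>Lq q\<close>, conservativeness
  (T t 1 = 1) is stated through sequences increasing to 1.
\<close>

definition markov :: "real \<Rightarrow> (real \<Rightarrow> 'p::prime_card L0 \<Rightarrow> 'p L0) \<Rightarrow> bool" where
  "markov q T \<longleftrightarrow>
     (\<forall>t\<ge>0. \<forall>f\<in>Lq q. between_0_1 f \<longrightarrow> between_0_1 (T t f))
     \<and> (\<forall>t\<ge>0. \<forall>(F :: nat \<Rightarrow> 'p padic \<Rightarrow> real) G.
          (\<forall>n. F n \<in> borel_measurable haar \<and> G n \<in> borel_measurable haar
             \<and> abs_L0 (\<lambda>x. complex_of_real (F n x)) \<in> Lq q
             \<and> T t (abs_L0 (\<lambda>x. complex_of_real (F n x))) = abs_L0 (G n)) \<longrightarrow>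
          (\<forall>x. incseq (\<lambda>n. F n x) \<and> (\<forall>n. 0 \<le> F n x) \<and> (\<lambda>n. F n x) \<longlonglongrightarrow> 1) \<longrightarrow>
          (AE x in haar. (\<lambda>n. G n x) \<longlonglongrightarrow> 1))"

definition translation_invariant ::
    "real \<Rightarrow> (real \<Rightarrow> 'p::prime_card L0 \<Rightarrow> 'p L0) \<Rightarrow> bool" where
  "translation_invariant q T \<longleftrightarrow>
     (\<forall>t\<ge>0. \<forall>a. \<forall>f\<in>borel_measurable haar. \<forall>g\<in>borel_measurable haar.
        abs_L0 f \<in> Lq q \<longrightarrow> T t (abs_L0 f) = abs_L0 g \<longrightarrow>
        T t (abs_L0 (\<lambda>x. f (x + a))) = abs_L0 (\<lambda>x. g (x + a)))"


section \<open>The operator of fractional derivative\<close>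

text \<open>
  For a test function u the function v with Fourier transform \<open>padic_norm \<xi> powr \<alpha> * fourier u \<xi>\<close>
  is integrable (it decays like \<open>padic_norm x powr (- 1 - \<alpha>)\<close>), so the Fourier integral of v applies;
  v is in general no longer a test function.
\<close>

definition frac_deriv :: "real \<Rightarrow> 'p::prime_card graph" where
  "frac_deriv \<alpha> = {(abs_L0 u, abs_L0 v) |u v. u \<in> test_functions \<and> integrable haar v
     \<and> (\<forall>\<xi>. fourier v \<xi> = complex_of_real (padic_norm \<xi> powr \<alpha>) * fourier u \<xi>)}"

definition frac_deriv_L2 :: "real \<Rightarrow> 'p::prime_card graph" where
  "frac_deriv_L2 \<alpha> = (THE A. self_adjoint A \<and> frac_deriv \<alpha> \<subseteq> A)"

text \<open>
  In the next definition S is the semigroup \<open>exp (- t * frac_deriv_L2 \<alpha>)\<close> and T its extension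
  from the intersection of \<open>Lq 2\<close> and \<open>Lq q\<close>, which is dense in \<open>Lq q\<close>.
\<close>

definition frac_deriv_Lq :: "real \<Rightarrow> real \<Rightarrow> 'p::prime_card graph" where
  "frac_deriv_Lq \<alpha> q = (THE A. \<exists>S T.
     contraction_semigroup 2 S \<and> generator 2 S = neg_operator (frac_deriv_L2 \<alpha>)
     \<and> contraction_semigroup q T \<and> (\<forall>t\<ge>0. \<forall>f\<in>Lq 2 \<inter> Lq q. T t f = S t f)
     \<and> generator q T = neg_operator A)"

end

theory Submission
  imports Defs "HOL-Probability.Probability" "HOL-Number_Theory.Cong"
begin

text \<open>
  Let \<open>avg n F\<close> be the average of F over the balls of radius \<open>p powi n\<close> and
  \<open>lev n F = avg n F - avg (n + 1) F\<close>. A class in \<open>L\<^sup>q\<close> is determined by its levels, because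
  \<open>avg n F\<close> tends to F as n goes to minus infinity and to 0 pointwise as n goes to infinity.
  The Fourier transform of a ball is a multiple of the indicator of the dual ball, so the operator
  of order \<open>\<alpha>\<close> acts on the level n as the scalar \<open>p powr (- n * \<alpha>)\<close>; its extensions to the spaces
  \<open>L\<^sup>q\<close> are restrictions of one and the same diagonal operator. The heat semigroup and the resolvents
  are diagonal with multipliers that are monotone functions of n, or combinations of such functions.
  By Abel summation a bounded monotone multiplier is a mixture of ball averages, and these are
  contractions of every \<open>L\<^sup>q\<close>. So the resolvent set does not depend on q: the spectrum consists of 0
  and the eigenvalues.
\<close>

section \<open>The p-adic norm\<close>

text \<open>The objects \<open>haar\<close>, \<open>padic_frac\<close>, \<open>frac_deriv_L2\<close>
  and \<open>frac_deriv_Lq\<close> are definite descriptions, so nothing can be said about them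
  before existence and uniqueness are proved; this dictates much of the work. The one graph
  \<open>frac_op \<alpha> q\<close>, defined by levels alone, turns out to be the operator that is
  meant for every q. The Fourier transform enters only to link it with \<open>frac_deriv\<close>.
  The delicate exponent is q = 1: averages over large balls keep the integral, so they need not tend
  to 0 in norm, and finite sums of levels are not dense. Hence a class is recovered from its levels
  through a pointwise limit, approximation by level sums is confined to \<open>Lq 2\<close>, and a
  semigroup on \<open>Lq q\<close> is compared with \<open>heat\<close> on truncations, which lie in
  both spaces. Strong continuity and the generator come from one estimate,
  \<open>mixture_approx\<close>: if G is the image of F, the difference quotient of
  \<open>heat\<close> at F is exactly minus a mixture of averages of G, with multiplier
  \<open>mean_exp\<close>.\<close>

lemma card_gt_1: "1 < real CARD('p::prime_card)"
  using prime_gt_1_nat[OF prime_card[where 'a='p]] by simp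

lemma card_powi_le_iff [simp]:
  "real CARD('p::prime_card) powi m \<le> real CARD('p) powi n \<longleftrightarrow> m \<le> n"
  using card_gt_1[where 'p='p] power_int_strict_increasing[of n m "real CARD('p)"]
  by (metis linorder_not_less order_less_imp_le power_int_increasing)

lemma card_powi_inject [simp]:
  "real CARD('p::prime_card) powi m = real CARD('p) powi n \<longleftrightarrow> m = n"
  by (simp add: order_eq_iff)

lemma card_powi_pos [simp]: "0 < real CARD('p::prime_card) powi n"
  using card_gt_1[where 'p='p] by (intro zero_less_power_int) simp

lemma padic_norm_tendsto:
  assumes "padic_Cauchy CARD('p::prime_card) X"
  shows "(\<lambda>n. padic_abs CARD('p) (X n)) \<longlonglongrightarrow> padic_norm (abs_padic X :: 'p padic)"
proof -
  have "padic_norm (abs_padic X :: 'p padic) = lim (\<lambda>n. padic_abs CARD('p) (X n))"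
    by (rule padic_norm.abs_eq) (rule padic_rel_refl[OF assms])
  with padic_Cauchy_convergent[OF prime_card assms] show ?thesis
    by (simp add: convergent_LIMSEQ_iff)
qed

lemma padic_cases:
  obtains X where "padic_Cauchy CARD('p::prime_card) X" "x = (abs_padic X :: 'p padic)"
  using Quotient_abs_rep[OF Quotient_padic, of x] Quotient_rep_reflp[OF Quotient_padic, of x]
  by (metis padic_rel_def)

lemma padic_norm_dist: "padic_norm (x - y) = dist x y"
  by (simp add: dist_padic_def)

lemma padic_norm_conv_dist: "padic_norm x = dist x 0"
  by (simp add: dist_padic_def)

lemma padic_norm_eq_0_iff [simp]: "padic_norm x = 0 \<longleftrightarrow> x = 0"
  by (simp add: padic_norm_conv_dist)

lemma padic_norm_0 [simp]: "padic_norm 0 = 0"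
  by simp

lemma padic_norm_nonneg [simp]: "0 \<le> padic_norm x"
  by (simp add: padic_norm_conv_dist)

lemma padic_norm_pos_iff [simp]: "0 < padic_norm x \<longleftrightarrow> x \<noteq> 0"
  by (simp add: padic_norm_conv_dist)

lemma padic_norm_mult: "padic_norm (x * y) = padic_norm x * padic_norm (y :: 'p::prime_card padic)"
proof -
  obtain X where X: "padic_Cauchy CARD('p) X" "x = abs_padic X" by (rule padic_cases)
  obtain Y where Y: "padic_Cauchy CARD('p) Y" "y = abs_padic Y" by (rule padic_cases)
  have XY: "padic_Cauchy CARD('p) (\<lambda>n. X n * Y n)"
    by (intro padic_Cauchy_mult X Y prime_card)
  have eq: "x * y = abs_padic (\<lambda>n. X n * Y n)"
    unfolding X Y by (rule times_padic.abs_eq) (intro padic_rel_refl X Y)+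
  have "(\<lambda>n. padic_abs CARD('p) (X n * Y n)) \<longlonglongrightarrow> padic_norm x * padic_norm y"
    unfolding padic_abs_mult[OF prime_card] X(2) Y(2) by (intro tendsto_mult padic_norm_tendsto X Y)
  with padic_norm_tendsto[OF XY] show ?thesis unfolding eq by (rule LIMSEQ_unique)
qed

lemma padic_norm_minus [simp]: "padic_norm (- x) = padic_norm (x :: 'p::prime_card padic)"
  by (metis add.inverse_neutral dist_commute diff_0 diff_zero padic_norm_dist)

lemma padic_norm_minus_commute: "padic_norm (x - y) = padic_norm (y - x :: 'p::prime_card padic)"
  by (metis minus_diff_eq padic_norm_minus)

lemma padic_norm_ultra:
  "padic_norm (x + y) \<le> max (padic_norm x) (padic_norm (y :: 'p::prime_card padic))"
proof -
  obtain X where X: "padic_Cauchy CARD('p) X" "x = abs_padic X" by (rule padic_cases)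
  obtain Y where Y: "padic_Cauchy CARD('p) Y" "y = abs_padic Y" by (rule padic_cases)
  have XY: "padic_Cauchy CARD('p) (\<lambda>n. X n + Y n)"
    by (intro padic_Cauchy_add X Y prime_card)
  have eq: "x + y = abs_padic (\<lambda>n. X n + Y n)"
    unfolding X Y by (rule plus_padic.abs_eq) (intro padic_rel_refl X Y)+
  have "(\<lambda>n. max (padic_abs CARD('p) (X n)) (padic_abs CARD('p) (Y n)))
      \<longlonglongrightarrow> max (padic_norm x) (padic_norm y)"
    unfolding X(2) Y(2) by (intro tendsto_max padic_norm_tendsto X Y)
  with padic_norm_tendsto[OF XY] show ?thesis unfolding eq
    by (rule LIMSEQ_le) (auto intro!: padic_abs_ultra prime_card)
qed

lemma padic_norm_add_le:
  "padic_norm x \<le> r \<Longrightarrow> padic_norm y \<le> r \<Longrightarrow> padic_norm (x + y :: 'p::prime_card padic) \<le> r"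
  using padic_norm_ultra[of x y] by simp

lemma padic_norm_diff_le:
  "padic_norm x \<le> r \<Longrightarrow> padic_norm y \<le> r \<Longrightarrow> padic_norm (x - y :: 'p::prime_card padic) \<le> r"
  using padic_norm_add_le[of x r "- y"] by simp

lemma padic_norm_1 [simp]: "padic_norm (1 :: 'p::prime_card padic) = 1"
  using padic_norm_mult[of "1::'p padic" 1] padic_norm_eq_0_iff[of "1::'p padic"]
  by (metis mult.right_neutral mult_left_cancel zero_neq_one)

lemma padic_norm_inverse:
  "padic_norm (inverse x) = inverse (padic_norm (x :: 'p::prime_card padic))"
proof (cases "x = 0")
  case False
  hence "padic_norm x * padic_norm (inverse x) = 1"
    by (simp add: padic_norm_mult[symmetric])
  thus ?thesis by (metis inverse_unique)
qed simp

lemma padic_norm_divide: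
  "padic_norm (x / y) = padic_norm x / padic_norm (y :: 'p::prime_card padic)"
  by (simp add: divide_inverse padic_norm_mult padic_norm_inverse)

lemma padic_norm_power:
  "padic_norm (x ^ n) = padic_norm (x :: 'p::prime_card padic) ^ n"
  by (induction n) (simp_all add: padic_norm_mult)

lemma padic_norm_power_int:
  "padic_norm (x powi n) = padic_norm (x :: 'p::prime_card padic) powi n"
  by (simp add: power_int_def padic_norm_power padic_norm_inverse)

section \<open>Approximation of p-adic numbers by rationals and integers\<close>

lemma minus_abs_padic:
  assumes "padic_Cauchy CARD('p::prime_card) X" "padic_Cauchy CARD('p) Y"
  shows "(abs_padic X - abs_padic Y :: 'p padic) = abs_padic (\<lambda>n. X n - Y n)"
  using assms padic_Cauchy_uminus
  by (auto simp: minus_padic_def uminus_padic.abs_eq plus_padic.abs_eq padic_rel_refl)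

lemma of_rat_padic: "(of_rat r :: 'p::prime_card padic) = abs_padic (\<lambda>_. r)"
proof -
  have int: "(of_int i :: 'p padic) = abs_padic (\<lambda>_. of_int i)" for i
    by (cases i rule: int_diff_cases)
       (simp add: of_nat_padic minus_abs_padic)
  obtain a b where r: "r = Fract a b" "b > 0" by (cases r) auto
  have "abs_padic (\<lambda>_. r) * (of_int b :: 'p padic) = of_int a"
    using r by (simp add: int times_padic.abs_eq padic_rel_refl Fract_of_int_quotient)
  thus ?thesis using r by (simp add: of_rat_rat field_simps)
qed

lemma padic_norm_of_rat [simp]:
  "padic_norm (of_rat r :: 'p::prime_card padic) = padic_abs CARD('p) r"
  using LIMSEQ_unique[OF padic_norm_tendsto[of "\<lambda>_. r", where 'p='p] tendsto_const]
  by (simp add: of_rat_padic)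

lemma padic_norm_abs_minus_of_rat:
  assumes X: "padic_Cauchy CARD('p::prime_card) X"
  shows "(\<lambda>n. padic_abs CARD('p) (X n - r)) \<longlonglongrightarrow> padic_norm (abs_padic X - of_rat r :: 'p padic)"
proof -
  have C: "padic_Cauchy CARD('p) (\<lambda>n. X n - r)"
    using padic_Cauchy_add[OF prime_card X padic_Cauchy_const[of _ "- r"]] by simp
  show ?thesis
    using padic_norm_tendsto[OF C] minus_abs_padic[OF X padic_Cauchy_const, of r]
    by (simp add: of_rat_padic)
qed

lemma of_rat_tendsto_abs_padic:
  assumes X: "padic_Cauchy CARD('p::prime_card) X"
  shows "(\<lambda>n. of_rat (X n)) \<longlonglongrightarrow> (abs_padic X :: 'p padic)"
proof (rule metric_LIMSEQ_I)
  fix e :: real assume e: "e > 0"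
  then obtain N where N: "\<forall>m\<ge>N. \<forall>n\<ge>N. padic_abs CARD('p) (X m - X n) < e / 2"
    using padic_CauchyD[OF X, of "e / 2"] by auto
  have "dist (of_rat (X n)) (abs_padic X :: 'p padic) < e" if "n \<ge> N" for n
  proof -
    have "padic_norm (abs_padic X - of_rat (X n) :: 'p padic) \<le> e / 2"
      using N that by (intro LIMSEQ_le_const2[OF padic_norm_abs_minus_of_rat[OF X]])
        (auto intro!: exI[of _ N] less_imp_le)
    thus ?thesis using e by (simp add: padic_norm_dist dist_commute)
  qed
  thus "\<exists>no. \<forall>n\<ge>no. dist (of_rat (X n)) (abs_padic X :: 'p padic) < e" by blast
qed

lemma padic_of_rat_dense:
  fixes x :: "'p::prime_card padic"
  assumes "e > 0"
  obtains r where "padic_norm (x - of_rat r) < e"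
proof -
  obtain X where X: "padic_Cauchy CARD('p) X" "x = abs_padic X" by (rule padic_cases)
  obtain n where "dist (of_rat (X n)) x < e"
    using metric_LIMSEQ_D[OF of_rat_tendsto_abs_padic[OF X(1)] assms] X(2) by blast
  thus ?thesis by (intro that[of "X n"]) (simp add: padic_norm_dist dist_commute)
qed

text \<open>Two applications of the ultrametric inequality: a perturbation smaller than x cannot
  change the size of x.\<close>

lemma padic_norm_eqI:
  fixes x y :: "'p::prime_card padic"
  assumes "padic_norm (x - y) < padic_norm x"
  shows "padic_norm y = padic_norm x"
  using padic_norm_ultra[of "x - y" y] padic_norm_ultra[of "y - x" x] assms
    padic_norm_minus_commute[of x y] by (simp add: max_def split: if_splits)

text \<open>A rational closer to x than \<open>padic_norm x\<close> has the same norm, and on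
  nonzero rationals the norm is a power of p by definition.\<close>

lemma padic_norm_discrete:
  fixes x :: "'p::prime_card padic"
  assumes "x \<noteq> 0"
  obtains n where "padic_norm x = real CARD('p) powi n"
proof -
  obtain r where "padic_norm (x - of_rat r) < padic_norm x"
    using padic_of_rat_dense[of "padic_norm x" x] assms by auto
  hence "padic_norm x = padic_abs CARD('p) r"
    using padic_norm_eqI[of x "of_rat r"] by simp
  moreover from this have "r \<noteq> 0" using assms by auto
  ultimately show ?thesis using that by (auto simp: padic_abs_def)
qed

lemma padic_abs_power_int:
  "padic_norm (of_nat CARD('p) powi n :: 'p::prime_card padic) = real CARD('p) powi (- n)"
proof -
  have "padic_abs CARD('p) (of_int (int CARD('p)) / of_int 1) = real CARD('p) powi (- 1)"
    using prime_gt_1_nat[OF prime_card[where 'a='p]] prime_card[where 'a='p]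
    by (subst Fract_of_int_quotient[symmetric], subst padic_abs_Fract) auto
  hence "padic_norm (of_nat CARD('p) :: 'p padic) = inverse (real CARD('p))"
    using padic_norm_of_rat[of "of_nat CARD('p)", where 'p='p] by simp
  thus ?thesis by (simp add: padic_norm_power_int power_int_minus power_int_inverse)
qed

lemma padic_norm_of_int_le_1: "padic_norm (of_int a :: 'p::prime_card padic) \<le> 1"
proof -
  have "padic_norm (of_nat n :: 'p padic) \<le> 1" for n
    by (induction n) (auto intro: padic_norm_add_le)
  thus ?thesis by (cases a rule: int_diff_cases) (auto intro: padic_norm_diff_le)
qed

text \<open>The norm of an integer is p to the minus its multiplicity. All counting modulo p^m
  passes through this dictionary.\<close>

lemma padic_norm_of_int_le_iff:
  "padic_norm (of_int a :: 'p::prime_card padic) \<le> real CARD('p) powi (- int m)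
     \<longleftrightarrow> int (CARD('p) ^ m) dvd a"
proof (cases "a = 0")
  case False
  have p: "prime CARD('p)" by (rule prime_card)
  have nu: "\<not> is_unit (int CARD('p))" using prime_gt_1_nat[OF p] by auto
  have "padic_norm (of_int a :: 'p padic) = padic_abs CARD('p) (Fract a 1)"
    using padic_norm_of_rat[of "of_int a", where 'p='p] by (simp add: Fract_of_int_quotient)
  also have "\<dots> = real CARD('p) powi (- int (multiplicity (int CARD('p)) a))"
    using False p by (subst padic_abs_Fract) auto
  finally show ?thesis
    using power_dvd_iff_le_multiplicity[OF False nu, of m] card_gt_1[where 'p='p]
    by simp
qed simp

lemma padic_abs_le_1_cases:
  assumes "padic_abs CARD('p::prime_card) r \<le> 1"
  obtains a b where "b > 0" "r = of_int a / of_int b" "coprime b (int CARD('p))"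
proof (cases "r = 0")
  case True
  thus ?thesis by (intro that[of 1 0]) auto
next
  case False
  let ?p = "int CARD('p)"
  have p: "prime ?p" using prime_card[where 'a='p] by simp
  obtain a b where ab: "quotient_of r = (a, b)" by force
  have b: "b > 0" using ab quotient_of_denom_pos by blast
  have r: "r = of_int a / of_int b" using ab by (rule quotient_of_div)
  have cop: "coprime a b" using ab by (rule quotient_of_coprime)
  have le: "multiplicity ?p b \<le> multiplicity ?p a"
    using assms False ab card_powi_le_iff[of "int (multiplicity ?p b) - int (multiplicity ?p a)" 0, where 'p='p]
    by (simp add: padic_abs_def)
  have "a \<noteq> 0" using r False by auto
  have "\<not> ?p dvd b"
  proof
    assume pb: "?p dvd b"
    hence "multiplicity ?p b > 0"
      using p b by (simp add: prime_multiplicity_gt_zero_iff)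
    hence "?p dvd a" using le \<open>a \<noteq> 0\<close> p by (metis gr0I less_le_trans not_dvd_imp_multiplicity_0 not_less0)
    thus False using cop pb p by (metis coprime_common_divisor not_prime_unit)
  qed
  hence "coprime b ?p" using p by (metis coprime_commute prime_imp_coprime)
  thus ?thesis using that b r by blast
qed

text \<open>This identifies Z_p modulo p^m with the residues modulo p^m: x is close to a rational,
  whose denominator is prime to p and therefore invertible modulo p^m.\<close>

lemma padic_integer_approx:
  fixes x :: "'p::prime_card padic"
  assumes x: "padic_norm x \<le> 1"
  obtains k where "k < CARD('p) ^ m" "padic_norm (x - of_nat k) \<le> real CARD('p) powi (- int m)"
proof -
  let ?q = "int CARD('p) ^ m"
  let ?e = "real CARD('p) powi (- int m)"
  have e1: "?e \<le> 1" using card_powi_le_iff[of "- int m" 0, where 'p='p] by simp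
  obtain r where r: "padic_norm (x - of_rat r) < ?e" using padic_of_rat_dense[of ?e x] by auto
  have "padic_norm (x - (x - of_rat r)) \<le> 1"
    by (rule padic_norm_diff_le[OF x]) (use r e1 in linarith)
  hence "padic_abs CARD('p) r \<le> 1" by simp
  then obtain a b where ab: "b > 0" "r = of_int a / of_int b" "coprime b (int CARD('p))"
    by (rule padic_abs_le_1_cases)
  have "coprime b ?q" using ab by simp
  \<comment> \<open>\<open>c\<close> inverts the denominator modulo p^m, so k = a c satisfies b k =
    a modulo p^m. As b has norm 1, this says that k is close to a / b.\<close>
  then obtain c where c: "[b * c = 1] (mod ?q)" by (metis cong_solve_coprime_int)
  define k where "k = (a * c) mod ?q"
  have q: "?q > 0" using prime_gt_0_nat[OF prime_card[where 'a='p]] by simp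
  have k: "0 \<le> k" "k < ?q" using q by (auto simp: k_def)
  have "[b * k = b * (a * c)] (mod ?q)" by (simp add: k_def cong_def mod_mult_right_eq)
  also have "b * (a * c) = a * (b * c)" by simp
  also have "[a * (b * c) = a * 1] (mod ?q)" using c by (rule cong_scalar_left)
  finally have "?q dvd a - b * k" by (simp add: cong_iff_dvd_diff cong_sym_eq dvd_diff_commute)
  hence 1: "padic_norm (of_int (a - b * k) :: 'p padic) \<le> ?e"
    by (subst padic_norm_of_int_le_iff) simp
  have "padic_norm (of_int b :: 'p padic) = 1"
  proof -
    have "\<not> int (CARD('p) ^ 1) dvd b"
      using ab(3) prime_card[where 'a='p] by (auto simp: coprime_absorb_right dest: coprime_common_divisor)
    hence "\<not> padic_norm (of_int b :: 'p padic) \<le> real CARD('p) powi (-1)"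
      using padic_norm_of_int_le_iff[of b 1, where 'p='p] by simp
    moreover obtain n where n: "padic_norm (of_int b :: 'p padic) = real CARD('p) powi n"
      using padic_norm_discrete[of "of_int b :: 'p padic"] ab(1) by auto
    moreover have "n \<le> 0" using padic_norm_of_int_le_1[of b, where 'p='p] n
        card_powi_le_iff[of n 0, where 'p='p] by simp
    moreover from calculation have "n > -1" using card_powi_le_iff[of n "-1", where 'p='p] by simp
    ultimately show ?thesis by (cases "n = 0") auto
  qed
  moreover have "of_rat r - (of_int k :: 'p padic) = of_int (a - b * k) / of_int b"
    using ab(1) unfolding ab(2) by (simp add: of_rat_divide field_simps)
  ultimately have 2: "padic_norm (of_rat r - (of_int k :: 'p padic)) \<le> ?e"
    using 1 by (simp add: padic_norm_divide)
  have "padic_norm ((x - of_rat r) + (of_rat r - of_int k)) \<le> ?e"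
    using r 2 by (intro padic_norm_add_le) auto
  moreover have "nat k < CARD('p) ^ m" "(of_int k :: 'p padic) = of_nat (nat k)"
    using k by (auto simp: nat_less_iff)
  ultimately show ?thesis using that[of "nat k"] by simp
qed

lemma padic_norm_of_nat_diff_less:
  assumes "i < CARD('p::prime_card) ^ m" "j < CARD('p) ^ m"
    "padic_norm (of_nat i - of_nat j :: 'p padic) \<le> real CARD('p) powi (- int m)"
  shows "i = j"
proof -
  have "int (CARD('p) ^ m) dvd int i - int j"
    using assms(3) padic_norm_of_int_le_iff[of "int i - int j" m, where 'p='p] by simp
  hence "[int i = int j] (mod int (CARD('p) ^ m))" by (simp add: cong_iff_dvd_diff)
  hence "[i = j] (mod CARD('p) ^ m)" by (metis cong_int_iff)
  thus ?thesis using assms(1,2) by (simp add: cong_less_modulus_unique_nat)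
qed

section \<open>Balls\<close>

text \<open>The index is the exponent of the radius. Nonzero norms are powers of p, so scales become
  integers, which later index the levels.\<close>

definition padic_ball :: "int \<Rightarrow> 'p::prime_card padic \<Rightarrow> 'p padic set" where
  "padic_ball n x = {y. padic_norm (y - x) \<le> real CARD('p) powi n}"

lemma mem_padic_ball: "y \<in> padic_ball n x \<longleftrightarrow> padic_norm (y - x) \<le> real CARD('p) powi n"
  for x y :: "'p::prime_card padic"
  by (simp add: padic_ball_def)

lemma padic_ball_self [simp]: "x \<in> padic_ball n x"
  by (simp add: mem_padic_ball less_imp_le)

lemma padic_ball_cball: "padic_ball n x = cball x (real CARD('p) powi n)"
  for x :: "'p::prime_card padic"
  by (auto simp: padic_ball_def cball_def padic_norm_dist dist_commute)

lemma padic_ball_sym: "y \<in> padic_ball n x \<longleftrightarrow> x \<in> padic_ball n y"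
  by (simp add: mem_padic_ball padic_norm_minus_commute)

lemma padic_ball_mono: "m \<le> n \<Longrightarrow> padic_ball m x \<subseteq> padic_ball n x"
  by (auto simp: mem_padic_ball elim!: order_trans)

lemma padic_ball_trans: "y \<in> padic_ball n x \<Longrightarrow> z \<in> padic_ball n y \<Longrightarrow> z \<in> padic_ball n x"
  using padic_norm_add_le[of "y - x" _ "z - y"] by (simp add: mem_padic_ball)

lemma padic_ball_eq: "y \<in> padic_ball n x \<Longrightarrow> padic_ball n y = padic_ball n x"
  using padic_ball_trans padic_ball_sym by blast

lemma padic_ball_translate: "x + y \<in> padic_ball n z \<longleftrightarrow> y \<in> padic_ball n (z - x)"
  by (simp add: mem_padic_ball algebra_simps)

lemma padic_ball_image_add: "(+) a ` padic_ball n x = padic_ball n (a + x)"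
proof -
  have "y \<in> (+) a ` padic_ball n x" if "y \<in> padic_ball n (a + x)" for y
    using that by (intro image_eqI[of _ _ "y - a"]) (auto simp: mem_padic_ball algebra_simps)
  thus ?thesis by (auto simp: mem_padic_ball)
qed

lemma powi_at_bot: "e > 0 \<Longrightarrow> \<exists>n. real CARD('p::prime_card) powi n < e"
proof -
  assume "e > 0"
  then obtain n where "inverse (real CARD('p)) ^ n < e"
    using real_arch_pow_inv[of e "inverse (real CARD('p))"] card_gt_1[where 'p='p]
    by (auto simp: inverse_less_1_iff)
  thus ?thesis by (intro exI[of _ "- int n"]) (simp add: power_int_minus power_inverse)
qed

lemma powi_at_top: "\<exists>n. e < real CARD('p::prime_card) powi n"
proof -
  obtain n where "e < real CARD('p) ^ n"
    using real_arch_pow[OF card_gt_1[where 'p='p]] by blast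
  thus ?thesis by (intro exI[of _ "int n"]) simp
qed

lemma padic_norm_exponent_exists: "\<exists>n. x \<in> padic_ball n (0 :: 'p::prime_card padic)"
  using powi_at_top[of "padic_norm x", where 'p='p] by (auto simp: mem_padic_ball intro: less_imp_le)

lemma open_padic_ball: "open (padic_ball n (x :: 'p::prime_card padic))"
  unfolding open_dist
proof (intro ballI exI conjI allI impI)
  fix y z :: "'p padic" assume "y \<in> padic_ball n x" "dist z y < real CARD('p) powi n"
  thus "z \<in> padic_ball n x"
    by (metis less_imp_le mem_padic_ball padic_ball_trans padic_norm_dist)
qed simp

lemma closed_padic_ball: "closed (padic_ball n x)"
  by (simp add: padic_ball_cball)

lemma padic_open_contains_ball:
  fixes x :: "'p::prime_card padic"
  assumes "open S" "x \<in> S"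
  obtains n where "padic_ball n x \<subseteq> S"
proof -
  obtain e where e: "e > 0" "ball x e \<subseteq> S" using assms open_contains_ball by blast
  obtain n where "real CARD('p) powi n < e" using powi_at_bot[OF e(1)] by blast
  hence "padic_ball n x \<subseteq> ball x e" by (auto simp: padic_ball_cball)
  thus ?thesis using that e by blast
qed

lemma padic_ball_rational:
  obtains r where "padic_ball n x = padic_ball n (of_rat r)"
proof -
  obtain r where "padic_norm (x - of_rat r) < real CARD('a) powi n"
    using padic_of_rat_dense[of "real CARD('a) powi n" x] by auto
  thus ?thesis using that[of r] padic_ball_eq[of x n "of_rat r"] by (simp add: mem_padic_ball)
qed

text \<open>Rational centres make the family countable; exponents at most 0 keep to the balls whose
  mass follows directly by subdividing the unit ball.\<close>

definition padic_balls :: "'p::prime_card padic set set" where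
  "padic_balls = {padic_ball n (of_rat r) |n r. n \<le> 0}"

lemma countable_padic_balls: "countable (padic_balls :: 'p::prime_card padic set set)"
proof -
  have "(padic_balls :: 'p padic set set) = (\<Union>n\<in>{..0}. range (\<lambda>r. padic_ball n (of_rat r)))"
    by (auto simp: padic_balls_def)
  moreover have "countable \<dots>" by (intro countable_UN countable_image countableI_type)
  ultimately show ?thesis by (simp only:)
qed

lemma padic_ball_in_padic_balls [simp]: "n \<le> 0 \<Longrightarrow> padic_ball n x \<in> padic_balls"
  by (rule padic_ball_rational[of n x]) (auto simp: padic_balls_def)

lemma padic_balls_cases: "B \<in> padic_balls \<Longrightarrow> \<exists>n x. n \<le> 0 \<and> B = padic_ball n x"
  by (auto simp: padic_balls_def)

lemma topological_basis_padic_balls: "topological_basis (padic_balls :: 'p::prime_card padic set set)"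
proof (rule topological_basisI)
  fix S :: "'p padic set" and x assume "open S" "x \<in> S"
  then obtain n where "padic_ball n x \<subseteq> S" by (rule padic_open_contains_ball)
  hence "padic_ball (min n 0) x \<subseteq> S" using padic_ball_mono[of "min n 0" n x] by auto
  thus "\<exists>B'\<in>padic_balls. x \<in> B' \<and> B' \<subseteq> S"
    by (intro bexI[of _ "padic_ball (min n 0) x"]) auto
qed (auto simp: padic_balls_def open_padic_ball)

instance padic :: (prime_card) second_countable_topology
proof
  have "countable (padic_balls :: 'a padic set set) \<and>
      open = generate_topology (padic_balls :: 'a padic set set)"
    by (intro conjI countable_padic_balls
        topological_basis_imp_subbasis topological_basis_padic_balls)
  thus "\<exists>B :: 'a padic set set. countable B \<and> open = generate_topology B" ..
qed

section \<open>Completeness and compactness\<close>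

text \<open>A Cauchy sequence of p-adic numbers is shadowed by rationals \<open>r n\<close> within 1
  / (n + 1). They form a rational Cauchy sequence, and its class is the limit.\<close>

instance padic :: (prime_card) complete_space
proof
  fix X :: "nat \<Rightarrow> 'a padic" assume X: "Cauchy X"
  have "\<exists>r. padic_norm (X n - of_rat r) < 1 / real (Suc n)" for n
    using padic_of_rat_dense[of "1 / real (Suc n)" "X n"] by auto
  then obtain r where r: "\<And>n. padic_norm (X n - of_rat (r n)) < 1 / real (Suc n)" by metis
  have lim: "(\<lambda>n. padic_norm (X n - of_rat (r n))) \<longlonglongrightarrow> 0"
  proof (rule tendsto_sandwich[OF _ _ tendsto_const LIMSEQ_inverse_real_of_nat])
    have "padic_norm (X n - of_rat (r n)) \<le> inverse (real (Suc n))" for n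
      using r[of n] by (simp only: inverse_eq_divide less_imp_le)
    thus "\<forall>\<^sub>F n in sequentially. padic_norm (X n - of_rat (r n)) \<le> inverse (real (Suc n))"
      by (intro always_eventually allI)
  qed (intro always_eventually allI padic_norm_nonneg)
  have "padic_Cauchy CARD('a) r"
    unfolding padic_Cauchy_def
  proof (intro allI impI)
    fix e :: real assume e: "e > 0"
    obtain M where M: "\<And>n. n \<ge> M \<Longrightarrow> padic_norm (X n - of_rat (r n)) < e"
      using order_tendstoD(2)[OF lim e] unfolding eventually_sequentially by blast
    obtain N where N: "\<And>m n. m \<ge> N \<Longrightarrow> n \<ge> N \<Longrightarrow> padic_norm (X m - X n) < e"
      using metric_CauchyD[OF X e] unfolding padic_norm_dist by blast
    have "padic_abs CARD('a) (r m - r n) < e" if "m \<ge> max M N" "n \<ge> max M N" for m n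
    proof -
      have "max (padic_norm (X m - X n))
          (max (padic_norm (X n - of_rat (r n))) (padic_norm (- (X m - of_rat (r m))))) < e"
        using M[of m] M[of n] N[of m n] that by (simp only: max_less_iff_conj padic_norm_minus max.bounded_iff)
      hence "padic_norm ((X m - X n) + ((X n - of_rat (r n)) + - (X m - of_rat (r m)))) < e"
        using padic_norm_ultra[of "X m - X n" "(X n - of_rat (r n)) + - (X m - of_rat (r m))"]
          padic_norm_ultra[of "X n - of_rat (r n)" "- (X m - of_rat (r m))"] by linarith
      also have "(X m - X n) + ((X n - of_rat (r n)) + - (X m - of_rat (r m))) = of_rat (r m - r n)"
        by (simp add: of_rat_diff)
      finally show ?thesis by simp
    qed
    thus "\<exists>N. \<forall>m\<ge>N. \<forall>n\<ge>N. padic_abs CARD('a) (r m - r n) < e" by blast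
  qed
  hence "(\<lambda>n. of_rat (r n)) \<longlonglongrightarrow> (abs_padic r :: 'a padic)" by (rule of_rat_tendsto_abs_padic)
  hence "(\<lambda>n. dist (of_rat (r n)) (abs_padic r :: 'a padic)) \<longlonglongrightarrow> 0"
    by (rule tendsto_dist_iff[THEN iffD1])
  from tendsto_add[OF lim this]
  have "(\<lambda>n. dist (X n) (of_rat (r n)) + dist (of_rat (r n)) (abs_padic r :: 'a padic)) \<longlonglongrightarrow> 0"
    by (simp only: padic_norm_dist add_0)
  hence "(\<lambda>n. dist (X n) (abs_padic r)) \<longlonglongrightarrow> 0"
    by (rule tendsto_sandwich[OF _ _ tendsto_const, rotated 2])
       (intro always_eventually allI zero_le_dist dist_triangle)+
  hence "X \<longlonglongrightarrow> abs_padic r" by (rule tendsto_dist_iff[THEN iffD2])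
  thus "convergent X" by (auto simp: convergent_def)
qed

lemma padic_ball_scale:
  fixes x :: "'p::prime_card padic"
  shows "x \<in> padic_ball n 0 \<longleftrightarrow> padic_norm (x * of_nat CARD('p) powi n) \<le> 1"
  by (simp add: mem_padic_ball padic_norm_mult padic_abs_power_int power_int_minus field_simps)

text \<open>After scaling by p^n this is \<open>padic_integer_approx\<close>: the residues below p^k
  index the parts. The element p^(-n) has norm p^n, hence the minus sign in
  \<open>f\<close>.\<close>

lemma padic_ball_partition:
  fixes a :: "'p::prime_card padic" and n :: int and k :: nat
  defines "f \<equiv> \<lambda>j. a + of_nat j * of_nat CARD('p) powi (- n)"
  shows "padic_ball n a = (\<Union>j<CARD('p) ^ k. padic_ball (n - int k) (f j))"
    and "disjoint_family_on (\<lambda>j. padic_ball (n - int k) (f j)) {..<CARD('p) ^ k}"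
proof -
  have pn: "real CARD('p) powi (- int k) * real CARD('p) powi n = real CARD('p) powi (n - int k)"
    using card_gt_1[where 'p='p] by (simp add: power_int_add[symmetric])
  show "padic_ball n a = (\<Union>j<CARD('p) ^ k. padic_ball (n - int k) (f j))" (is "_ = ?U")
  proof
    show "padic_ball n a \<subseteq> ?U"
    proof
      fix x assume "x \<in> padic_ball n a"
      hence "x - a \<in> padic_ball n 0" by (simp add: mem_padic_ball)
      hence "padic_norm ((x - a) * of_nat CARD('p) powi n) \<le> 1" by (simp add: padic_ball_scale)
      then obtain j where j: "j < CARD('p) ^ k"
        "padic_norm ((x - a) * of_nat CARD('p) powi n - of_nat j) \<le> real CARD('p) powi (- int k)"
        by (rule padic_integer_approx)
      have "x - f j = ((x - a) * of_nat CARD('p) powi n - of_nat j) * of_nat CARD('p) powi (- n)"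
        by (simp add: f_def field_simps power_int_minus)
      hence "padic_norm (x - f j) \<le> real CARD('p) powi (- int k) * real CARD('p) powi n"
        using j by (simp add: padic_norm_mult padic_abs_power_int)
      thus "x \<in> ?U" using j pn by (auto simp: mem_padic_ball)
    qed
    have "padic_ball (n - int k) (f j) \<subseteq> padic_ball n a" for j
    proof -
      have "padic_norm (of_nat j :: 'p padic) * real CARD('p) powi n \<le> 1 * real CARD('p) powi n"
        using padic_norm_of_int_le_1[of "int j", where 'p='p]
        by (intro mult_right_mono) (auto simp: less_imp_le)
      hence "f j \<in> padic_ball n a"
        by (simp add: mem_padic_ball f_def padic_norm_mult padic_abs_power_int)
      from padic_ball_eq[OF this] show ?thesis
        using padic_ball_mono[of "n - int k" n "f j"] by simp
    qed
    thus "?U \<subseteq> padic_ball n a" by blast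
  qed
  show "disjoint_family_on (\<lambda>j. padic_ball (n - int k) (f j)) {..<CARD('p) ^ k}"
    unfolding disjoint_family_on_def
  proof (intro ballI impI)
    fix i j assume ij: "i \<in> {..<CARD('p) ^ k}" "j \<in> {..<CARD('p) ^ k}" "i \<noteq> j"
    show "padic_ball (n - int k) (f i) \<inter> padic_ball (n - int k) (f j) = {}"
    proof (rule ccontr)
      assume "\<not> ?thesis"
      then obtain x where "x \<in> padic_ball (n - int k) (f i)" "x \<in> padic_ball (n - int k) (f j)"
        by blast
      hence "f i \<in> padic_ball (n - int k) (f j)" using padic_ball_sym padic_ball_trans by blast
      moreover have "f i - f j = (of_nat i - of_nat j) * of_nat CARD('p) powi (- n)"
        by (simp add: f_def algebra_simps)
      ultimately have "padic_norm (of_nat i - of_nat j :: 'p padic) * real CARD('p) powi n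
          \<le> real CARD('p) powi (- int k) * real CARD('p) powi n"
        by (simp add: mem_padic_ball padic_norm_mult padic_abs_power_int pn)
      hence "padic_norm (of_nat i - of_nat j :: 'p padic) \<le> real CARD('p) powi (- int k)"
        by (rule mult_right_le_imp_le) simp
      thus False using padic_norm_of_nat_diff_less[of i k j, where 'p='p] ij by auto
    qed
  qed
qed

lemma padic_ball_finite_cover:
  fixes a :: "'p::prime_card padic"
  shows "\<exists>K. finite K \<and> padic_ball n a \<subseteq> (\<Union>x\<in>K. padic_ball m x)"
proof -
  let ?f = "\<lambda>j. a + of_nat j * of_nat CARD('p) powi (- n)"
  let ?k = "nat (n - m)"
  have "padic_ball (n - int ?k) x \<subseteq> padic_ball m x" for x :: "'p padic"
    by (rule padic_ball_mono) simp
  hence "padic_ball n a \<subseteq> (\<Union>x\<in>?f ` {..<CARD('p) ^ ?k}. padic_ball m x)"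
    unfolding padic_ball_partition(1)[of n a ?k] by blast
  thus ?thesis by blast
qed

lemma compact_padic_ball: "compact (padic_ball n (a :: 'p::prime_card padic))"
  unfolding compact_eq_totally_bounded
proof (intro conjI allI impI)
  show "Topological_Spaces.complete (padic_ball n a)" by (simp add: complete_eq_closed closed_padic_ball)
  fix e :: real assume "e > 0"
  then obtain m where m: "real CARD('p) powi m < e" using powi_at_bot by blast
  obtain K where K: "finite K" "padic_ball n a \<subseteq> (\<Union>x\<in>K. padic_ball m x)"
    using padic_ball_finite_cover by blast
  have "padic_ball m x \<subseteq> ball x e" for x :: "'p padic"
    using m by (auto simp: padic_ball_cball)
  hence "(\<Union>x\<in>K. padic_ball m x) \<subseteq> (\<Union>x\<in>K. ball x e)" by (intro UN_mono subset_refl)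
  with K(2) have "padic_ball n a \<subseteq> (\<Union>x\<in>K. ball x e)" by (rule order_trans)
  with K(1) show "\<exists>k. finite k \<and> padic_ball n a \<subseteq> (\<Union>x\<in>k. ball x e)"
    by (intro exI conjI)
qed

text \<open>Continuity of addition gives the measurability of sums, on which averaging over
  translates rests.\<close>

instance padic :: (prime_card) topological_monoid_add
proof
  fix a b :: "'a padic"
  have "dist (fst z + snd z) (a + b) \<le> dist (fst z) a + dist (snd z) b" for z :: "'a padic \<times> 'a padic"
  proof -
    have "dist (fst z + snd z) (a + b) = padic_norm ((fst z - a) + (snd z - b))"
      by (simp add: padic_norm_dist[symmetric] algebra_simps)
    also have "\<dots> \<le> padic_norm (fst z - a) + padic_norm (snd z - b)"
      using padic_norm_ultra[of "fst z - a" "snd z - b"] padic_norm_nonneg[of "fst z - a"]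
        padic_norm_nonneg[of "snd z - b"] by linarith
    finally show ?thesis by (simp add: padic_norm_dist)
  qed
  moreover have "((\<lambda>z. dist (fst z) a + dist (snd z) b) \<longlongrightarrow> 0) (nhds a \<times>\<^sub>F nhds b)"
  proof -
    have "(fst \<longlongrightarrow> a) (nhds a \<times>\<^sub>F nhds b)" "(snd \<longlongrightarrow> b) (nhds a \<times>\<^sub>F nhds b)"
      by (rule filterlim_fst filterlim_snd)+
    from this[THEN tendsto_dist_iff[THEN iffD1]] show ?thesis by (rule tendsto_add_zero)
  qed
  ultimately have "((\<lambda>z. dist (fst z + snd z) (a + b)) \<longlongrightarrow> 0) (nhds a \<times>\<^sub>F nhds b)"
    by (intro tendsto_sandwich[OF _ _ tendsto_const, of _ "\<lambda>z. dist (fst z + snd z) (a + b)"])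
       (auto intro!: always_eventually)
  thus "((\<lambda>x. fst x + snd x) \<longlongrightarrow> a + b) (nhds a \<times>\<^sub>F nhds b)"
    by (rule tendsto_dist_iff[THEN iffD2])
qed

section \<open>Haar measure\<close>

text \<open>The balls are a countable base of the topology. The empty set is added because two balls
  may be disjoint and the generator has to be closed under intersection.\<close>

lemma sets_borel_padic: "sets (borel :: 'p::prime_card padic measure) = sigma_sets UNIV (insert {} padic_balls)"
proof -
  have "topological_basis (insert {} padic_balls :: 'p padic set set)"
  proof (rule topological_basisI)
    fix S :: "'p padic set" and x assume "open S" "x \<in> S"
    then obtain B where "B \<in> padic_balls" "x \<in> B" "B \<subseteq> S"
      using topological_basisE[OF topological_basis_padic_balls] by metis
    thus "\<exists>B'\<in>insert {} padic_balls. x \<in> B' \<and> B' \<subseteq> S" by blast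
  next
    fix B :: "'p padic set" assume "B \<in> insert {} padic_balls"
    thus "open B" using topological_basis_open[OF topological_basis_padic_balls] by auto
  qed
  hence "(borel :: 'p padic measure) = sigma UNIV (insert {} padic_balls)"
    by (intro borel_eq_countable_basis) (simp_all add: countable_padic_balls)
  from arg_cong[OF this, of sets] show ?thesis by (subst (asm) sets_measure_of) auto
qed

lemma padic_ball_Int:
  assumes "m \<le> n"
  shows "padic_ball m x \<inter> padic_ball n y = (if x \<in> padic_ball n y then padic_ball m x else {})"
proof -
  have "padic_ball m x \<subseteq> padic_ball n x" using assms by (rule padic_ball_mono)
  moreover have "padic_ball n x \<inter> padic_ball n y = {}" if "x \<notin> padic_ball n y"
    using that padic_ball_sym padic_ball_trans by blast
  ultimately show ?thesis using padic_ball_eq[of x n y] by auto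
qed

lemma Int_stable_padic_balls: "Int_stable (insert {} padic_balls :: 'p::prime_card padic set set)"
proof (rule Int_stableI)
  fix A B :: "'p padic set"
  assume A: "A \<in> insert {} padic_balls" and B: "B \<in> insert {} padic_balls"
  show "A \<inter> B \<in> insert {} padic_balls"
  proof (cases "A = {} \<or> B = {}")
    case False
    obtain m x where m: "m \<le> 0" "A = padic_ball m x" using A False padic_balls_cases by blast
    obtain n y where n: "n \<le> 0" "B = padic_ball n y" using B False padic_balls_cases by blast
    consider "m \<le> n" | "n \<le> m" by linarith
    thus ?thesis
    proof cases
      case 1
      show ?thesis unfolding m(2) n(2) padic_ball_Int[OF 1] using m by simp
    next
      case 2
      show ?thesis unfolding m(2) n(2) Int_commute[of "padic_ball m x"] padic_ball_Int[OF 2] using n by simp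
    qed
  qed auto
qed

text \<open>The balls form a generator closed under intersection, and countably many unit balls of
  finite mass cover the space. Both the uniqueness of Haar measure and the invariance of its model
  rest on this.\<close>

lemma padic_measure_eqI:
  fixes M N :: "'p::prime_card padic measure"
  assumes "sets M = sets borel" "sets N = sets borel"
    and eq: "\<And>n x. n \<le> 0 \<Longrightarrow> emeasure M (padic_ball n x) = emeasure N (padic_ball n x)"
    and fin: "\<And>x. emeasure M (padic_ball 0 x) \<noteq> \<infinity>"
  shows "M = N"
proof (rule measure_eqI_generator_eq_countable[OF Int_stable_padic_balls])
  show "emeasure M X = emeasure N X" if "X \<in> insert {} padic_balls" for X
    using that padic_balls_cases[of X] eq by auto
  let ?A = "range (padic_ball 0) :: 'p padic set set"
  show "?A \<subseteq> insert {} padic_balls" by auto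
  hence "?A \<subseteq> padic_balls" by auto
  thus "countable ?A" by (rule countable_subset) (rule countable_padic_balls)
  show "\<Union>?A = UNIV" using padic_ball_self by blast
  show "emeasure M a \<noteq> \<infinity>" if "a \<in> ?A" for a using that fin by auto
  show "sets M = sigma_sets UNIV (insert {} padic_balls)" "sets N = sigma_sets UNIV (insert {} padic_balls)"
    unfolding assms(1,2) by (rule sets_borel_padic)+
qed simp

lemma sets_padic_ball [measurable, simp]: "padic_ball n x \<in> sets borel"
  by (simp add: open_padic_ball)

lemma emeasure_ball_partition:
  fixes M :: "'p::prime_card padic measure"
  assumes M: "sets M = sets borel"
    and inv: "\<And>a A. A \<in> sets borel \<Longrightarrow> emeasure M ((+) a ` A) = emeasure M A"
  shows "emeasure M (padic_ball n x) = of_nat (CARD('p) ^ k) * emeasure M (padic_ball (n - int k) y)"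
proof -
  define f where "f = (\<lambda>j. x + of_nat j * of_nat CARD('p) powi (- n) :: 'p padic)"
  have "emeasure M (padic_ball n x) = (\<Sum>j<CARD('p) ^ k. emeasure M (padic_ball (n - int k) (f j)))"
    unfolding padic_ball_partition(1)[of n x k] f_def
    by (intro sum_emeasure[symmetric] padic_ball_partition(2) finite_lessThan) (auto simp: M)
  also have "\<dots> = (\<Sum>j<CARD('p) ^ k. emeasure M (padic_ball (n - int k) y))"
  proof (rule sum.cong[OF refl])
    fix j
    show "emeasure M (padic_ball (n - int k) (f j)) = emeasure M (padic_ball (n - int k) y)"
      using inv[of "padic_ball (n - int k) y" "f j - y"] by (simp add: padic_ball_image_add)
  qed
  finally show ?thesis by simp
qed

text \<open>The unit ball splits into p^k translates of a ball of radius p^(-k), and invariance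
  gives them equal mass.\<close>

lemma invariant_emeasure_small_ball:
  fixes M :: "'p::prime_card padic measure"
  assumes M: "sets M = sets borel"
    and inv: "\<And>a A. A \<in> sets borel \<Longrightarrow> emeasure M ((+) a ` A) = emeasure M A"
    and 1: "emeasure M (padic_ball 0 0) = 1" and n: "n \<le> 0"
  shows "emeasure M (padic_ball n x) = ennreal (real CARD('p) powi n)"
proof -
  define k where "k = nat (- n)"
  have k: "n = 0 - int k" using n by (simp add: k_def)
  let ?q = "real CARD('p) ^ k"
  have q: "?q > 0" using card_gt_1[where 'p='p] by simp
  have "of_nat (CARD('p) ^ k) * emeasure M (padic_ball n x) = 1"
    using emeasure_ball_partition[OF M inv, of 0 0 k x] 1 k by simp
  hence "ennreal ?q * emeasure M (padic_ball n x) = 1"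
    by (simp add: ennreal_of_nat_eq_real_of_nat)
  hence "ennreal (inverse ?q) * (ennreal ?q * emeasure M (padic_ball n x)) = ennreal (inverse ?q)"
    by simp
  moreover have "ennreal (inverse ?q) * ennreal ?q = 1"
    using q by (simp add: ennreal_mult[symmetric])
  moreover have "real CARD('p) powi n = inverse ?q"
    unfolding k by (simp add: power_int_minus)
  ultimately show ?thesis by (simp add: mult.assoc[symmetric])
qed

section \<open>Digit expansions and the uniform distribution on the unit ball\<close>

definition digit_sum :: "nat \<Rightarrow> (nat \<Rightarrow> nat) \<Rightarrow> nat \<Rightarrow> nat" where
  "digit_sum b d m = (\<Sum>i<m. d i * b ^ i)"

definition padic_of_digits :: "(nat \<Rightarrow> nat) \<Rightarrow> 'p::prime_card padic" where
  "padic_of_digits d = abs_padic (\<lambda>n. of_nat (digit_sum CARD('p) d n))"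

lemma digit_sum_Suc: "digit_sum b d (Suc m) = digit_sum b d m + d m * b ^ m"
  by (simp add: digit_sum_def)

lemma digit_sum_less:
  assumes "\<And>i. d i < b"
  shows "digit_sum b d m < b ^ m"
proof (induction m)
  case (Suc m)
  have "digit_sum b d (Suc m) < b ^ m + d m * b ^ m" using Suc by (simp add: digit_sum_Suc)
  also have "\<dots> = Suc (d m) * b ^ m" by simp
  also have "\<dots> \<le> b * b ^ m" using assms[of m] by (intro mult_right_mono) auto
  finally show ?case by simp
qed (simp add: digit_sum_def)

text \<open>Uniqueness of base-b expansions, by splitting off the top digit. It turns a condition on
  the number \<open>digit_sum b d m\<close> into a cylinder condition on the digit sequence.\<close>

lemma digit_sum_eq_iff:
  assumes "k < b ^ m"
  shows "\<exists>e. (\<forall>i<m. e i < b) \<and> (\<forall>d. (\<forall>i. d i < b) \<longrightarrow> digit_sum b d m = k \<longleftrightarrow> (\<forall>i<m. d i = e i))"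
  using assms
proof (induction m arbitrary: k)
  case (Suc m)
  have b: "b > 0" using Suc.prems by (cases b) auto
  have "k mod b ^ m < b ^ m" using b by simp
  from Suc.IH[OF this] obtain e where e: "\<forall>i<m. e i < b"
    "\<And>d. \<forall>i. d i < b \<Longrightarrow> digit_sum b d m = k mod b ^ m \<longleftrightarrow> (\<forall>i<m. d i = e i)" by blast
  define e' where "e' = e(m := k div b ^ m)"
  have "k div b ^ m < b" using Suc.prems by (simp add: less_mult_imp_div_less mult.commute)
  hence "\<forall>i<Suc m. e' i < b" using e(1) by (auto simp: e'_def less_Suc_eq)
  moreover have "digit_sum b d (Suc m) = k \<longleftrightarrow> (\<forall>i<Suc m. d i = e' i)" if d: "\<forall>i. d i < b" for d
  proof -
    have lt: "digit_sum b d m < b ^ m" using d digit_sum_less by blast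
    have "digit_sum b d (Suc m) = k \<longleftrightarrow> digit_sum b d m = k mod b ^ m \<and> d m = k div b ^ m"
    proof
      assume "digit_sum b d (Suc m) = k"
      thus "digit_sum b d m = k mod b ^ m \<and> d m = k div b ^ m" using lt b
        by (auto simp: digit_sum_Suc)
    next
      assume "digit_sum b d m = k mod b ^ m \<and> d m = k div b ^ m"
      thus "digit_sum b d (Suc m) = k" by (simp add: digit_sum_Suc mod_div_mult_eq)
    qed
    also have "\<dots> \<longleftrightarrow> (\<forall>i<Suc m. d i = e' i)" using e(2)[OF d] by (auto simp: e'_def less_Suc_eq)
    finally show ?thesis .
  qed
  ultimately show ?case by blast
qed (auto simp: digit_sum_def)

lemma digit_sum_dvd: "m \<le> n \<Longrightarrow> int (b ^ m) dvd int (digit_sum b d n) - int (digit_sum b d m)"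
proof (induction n rule: dec_induct)
  case (step n)
  have "int (b ^ m) dvd int (d n * b ^ n)"
    using step.hyps by (intro dvd_trans[OF _ dvd_mult[OF dvd_refl]] of_nat_dvd_iff[THEN iffD2]) (auto simp: le_imp_power_dvd)
  from dvd_add[OF step.IH this] show ?case by (simp add: digit_sum_Suc algebra_simps)
qed simp

lemma digit_sum_diff_norm:
  "m \<le> n \<Longrightarrow> padic_abs CARD('p::prime_card) (of_nat (digit_sum CARD('p) d n) - of_nat (digit_sum CARD('p) d m))
     \<le> real CARD('p) powi (- int m)"
  using padic_norm_of_int_le_iff[of "int (digit_sum CARD('p) d n) - int (digit_sum CARD('p) d m)" m, where 'p='p]
    padic_norm_of_rat[of "of_nat (digit_sum CARD('p) d n) - of_nat (digit_sum CARD('p) d m)", where 'p='p]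
    digit_sum_dvd[of m n "CARD('p)" d]
  by (simp add: of_rat_diff)

lemma padic_Cauchy_digits: "padic_Cauchy CARD('p::prime_card) (\<lambda>n. of_nat (digit_sum CARD('p) d n))"
  unfolding padic_Cauchy_def
proof (intro allI impI)
  fix e :: real assume "e > 0"
  then obtain N where N: "real CARD('p) powi N < e" using powi_at_bot by blast
  let ?K = "nat (- N)"
  let ?s = "\<lambda>n. of_nat (digit_sum CARD('p) d n) :: rat"
  have le: "padic_abs CARD('p) (?s n - ?s m) < e" if "?K \<le> m" "m \<le> n" for m n
  proof -
    have "padic_abs CARD('p) (?s n - ?s m) \<le> real CARD('p) powi (- int m)"
      by (rule digit_sum_diff_norm) (rule that)
    also have "\<dots> \<le> real CARD('p) powi N" using that by simp
    finally show ?thesis using N by simp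
  qed
  have "padic_abs CARD('p) (?s m - ?s n) < e" if "m \<ge> ?K" "n \<ge> ?K" for m n
    using le[of m n] le[of n m] that by (cases "m \<le> n") (auto simp: padic_abs_minus_commute)
  thus "\<exists>N. \<forall>m\<ge>N. \<forall>n\<ge>N. padic_abs CARD('p) (?s m - ?s n) < e" by blast
qed

lemma padic_of_digits_approx:
  "padic_norm (padic_of_digits d - of_nat (digit_sum CARD('p) d m) :: 'p::prime_card padic)
     \<le> real CARD('p) powi (- int m)"
proof -
  have "(\<lambda>n. padic_abs CARD('p) (of_nat (digit_sum CARD('p) d n) - of_nat (digit_sum CARD('p) d m)))
    \<longlonglongrightarrow> padic_norm (padic_of_digits d - of_nat (digit_sum CARD('p) d m) :: 'p padic)"
    using padic_norm_abs_minus_of_rat[OF padic_Cauchy_digits[of d], of "of_nat (digit_sum CARD('p) d m)", where 'p='p]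
    by (simp add: padic_of_digits_def)
  thus ?thesis
    by (rule LIMSEQ_le_const2) (intro exI[of _ m] allI impI digit_sum_diff_norm)
qed

text \<open>The digits from position m on contribute at most p^(-m), so a ball of that radius sees
  only the first m digits.\<close>

lemma padic_of_digits_ball_iff:
  "padic_of_digits d \<in> padic_ball (- int m) (a :: 'p::prime_card padic)
     \<longleftrightarrow> of_nat (digit_sum CARD('p) d m) \<in> padic_ball (- int m) a"
  using padic_of_digits_approx[of d m, where 'p='p] padic_ball_trans padic_ball_sym
  by (metis mem_padic_ball)

definition digit_space :: "nat \<Rightarrow> (nat \<Rightarrow> nat) measure" where
  "digit_space b = PiM UNIV (\<lambda>_. uniform_count_measure {..<b})"

lemma space_digit_space: "space (digit_space b) = {d. \<forall>i. d i < b}"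
  by (auto simp: digit_space_def space_PiM space_uniform_count_measure PiE_def Pi_def)

lemma product_prob_space_digits:
  assumes "b > 0"
  shows "product_prob_space (\<lambda>_ :: nat. uniform_count_measure {..<b :: nat})"
proof -
  have P: "prob_space (uniform_count_measure {..<b})"
    using assms by (intro prob_space_uniform_count_measure) auto
  interpret prob_space "uniform_count_measure {..<b}" by (rule P)
  show ?thesis by unfold_locales
qed

lemma digit_cylinder:
  assumes b: "b > 0" and e: "\<forall>i<m. e i < b"
  shows "{d \<in> space (digit_space b). \<forall>i<m. d i = e i} \<in> sets (digit_space b)"
    and "emeasure (digit_space b) {d \<in> space (digit_space b). \<forall>i<m. d i = e i} = ennreal ((1 / real b) ^ m)"
proof -
  let ?M = "\<lambda>_ :: nat. uniform_count_measure {..<b}"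
  interpret product_prob_space ?M UNIV by (rule product_prob_space_digits[OF b])
  have eq: "{d \<in> space (digit_space b). \<forall>i<m. d i = e i} = prod_emb UNIV ?M {..<m} (Pi\<^sub>E {..<m} (\<lambda>i. {e i}))"
    by (auto simp: prod_emb_def space_digit_space space_PiM space_uniform_count_measure PiE_def Pi_def extensional_def)
  have s: "{e i} \<in> sets (?M i)" if "i \<in> {..<m}" for i
    using e that by (auto simp: sets_uniform_count_measure)
  show "{d \<in> space (digit_space b). \<forall>i<m. d i = e i} \<in> sets (digit_space b)"
    unfolding eq unfolding digit_space_def using s by (intro sets_PiM_I) auto
  have "emeasure (digit_space b) {d \<in> space (digit_space b). \<forall>i<m. d i = e i}
      = (\<Prod>i<m. emeasure (?M i) {e i})"
    unfolding eq unfolding digit_space_def using s by (intro emeasure_PiM_emb) auto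
  also have "\<dots> = (\<Prod>i<m. ennreal (1 / real b))"
    using e by (intro prod.cong) (auto simp: emeasure_uniform_count_measure)
  finally show "emeasure (digit_space b) {d \<in> space (digit_space b). \<forall>i<m. d i = e i} = ennreal ((1 / real b) ^ m)"
    by (simp add: ennreal_power)
qed

text \<open>For a centre in the unit ball take the integer k below p^m that represents it: the
  preimage is the cylinder fixing the m digits of k, of mass p^(-m). A centre outside the unit ball
  is too far from every digit expansion, whence the value 0.\<close>

lemma digits_vimage_ball:
  fixes a :: "'p::prime_card padic" and m :: nat
  defines "D \<equiv> digit_space CARD('p)"
  defines "X \<equiv> padic_of_digits -` padic_ball (- int m) a \<inter> space D"
  shows "X \<in> sets D"
    and "emeasure D X = (if padic_norm a \<le> 1 then ennreal (real CARD('p) powi (- int m)) else 0)"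
proof -
  let ?S = "\<lambda>d. digit_sum CARD('p) d m"
  have p: "CARD('p) > 0" by simp
  have X: "X = {d \<in> space D. of_nat (?S d) \<in> padic_ball (- int m) a}"
    by (auto simp: X_def padic_of_digits_ball_iff)
  have "X \<in> sets D \<and> emeasure D X = (if padic_norm a \<le> 1 then ennreal (real CARD('p) powi (- int m)) else 0)"
  proof (cases "padic_norm a \<le> 1")
    case True
    then obtain k where k: "k < CARD('p) ^ m" "padic_norm (a - of_nat k) \<le> real CARD('p) powi (- int m)"
      by (rule padic_integer_approx)
    obtain e where e: "\<forall>i<m. e i < CARD('p)"
        "\<And>d. \<forall>i. d i < CARD('p) \<Longrightarrow> ?S d = k \<longleftrightarrow> (\<forall>i<m. d i = e i)"
      using digit_sum_eq_iff[OF k(1)] by blast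
    have ball: "padic_ball (- int m) a = padic_ball (- int m) (of_nat k)"
      using k(2) padic_ball_eq by (simp add: mem_padic_ball)
    have "of_nat (?S d) \<in> padic_ball (- int m) a \<longleftrightarrow> (\<forall>i<m. d i = e i)" if "d \<in> space D" for d
    proof -
      have d: "\<forall>i. d i < CARD('p)" using that by (simp add: D_def space_digit_space)
      have "of_nat (?S d) \<in> padic_ball (- int m) a \<longleftrightarrow> ?S d = k"
        unfolding ball mem_padic_ball
        using padic_norm_of_nat_diff_less[OF digit_sum_less[of d "CARD('p)" m] k(1)] d
        by (auto simp: less_imp_le)
      thus ?thesis using e(2)[OF d] by simp
    qed
    hence X': "X = {d \<in> space D. \<forall>i<m. d i = e i}" unfolding X by blast
    have pm: "real CARD('p) powi (- int m) = (1 / real CARD('p)) ^ m"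
      by (simp add: power_int_minus power_one_over inverse_eq_divide)
    show ?thesis
      unfolding X' pm using digit_cylinder[OF p e(1), folded D_def] True by (simp only: if_True simp_thms)
  next
    case False
    have "X = {}"
    proof (rule ccontr)
      assume "X \<noteq> {}"
      then obtain d where "of_nat (?S d) \<in> padic_ball (- int m) a" by (auto simp: X)
      hence "padic_norm (of_nat (?S d) - a) \<le> 1"
        using card_powi_le_iff[of "- int m" 0, where 'p='p] by (simp add: mem_padic_ball)
      moreover have "padic_norm (of_nat (?S d) :: 'p padic) \<le> 1"
        using padic_norm_of_int_le_1[of "int (?S d)"] by simp
      ultimately have "padic_norm (of_nat (?S d) - (of_nat (?S d) - a)) \<le> 1"
        by (rule padic_norm_diff_le[rotated])
      thus False using False by simp
    qed
    thus ?thesis using False by simp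
  qed
  thus "X \<in> sets D" "emeasure D X = (if padic_norm a \<le> 1 then ennreal (real CARD('p) powi (- int m)) else 0)"
    by blast+
qed

lemma padic_of_digits_measurable [measurable]:
  "(padic_of_digits :: _ \<Rightarrow> 'p::prime_card padic) \<in> borel_measurable (digit_space CARD('p))"
proof -
  have "padic_of_digits -` A \<inter> space (digit_space CARD('p)) \<in> sets (digit_space CARD('p))"
    if "A \<in> insert {} padic_balls" for A :: "'p padic set"
  proof (cases "A = {}")
    case False
    hence "A \<in> padic_balls" using that by simp
    then obtain n x where "n \<le> 0" "A = padic_ball n x" by (metis padic_balls_cases)
    hence A: "A = padic_ball (- int (nat (- n))) x" by simp
    show ?thesis unfolding A by (rule digits_vimage_ball(1))
  qed simp
  hence "(padic_of_digits :: _ \<Rightarrow> 'p padic) \<in> measurable (digit_space CARD('p)) (sigma UNIV (insert {} padic_balls))"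
    by (intro measurable_measure_of) auto
  moreover have "sets (sigma UNIV (insert {} padic_balls)) = sets (borel :: 'p padic measure)"
    unfolding sets_borel_padic by (rule sets_measure_of) simp
  ultimately show ?thesis by (subst measurable_cong_sets[OF refl, symmetric])
qed

text \<open>
  The measure is built as the image of a product: the choice of a coset of the unit ball
  (counting measure on representatives), and independent uniform digits inside the unit ball.
\<close>

definition coset_reps :: "'p::prime_card padic set" where
  "coset_reps = (\<lambda>B. SOME x. x \<in> B) ` range (padic_ball 0)"

lemma coset_reps_ex1: "\<exists>!c. c \<in> coset_reps \<and> x \<in> padic_ball 0 c"
proof -
  let ?c = "\<lambda>x. SOME y. y \<in> padic_ball 0 x"
  have c: "?c x \<in> padic_ball 0 x" for x by (rule someI) (rule padic_ball_self)
  show ?thesis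
  proof (rule ex1I[of _ "?c x"])
    show "?c x \<in> coset_reps \<and> x \<in> padic_ball 0 (?c x)"
      using c[of x] padic_ball_sym by (auto simp: coset_reps_def)
    fix c' assume c': "c' \<in> coset_reps \<and> x \<in> padic_ball 0 c'"
    then obtain z where z: "c' = ?c z" by (auto simp: coset_reps_def)
    have "padic_ball 0 x = padic_ball 0 c'" using c' padic_ball_eq by blast
    also have "\<dots> = padic_ball 0 z" unfolding z by (rule padic_ball_eq[OF c])
    finally show "c' = ?c x" using z by simp
  qed
qed

definition haar_model :: "'p::prime_card padic measure" where
  "haar_model = distr (count_space coset_reps \<Otimes>\<^sub>M distr (digit_space CARD('p)) borel padic_of_digits)
     borel (\<lambda>(c, y). c + y)"

text \<open>A ball of radius at most 1 lies in a single coset of the unit ball, so only the section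
  over one representative has mass, and there the uniform digits give the value.\<close>

lemma emeasure_haar_model_ball:
  assumes n: "n \<le> 0"
  shows "emeasure haar_model (padic_ball n (a :: 'p::prime_card padic)) = ennreal (real CARD('p) powi n)"
proof -
  let ?D = "digit_space CARD('p)"
  let ?U = "distr ?D borel (padic_of_digits :: _ \<Rightarrow> 'p padic)"
  let ?C = "count_space (coset_reps :: 'p padic set)"
  have D: "prob_space ?D"
    unfolding digit_space_def by (intro prob_space_PiM prob_space_uniform_count_measure)
      (auto simp: lessThan_empty_iff)
  then interpret U: prob_space ?U by (intro prob_space.prob_space_distr) measurable
  have meas: "(\<lambda>(c, y). c + y) \<in> borel_measurable (?C \<Otimes>\<^sub>M ?U)"
  proof -
    have "fst \<in> measurable (?C \<Otimes>\<^sub>M ?U) borel"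
      by (rule measurable_compose[OF measurable_fst]) simp
    moreover have "snd \<in> measurable (?C \<Otimes>\<^sub>M ?U) borel"
      by (rule measurable_compose[OF measurable_snd]) simp
    ultimately show ?thesis unfolding case_prod_beta by (rule borel_measurable_add)
  qed
  let ?X = "(\<lambda>(c, y). c + y) -` padic_ball n a \<inter> space (?C \<Otimes>\<^sub>M ?U)"
  have X: "?X \<in> sets (?C \<Otimes>\<^sub>M ?U)" using meas by (rule measurable_sets) simp
  obtain c0 where c0: "c0 \<in> coset_reps" "a \<in> padic_ball 0 c0"
    "\<And>c. c \<in> coset_reps \<Longrightarrow> a \<in> padic_ball 0 c \<Longrightarrow> c = c0"
    using coset_reps_ex1[of a] by blast
  have sec: "emeasure ?U (Pair c -` ?X) = ennreal (real CARD('p) powi n) * indicator {c0} c"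
    if c: "c \<in> coset_reps" for c
  proof -
    have "Pair c -` ?X = padic_ball (- int (nat (- n))) (a - c)"
      using c n by (auto simp: space_pair_measure padic_ball_translate)
    hence "emeasure ?U (Pair c -` ?X) = emeasure ?D (padic_of_digits -` padic_ball (- int (nat (- n))) (a - c) \<inter> space ?D)"
      by (subst emeasure_distr) auto
    also have "\<dots> = (if padic_norm (a - c) \<le> 1 then ennreal (real CARD('p) powi n) else 0)"
      using n by (subst digits_vimage_ball) simp
    also have "padic_norm (a - c) \<le> 1 \<longleftrightarrow> c = c0"
      unfolding mem_padic_ball[of a 0 c, unfolded power_int_0_right, symmetric] using c0 c by blast
    finally have E: "emeasure ?U (Pair c -` ?X) = (if c = c0 then ennreal (real CARD('p) powi n) else 0)" .
    show ?thesis unfolding E by (simp add: indicator_def)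
  qed
  have "emeasure haar_model (padic_ball n a) = emeasure (?C \<Otimes>\<^sub>M ?U) ?X"
    unfolding haar_model_def by (rule emeasure_distr[OF meas]) simp
  also have "\<dots> = (\<integral>\<^sup>+c. emeasure ?U (Pair c -` ?X) \<partial>?C)" by (rule U.emeasure_pair_measure_alt[OF X])
  also have "\<dots> = (\<integral>\<^sup>+c. ennreal (real CARD('p) powi n) * indicator {c0} c \<partial>?C)"
    by (rule nn_integral_cong) (use sec in simp)
  also have "\<dots> = ennreal (real CARD('p) powi n)"
    using c0(1) by (subst nn_integral_cmult_indicator) auto
  finally show ?thesis .
qed

lemma vimage_add_eq_image: "(+) (- a) -` A = (+) a ` (A :: 'p::prime_card padic set)"
proof -
  have "x \<in> (+) a ` A" if "- a + x \<in> A" for x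
    using that by (intro image_eqI[of _ _ "- a + x"]) auto
  thus ?thesis by auto
qed

lemma borel_measurable_add_const [measurable]: "(\<lambda>x. a + x) \<in> borel_measurable (borel :: 'p::prime_card padic measure)"
  by (intro borel_measurable_add) auto

text \<open>Translation carries balls to balls of the same radius, whose masses agree;
  \<open>padic_measure_eqI\<close> extends this to all Borel sets.\<close>

lemma haar_model_invariant:
  assumes A: "A \<in> sets borel"
  shows "emeasure haar_model ((+) a ` A) = emeasure haar_model (A :: 'p::prime_card padic set)"
proof -
  have s: "sets (haar_model :: 'p padic measure) = sets borel" by (simp add: haar_model_def)
  have m: "(\<lambda>x. - a + x) \<in> measurable haar_model borel"
    unfolding measurable_cong_sets[OF s refl] by (rule borel_measurable_add_const)
  have sp: "space (haar_model :: 'p padic measure) = UNIV" using sets_eq_imp_space_eq[OF s] by simp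
  have "distr haar_model borel (\<lambda>x. - a + x) = haar_model"
  proof (rule padic_measure_eqI)
    fix n :: int and x assume n: "n \<le> 0"
    show "emeasure (distr haar_model borel (\<lambda>x. - a + x)) (padic_ball n x) = emeasure haar_model (padic_ball n x)"
      using n by (subst emeasure_distr[OF m])
        (auto simp: sp vimage_add_eq_image padic_ball_image_add emeasure_haar_model_ball)
  next
    fix x
    show "emeasure (distr haar_model borel (\<lambda>x. - a + x)) (padic_ball 0 x) \<noteq> \<infinity>"
      by (subst emeasure_distr[OF m])
        (auto simp: sp vimage_add_eq_image padic_ball_image_add emeasure_haar_model_ball)
  qed (auto simp: s)
  hence "emeasure haar_model A = emeasure (distr haar_model borel (\<lambda>x. - a + x)) A" by simp
  also have "\<dots> = emeasure haar_model ((+) a ` A)"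
    using A by (subst emeasure_distr[OF m]) (auto simp: sp vimage_add_eq_image)
  finally show ?thesis by simp
qed

text \<open>The model has the three properties in the description of \<open>haar\<close>, and these
  properties fix the mass of every ball of radius at most 1.\<close>

lemma haar_eq_model: "haar = (haar_model :: 'p::prime_card padic measure)"
  unfolding haar_def
proof (rule the_equality)
  have unit: "{x. padic_norm x \<le> 1} = (padic_ball 0 0 :: 'p padic set)"
    by (simp add: padic_ball_def)
  show "sets haar_model = sets borel \<and> (\<forall>a. \<forall>A\<in>sets borel. emeasure haar_model ((+) a ` A) = emeasure haar_model A)
      \<and> emeasure haar_model {x :: 'p padic. padic_norm x \<le> 1} = 1"
    unfolding unit by (simp add: haar_model_invariant emeasure_haar_model_ball) (simp add: haar_model_def)
  fix M :: "'p padic measure"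
  assume "sets M = sets borel \<and> (\<forall>a. \<forall>A\<in>sets borel. emeasure M ((+) a ` A) = emeasure M A)
      \<and> emeasure M {x. padic_norm x \<le> 1} = 1"
  hence M: "sets M = sets borel" "\<And>a A. A \<in> sets borel \<Longrightarrow> emeasure M ((+) a ` A) = emeasure M A"
      "emeasure M (padic_ball 0 0) = 1" by (auto simp: unit)
  show "M = haar_model"
  proof (rule padic_measure_eqI)
    show "emeasure M (padic_ball n x) = emeasure haar_model (padic_ball n x)" if "n \<le> 0" for n x
      using invariant_emeasure_small_ball[OF M that] that by (simp add: emeasure_haar_model_ball)
    show "emeasure M (padic_ball 0 x) \<noteq> \<infinity>" for x
      using invariant_emeasure_small_ball[OF M order_refl] by simp
  qed (auto simp: M haar_model_def)
qed

lemma sets_haar [simp, measurable_cong]: "sets haar = sets borel"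
  by (simp add: haar_eq_model haar_model_def)

lemma space_haar [simp]: "space haar = UNIV"
  using sets_eq_imp_space_eq[OF sets_haar] by simp

lemma haar_invariant: "A \<in> sets borel \<Longrightarrow> emeasure haar ((+) a ` A) = emeasure haar A"
  by (simp add: haar_eq_model haar_model_invariant)

lemma emeasure_haar_ball [simp]:
  "emeasure haar (padic_ball n (x :: 'p::prime_card padic)) = ennreal (real CARD('p) powi n)"
proof (cases "n \<le> 0")
  case True
  thus ?thesis by (simp add: haar_eq_model emeasure_haar_model_ball)
next
  case False
  define k where "k = nat n"
  have k: "n = int k" using False by (simp add: k_def)
  have "emeasure haar (padic_ball n x) = of_nat (CARD('p) ^ k) * emeasure haar (padic_ball 0 x)"
    using emeasure_ball_partition[OF sets_haar haar_invariant, of n x k x] k by simp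
  also have "emeasure haar (padic_ball 0 x) = 1"
    by (simp add: haar_eq_model emeasure_haar_model_ball)
  finally show ?thesis by (simp add: k ennreal_of_nat_eq_real_of_nat)
qed

lemma measure_haar_ball [simp]: "measure haar (padic_ball n (x :: 'p::prime_card padic)) = real CARD('p) powi n"
  by (simp add: measure_def less_imp_le)

lemma haar_translate: "distr haar borel (\<lambda>x. a + x) = haar"
proof (rule measure_eqI)
  fix A assume "A \<in> sets (distr haar borel (\<lambda>x. a + x))"
  hence A: "A \<in> sets borel" by (simp only: sets_distr)
  have "emeasure (distr haar borel (\<lambda>x. a + x)) A = emeasure haar ((+) (- a) ` A)"
    using A vimage_add_eq_image[of "- a" A] by (subst emeasure_distr) auto
  also have "\<dots> = emeasure haar A" by (rule haar_invariant[OF A])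
  finally show "emeasure (distr haar borel (\<lambda>x. a + x)) A = emeasure haar A" .
qed simp

lemma sigma_finite_haar: "sigma_finite_measure haar"
proof
  show "\<exists>A. countable A \<and> A \<subseteq> sets (haar :: 'a padic measure) \<and> \<Union>A = space haar \<and> (\<forall>a\<in>A. emeasure haar a \<noteq> \<infinity>)"
  proof (intro exI conjI ballI)
    let ?A = "range (padic_ball 0) :: 'a padic set set"
    have "?A \<subseteq> padic_balls" by auto
    thus "countable ?A" by (rule countable_subset) (rule countable_padic_balls)
    show "\<Union>?A = space haar" using padic_ball_self by (simp only: space_haar) blast
  qed auto
qed

interpretation haar: sigma_finite_measure haar
  by (rule sigma_finite_haar)

lemma nn_integral_haar_translate:
  assumes "f \<in> borel_measurable borel"
  shows "(\<integral>\<^sup>+x. f (a + x) \<partial>haar) = (\<integral>\<^sup>+x. f x \<partial>haar)"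
proof -
  have "(\<integral>\<^sup>+x. f x \<partial>haar) = (\<integral>\<^sup>+x. f x \<partial>distr haar borel (\<lambda>x. a + x))" unfolding haar_translate ..
  also have "\<dots> = (\<integral>\<^sup>+x. f (a + x) \<partial>haar)" using assms by (subst nn_integral_distr) auto
  finally show ?thesis by simp
qed

lemma integral_haar_translate:
  fixes f :: "'p::prime_card padic \<Rightarrow> 'b::{banach, second_countable_topology}"
  assumes "f \<in> borel_measurable borel"
  shows "(\<integral>x. f (a + x) \<partial>haar) = (\<integral>x. f x \<partial>haar)"
proof -
  have "(\<integral>x. f x \<partial>haar) = (\<integral>x. f x \<partial>distr haar borel (\<lambda>x. a + x))" unfolding haar_translate ..
  also have "\<dots> = (\<integral>x. f (a + x) \<partial>haar)" using assms by (subst integral_distr) auto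
  finally show ?thesis by simp
qed

lemma AE_haar_translate:
  assumes "AE x in haar. P x"
  shows "AE x in haar. P (a + x)"
proof -
  have "AE x in distr haar borel (\<lambda>x. a + x). P x" unfolding haar_translate by (rule assms)
  thus ?thesis by (rule AE_distrD[rotated]) simp
qed

section \<open>The spaces of q-integrable functions\<close>

lemma ae_rel_iff:
  "ae_rel f g \<longleftrightarrow> f \<in> borel_measurable borel \<and> g \<in> borel_measurable borel \<and> (AE x in haar. f x = g x)"
  by (simp add: ae_rel_def measurable_cong_sets[OF sets_haar refl])

lemma abs_L0_eq_iff:
  assumes "f \<in> borel_measurable borel" "g \<in> borel_measurable borel"
  shows "abs_L0 f = abs_L0 g \<longleftrightarrow> (AE x in haar. f x = g x)"
  using Quotient_rel[OF Quotient_L0, of f g] assms by (simp add: ae_rel_iff)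

lemma abs_L0_cong_AE:
  "f \<in> borel_measurable borel \<Longrightarrow> g \<in> borel_measurable borel \<Longrightarrow> (AE x in haar. f x = g x)
    \<Longrightarrow> abs_L0 f = abs_L0 g"
  by (simp add: abs_L0_eq_iff)

lemma L0_cases:
  obtains f where "f \<in> borel_measurable borel" "F = abs_L0 f"
  using Quotient_abs_rep[OF Quotient_L0, of F] Quotient_rep_reflp[OF Quotient_L0, of F]
  by (metis ae_rel_iff)

lemma rep_L0_measurable [measurable]: "rep_L0 F \<in> borel_measurable borel"
  using Quotient_rep_reflp[OF Quotient_L0, of F] by (simp add: ae_rel_iff)

lemma abs_rep_L0: "abs_L0 (rep_L0 F) = F"
  by (rule Quotient_abs_rep[OF Quotient_L0])

lemma plus_abs_L0:
  "f \<in> borel_measurable borel \<Longrightarrow> g \<in> borel_measurable borel \<Longrightarrow>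
    abs_L0 f + abs_L0 g = abs_L0 (\<lambda>x. f x + g x)"
  by (rule plus_L0.abs_eq) (simp_all add: ae_rel_iff)

lemma minus_abs_L0:
  "f \<in> borel_measurable borel \<Longrightarrow> g \<in> borel_measurable borel \<Longrightarrow>
    abs_L0 f - abs_L0 g = abs_L0 (\<lambda>x. f x - g x)"
  by (rule minus_L0.abs_eq) (simp_all add: ae_rel_iff)

lemma scale_abs_L0: "f \<in> borel_measurable borel \<Longrightarrow> c *\<^sub>C abs_L0 f = abs_L0 (\<lambda>x. c * f x)"
  by (rule scale_L0.abs_eq) (simp_all add: ae_rel_iff)

lemma zero_abs_L0: "0 = abs_L0 (\<lambda>x. 0)"
  unfolding zero_L0_def by simp

lemma scale_L0_add_right: "c *\<^sub>C (F + G) = c *\<^sub>C F + c *\<^sub>C (G :: 'p::prime_card L0)"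
proof -
  obtain f where "f \<in> borel_measurable borel" "F = abs_L0 f" by (rule L0_cases)
  moreover obtain g where "g \<in> borel_measurable borel" "G = abs_L0 g" by (rule L0_cases)
  ultimately show ?thesis by (simp add: plus_abs_L0 scale_abs_L0 distrib_left)
qed

lemma scale_L0_add_left: "(a + b) *\<^sub>C F = a *\<^sub>C F + b *\<^sub>C (F :: 'p::prime_card L0)"
proof -
  obtain f where "f \<in> borel_measurable borel" "F = abs_L0 f" by (rule L0_cases)
  thus ?thesis by (simp add: plus_abs_L0 scale_abs_L0 distrib_right)
qed

lemma scale_L0_scale [simp]: "a *\<^sub>C b *\<^sub>C F = (a * b) *\<^sub>C (F :: 'p::prime_card L0)"
proof -
  obtain f where "f \<in> borel_measurable borel" "F = abs_L0 f" by (rule L0_cases)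
  thus ?thesis by (simp add: scale_abs_L0 mult.assoc)
qed

lemma scale_L0_one [simp]: "1 *\<^sub>C F = (F :: 'p::prime_card L0)"
proof -
  obtain f where "f \<in> borel_measurable borel" "F = abs_L0 f" by (rule L0_cases)
  thus ?thesis by (simp add: scale_abs_L0)
qed

interpretation L0: module "scale_L0 :: complex \<Rightarrow> 'p::prime_card L0 \<Rightarrow> 'p L0"
  by unfold_locales (auto simp: scale_L0_add_left scale_L0_add_right)

text \<open>The q-th power of the norm with values in \<open>ennreal\<close>. It is infinite outside
  \<open>Lq q\<close>, where \<open>Lq_norm\<close> falls back to 0, so estimates are made here and
  read back with \<open>Lq_normI\<close>.\<close>

definition lq_pow :: "real \<Rightarrow> ('p::prime_card padic \<Rightarrow> complex) \<Rightarrow> ennreal" where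
  "lq_pow q f = (\<integral>\<^sup>+x. ennreal (norm (f x) powr q) \<partial>haar)"

lemma abs_in_Lq_iff:
  assumes [measurable]: "f \<in> borel_measurable borel"
  shows "abs_L0 f \<in> Lq q \<longleftrightarrow> lq_pow q f < \<infinity>"
proof -
  have "abs_L0 f \<in> Lq q \<longleftrightarrow> integrable haar (\<lambda>x. norm (f x) powr q)"
    unfolding Lq_def mem_Collect_eq using assms by (intro in_Lq.abs_eq) (simp add: ae_rel_iff)
  thus ?thesis by (simp add: lq_pow_def integrable_iff_bounded)
qed

lemma Lq_norm_abs:
  assumes [measurable]: "f \<in> borel_measurable borel"
  shows "Lq_norm q (abs_L0 f) = enn2real (lq_pow q f) powr (1 / q)"
proof -
  have "Lq_norm q (abs_L0 f) = (\<integral>x. norm (f x) powr q \<partial>haar) powr (1 / q)"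
    using assms by (intro Lq_norm.abs_eq) (simp add: ae_rel_iff)
  thus ?thesis by (simp add: lq_pow_def integral_eq_nn_integral)
qed

lemma Lq_norm_nonneg [simp]: "0 \<le> Lq_norm q F"
  by (rule L0_cases[of F]) (simp add: Lq_norm_abs)

lemma lq_pow_eq_norm:
  assumes "f \<in> borel_measurable borel" "abs_L0 f \<in> Lq q" "1 \<le> q"
  shows "lq_pow q f = ennreal (Lq_norm q (abs_L0 f) powr q)"
  using assms by (simp add: Lq_norm_abs abs_in_Lq_iff powr_powr ennreal_enn2real_if)

lemma Lq_normI:
  assumes "f \<in> borel_measurable borel" "1 \<le> q" "0 \<le> c" "lq_pow q f \<le> ennreal (c powr q)"
  shows "abs_L0 f \<in> Lq q" "Lq_norm q (abs_L0 f) \<le> c"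
proof -
  show "abs_L0 f \<in> Lq q"
    using assms(1,4) by (simp add: abs_in_Lq_iff le_less_trans[OF _ ennreal_less_top])
  have "enn2real (lq_pow q f) \<le> c powr q" using assms(4) by (intro enn2real_leI) auto
  hence "enn2real (lq_pow q f) powr (1 / q) \<le> (c powr q) powr (1 / q)"
    using assms by (intro powr_mono2) auto
  thus "Lq_norm q (abs_L0 f) \<le> c" using assms by (simp add: Lq_norm_abs powr_powr)
qed

lemma Lq_zero [simp]: "0 \<in> Lq q" "1 \<le> q \<Longrightarrow> Lq_norm q 0 = 0"
  by (simp_all add: zero_abs_L0 abs_in_Lq_iff Lq_norm_abs lq_pow_def)

lemma Lq_norm_eq_0D:
  assumes "Lq_norm q F = 0" "F \<in> Lq q" "1 \<le> q"
  shows "F = 0"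
proof -
  obtain f where f[measurable]: "f \<in> borel_measurable borel" "F = abs_L0 f" by (rule L0_cases)
  have "lq_pow q f = 0" using lq_pow_eq_norm[OF f(1)] assms f(2) by simp
  hence "AE x in haar. ennreal (norm (f x) powr q) = 0"
    unfolding lq_pow_def by (subst (asm) nn_integral_0_iff_AE) auto
  hence "AE x in haar. f x = 0" by eventually_elim (simp add: ennreal_eq_0_iff)
  thus ?thesis unfolding f(2) zero_abs_L0 using f(1) by (intro abs_L0_cong_AE) auto
qed

lemma Lq_scale:
  assumes "F \<in> Lq q" "1 \<le> q"
  shows "c *\<^sub>C F \<in> Lq q" "Lq_norm q (c *\<^sub>C F) = norm c * Lq_norm q F"
proof -
  obtain f where f[measurable]: "f \<in> borel_measurable borel" "F = abs_L0 f" by (rule L0_cases)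
  have "lq_pow q (\<lambda>x. c * f x) = (\<integral>\<^sup>+x. ennreal (norm c powr q) * ennreal (norm (f x) powr q) \<partial>haar)"
    unfolding lq_pow_def by (simp add: norm_mult powr_mult ennreal_mult)
  also have "\<dots> = ennreal (norm c powr q) * lq_pow q f"
    unfolding lq_pow_def by (rule nn_integral_cmult) measurable
  finally have eq: "lq_pow q (\<lambda>x. c * f x) = ennreal (norm c powr q) * lq_pow q f" .
  show "c *\<^sub>C F \<in> Lq q"
    using assms(1) unfolding f(2) scale_abs_L0[OF f(1)]
    by (simp add: abs_in_Lq_iff eq ennreal_mult_less_top)
  show "Lq_norm q (c *\<^sub>C F) = norm c * Lq_norm q F"
    using assms(2) unfolding f(2) scale_abs_L0[OF f(1)]
    by (simp add: Lq_norm_abs eq enn2real_mult powr_mult powr_powr)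
qed

text \<open>Bernoulli's inequality: Young's inequality for s^q and 1 with weights 1 / q and 1 - 1 /
  q gives s \<le> s^q / q + 1 - 1 / q.\<close>

lemma powr_ge_tangent:
  fixes s q :: real
  assumes "0 \<le> s" "1 \<le> q"
  shows "1 + q * (s - 1) \<le> s powr q"
proof (cases "s = 0")
  case False
  have "(s powr q) powr (1 / q) * 1 powr (1 - 1 / q) \<le> (1 / q) * (s powr q) + (1 - 1 / q) * 1"
    using assms False by (intro Youngs_inequality_0) auto
  hence "s \<le> s powr q / q + (1 - 1 / q)" using assms by (simp add: powr_powr)
  hence "q * s \<le> q * (s powr q / q + (1 - 1 / q))" using assms by (intro mult_left_mono) auto
  thus ?thesis using assms by (simp add: algebra_simps)
next
  case True
  have "1 + q * (s - 1) = 1 - q" using True by simp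
  also have "\<dots> \<le> 0" using assms by simp
  finally show ?thesis by (rule order_trans) simp
qed

lemma powr_ge_tangent_at:
  fixes s m q :: real
  assumes "0 \<le> s" "0 < m" "1 \<le> q"
  shows "m powr q + q * m powr q / m * (s - m) \<le> s powr q"
proof -
  have "m powr q * (1 + q * (s / m - 1)) \<le> m powr q * (s / m) powr q"
    using assms by (intro mult_left_mono powr_ge_tangent) auto
  also have "\<dots> = s powr q" using assms by (simp add: powr_divide)
  finally show ?thesis using assms by (simp add: field_simps)
qed

lemma powr_convex_comb:
  fixes a b \<theta> q :: real
  assumes "0 \<le> a" "0 \<le> b" "0 \<le> \<theta>" "\<theta> \<le> 1" "1 \<le> q"
  shows "(\<theta> * a + (1 - \<theta>) * b) powr q \<le> \<theta> * a powr q + (1 - \<theta>) * b powr q"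
proof -
  define m where "m = \<theta> * a + (1 - \<theta>) * b"
  have "m \<ge> 0" unfolding m_def using assms by (intro add_nonneg_nonneg mult_nonneg_nonneg) auto
  show ?thesis
  proof (cases "m = 0")
    case True
    thus ?thesis unfolding m_def[symmetric] using assms by simp
  next
    case False
    hence m: "m > 0" using \<open>m \<ge> 0\<close> by simp
    define C where "C = q * m powr q / m"
    have "\<theta> * (m powr q + C * (a - m)) + (1 - \<theta>) * (m powr q + C * (b - m))
        \<le> \<theta> * a powr q + (1 - \<theta>) * b powr q"
      unfolding C_def using assms m by (intro add_mono mult_left_mono powr_ge_tangent_at) auto
    also have "\<theta> * (m powr q + C * (a - m)) + (1 - \<theta>) * (m powr q + C * (b - m))
        = m powr q + C * (\<theta> * a + (1 - \<theta>) * b - m)"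
      by (simp add: algebra_simps)
    also have "\<dots> = m powr q" by (simp add: m_def[symmetric])
    finally show ?thesis by (simp add: m_def)
  qed
qed

lemma le_one_plus_powr: "0 \<le> s \<Longrightarrow> 1 \<le> q \<Longrightarrow> s \<le> 1 + s powr (q :: real)"
proof (cases "s \<le> 1")
  case False
  assume "1 \<le> q"
  hence "s powr 1 \<le> s powr q" using False by (intro powr_mono) auto
  thus ?thesis using False by simp
qed (simp add: add_increasing2)

text \<open>Jensen's inequality by integrating the tangent of s^q at the mean m, whose linear term
  integrates to 0. An infinite right side and the case m = 0, where the tangent formula divides by
  0, are split off.\<close>

lemma (in prob_space) powr_norm_integral_le:
  fixes h :: "'a \<Rightarrow> complex"
  assumes [measurable]: "h \<in> borel_measurable M" and q: "1 \<le> q"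
  shows "ennreal (norm (\<integral>x. h x \<partial>M) powr q) \<le> (\<integral>\<^sup>+x. ennreal (norm (h x) powr q) \<partial>M)"
proof (cases "(\<integral>\<^sup>+x. ennreal (norm (h x) powr q) \<partial>M) = \<infinity> \<or> (\<integral>x. norm (h x) \<partial>M) = 0")
  case True
  thus ?thesis
  proof
    assume "(\<integral>x. norm (h x) \<partial>M) = 0"
    hence "norm (\<integral>x. h x \<partial>M) = 0"
      using integral_norm_bound[of M h] norm_ge_zero[of "\<integral>x. h x \<partial>M"] by linarith
    thus ?thesis using q by simp
  qed simp
next
  case False
  define m where "m = (\<integral>x. norm (h x) \<partial>M)"
  have m: "m > 0" using False by (simp add: m_def order_less_le)
  have iq: "integrable M (\<lambda>x. norm (h x) powr q)"
    using False by (simp add: integrable_iff_bounded top.not_eq_extremum)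
  have i1: "integrable M (\<lambda>x. norm (h x))"
  proof (rule Bochner_Integration.integrable_bound)
    show "integrable M (\<lambda>x. 1 + norm (h x) powr q)" using iq by simp
    show "AE x in M. norm (norm (h x)) \<le> norm (1 + norm (h x) powr q)"
      using le_one_plus_powr[OF norm_ge_zero q] by (auto simp: add_nonneg_nonneg)
  qed simp
  have "m powr q = (\<integral>x. m powr q + q * m powr q / m * (norm (h x) - m) \<partial>M)"
    using i1 by (simp add: m_def[symmetric] prob_space)
  also have "\<dots> \<le> (\<integral>x. norm (h x) powr q \<partial>M)"
    using i1 iq m q by (intro integral_mono powr_ge_tangent_at) auto
  finally have "m powr q \<le> (\<integral>x. norm (h x) powr q \<partial>M)" .
  moreover have "norm (\<integral>x. h x \<partial>M) powr q \<le> m powr q"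
    unfolding m_def using q by (intro powr_mono2 integral_norm_bound) auto
  ultimately have "ennreal (norm (\<integral>x. h x \<partial>M) powr q) \<le> ennreal (\<integral>x. norm (h x) powr q \<partial>M)"
    by (intro ennreal_leI) linarith
  also have "\<dots> = (\<integral>\<^sup>+x. ennreal (norm (h x) powr q) \<partial>M)"
    using iq by (intro nn_integral_eq_integral[symmetric]) auto
  finally show ?thesis .
qed

text \<open>Minkowski's inequality from convexity of s^q: |f| + |g| is a + b times the convex
  combination of |f| / a and |g| / b with weights a / (a + b) and b / (a + b). The strict bounds
  keep a and b positive even if a norm vanishes.\<close>

lemma Lq_triangle_strict:
  assumes F: "F \<in> Lq q" and G: "G \<in> Lq q" and q: "1 \<le> q"
    and ab: "Lq_norm q F < a" "Lq_norm q G < b"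
  shows "F + G \<in> Lq q" "Lq_norm q (F + G) \<le> a + b"
proof -
  obtain f where f[measurable]: "f \<in> borel_measurable borel" "F = abs_L0 f" by (rule L0_cases)
  obtain g where g[measurable]: "g \<in> borel_measurable borel" "G = abs_L0 g" by (rule L0_cases)
  have a: "a > 0" and b: "b > 0" using ab le_less_trans[OF Lq_norm_nonneg] by auto
  define \<theta> where "\<theta> = a / (a + b)"
  have \<theta>: "0 \<le> \<theta>" "\<theta> \<le> 1" "\<theta> = a / (a + b)" "1 - \<theta> = b / (a + b)"
    using a b by (auto simp: \<theta>_def field_simps)
  define A where "A = (a + b) powr q * \<theta> / a powr q"
  define B where "B = (a + b) powr q * (1 - \<theta>) / b powr q"
  have AB: "A \<ge> 0" "B \<ge> 0" unfolding A_def B_def using \<theta>(1,2)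
    by simp_all
  have pt: "norm (f x + g x) powr q \<le> A * norm (f x) powr q + B * norm (g x) powr q" for x
  proof -
    have "\<theta> * (norm (f x) / a) + (1 - \<theta>) * (norm (g x) / b) = (norm (f x) + norm (g x)) / (a + b)"
      unfolding \<theta>(4) unfolding \<theta>_def using a b by (simp add: add_divide_distrib)
    hence eq: "norm (f x) + norm (g x) = (a + b) * (\<theta> * (norm (f x) / a) + (1 - \<theta>) * (norm (g x) / b))"
      using a b by (simp add: field_simps)
    have "norm (f x + g x) powr q \<le> (norm (f x) + norm (g x)) powr q"
      using q by (intro powr_mono2 norm_triangle_ineq) auto
    also have "\<dots> = (a + b) powr q * (\<theta> * (norm (f x) / a) + (1 - \<theta>) * (norm (g x) / b)) powr q"
      unfolding eq by (rule powr_mult)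
    also have "\<dots> \<le> (a + b) powr q * (\<theta> * (norm (f x) / a) powr q + (1 - \<theta>) * (norm (g x) / b) powr q)"
      using a b \<theta> q by (intro mult_left_mono powr_convex_comb) auto
    also have "\<dots> = A * norm (f x) powr q + B * norm (g x) powr q"
      using a b by (simp add: A_def B_def powr_divide algebra_simps)
    finally show ?thesis .
  qed
  have "lq_pow q (\<lambda>x. f x + g x) \<le> (\<integral>\<^sup>+x. ennreal A * ennreal (norm (f x) powr q) + ennreal B * ennreal (norm (g x) powr q) \<partial>haar)"
    unfolding lq_pow_def using pt AB
    by (intro nn_integral_mono) (simp add: ennreal_mult[symmetric] ennreal_plus[symmetric] del: ennreal_plus)
  also have "\<dots> = ennreal A * lq_pow q f + ennreal B * lq_pow q g"
    unfolding lq_pow_def by (subst nn_integral_add) (auto simp: nn_integral_cmult)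
  also have "\<dots> \<le> ennreal A * ennreal (a powr q) + ennreal B * ennreal (b powr q)"
    using F G ab q a b unfolding f(2) g(2)
    by (intro add_mono mult_left_mono) (auto simp: lq_pow_eq_norm intro!: ennreal_leI powr_mono2)
  also have "\<dots> = ennreal (A * a powr q + B * b powr q)"
    using AB by (simp add: ennreal_mult[symmetric] ennreal_plus[symmetric] del: ennreal_plus)
  also have "A * a powr q + B * b powr q = (a + b) powr q * \<theta> + (a + b) powr q * (1 - \<theta>)"
    using a b by (simp add: A_def B_def)
  also have "\<dots> = (a + b) powr q" by (simp add: distrib_left[symmetric])
  finally have "lq_pow q (\<lambda>x. f x + g x) \<le> ennreal ((a + b) powr q)" .
  moreover have "(\<lambda>x. f x + g x) \<in> borel_measurable borel" by measurable
  moreover have "0 \<le> a + b" using a b by simp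
  ultimately show "F + G \<in> Lq q" "Lq_norm q (F + G) \<le> a + b"
    unfolding f(2) g(2) plus_abs_L0[OF f(1) g(1)] using Lq_normI q by blast+
qed

lemma Lq_add: "F \<in> Lq q \<Longrightarrow> G \<in> Lq q \<Longrightarrow> 1 \<le> q \<Longrightarrow> F + G \<in> Lq q"
  by (rule Lq_triangle_strict(1)[OF _ _ _ less_add_one less_add_one])

lemma Lq_triangle:
  assumes "F \<in> Lq q" "G \<in> Lq q" "1 \<le> q"
  shows "Lq_norm q (F + G) \<le> Lq_norm q F + Lq_norm q G"
proof (rule field_le_epsilon)
  fix e :: real assume "e > 0"
  thus "Lq_norm q (F + G) \<le> Lq_norm q F + Lq_norm q G + e"
    using Lq_triangle_strict(2)[OF assms, of "Lq_norm q F + e / 2" "Lq_norm q G + e / 2"] by simp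
qed

lemma uminus_L0_scale: "- F = (- 1) *\<^sub>C (F :: 'p::prime_card L0)"
  by simp

lemma Lq_uminus: "F \<in> Lq q \<Longrightarrow> 1 \<le> q \<Longrightarrow> - F \<in> Lq q"
  unfolding uminus_L0_scale by (rule Lq_scale)

lemma Lq_norm_uminus: "F \<in> Lq q \<Longrightarrow> 1 \<le> q \<Longrightarrow> Lq_norm q (- F) = Lq_norm q F"
  unfolding uminus_L0_scale by (simp add: Lq_scale del: L0.scale_minus_left)

lemma Lq_diff: "F \<in> Lq q \<Longrightarrow> G \<in> Lq q \<Longrightarrow> 1 \<le> q \<Longrightarrow> F - G \<in> Lq q"
  unfolding diff_conv_add_uminus by (intro Lq_add Lq_uminus)

lemma Lq_norm_diff_triangle:
  "F \<in> Lq q \<Longrightarrow> G \<in> Lq q \<Longrightarrow> 1 \<le> q \<Longrightarrow> Lq_norm q (F - G) \<le> Lq_norm q F + Lq_norm q G"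
  using Lq_triangle[of F q "- G"] Lq_uminus[of G q] Lq_norm_uminus[of G q] by simp

lemma Lq_norm_minus_commute:
  "F \<in> Lq q \<Longrightarrow> G \<in> Lq q \<Longrightarrow> 1 \<le> q \<Longrightarrow> Lq_norm q (F - G) = Lq_norm q (G - F)"
  using Lq_norm_uminus[of "F - G" q] Lq_diff[of F q G] by simp

lemma Lq_norm_triangle3:
  assumes "F \<in> Lq q" "G \<in> Lq q" "H \<in> Lq q" "1 \<le> q"
  shows "Lq_norm q (F - H) \<le> Lq_norm q (F - G) + Lq_norm q (G - H)"
  using Lq_triangle[of "F - G" q "G - H"] assms by (simp add: Lq_diff)

lemma Lq_tendsto_unique:
  assumes "Lq_tendsto q X F" "Lq_tendsto q X G" "F \<in> Lq q" "G \<in> Lq q" "\<And>n. X n \<in> Lq q" "1 \<le> q"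
  shows "F = G"
proof -
  have "(\<lambda>n. Lq_norm q (X n - F) + Lq_norm q (X n - G)) \<longlonglongrightarrow> 0 + 0"
    using assms(1,2) unfolding Lq_tendsto_def by (rule tendsto_add)
  moreover have "Lq_norm q (F - G) \<le> Lq_norm q (X n - F) + Lq_norm q (X n - G)" for n
    using Lq_norm_triangle3[of F q "X n" G] Lq_norm_minus_commute[of F q "X n"] assms by simp
  ultimately have "Lq_norm q (F - G) \<le> 0"
    by (intro LIMSEQ_le_const) auto
  hence "Lq_norm q (F - G) = 0" by (simp add: order_antisym)
  hence "F - G = 0" using assms by (intro Lq_norm_eq_0D Lq_diff)
  thus ?thesis by simp
qed

section \<open>Averaging with respect to a probability measure\<close>

text \<open>The sign in \<open>x + y\<close> makes this convolution with the reflection of \<mu>.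
  The definition fixes a representative; \<open>conv_abs\<close> frees it from that choice.\<close>

definition conv :: "'p::prime_card padic measure \<Rightarrow> 'p L0 \<Rightarrow> 'p L0" where
  "conv \<mu> F = abs_L0 (\<lambda>x. \<integral>y. rep_L0 F (x + y) \<partial>\<mu>)"

locale padic_prob = prob_space \<mu> for \<mu> :: "'p::prime_card padic measure" +
  assumes sets_mu [simp, measurable_cong]: "sets \<mu> = sets borel"
begin

sublocale P: pair_sigma_finite haar \<mu> ..

lemma space_mu [simp]: "space \<mu> = UNIV"
  using sets_eq_imp_space_eq[OF sets_mu] by simp

lemma conv_fun_measurable [measurable]:
  assumes [measurable]: "f \<in> borel_measurable borel"
  shows "(\<lambda>x. \<integral>y. f (x + y) \<partial>\<mu> :: complex) \<in> borel_measurable borel"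
  by measurable

text \<open>For fixed y the exceptional set of x is a null set by translation invariance. Fubini
  exchanges the quantifiers, so this holds even for singular \<mu>.\<close>

lemma AE_translate:
  assumes [measurable]: "Measurable.pred borel P" and "AE x in haar. P x"
  shows "AE x in haar. AE y in \<mu>. P (x + y)"
proof -
  have "AE y in \<mu>. AE x in haar. P (x + y)"
    using AE_haar_translate[OF assms(2)] by (simp add: add.commute)
  moreover have "Measurable.pred (haar \<Otimes>\<^sub>M \<mu>) (\<lambda>z. P (fst z + snd z))" by measurable
  ultimately show ?thesis using P.AE_commute[of "\<lambda>x y. P (x + y)"] by (simp add: pred_def)
qed

lemma conv_abs:
  assumes [measurable]: "f \<in> borel_measurable borel"
  shows "conv \<mu> (abs_L0 f) = abs_L0 (\<lambda>x. \<integral>y. f (x + y) \<partial>\<mu>)"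
  unfolding conv_def
proof (rule abs_L0_cong_AE)
  have "AE x in haar. rep_L0 (abs_L0 f) x = f x"
    using abs_rep_L0[of "abs_L0 f"] by (subst (asm) abs_L0_eq_iff) auto
  hence "AE x in haar. AE y in \<mu>. rep_L0 (abs_L0 f) (x + y) = f (x + y)"
    by (intro AE_translate) auto
  thus "AE x in haar. (\<integral>y. rep_L0 (abs_L0 f) (x + y) \<partial>\<mu>) = (\<integral>y. f (x + y) \<partial>\<mu>)"
    by eventually_elim (intro integral_cong_AE; measurable)
qed measurable

lemma nn_integral_conv:
  assumes [measurable]: "g \<in> borel_measurable borel"
  shows "(\<integral>\<^sup>+x. \<integral>\<^sup>+y. g (x + y) \<partial>\<mu> \<partial>haar) = (\<integral>\<^sup>+x. g x \<partial>haar)"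
proof -
  have "(\<integral>\<^sup>+x. \<integral>\<^sup>+y. g (x + y) \<partial>\<mu> \<partial>haar) = (\<integral>\<^sup>+y. \<integral>\<^sup>+x. g (x + y) \<partial>haar \<partial>\<mu>)"
    by (rule P.Fubini'[symmetric]) measurable
  also have "\<dots> = (\<integral>\<^sup>+y. \<integral>\<^sup>+x. g x \<partial>haar \<partial>\<mu>)"
    using nn_integral_haar_translate[OF assms] by (simp add: add.commute)
  also have "\<dots> = (\<integral>\<^sup>+x. g x \<partial>haar)"
    using emeasure_space_1 by simp
  finally show ?thesis .
qed

text \<open>Jensen inside, then Fubini and invariance outside: averaging over translates contracts
  every \<open>Lq q\<close>, whatever the probability measure.\<close>

lemma lq_pow_conv_le:
  assumes [measurable]: "f \<in> borel_measurable borel" and q: "1 \<le> q"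
  shows "lq_pow q (\<lambda>x. \<integral>y. f (x + y) \<partial>\<mu>) \<le> lq_pow q f"
proof -
  have "lq_pow q (\<lambda>x. \<integral>y. f (x + y) \<partial>\<mu>) \<le> (\<integral>\<^sup>+x. \<integral>\<^sup>+y. ennreal (norm (f (x + y)) powr q) \<partial>\<mu> \<partial>haar)"
    unfolding lq_pow_def by (intro nn_integral_mono powr_norm_integral_le[OF _ q]) measurable
  also have "\<dots> = lq_pow q f" unfolding lq_pow_def by (rule nn_integral_conv) measurable
  finally show ?thesis .
qed

lemma conv_Lq:
  assumes "F \<in> Lq q" "1 \<le> q"
  shows "conv \<mu> F \<in> Lq q" "Lq_norm q (conv \<mu> F) \<le> Lq_norm q F"
proof -
  obtain f where f[measurable]: "f \<in> borel_measurable borel" "F = abs_L0 f" by (rule L0_cases)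
  have "lq_pow q (\<lambda>x. \<integral>y. f (x + y) \<partial>\<mu>) \<le> ennreal (Lq_norm q F powr q)"
    using lq_pow_conv_le[OF f(1) assms(2)] lq_pow_eq_norm[OF f(1)] assms f(2) by simp
  from Lq_normI[OF _ assms(2) _ this] show "conv \<mu> F \<in> Lq q" "Lq_norm q (conv \<mu> F) \<le> Lq_norm q F"
    unfolding f(2) conv_abs[OF f(1)] by auto
qed

text \<open>The q-th moment is finite for almost every x, and s \<le> 1 + s^q on a probability
  space. Without integrability the integral would default to 0 and additivity of \<open>conv\<close>
  would be in doubt.\<close>

lemma AE_integrable_translate:
  assumes [measurable]: "f \<in> borel_measurable borel" and "abs_L0 f \<in> Lq q" and q: "1 \<le> q"
  shows "AE x in haar. integrable \<mu> (\<lambda>y. f (x + y))"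
proof -
  have "(\<integral>\<^sup>+x. \<integral>\<^sup>+y. ennreal (norm (f (x + y)) powr q) \<partial>\<mu> \<partial>haar) = lq_pow q f"
    unfolding lq_pow_def by (rule nn_integral_conv) measurable
  also have "\<dots> < \<infinity>" using assms by (simp add: abs_in_Lq_iff)
  finally have "AE x in haar. (\<integral>\<^sup>+y. ennreal (norm (f (x + y)) powr q) \<partial>\<mu>) \<noteq> \<infinity>"
    by (intro nn_integral_noteq_infinite) auto
  thus ?thesis
  proof eventually_elim
    case (elim x)
    have "integrable \<mu> (\<lambda>y. norm (f (x + y)) powr q)"
      using elim by (simp add: integrable_iff_bounded top.not_eq_extremum)
    hence "integrable \<mu> (\<lambda>y. 1 + norm (f (x + y)) powr q)" by simp
    thus ?case
    proof (rule Bochner_Integration.integrable_bound)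
      show "AE y in \<mu>. norm (f (x + y)) \<le> norm (1 + norm (f (x + y)) powr q)"
        using le_one_plus_powr[OF norm_ge_zero q] by (auto simp: add_nonneg_nonneg)
    qed measurable
  qed
qed

lemma conv_add:
  assumes "F \<in> Lq q" "G \<in> Lq q" "1 \<le> q"
  shows "conv \<mu> (F + G) = conv \<mu> F + conv \<mu> G"
proof -
  obtain f where f[measurable]: "f \<in> borel_measurable borel" "F = abs_L0 f" by (rule L0_cases)
  obtain g where g[measurable]: "g \<in> borel_measurable borel" "G = abs_L0 g" by (rule L0_cases)
  have "AE x in haar. (\<integral>y. f (x + y) + g (x + y) \<partial>\<mu>) = (\<integral>y. f (x + y) \<partial>\<mu>) + (\<integral>y. g (x + y) \<partial>\<mu>)"
    using AE_integrable_translate[of f q] AE_integrable_translate[of g q] assms f g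
    by (auto elim!: eventually_elim2)
  thus ?thesis unfolding f(2) g(2) by (simp add: plus_abs_L0 conv_abs abs_L0_cong_AE)
qed

lemma conv_scale: "conv \<mu> (c *\<^sub>C F) = c *\<^sub>C conv \<mu> F"
proof -
  obtain f where f[measurable]: "f \<in> borel_measurable borel" "F = abs_L0 f" by (rule L0_cases)
  show ?thesis unfolding f(2) by (simp add: scale_abs_L0 conv_abs)
qed

lemma conv_diff:
  assumes "F \<in> Lq q" "G \<in> Lq q" "1 \<le> q"
  shows "conv \<mu> (F - G) = conv \<mu> F - conv \<mu> G"
  using conv_add[OF assms(1) Lq_uminus[OF assms(2,3)] assms(3)] conv_scale[of "-1" G] by simp

lemma conv_translate:
  assumes [measurable]: "f \<in> borel_measurable borel" "g \<in> borel_measurable borel"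
    and "conv \<mu> (abs_L0 f) = abs_L0 g"
  shows "conv \<mu> (abs_L0 (\<lambda>x. f (x + a))) = abs_L0 (\<lambda>x. g (x + a))"
proof -
  have "AE x in haar. (\<integral>y. f (x + y) \<partial>\<mu>) = g x"
    using assms(3) by (simp add: conv_abs abs_L0_eq_iff)
  from AE_haar_translate[OF this, of a]
  have "AE x in haar. (\<integral>y. f (x + y + a) \<partial>\<mu>) = g (x + a)"
    by (simp add: add_ac)
  thus ?thesis by (simp add: conv_abs abs_L0_eq_iff)
qed

lemma conv_between_0_1:
  assumes "between_0_1 F"
  shows "between_0_1 (conv \<mu> F)"
proof -
  obtain f where f[measurable]: "f \<in> borel_measurable borel" "F = abs_L0 f" by (rule L0_cases)
  let ?P = "\<lambda>z. \<exists>r\<in>{0..1}. z = complex_of_real r"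
  have P: "?P z \<longleftrightarrow> Im z = 0 \<and> 0 \<le> Re z \<and> Re z \<le> 1" for z
    by (auto simp: complex_eq_iff)
  have bt: "between_0_1 (abs_L0 h) \<longleftrightarrow> (AE x in haar. ?P (h x))" if "h \<in> borel_measurable borel" for h
    using that by (intro between_0_1.abs_eq) (simp add: ae_rel_iff)
  have "AE x in haar. ?P (f x)" using assms f(2) bt[OF f(1)] by simp
  hence "AE x in haar. AE y in \<mu>. ?P (f (x + y))"
    by (intro AE_translate) (unfold P, measurable)
  hence "AE x in haar. ?P (\<integral>y. f (x + y) \<partial>\<mu>)"
  proof eventually_elim
    case (elim x)
    have "(\<integral>y. f (x + y) \<partial>\<mu>) = (\<integral>y. complex_of_real (Re (f (x + y))) \<partial>\<mu>)"
      using elim by (intro integral_cong_AE) (auto elim!: eventually_mono)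
    also have "\<dots> = complex_of_real (\<integral>y. Re (f (x + y)) \<partial>\<mu>)" by (rule integral_complex_of_real)
    finally have eq: "(\<integral>y. f (x + y) \<partial>\<mu>) = complex_of_real (\<integral>y. Re (f (x + y)) \<partial>\<mu>)" .
    have "AE y in \<mu>. 0 \<le> Re (f (x + y))" "AE y in \<mu>. Re (f (x + y)) \<le> 1"
      using elim by (auto elim!: eventually_mono)
    hence "(\<integral>y. Re (f (x + y)) \<partial>\<mu>) \<in> {0..1}"
      by (auto intro!: integral_nonneg_AE integral_le_const integrable_const_bound[of _ 1]
          elim!: eventually_elim2)
    thus ?case unfolding eq by blast
  qed
  thus ?thesis unfolding f(2) conv_abs[OF f(1)] by (subst bt) auto
qed

text \<open>A sequence increasing to 1 is dominated by 1, so the limit passes under the integral,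
  and \<mu> has mass 1.\<close>

lemma conv_conservative:
  fixes F :: "nat \<Rightarrow> 'p padic \<Rightarrow> real" and G :: "nat \<Rightarrow> 'p padic \<Rightarrow> complex"
  assumes [measurable]: "\<And>n. F n \<in> borel_measurable borel" "\<And>n. G n \<in> borel_measurable borel"
    and eq: "\<And>n. conv \<mu> (abs_L0 (\<lambda>x. complex_of_real (F n x))) = abs_L0 (G n)"
    and F: "\<And>x. incseq (\<lambda>n. F n x)" "\<And>n x. 0 \<le> F n x" "\<And>x. (\<lambda>n. F n x) \<longlonglongrightarrow> 1"
  shows "AE x in haar. (\<lambda>n. G n x) \<longlonglongrightarrow> 1"
proof -
  have "AE x in haar. G n x = (\<integral>y. complex_of_real (F n (x + y)) \<partial>\<mu>)" for n
    using eq[of n, symmetric] by (simp add: conv_abs abs_L0_eq_iff)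
  hence "AE x in haar. \<forall>n. G n x = (\<integral>y. complex_of_real (F n (x + y)) \<partial>\<mu>)"
    by (simp add: AE_all_countable)
  thus ?thesis
  proof eventually_elim
    case (elim x)
    have le: "F n z \<le> 1" for n z using incseq_le[OF F(1) F(3)] .
    have "(\<lambda>n. \<integral>y. complex_of_real (F n (x + y)) \<partial>\<mu>) \<longlonglongrightarrow> (\<integral>y. 1 \<partial>\<mu>)"
    proof (rule integral_dominated_convergence[where w = "\<lambda>_. 1"])
      show "AE y in \<mu>. (\<lambda>n. complex_of_real (F n (x + y))) \<longlonglongrightarrow> 1"
        using tendsto_of_real[OF F(3), where 'a=complex] by simp
      show "AE y in \<mu>. norm (complex_of_real (F n (x + y))) \<le> 1" for n
        using F(2) le by simp
    qed auto
    thus ?case using elim prob_space by simp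
  qed
qed

end

lemma padic_prob_sum:
  assumes "padic_prob \<mu>" "padic_prob \<nu>"
  shows "padic_prob (distr (\<mu> \<Otimes>\<^sub>M \<nu>) borel (\<lambda>z. fst z + snd z :: 'p::prime_card padic))"
proof -
  interpret \<mu>: padic_prob \<mu> by fact
  interpret \<nu>: padic_prob \<nu> by fact
  interpret P: pair_prob_space \<mu> \<nu> ..
  have "(\<lambda>z. fst z + snd z) \<in> borel_measurable (\<mu> \<Otimes>\<^sub>M \<nu>)" by measurable
  thus ?thesis
    by (intro padic_prob.intro padic_prob_axioms.intro P.prob_space_distr) simp_all
qed

text \<open>Averaging twice is averaging over the law of a sum of independent variables;
  integrability at almost every x licenses Fubini there.\<close>

lemma conv_conv:
  assumes \<mu>: "padic_prob \<mu>" and \<nu>: "padic_prob \<nu>" and F: "F \<in> Lq q" and q: "1 \<le> q"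
  shows "conv \<mu> (conv \<nu> F) = conv (distr (\<mu> \<Otimes>\<^sub>M \<nu>) borel (\<lambda>z. fst z + snd z)) F"
proof -
  interpret \<mu>: padic_prob \<mu> by fact
  interpret \<nu>: padic_prob \<nu> by fact
  interpret pair_sigma_finite \<mu> \<nu> ..
  let ?l = "distr (\<mu> \<Otimes>\<^sub>M \<nu>) borel (\<lambda>z. fst z + snd z)"
  interpret l: padic_prob ?l by (rule padic_prob_sum[OF \<mu> \<nu>])
  obtain f where f[measurable]: "f \<in> borel_measurable borel" "F = abs_L0 f" by (rule L0_cases)
  have "AE x in haar. integrable ?l (\<lambda>w. f (x + w))"
    using l.AE_integrable_translate[OF f(1)] F f(2) q by simp
  hence ae: "AE x in haar. (\<integral>y. \<integral>z. f (x + y + z) \<partial>\<nu> \<partial>\<mu>) = (\<integral>w. f (x + w) \<partial>?l)"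
  proof eventually_elim
    case (elim x)
    have i: "integrable (\<mu> \<Otimes>\<^sub>M \<nu>) (\<lambda>z. f (x + (fst z + snd z)))"
      using elim by (subst (asm) integrable_distr_eq) auto
    have "(\<integral>w. f (x + w) \<partial>?l) = (\<integral>z. f (x + (fst z + snd z)) \<partial>(\<mu> \<Otimes>\<^sub>M \<nu>))"
      by (rule integral_distr) measurable
    also have "\<dots> = (\<integral>y. \<integral>z. f (x + (y + z)) \<partial>\<nu> \<partial>\<mu>)"
      using integral_fst'[OF i] by simp
    finally show ?case by (simp add: add.assoc)
  qed
  have m: "(\<lambda>x. \<integral>z. f (x + z) \<partial>\<nu>) \<in> borel_measurable borel" by measurable
  show ?thesis
    unfolding f(2) \<nu>.conv_abs[OF f(1)] \<mu>.conv_abs[OF m] l.conv_abs[OF f(1)]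
    using ae by (intro abs_L0_cong_AE) (auto simp: add.assoc)
qed

lemma conv_commute:
  assumes \<mu>: "padic_prob \<mu>" and \<nu>: "padic_prob \<nu>" and F: "F \<in> Lq q" and q: "1 \<le> q"
  shows "conv \<mu> (conv \<nu> F) = conv \<nu> (conv \<mu> F)"
proof -
  interpret \<mu>: padic_prob \<mu> by fact
  interpret \<nu>: padic_prob \<nu> by fact
  interpret pair_sigma_finite \<mu> \<nu> ..
  have "distr (\<mu> \<Otimes>\<^sub>M \<nu>) borel (\<lambda>z. fst z + snd z)
      = distr (distr (\<nu> \<Otimes>\<^sub>M \<mu>) (\<mu> \<Otimes>\<^sub>M \<nu>) (\<lambda>(x, y). (y, x))) borel (\<lambda>z. fst z + snd z :: 'a padic)"
    by (subst distr_pair_swap) simp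
  also have "\<dots> = distr (\<nu> \<Otimes>\<^sub>M \<mu>) borel (\<lambda>z. fst z + snd z)"
    by (subst distr_distr) (auto simp: comp_def case_prod_beta add.commute)
  finally show ?thesis using conv_conv[OF \<mu> \<nu> F q] conv_conv[OF \<nu> \<mu> F q] by simp
qed

section \<open>Averages over balls\<close>

definition ball_measure :: "int \<Rightarrow> 'p::prime_card padic measure" where
  "ball_measure n = uniform_measure haar (padic_ball n 0)"

definition avg :: "int \<Rightarrow> 'p::prime_card L0 \<Rightarrow> 'p L0" where
  "avg n = conv (ball_measure n)"

lemma padic_prob_ball_measure: "padic_prob (ball_measure n :: 'p::prime_card padic measure)"
proof -
  interpret prob_space "ball_measure n :: 'p padic measure"
    unfolding ball_measure_def by (rule prob_space_uniform_measure) simp_all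
  show ?thesis by unfold_locales (simp add: ball_measure_def)
qed

interpretation ball_measure: padic_prob "ball_measure n"
  by (rule padic_prob_ball_measure)

lemmas avg_Lq = ball_measure.conv_Lq[folded avg_def]
lemmas avg_add = ball_measure.conv_add[folded avg_def]
lemmas avg_diff = ball_measure.conv_diff[folded avg_def]
lemmas avg_scale = ball_measure.conv_scale[folded avg_def]
lemmas avg_abs = ball_measure.conv_abs[folded avg_def]

lemma avg_zero [simp]: "avg n 0 = 0"
  using avg_scale[of n 0 0] by simp

lemma integral_ball_measure:
  fixes f :: "'p::prime_card padic \<Rightarrow> complex"
  assumes [measurable]: "f \<in> borel_measurable borel"
  shows "(\<integral>y. f (x + y) \<partial>ball_measure n)
    = (\<integral>z. indicator (padic_ball n x) z *\<^sub>R f z \<partial>haar) /\<^sub>R (real CARD('p) powi n)"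
proof -
  let ?c = "real CARD('p) powi n"
  have pos: "?c > 0" by simp
  have "(ball_measure n :: 'p padic measure) = density haar (\<lambda>y. ennreal (indicator (padic_ball n 0) y / ?c) :: ennreal)"
    unfolding ball_measure_def uniform_measure_def emeasure_haar_ball
    by (intro arg_cong[of _ _ "density haar"] ext, subst divide_ennreal[symmetric])
       (simp_all add: ennreal_indicator)
  hence "(\<integral>y. f (x + y) \<partial>ball_measure n)
      = (\<integral>y. (indicator (padic_ball n 0) y / ?c) *\<^sub>R f (x + y) \<partial>haar)"
    by (simp only:) (intro integral_density; simp)
  also have "\<dots> = (\<integral>y. (indicator (padic_ball n x) (x + y) / ?c) *\<^sub>R f (x + y) \<partial>haar)"
    by (simp add: indicator_def padic_ball_translate)
  also have "\<dots> = (\<integral>z. (indicator (padic_ball n x) z / ?c) *\<^sub>R f z \<partial>haar)"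
    by (rule integral_haar_translate) simp
  also have "\<dots> = (\<integral>z. (1 / ?c) *\<^sub>R (indicator (padic_ball n x) z *\<^sub>R f z) \<partial>haar)"
    by (simp add: divide_inverse mult.commute)
  also have "\<dots> = (1 / ?c) *\<^sub>R (\<integral>z. indicator (padic_ball n x) z *\<^sub>R f z \<partial>haar)"
    by (rule integral_scaleR_right)
  finally show ?thesis by (simp add: divide_inverse)
qed

lemma integral_ball_measure_cong_ball:
  fixes f :: "'p::prime_card padic \<Rightarrow> complex"
  assumes "f \<in> borel_measurable borel" "x' \<in> padic_ball n x"
  shows "(\<integral>y. f (x' + y) \<partial>ball_measure n) = (\<integral>y. f (x + y) \<partial>ball_measure n)"
  using assms padic_ball_eq[OF assms(2)] by (simp add: integral_ball_measure)

lemma AE_ball_measure: "AE y in ball_measure n. y \<in> padic_ball n 0"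
  unfolding ball_measure_def by (intro AE_uniform_measureI) auto

lemma integral_ball_measure_const:
  fixes g :: "'p::prime_card padic \<Rightarrow> complex"
  assumes [measurable]: "g \<in> borel_measurable borel" and g: "\<And>y. y \<in> padic_ball n x \<Longrightarrow> g y = c"
  shows "(\<integral>y. g (x + y) \<partial>ball_measure n) = c"
proof -
  have "(\<integral>y. g (x + y) \<partial>ball_measure n) = (\<integral>y. c \<partial>(ball_measure n :: 'p padic measure))"
  proof (rule integral_cong_AE)
    show "AE y in ball_measure n. g (x + y) = c"
      using AE_ball_measure[of n] by eventually_elim (rule g, simp add: padic_ball_translate)
  qed measurable
  thus ?thesis by (simp add: ball_measure.prob_space[simplified])
qed

lemma avg_locally_constant:
  assumes f[measurable]: "f \<in> borel_measurable borel"
    and "\<And>x y. y \<in> padic_ball n x \<Longrightarrow> f y = f x"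
  shows "avg n (abs_L0 f) = abs_L0 f"
  using assms by (simp add: avg_abs integral_ball_measure_const)

text \<open>An average over radius p^n is constant on balls of radius p^n, so averages over smaller
  balls leave it alone.\<close>

lemma avg_avg_le:
  assumes "m \<le> n"
  shows "avg m (avg n F) = avg n F"
proof -
  obtain f where f[measurable]: "f \<in> borel_measurable borel" "F = abs_L0 f" by (rule L0_cases)
  show ?thesis
    unfolding f(2) avg_abs[OF f(1)]
  proof (rule avg_locally_constant)
    show "(\<integral>z. f (y + z) \<partial>ball_measure n) = (\<integral>z. f (x + z) \<partial>ball_measure n)"
      if "y \<in> padic_ball m x" for x y
      using that padic_ball_mono[OF assms] by (intro integral_ball_measure_cong_ball) auto
  qed measurable
qed

lemma avg_commute:
  assumes "padic_prob \<mu>" "F \<in> Lq q" "1 \<le> q"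
  shows "avg n (conv \<mu> F) = conv \<mu> (avg n F)"
  unfolding avg_def by (rule conv_commute[OF padic_prob_ball_measure assms])

lemma avg_avg:
  assumes "F \<in> Lq q" "1 \<le> q"
  shows "avg m (avg n F) = avg (max m n) F"
proof (cases "m \<le> n")
  case False
  have "avg m (avg n F) = avg n (avg m F)"
    using avg_commute[OF padic_prob_ball_measure assms] unfolding avg_def by simp
  thus ?thesis using False avg_avg_le[of n m F] by (simp add: max_def)
qed (simp add: avg_avg_le max_def)

text \<open>Jensen on a ball of measure p^n. The bound falls to 0 as n grows, uniformly in x and for
  every q \<ge> 1; it replaces decay in norm, which fails for q = 1.\<close>

lemma norm_avg_le:
  fixes f :: "'p::prime_card padic \<Rightarrow> complex"
  assumes [measurable]: "f \<in> borel_measurable borel" and f: "abs_L0 f \<in> Lq q" and q: "1 \<le> q"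
  shows "norm (\<integral>y. f (x + y) \<partial>ball_measure n) powr q
    \<le> Lq_norm q (abs_L0 f) powr q / (real CARD('p) powi n)"
proof -
  let ?c = "real CARD('p) powi n"
  have pos: "?c > 0" by simp
  have "ennreal (norm (\<integral>y. f (x + y) \<partial>ball_measure n) powr q)
      \<le> (\<integral>\<^sup>+y. ennreal (norm (f (x + y)) powr q) \<partial>ball_measure n)"
    by (rule ball_measure.powr_norm_integral_le[OF _ q]) measurable
  also have "\<dots> = (\<integral>\<^sup>+y. ennreal (norm (f (x + y)) powr q) * indicator (padic_ball n 0) y \<partial>haar) / ennreal ?c"
    unfolding ball_measure_def by (subst nn_integral_uniform_measure) auto
  also have "\<dots> \<le> (\<integral>\<^sup>+y. ennreal (norm (f (x + y)) powr q) \<partial>haar) / ennreal ?c"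
    by (intro divide_right_mono_ennreal nn_integral_mono) (simp add: indicator_def)
  also have "\<dots> = lq_pow q f / ennreal ?c"
    unfolding lq_pow_def by (subst nn_integral_haar_translate) auto
  also have "\<dots> = ennreal (Lq_norm q (abs_L0 f) powr q / ?c)"
    using lq_pow_eq_norm[OF assms(1) f q] pos by (simp add: divide_ennreal)
  finally show ?thesis using pos by (subst (asm) ennreal_le_iff) auto
qed

section \<open>Convergence of the averages\<close>

lemma Lq_norm_tendsto_0I:
  assumes meas: "\<And>n. f n \<in> borel_measurable borel" and q: "1 \<le> q"
    and lim: "((\<lambda>n. lq_pow q (f n)) \<longlongrightarrow> 0) F"
  shows "((\<lambda>n. Lq_norm q (abs_L0 (f n))) \<longlongrightarrow> 0) F"
proof -
  have "((\<lambda>n. enn2real (lq_pow q (f n))) \<longlongrightarrow> 0) F"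
    using lim by (intro tendsto_enn2real) auto
  hence "((\<lambda>n. enn2real (lq_pow q (f n)) powr (1 / q)) \<longlongrightarrow> 0 powr (1 / q)) F"
    using q by (intro tendsto_powr' tendsto_const) auto
  thus ?thesis using meas q by (simp add: Lq_norm_abs)
qed

lemma Lq_dominated_convergence:
  fixes s :: "nat \<Rightarrow> 'p::prime_card padic \<Rightarrow> complex"
  assumes [measurable]: "\<And>i. s i \<in> borel_measurable borel" "f \<in> borel_measurable borel"
      "g \<in> borel_measurable borel"
    and g: "abs_L0 g \<in> Lq q" and q: "1 \<le> q"
    and bound: "\<And>i x. norm (s i x) \<le> norm (g x)"
    and lim: "\<And>x. (\<lambda>i. s i x) \<longlonglongrightarrow> f x"
  shows "(\<lambda>i. Lq_norm q (abs_L0 (s i) - abs_L0 f)) \<longlonglongrightarrow> 0"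
proof -
  have "(\<lambda>i. lq_pow q (\<lambda>x. s i x - f x)) \<longlonglongrightarrow> (\<integral>\<^sup>+x. 0 \<partial>(haar :: 'p padic measure))"
    unfolding lq_pow_def
  proof (rule nn_integral_dominated_convergence[where w = "\<lambda>x. ennreal (2 powr q) * ennreal (norm (g x) powr q)"])
    have fg: "norm (f x) \<le> norm (g x)" for x
      using bound by (intro LIMSEQ_le_const2[OF tendsto_norm[OF lim]]) auto
    have "norm (s i x - f x) powr q \<le> 2 powr q * norm (g x) powr q" for i x
    proof -
      have "norm (s i x - f x) \<le> 2 * norm (g x)"
        using norm_triangle_ineq4[of "s i x" "f x"] bound[of i x] fg[of x] by simp
      hence "norm (s i x - f x) powr q \<le> (2 * norm (g x)) powr q" using q by (intro powr_mono2) auto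
      thus ?thesis by (simp add: powr_mult)
    qed
    thus "AE x in haar. ennreal (norm (s i x - f x) powr q) \<le> ennreal (2 powr q) * ennreal (norm (g x) powr q)" for i
      by (simp add: ennreal_mult[symmetric])
    have "(\<integral>\<^sup>+x. ennreal (2 powr q) * ennreal (norm (g x) powr q) \<partial>haar) = ennreal (2 powr q) * lq_pow q g"
      unfolding lq_pow_def by (rule nn_integral_cmult) measurable
    thus "(\<integral>\<^sup>+x. ennreal (2 powr q) * ennreal (norm (g x) powr q) \<partial>haar) < \<infinity>"
      using g by (simp add: abs_in_Lq_iff ennreal_mult_less_top)
    have "(\<lambda>i. ennreal (norm (s i x - f x) powr q)) \<longlonglongrightarrow> ennreal (0 powr q)" for x
      using q tendsto_norm_zero[OF LIM_zero[OF lim[of x]]]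
      by (intro tendsto_ennrealI tendsto_powr' tendsto_const) auto
    thus "AE x in haar. (\<lambda>i. ennreal (norm (s i x - f x) powr q)) \<longlonglongrightarrow> 0" by simp
  qed measurable
  hence "(\<lambda>i. Lq_norm q (abs_L0 (\<lambda>x. s i x - f x))) \<longlonglongrightarrow> 0"
    using q by (intro Lq_norm_tendsto_0I) auto
  thus ?thesis by (simp add: minus_abs_L0)
qed

text \<open>The classes recovered by averages over shrinking balls. As a set it can be shown to be a
  subspace closed under norm limits, which leaves only enough members to be exhibited.\<close>

definition avg_approx :: "real \<Rightarrow> 'p::prime_card L0 set" where
  "avg_approx q = {F \<in> Lq q. ((\<lambda>n. Lq_norm q (avg n F - F)) \<longlongrightarrow> 0) at_bot}"

text \<open>All averages are contractions, so the error for F is at most the error for X k plus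
  twice the distance from F to X k.\<close>

lemma avg_approx_limit:
  assumes q: "1 \<le> q" and F: "F \<in> Lq q" and X: "\<And>k. X k \<in> avg_approx q"
    and lim: "(\<lambda>k. Lq_norm q (X k - F)) \<longlonglongrightarrow> 0"
  shows "F \<in> avg_approx q"
proof -
  have "((\<lambda>n. Lq_norm q (avg n F - F)) \<longlongrightarrow> 0) at_bot"
  proof (rule tendstoI)
    fix e :: real assume e: "e > 0"
    obtain k where k: "Lq_norm q (X k - F) < e / 3"
      using order_tendstoD(2)[OF lim, of "e / 3"] e by (auto simp: eventually_sequentially)
    have Xk: "X k \<in> Lq q" and "((\<lambda>n. Lq_norm q (avg n (X k) - X k)) \<longlongrightarrow> 0) at_bot"
      using X by (auto simp: avg_approx_def)
    from order_tendstoD(2)[OF this(2), of "e / 3"] e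
    have "\<forall>\<^sub>F n in at_bot. Lq_norm q (avg n (X k) - X k) < e / 3" by simp
    thus "\<forall>\<^sub>F n in at_bot. dist (Lq_norm q (avg n F - F)) 0 < e"
    proof eventually_elim
      case (elim n)
      have 1: "Lq_norm q (avg n F - avg n (X k)) \<le> Lq_norm q (F - X k)"
        using avg_Lq(2)[OF Lq_diff[OF F Xk q] q, of n] avg_diff[OF F Xk q, of n] by simp
      have 2: "Lq_norm q (F - X k) < e / 3" using k Lq_norm_minus_commute[OF F Xk q] by simp
      have "Lq_norm q (avg n F - F) \<le> Lq_norm q (avg n F - avg n (X k)) + Lq_norm q (avg n (X k) - F)"
        using F Xk q by (intro Lq_norm_triangle3 avg_Lq) auto
      moreover have "Lq_norm q (avg n (X k) - F) \<le> Lq_norm q (avg n (X k) - X k) + Lq_norm q (X k - F)"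
        using F Xk q by (intro Lq_norm_triangle3 avg_Lq) auto
      ultimately show ?case using 1 2 k elim by simp
    qed
  qed
  thus ?thesis using F by (simp add: avg_approx_def)
qed

lemma avg_approx_add:
  assumes "F \<in> avg_approx q" "G \<in> avg_approx q" "1 \<le> q"
  shows "F + G \<in> avg_approx q"
proof -
  have FG: "F \<in> Lq q" "G \<in> Lq q" using assms by (auto simp: avg_approx_def)
  have "((\<lambda>n. Lq_norm q (avg n F - F) + Lq_norm q (avg n G - G)) \<longlongrightarrow> 0) at_bot"
    using assms by (intro tendsto_add_zero) (auto simp: avg_approx_def)
  moreover have "Lq_norm q (avg n (F + G) - (F + G)) \<le> Lq_norm q (avg n F - F) + Lq_norm q (avg n G - G)" for n
    using Lq_triangle[of "avg n F - F" q "avg n G - G"] FG assms(3)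
    by (simp add: avg_add[OF FG assms(3)] Lq_diff avg_Lq algebra_simps)
  ultimately have "((\<lambda>n. Lq_norm q (avg n (F + G) - (F + G))) \<longlongrightarrow> 0) at_bot"
    by (intro tendsto_sandwich[OF _ _ tendsto_const, of _ "\<lambda>n. Lq_norm q (avg n (F + G) - (F + G))"])
       auto
  thus ?thesis using Lq_add[OF FG assms(3)] by (simp add: avg_approx_def)
qed

lemma avg_approx_scale:
  assumes "F \<in> avg_approx q" "1 \<le> q"
  shows "c *\<^sub>C F \<in> avg_approx q"
proof -
  have F: "F \<in> Lq q" using assms by (auto simp: avg_approx_def)
  have "Lq_norm q (avg n (c *\<^sub>C F) - c *\<^sub>C F) = norm c * Lq_norm q (avg n F - F)" for n
    using Lq_scale(2)[of "avg n F - F" q c] assms(2) F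
    by (simp add: avg_scale Lq_diff avg_Lq L0.scale_right_diff_distrib)
  moreover have "((\<lambda>n. norm c * Lq_norm q (avg n F - F)) \<longlongrightarrow> 0) at_bot"
    using assms by (intro tendsto_mult_right_zero) (auto simp: avg_approx_def)
  ultimately show ?thesis using Lq_scale(1)[OF F assms(2)] by (simp add: avg_approx_def)
qed

lemma avg_approx_diff:
  assumes "F \<in> avg_approx q" "G \<in> avg_approx q" "1 \<le> q"
  shows "F - G \<in> avg_approx q"
  using avg_approx_add[OF assms(1) avg_approx_scale[OF assms(2,3), of "-1"] assms(3)] by simp

lemma avg_approx_zero: "1 \<le> q \<Longrightarrow> 0 \<in> avg_approx q"
  by (simp add: avg_approx_def)

lemma avg_approxI:
  assumes "F \<in> Lq q" "1 \<le> q" "avg n F = F"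
  shows "F \<in> avg_approx q"
proof -
  have "avg m F = F" if "m \<le> n" for m
    using avg_avg_le[OF that, of F] assms(3) by simp
  hence "\<forall>\<^sub>F m in at_bot. Lq_norm q (avg m F - F) = 0"
    unfolding eventually_at_bot_linorder using assms(2) by (intro exI[of _ n]) simp
  thus ?thesis using assms(1) by (simp add: avg_approx_def tendsto_eventually)
qed

section \<open>Convergence of small averages, from indicators of balls to all of
  \<open>Lq q\<close>\<close>

definition ind :: "'p::prime_card padic set \<Rightarrow> 'p padic \<Rightarrow> complex" where
  "ind A = indicator A"

lemma ind_measurable [measurable]: "A \<in> sets borel \<Longrightarrow> ind A \<in> borel_measurable borel"
  unfolding ind_def by (rule borel_measurable_indicator)

lemma lq_pow_ind: "A \<in> sets borel \<Longrightarrow> lq_pow q (ind A) = emeasure haar A"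
proof -
  assume [measurable]: "A \<in> sets borel"
  have "lq_pow q (ind A) = (\<integral>\<^sup>+x. indicator A x \<partial>haar)"
    unfolding lq_pow_def ind_def by (intro nn_integral_cong) (simp split: split_indicator)
  thus ?thesis by simp
qed

lemma ind_in_Lq_iff: "A \<in> sets borel \<Longrightarrow> abs_L0 (ind A) \<in> Lq q \<longleftrightarrow> emeasure haar A < \<infinity>"
  by (simp add: abs_in_Lq_iff lq_pow_ind)

lemma ind_diff: "B \<subseteq> A \<Longrightarrow> A \<in> sets borel \<Longrightarrow> B \<in> sets borel \<Longrightarrow>
    abs_L0 (ind (A - B)) = abs_L0 (ind A) - abs_L0 (ind B)"
  by (simp add: minus_abs_L0) (intro arg_cong[of _ _ abs_L0] ext, auto simp: ind_def indicator_def)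

lemma ind_Un: "A \<inter> B = {} \<Longrightarrow> A \<in> sets borel \<Longrightarrow> B \<in> sets borel \<Longrightarrow>
    abs_L0 (ind (A \<union> B)) = abs_L0 (ind A) + abs_L0 (ind B)"
  by (simp add: plus_abs_L0) (intro arg_cong[of _ _ abs_L0] ext, auto simp: ind_def indicator_def)

lemma ind_tendsto:
  assumes q: "1 \<le> q" and [measurable]: "\<And>i. A i \<in> sets borel" "B \<in> sets borel"
    and A: "\<And>i. A i \<subseteq> B" "incseq A" and B: "emeasure haar B < \<infinity>"
  shows "(\<lambda>i. Lq_norm q (abs_L0 (ind (A i)) - abs_L0 (ind (\<Union>i. A i)))) \<longlonglongrightarrow> 0"
proof (rule Lq_dominated_convergence[where g = "ind B"])
  show "norm (ind (A i) x) \<le> norm (ind B x)" for i x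
    using A(1)[of i] by (auto simp: ind_def split: split_indicator)
  show "(\<lambda>i. ind (A i) x) \<longlonglongrightarrow> ind (\<Union>i. A i) x" for x
    using LIMSEQ_indicator_incseq[OF A(2), of x] by (simp add: ind_def)
qed (use q B in \<open>auto simp: ind_in_Lq_iff\<close>)

lemma ind_ball_avg_approx:
  fixes x :: "'p::prime_card padic"
  assumes "1 \<le> q"
  shows "abs_L0 (ind (padic_ball n x)) \<in> avg_approx q"
proof (rule avg_approxI[where n = n])
  show "avg n (abs_L0 (ind (padic_ball n x))) = abs_L0 (ind (padic_ball n x))"
  proof (rule avg_locally_constant)
    fix y z :: "'p padic" assume "z \<in> padic_ball n y"
    hence "z \<in> padic_ball n x \<longleftrightarrow> y \<in> padic_ball n x"
      using padic_ball_sym padic_ball_trans by blast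
    thus "ind (padic_ball n x) z = ind (padic_ball n x) y" by (simp add: ind_def indicator_def)
  qed measurable
qed (simp_all add: ind_in_Lq_iff assms)

lemma emeasure_Int_ball_finite: "A \<in> sets borel \<Longrightarrow> emeasure haar (A \<inter> padic_ball n x) < \<infinity>"
  by (rule le_less_trans[OF emeasure_mono[of _ "padic_ball n x"]]) auto

text \<open>Induction over the generated sigma-algebra: complements and disjoint unions become
  differences and norm limits. Intersecting with a fixed ball keeps every indicator in
  \<open>Lq q\<close>.\<close>

lemma ind_Int_ball_avg_approx:
  fixes A :: "'p::prime_card padic set"
  assumes A: "A \<in> sets borel" and q: "1 \<le> q"
  shows "abs_L0 (ind (A \<inter> padic_ball n x)) \<in> avg_approx q"
proof -
  let ?B = "padic_ball n x"
  have "A \<in> sigma_sets UNIV (insert {} padic_balls)" using A by (simp add: sets_borel_padic)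
  moreover have "insert {} padic_balls \<subseteq> Pow (UNIV :: 'p padic set)" by simp
  note * = Int_stable_padic_balls this calculation
  from * show ?thesis
  proof (induction rule: sigma_sets_induct_disjoint)
    case (basic A)
    show ?case
    proof (cases "A = {}")
      case True
      thus ?thesis using q avg_approx_zero by (simp add: ind_def zero_abs_L0[symmetric])
    next
      case False
      hence "A \<in> padic_balls" using basic by simp
      then obtain m y where m: "A = padic_ball m y" by (metis padic_balls_cases)
      have "A \<inter> ?B = {} \<or> A \<inter> ?B = A \<or> A \<inter> ?B = ?B"
        using padic_ball_Int[of m n y x] padic_ball_Int[of n m x y] unfolding m
        by (cases "m \<le> n") (auto simp: Int_commute)
      thus ?thesis using q avg_approx_zero ind_ball_avg_approx
        unfolding m by (auto simp: ind_def zero_abs_L0[symmetric])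
    qed
  next
    case empty
    show ?case using q avg_approx_zero by (simp add: ind_def zero_abs_L0[symmetric])
  next
    case (compl A)
    have A: "A \<in> sets borel" using compl by (simp add: sets_borel_padic)
    have "(UNIV - A) \<inter> ?B = ?B - (A \<inter> ?B)" by auto
    hence "abs_L0 (ind ((UNIV - A) \<inter> ?B)) = abs_L0 (ind ?B) - abs_L0 (ind (A \<inter> ?B))"
      using A by (simp add: ind_diff)
    also have "\<dots> \<in> avg_approx q"
      by (intro avg_approx_diff ind_ball_avg_approx compl(2) q)
    finally show ?case .
  next
    case (union A)
    have A[measurable]: "A i \<in> sets borel" for i using union(2) by (auto simp: sets_borel_padic)
    let ?X = "\<lambda>k. (\<Union>i\<in>{0..<k}. A i) \<inter> ?B"
    have X: "abs_L0 (ind (?X k)) \<in> avg_approx q" for k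
    proof (induction k)
      case 0
      show ?case using q avg_approx_zero by (simp add: ind_def zero_abs_L0[symmetric])
    next
      case (Suc k)
      have eq: "?X (Suc k) = ?X k \<union> (A k \<inter> ?B)" by (auto simp: less_Suc_eq)
      have "A i \<inter> A k = {}" if "i < k" for i
        using union(1) that by (intro disjoint_family_onD[of A UNIV]) auto
      hence "y \<notin> A k" if "y \<in> A i" "i < k" for y i using that by blast
      hence "?X k \<inter> (A k \<inter> ?B) = {}" by auto
      hence "abs_L0 (ind (?X (Suc k))) = abs_L0 (ind (?X k)) + abs_L0 (ind (A k \<inter> ?B))"
        unfolding eq by (intro ind_Un) auto
      thus ?case using Suc union(3)[of k] q by (simp add: avg_approx_add)
    qed
    have U: "(\<Union>i. A i) \<inter> ?B = (\<Union>k. ?X k)"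
      by (subst UN_UN_finite_eq[of A, symmetric]) blast
    show ?case
      unfolding U
    proof (rule avg_approx_limit[OF q _ X])
      show "(\<lambda>k. Lq_norm q (abs_L0 (ind (?X k)) - abs_L0 (ind (\<Union>k. ?X k)))) \<longlonglongrightarrow> 0"
      proof (rule ind_tendsto[OF q, where B = ?B])
        show "incseq ?X" by (intro monoI Int_mono UN_mono) auto
      qed auto
      show "abs_L0 (ind (\<Union>k. ?X k)) \<in> Lq q"
        unfolding U[symmetric] using emeasure_Int_ball_finite[of "\<Union>i. A i" n x]
        by (subst ind_in_Lq_iff) auto
    qed
  qed
qed

lemma UN_padic_ball: "(\<Union>k::nat. padic_ball (int k) x) = (UNIV :: 'p::prime_card padic set)"
proof -
  have "\<exists>k::nat. y \<in> padic_ball (int k) x" for y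
  proof -
    obtain n where "y - x \<in> padic_ball n 0" using padic_norm_exponent_exists by blast
    hence "y \<in> padic_ball n x" by (simp add: mem_padic_ball)
    hence "y \<in> padic_ball (int (nat n)) x" using padic_ball_mono[of n "int (nat n)" x] by auto
    thus ?thesis ..
  qed
  thus ?thesis by auto
qed

text \<open>Induction over integrable functions. A set of finite measure, possibly unbounded, is
  exhausted by its intersections with growing balls.\<close>

lemma L1_avg_approx:
  assumes "F \<in> Lq 1"
  shows "F \<in> avg_approx 1"
proof -
  obtain f where f[measurable]: "f \<in> borel_measurable borel" "F = abs_L0 f" by (rule L0_cases)
  have L1: "abs_L0 g \<in> Lq 1 \<longleftrightarrow> integrable haar g" if "g \<in> borel_measurable borel" for g
    using that by (simp add: abs_in_Lq_iff lq_pow_def integrable_iff_bounded)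
  have "integrable haar f" using assms f(2) L1[OF f(1)] by simp
  hence "abs_L0 f \<in> avg_approx 1"
  proof (induction rule: integrable_induct)
    case (base A c)
    hence [measurable]: "A \<in> sets borel" by simp
    let ?X = "\<lambda>k. A \<inter> padic_ball (int k) 0"
    have U: "(\<Union>k. ?X k) = A" using UN_padic_ball[of 0] by blast
    have "abs_L0 (ind A) \<in> avg_approx 1"
    proof (rule avg_approx_limit[where X = "\<lambda>k. abs_L0 (ind (?X k))"])
      show "(\<lambda>k. Lq_norm 1 (abs_L0 (ind (?X k)) - abs_L0 (ind A))) \<longlonglongrightarrow> 0"
      proof (subst (2) U[symmetric], rule ind_tendsto[where B = A])
        show "incseq ?X" by (intro monoI Int_mono padic_ball_mono) auto
      qed (use base in auto)
      show "abs_L0 (ind (?X k)) \<in> avg_approx 1" for k by (rule ind_Int_ball_avg_approx) auto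
    qed (use base in \<open>auto simp: ind_in_Lq_iff\<close>)
    hence "c *\<^sub>C abs_L0 (ind A) \<in> avg_approx 1" by (rule avg_approx_scale) simp
    moreover have "c *\<^sub>C abs_L0 (ind A) = abs_L0 (\<lambda>x. indicator A x *\<^sub>R c)"
      by (simp add: scale_abs_L0) (intro arg_cong[of _ _ abs_L0] ext, auto simp: ind_def indicator_def)
    ultimately show ?case by simp
  next
    case (add f g)
    hence "f \<in> borel_measurable borel" "g \<in> borel_measurable borel"
      by (auto dest!: borel_measurable_integrable simp: measurable_cong_sets[OF sets_haar refl])
    with add avg_approx_add[of "abs_L0 f" 1 "abs_L0 g"] show ?case by (simp add: plus_abs_L0)
  next
    case (lim f s)
    hence [measurable]: "f \<in> borel_measurable borel" "s i \<in> borel_measurable borel" for i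
      by (auto dest!: borel_measurable_integrable simp: measurable_cong_sets[OF sets_haar refl])
    have f1: "abs_L0 f \<in> Lq 1" using lim by (simp add: L1)
    show ?case
    proof (rule avg_approx_limit[OF _ f1 lim.IH])
      have "abs_L0 (\<lambda>x. 2 * f x) \<in> Lq 1"
        using Lq_scale(1)[OF f1, of 2] by (simp add: scale_abs_L0)
      thus "(\<lambda>k. Lq_norm 1 (abs_L0 (s k) - abs_L0 f)) \<longlonglongrightarrow> 0"
        using lim by (intro Lq_dominated_convergence[where g = "\<lambda>x. 2 * f x"]) (auto simp: norm_mult)
    qed simp
  qed
  thus ?thesis by (simp add: f(2))
qed

text \<open>Cuts off in value and in support at once, so a truncation lies in every
  \<open>Lq q\<close>; later this also links different exponents.\<close>

definition trunc :: "nat \<Rightarrow> ('p::prime_card padic \<Rightarrow> complex) \<Rightarrow> 'p padic \<Rightarrow> complex" where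
  "trunc k f x = (if norm (f x) \<le> real k \<and> x \<in> padic_ball (int k) 0 then f x else 0)"

lemma trunc_measurable [measurable]:
  assumes [measurable]: "f \<in> borel_measurable borel"
  shows "trunc k f \<in> borel_measurable borel"
  unfolding trunc_def by measurable

lemma norm_trunc_le: "norm (trunc k f x) \<le> real k"
  by (simp add: trunc_def)

lemma trunc_outside: "x \<notin> padic_ball (int k) 0 \<Longrightarrow> trunc k f x = 0"
  by (simp add: trunc_def)

lemma trunc_tendsto:
  assumes [measurable]: "f \<in> borel_measurable borel" and "abs_L0 f \<in> Lq q" "1 \<le> q"
  shows "(\<lambda>k. Lq_norm q (abs_L0 (trunc k f) - abs_L0 f)) \<longlonglongrightarrow> 0"
proof (rule Lq_dominated_convergence[where g = f])
  show "(\<lambda>k. trunc k f x) \<longlonglongrightarrow> f x" for x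
  proof (rule tendsto_eventually)
    obtain n where n: "x \<in> padic_ball (int n) 0" using UN_padic_ball[of "0 :: 'a padic"] by blast
    obtain m where m: "norm (f x) \<le> real m" using real_arch_simple by blast
    have "trunc k f x = f x" if "k \<ge> max m n" for k
    proof -
      have "x \<in> padic_ball (int k) 0" using n padic_ball_mono[of "int n" "int k" 0] that by auto
      thus ?thesis using m that by (simp add: trunc_def)
    qed
    thus "\<forall>\<^sub>F k in sequentially. trunc k f x = f x" unfolding eventually_sequentially by blast
  qed
qed (use assms in \<open>auto simp: trunc_def\<close>)

lemma bounded_support_in_Lq:
  assumes [measurable]: "f \<in> borel_measurable borel" and q: "1 \<le> q"
    and B: "\<And>x. norm (f x) \<le> B" and supp: "\<And>x. x \<notin> padic_ball n a \<Longrightarrow> f x = 0"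
  shows "abs_L0 f \<in> Lq q"
proof -
  have pt: "ennreal (norm (f x) powr q) \<le> ennreal (B powr q) * indicator (padic_ball n a) x" for x
    using B[of x] supp[of x] q by (auto split: split_indicator intro!: ennreal_leI powr_mono2)
  have "lq_pow q f \<le> (\<integral>\<^sup>+x. ennreal (B powr q) * indicator (padic_ball n a) x \<partial>haar)"
    unfolding lq_pow_def using pt by (intro nn_integral_mono)
  also have "\<dots> = ennreal (B powr q) * ennreal (real CARD('a) powi n)"
    by (subst nn_integral_cmult_indicator) auto
  also have "\<dots> < \<infinity>" by (simp add: ennreal_mult_less_top)
  finally show ?thesis by (simp add: abs_in_Lq_iff)
qed

lemma trunc_in_Lq: "f \<in> borel_measurable borel \<Longrightarrow> 1 \<le> q \<Longrightarrow> abs_L0 (trunc k f) \<in> Lq q"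
  by (rule bounded_support_in_Lq[OF _ _ norm_trunc_le trunc_outside]) auto

text \<open>For bounded functions convergence in L1 is enough: |h| \<le> 2 k implies |h|^q \<le> (2
  k)^(q - 1) |h|. The truncation and all its averages are bounded by k.\<close>

lemma trunc_avg_approx:
  assumes [measurable]: "f \<in> borel_measurable borel" and q: "1 \<le> q"
  shows "abs_L0 (trunc k f) \<in> avg_approx q"
proof -
  let ?g = "trunc k f"
  let ?a = "\<lambda>n x. \<integral>y. ?g (x + y) \<partial>ball_measure n"
  let ?C = "(2 * real k) powr (q - 1)"
  have g1: "abs_L0 ?g \<in> Lq 1" by (rule trunc_in_Lq) auto
  have bound: "norm (?a n x) \<le> real k" for n x
  proof -
    have "integrable (ball_measure n) (\<lambda>y. ?g (x + y))"
      by (rule ball_measure.integrable_const_bound[where B = "real k"]) (auto simp: norm_trunc_le)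
    hence "(\<integral>y. norm (?g (x + y)) \<partial>ball_measure n) \<le> real k"
      by (intro ball_measure.integral_le_const) (auto simp: norm_trunc_le)
    thus ?thesis by (rule order_trans[OF integral_norm_bound])
  qed
  have le: "lq_pow q (\<lambda>x. ?a n x - ?g x) \<le> ennreal ?C * lq_pow 1 (\<lambda>x. ?a n x - ?g x)" for n
  proof -
    have "norm (?a n x - ?g x) powr q \<le> ?C * norm (?a n x - ?g x) powr 1" for x
    proof (cases "?a n x - ?g x = 0")
      case False
      have "norm (?a n x - ?g x) \<le> 2 * real k"
        using norm_triangle_ineq4[of "?a n x" "?g x"] bound[of n x] norm_trunc_le[of k f x] by linarith
      hence "norm (?a n x - ?g x) powr (q - 1) \<le> ?C" using q by (intro powr_mono2) auto
      hence "norm (?a n x - ?g x) powr (q - 1) * norm (?a n x - ?g x) powr 1 \<le> ?C * norm (?a n x - ?g x) powr 1"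
        by (intro mult_right_mono) auto
      thus ?thesis by (simp only: powr_add[symmetric]) simp
    qed simp
    hence "lq_pow q (\<lambda>x. ?a n x - ?g x) \<le> (\<integral>\<^sup>+x. ennreal ?C * ennreal (norm (?a n x - ?g x) powr 1) \<partial>haar)"
      unfolding lq_pow_def by (intro nn_integral_mono) (simp add: ennreal_mult[symmetric] ennreal_leI del: powr_one)
    also have "\<dots> = ennreal ?C * lq_pow 1 (\<lambda>x. ?a n x - ?g x)"
      unfolding lq_pow_def by (rule nn_integral_cmult) measurable
    finally show ?thesis .
  qed
  have diff: "avg n (abs_L0 ?g) - abs_L0 ?g = abs_L0 (\<lambda>x. ?a n x - ?g x)" for n
    by (simp add: avg_abs minus_abs_L0)
  have lim1: "((\<lambda>n. Lq_norm 1 (avg n (abs_L0 ?g) - abs_L0 ?g)) \<longlongrightarrow> 0) at_bot"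
    using L1_avg_approx[OF g1] by (simp add: avg_approx_def)
  have in1: "avg n (abs_L0 ?g) - abs_L0 ?g \<in> Lq 1" for n
    by (intro Lq_diff avg_Lq g1) auto
  have eq1: "lq_pow 1 (\<lambda>x. ?a n x - ?g x) = ennreal (Lq_norm 1 (avg n (abs_L0 ?g) - abs_L0 ?g))" for n
    using lq_pow_eq_norm[of "\<lambda>x. ?a n x - ?g x" 1] in1[of n] unfolding diff by simp
  have "((\<lambda>n. ennreal (Lq_norm 1 (avg n (abs_L0 ?g) - abs_L0 ?g))) \<longlongrightarrow> ennreal 0) at_bot"
    by (intro tendsto_ennrealI lim1)
  hence "((\<lambda>n. ennreal ?C * lq_pow 1 (\<lambda>x. ?a n x - ?g x)) \<longlongrightarrow> ennreal ?C * 0) at_bot"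
    unfolding eq1 by (intro ennreal_tendsto_cmult) auto
  hence "((\<lambda>n. lq_pow q (\<lambda>x. ?a n x - ?g x)) \<longlongrightarrow> 0) at_bot"
    by (intro tendsto_sandwich[OF _ _ tendsto_const, of _ "\<lambda>n. lq_pow q (\<lambda>x. ?a n x - ?g x)"])
       (auto simp: le)
  hence "((\<lambda>n. Lq_norm q (abs_L0 (\<lambda>x. ?a n x - ?g x))) \<longlongrightarrow> 0) at_bot"
    using q by (intro Lq_norm_tendsto_0I) auto
  thus ?thesis using trunc_in_Lq[OF assms] by (simp add: avg_approx_def diff)
qed

lemma avg_tendsto:
  assumes F: "F \<in> Lq q" and q: "1 \<le> q"
  shows "((\<lambda>n. Lq_norm q (avg n F - F)) \<longlongrightarrow> 0) at_bot"
proof -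
  obtain f where f[measurable]: "f \<in> borel_measurable borel" "F = abs_L0 f" by (rule L0_cases)
  have "F \<in> avg_approx q"
    using F q unfolding f(2)
    by (intro avg_approx_limit[OF q _ trunc_avg_approx trunc_tendsto]) auto
  thus ?thesis by (simp add: avg_approx_def)
qed

section \<open>The spectral levels\<close>

text \<open>
  \<open>lev n\<close> is the projection onto the functions whose Fourier transform lives on the sphere of
  radius \<open>p powi (- n)\<close>.
\<close>

definition lev :: "int \<Rightarrow> 'p::prime_card L0 \<Rightarrow> 'p L0" where
  "lev n F = avg n F - avg (n + 1) F"

lemma lev_Lq: "F \<in> Lq q \<Longrightarrow> 1 \<le> q \<Longrightarrow> lev n F \<in> Lq q"
  unfolding lev_def by (intro Lq_diff avg_Lq)

lemma lev_norm_le: "F \<in> Lq q \<Longrightarrow> 1 \<le> q \<Longrightarrow> Lq_norm q (lev n F) \<le> 2 * Lq_norm q F"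
  unfolding lev_def
  using Lq_norm_diff_triangle[of "avg n F" q "avg (n + 1) F"] avg_Lq[of F q n] avg_Lq[of F q "n + 1"]
  by simp

lemma lev_add: "F \<in> Lq q \<Longrightarrow> G \<in> Lq q \<Longrightarrow> 1 \<le> q \<Longrightarrow> lev n (F + G) = lev n F + lev n G"
  unfolding lev_def by (simp add: avg_add)

lemma lev_scale: "lev n (c *\<^sub>C F) = c *\<^sub>C lev n F"
  unfolding lev_def by (simp add: avg_scale L0.scale_right_diff_distrib)

lemma lev_diff: "F \<in> Lq q \<Longrightarrow> G \<in> Lq q \<Longrightarrow> 1 \<le> q \<Longrightarrow> lev n (F - G) = lev n F - lev n G"
  unfolding lev_def by (simp add: avg_diff)

lemma lev_uminus: "lev n (- F) = - lev n F"
  using lev_scale[of n "- 1" F] by simp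

lemma lev_zero [simp]: "lev n 0 = 0"
  by (simp add: lev_def)

text \<open>Two averages compose to the coarser one. For m \<le> n both terms of
  \<open>lev n\<close> survive, otherwise both become \<open>avg m F\<close> and cancel.\<close>

lemma avg_lev:
  assumes "F \<in> Lq q" "1 \<le> q"
  shows "avg m (lev n F) = (if m \<le> n then lev n F else 0)"
proof -
  have "max m (n + 1) = max m n" if "\<not> m \<le> n" using that by simp
  moreover have "max m n = n" "max m (n + 1) = n + 1" if "m \<le> n" using that by simp_all
  ultimately show ?thesis
    unfolding lev_def using assms
    by (auto simp: avg_diff[OF avg_Lq(1) avg_Lq(1)] avg_avg)
qed

lemma lev_avg:
  assumes "F \<in> Lq q" "1 \<le> q"
  shows "lev m (avg n F) = (if n \<le> m then lev m F else 0)"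
  unfolding lev_def using assms by (auto simp: avg_avg max_def)

lemma lev_lev:
  assumes "F \<in> Lq q" "1 \<le> q"
  shows "lev m (lev n F) = (if m = n then lev n F else 0)"
  unfolding lev_def[of m] using assms by (auto simp: avg_lev)

text \<open>The integrals of a representative over balls form a representative that is bounded at
  every point, not only almost everywhere; this allows integration against other measures.\<close>

lemma avg_bounded_powr:
  assumes F: "F \<in> Lq q" and q: "1 \<le> q"
  obtains g where "g \<in> borel_measurable borel" "avg n F = abs_L0 g"
    "\<And>x :: 'p::prime_card padic. norm (g x) powr q \<le> Lq_norm q F powr q / real CARD('p) powi n"
proof -
  obtain f where f[measurable]: "f \<in> borel_measurable borel" "F = abs_L0 f" by (rule L0_cases)
  show ?thesis
  proof (rule that)
    show "avg n F = abs_L0 (\<lambda>x. \<integral>y. f (x + y) \<partial>ball_measure n)" unfolding f(2) by (rule avg_abs[OF f(1)])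
    show "norm (\<integral>y. f (x + y) \<partial>ball_measure n) powr q \<le> Lq_norm q F powr q / real CARD('p) powi n" for x
      using norm_avg_le[OF f(1) _ q] F unfolding f(2) by blast
  qed measurable
qed

lemma real_powi_divide_tendsto_0: "(\<lambda>k. c / real CARD('p::prime_card) powi int k) \<longlonglongrightarrow> 0"
proof -
  have "(\<lambda>k. c * inverse (real CARD('p)) ^ k) \<longlonglongrightarrow> c * 0"
    using card_gt_1[where 'p='p] by (intro tendsto_mult tendsto_const LIMSEQ_realpow_zero) (auto simp: inverse_less_1_iff)
  thus ?thesis by (simp add: divide_inverse power_inverse)
qed

lemma lev_eq_0_imp_eq_0:
  fixes F :: "'p::prime_card L0"
  assumes F: "F \<in> Lq q" and q: "1 \<le> q" and lev: "\<And>n. lev n F = 0"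
  shows "F = 0"
proof -
  have step: "avg n F = avg (n + 1) F" for n using lev[of n] by (simp add: lev_def)
  have const: "avg n F = avg 0 F" for n
  proof (induction n rule: int_induct[where k = 0])
    case (step1 i)
    thus ?case using step[of i] by simp
  next
    case (step2 i)
    thus ?case using step[of "i - 1"] by simp
  qed simp
  have "(\<lambda>n. Lq_norm q (avg n F - F)) = (\<lambda>_. Lq_norm q (avg 0 F - F))"
    by (rule ext) (subst const, rule refl)
  with avg_tendsto[OF F q] have "((\<lambda>n :: int. Lq_norm q (avg 0 F - F)) \<longlongrightarrow> 0) at_bot"
    by (simp only:)
  hence "Lq_norm q (avg 0 F - F) = 0" by (simp add: tendsto_const_iff)
  hence "avg 0 F - F = 0" using F q by (intro Lq_norm_eq_0D Lq_diff avg_Lq) auto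
  hence avg: "avg n F = F" for n using const[of n] by simp
  obtain f where f[measurable]: "f \<in> borel_measurable borel" "F = abs_L0 f" by (rule L0_cases)
  \<comment> \<open>A pointwise bound, because for q = 1 averages over growing balls need not tend
    to 0 in norm. Countably many exceptional null sets are joined afterwards.\<close>
  have "AE x in haar. norm (f x) powr q \<le> Lq_norm q F powr q / real CARD('p) powi n" for n
  proof -
    obtain g where g: "g \<in> borel_measurable borel" "avg n F = abs_L0 g"
      "\<And>x. norm (g x) powr q \<le> Lq_norm q F powr q / real CARD('p) powi n"
      using avg_bounded_powr[OF F q, of n] by blast
    have "abs_L0 f = abs_L0 g" using g(2) f(2) avg[of n] by simp
    hence "AE x in haar. f x = g x" by (simp only: abs_L0_eq_iff[OF f(1) g(1)])
    thus ?thesis by eventually_elim (simp add: g(3))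
  qed
  hence "AE x in haar. \<forall>k. norm (f x) powr q \<le> Lq_norm q F powr q / real CARD('p) powi int k"
    unfolding AE_all_countable by blast
  hence "AE x in haar. f x = 0"
  proof eventually_elim
    case (elim x)
    have "norm (f x) powr q \<le> 0"
      using elim by (intro LIMSEQ_le_const[OF real_powi_divide_tendsto_0]) auto
    thus ?case by simp
  qed
  thus ?thesis unfolding f(2) zero_abs_L0 by (intro abs_L0_cong_AE) auto
qed

lemma lev_inject:
  assumes "F \<in> Lq q" "G \<in> Lq q" "1 \<le> q" "\<And>n. lev n F = lev n G"
  shows "F = G"
  using lev_eq_0_imp_eq_0[OF Lq_diff[OF assms(1-3)] assms(3)] assms by (simp add: lev_diff)

section \<open>Mixtures of averages\<close>

text \<open>The shape of the distribution function of a probability on the integers; in this form a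
  monotone multiplier becomes a mixture.\<close>

definition cdf_fun :: "(int \<Rightarrow> real) \<Rightarrow> bool" where
  "cdf_fun \<phi> \<longleftrightarrow> mono \<phi> \<and> (\<phi> \<longlongrightarrow> 0) at_bot \<and> (\<phi> \<longlongrightarrow> 1) at_top"

lemma cdf_fun_bounds:
  assumes "cdf_fun \<phi>"
  shows "0 \<le> \<phi> n" "\<phi> n \<le> 1"
proof -
  have m: "mono \<phi>" and 0: "(\<phi> \<longlongrightarrow> 0) at_bot" and 1: "(\<phi> \<longlongrightarrow> 1) at_top"
    using assms by (auto simp: cdf_fun_def)
  show "0 \<le> \<phi> n"
    by (rule tendsto_upperbound[OF 0]) (auto simp: eventually_at_bot_linorder intro!: exI[of _ n] monoD[OF m])
  show "\<phi> n \<le> 1"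
    by (rule tendsto_lowerbound[OF 1]) (auto simp: eventually_at_top_linorder intro!: exI[of _ n] monoD[OF m])
qed

text \<open>The mass at n is \<open>\<phi> n - \<phi> (n - 1)\<close>. Sums telescope; the limit at
  minus infinity removes the lower end, and the limit at infinity makes the total mass 1.\<close>

lemma pmf_of_cdf_fun:
  assumes "cdf_fun \<phi>"
  obtains w :: "int pmf" where "\<And>m. measure (measure_pmf w) {..m} = \<phi> m"
proof -
  have m: "mono \<phi>" and 0: "(\<phi> \<longlongrightarrow> 0) at_bot" and 1: "(\<phi> \<longlongrightarrow> 1) at_top"
    using assms by (auto simp: cdf_fun_def)
  define f where "f n = \<phi> n - \<phi> (n - 1)" for n
  have f: "0 \<le> f n" for n using monoD[OF m, of "n - 1" n] by (simp add: f_def)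
  define D where "D = density (count_space UNIV) (\<lambda>n. ennreal (f n))"
  have fin: "emeasure D {i - int k..i} = ennreal (\<phi> i - \<phi> (i - int k - 1))" for i k
  proof -
    have "(\<Sum>n\<in>{i - int k..i}. f n) = \<phi> i - \<phi> (i - int k - 1)"
    proof (induction k)
      case (Suc k)
      have "{i - int (Suc k)..i} = insert (i - int (Suc k)) {i - int k..i}" by auto
      thus ?case using Suc by (simp add: f_def algebra_simps)
    qed (simp add: f_def)
    moreover have "emeasure D {i - int k..i} = (\<Sum>n\<in>{i - int k..i}. ennreal (f n))"
    proof -
      have "emeasure D {i - int k..i} = (\<integral>\<^sup>+n. ennreal (f n) * indicator {i - int k..i} n \<partial>count_space UNIV)"
        unfolding D_def by (subst emeasure_density) auto
      also have "\<dots> = (\<Sum>n\<in>{i - int k..i}. ennreal (f n) * indicator {i - int k..i} n)"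
        by (rule nn_integral_count_space'[OF finite_atLeastAtMost_int]) auto
      finally show ?thesis by simp
    qed
    ultimately show ?thesis using f by (simp add: sum_ennreal)
  qed
  have below: "emeasure D {..i} = ennreal (\<phi> i)" for i
  proof -
    have "(\<lambda>k. emeasure D {i - int k..i}) \<longlonglongrightarrow> emeasure D (\<Union>k. {i - int k..i})"
      by (rule Lim_emeasure_incseq) (auto simp: D_def incseq_def)
    moreover have "(\<Union>k. {i - int k..i}) = {..i}"
    proof -
      have "x \<in> {i - int (nat (i - x))..i}" if "x \<le> i" for x using that by simp
      thus ?thesis by fastforce
    qed
    moreover have "(\<lambda>k. ennreal (\<phi> i - \<phi> (i - int k - 1))) \<longlonglongrightarrow> ennreal (\<phi> i - 0)"
    proof (intro tendsto_ennrealI tendsto_diff tendsto_const)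
      have "filterlim (\<lambda>k. i - int k - 1) at_bot sequentially"
        unfolding filterlim_at_bot
      proof
        fix Z
        have "i - int k - 1 \<le> Z" if "k \<ge> nat (i - Z)" for k using that by linarith
        thus "\<forall>\<^sub>F k in sequentially. i - int k - 1 \<le> Z" unfolding eventually_sequentially by blast
      qed
      thus "(\<lambda>k. \<phi> (i - int k - 1)) \<longlonglongrightarrow> 0" by (rule filterlim_compose[OF 0])
    qed
    ultimately show ?thesis using LIMSEQ_unique by (simp add: fin)
  qed
  have "emeasure D UNIV = 1"
  proof -
    have "(\<lambda>k. emeasure D {..int k}) \<longlonglongrightarrow> emeasure D (\<Union>k. {..int k})"
      by (rule Lim_emeasure_incseq) (auto simp: D_def incseq_def)
    moreover have "(\<Union>k. {..int k}) = UNIV"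
    proof -
      have "x \<le> int (nat x)" for x by simp
      thus ?thesis by blast
    qed
    moreover have "(\<lambda>k. ennreal (\<phi> (int k))) \<longlonglongrightarrow> ennreal 1"
      by (intro tendsto_ennrealI filterlim_compose[OF 1] filterlim_int_sequentially)
    ultimately show ?thesis using LIMSEQ_unique by (simp add: below)
  qed
  hence nn1: "(\<integral>\<^sup>+n. ennreal (f n) \<partial>count_space UNIV) = 1"
    unfolding D_def by (subst (asm) emeasure_density) auto
  have "measure_pmf (embed_pmf f) = D"
    unfolding measure_pmf_eq_density D_def using pmf_embed_pmf[OF f nn1] by simp
  hence "measure (measure_pmf (embed_pmf f)) {..i} = \<phi> i" for i
    using below[of i] cdf_fun_bounds(1)[OF assms, of i] by (simp add: measure_def)
  thus ?thesis by (rule that)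
qed

definition mixture :: "int pmf \<Rightarrow> 'p::prime_card padic measure" where
  "mixture w = measure_pmf w \<bind> ball_measure"

lemma ball_measure_kernel: "ball_measure \<in> measurable (measure_pmf w) (subprob_algebra borel)"
proof -
  have "(ball_measure n :: 'a padic measure) \<in> space (subprob_algebra borel)" for n
    by (simp add: space_subprob_algebra ball_measure.prob_space_axioms prob_space_imp_subprob_space)
  thus ?thesis by simp
qed

lemma padic_prob_mixture: "padic_prob (mixture w :: 'p::prime_card padic measure)"
proof (intro padic_prob.intro padic_prob_axioms.intro)
  show "prob_space (mixture w :: 'p padic measure)"
    unfolding mixture_def
    by (rule measure_pmf.prob_space_bind[OF _ ball_measure_kernel]) (simp add: ball_measure.prob_space_axioms)
  show "sets (mixture w :: 'p padic measure) = sets borel"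
    unfolding mixture_def by (rule sets_bind) auto
qed

interpretation mixture: padic_prob "mixture w"
  by (rule padic_prob_mixture)

lemma integral_mixture:
  fixes h :: "'p::prime_card padic \<Rightarrow> complex"
  assumes [measurable]: "h \<in> borel_measurable borel" and B: "\<And>x. norm (h x) \<le> B"
  shows "(\<integral>y. h y \<partial>mixture w) = (\<integral>n. (\<integral>y. h y \<partial>ball_measure n) \<partial>measure_pmf w)"
proof -
  have bind: "(\<integral>y. g y \<partial>mixture w) = (\<integral>n. (\<integral>y. g y \<partial>ball_measure n) \<partial>measure_pmf w)"
    if [measurable]: "g \<in> borel_measurable borel" and "\<And>x. \<bar>g x\<bar> \<le> B" for g :: "'p padic \<Rightarrow> real"
    unfolding mixture_def using that(2)
    by (intro integral_bind[where K = borel and B' = 1 and B = B] ball_measure_kernel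
        measure_pmf.finite_measure_axioms) (auto simp: ball_measure.emeasure_space_1[simplified])
  have ih: "integrable (ball_measure n) h" for n
    by (rule ball_measure.integrable_const_bound[where B = B]) (auto simp: B)
  have im: "integrable (mixture w) h"
    by (rule mixture.integrable_const_bound[where B = B]) (auto simp: B)
  have bound: "norm (\<integral>y. h y \<partial>ball_measure n) \<le> B" for n
  proof -
    have "(\<integral>y. norm (h y) \<partial>ball_measure n) \<le> B"
      using ih[of n] by (intro ball_measure.integral_le_const) (auto simp: B)
    thus ?thesis by (rule order_trans[OF integral_norm_bound])
  qed
  have iw: "integrable (measure_pmf w) (\<lambda>n. \<integral>y. h y \<partial>ball_measure n)"
    by (rule measure_pmf.integrable_const_bound[where B = B]) (auto simp: bound)
  have B': "\<bar>Re (h x)\<bar> \<le> B" "\<bar>Im (h x)\<bar> \<le> B" for x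
    using B[of x] abs_Re_le_cmod[of "h x"] abs_Im_le_cmod[of "h x"] by linarith+
  show ?thesis
  proof (rule complex_eqI)
    show "Re (\<integral>y. h y \<partial>mixture w) = Re (\<integral>n. (\<integral>y. h y \<partial>ball_measure n) \<partial>measure_pmf w)"
      using bind[of "\<lambda>x. Re (h x)"] B' by (simp add: integral_Re[OF im, symmetric] integral_Re[OF iw, symmetric] integral_Re[OF ih])
    show "Im (\<integral>y. h y \<partial>mixture w) = Im (\<integral>n. (\<integral>y. h y \<partial>ball_measure n) \<partial>measure_pmf w)"
      using bind[of "\<lambda>x. Im (h x)"] B' by (simp add: integral_Im[OF im, symmetric] integral_Im[OF iw, symmetric] integral_Im[OF ih])
  qed
qed

lemma lev_conv:
  assumes "padic_prob \<mu>" "F \<in> Lq q" "1 \<le> q"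
  shows "lev m (conv \<mu> F) = conv \<mu> (lev m F)"
proof -
  interpret padic_prob \<mu> by fact
  show ?thesis
    unfolding lev_def using assms
    by (simp add: avg_commute[OF assms] conv_diff[OF avg_Lq(1) avg_Lq(1)])
qed

text \<open>\<open>avg n\<close> keeps \<open>lev m F\<close> for n \<le> m and kills it otherwise,
  so the mixture multiplies it by the probability of \<open>{..m}\<close>. This is the Abel
  summation behind monotone multipliers.\<close>

lemma lev_mixture:
  assumes F: "F \<in> Lq q" and q: "1 \<le> q"
  shows "lev m (conv (mixture w) F) = complex_of_real (measure (measure_pmf w) {..m}) *\<^sub>C lev m (F :: 'p::prime_card L0)"
proof -
  obtain g where g[measurable]: "g \<in> borel_measurable borel" "avg m F = abs_L0 g"
    "\<And>x. norm (g x) powr q \<le> Lq_norm q F powr q / real CARD('p) powi m"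
    using avg_bounded_powr[OF F q, of m] by blast
  obtain g' where g'[measurable]: "g' \<in> borel_measurable borel" "avg (m + 1) F = abs_L0 g'"
    "\<And>x. norm (g' x) powr q \<le> Lq_norm q F powr q / real CARD('p) powi (m + 1)"
    using avg_bounded_powr[OF F q, of "m + 1"] by blast
  define h where "h x = g x - g' x" for x
  \<comment> \<open>The inequality s \<le> 1 + s^q turns bounds on q-th powers into a bound on h, as
    \<open>integral_mixture\<close> asks for bounded functions.\<close>
  define B where "B = (1 + Lq_norm q F powr q / real CARD('p) powi m) + (1 + Lq_norm q F powr q / real CARD('p) powi (m + 1))"
  have h[measurable]: "h \<in> borel_measurable borel" unfolding h_def by measurable
  have lev: "lev m F = abs_L0 h"
    unfolding lev_def g(2) g'(2) minus_abs_L0[OF g(1) g'(1)] h_def ..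
  have B: "norm (h x) \<le> B" for x
    using norm_triangle_ineq4[of "g x" "g' x"] g(3)[of x] g'(3)[of x]
      le_one_plus_powr[OF norm_ge_zero q, of "g x"] le_one_plus_powr[OF norm_ge_zero q, of "g' x"]
    unfolding h_def B_def by linarith
  have "AE x in haar. (\<integral>y. h (x + y) \<partial>ball_measure n) = (if n \<le> m then h x else 0)" for n
  proof -
    have "avg n (lev m F) = (if n \<le> m then lev m F else 0)" by (rule avg_lev[OF F q])
    thus ?thesis unfolding lev by (auto simp: avg_abs abs_L0_eq_iff zero_abs_L0 split: if_splits)
  qed
  hence "AE x in haar. \<forall>n. (\<integral>y. h (x + y) \<partial>ball_measure n) = (if n \<le> m then h x else 0)"
    by (simp add: AE_all_countable)
  hence ae: "AE x in haar. (\<integral>y. h (x + y) \<partial>mixture w) = complex_of_real (measure (measure_pmf w) {..m}) * h x"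
  proof eventually_elim
    case (elim x)
    have "(\<integral>y. h (x + y) \<partial>mixture w) = (\<integral>n. (\<integral>y. h (x + y) \<partial>ball_measure n) \<partial>measure_pmf w)"
      by (rule integral_mixture[where B = B]) (auto simp: B)
    also have "\<dots> = (\<integral>n. indicator {..m} n *\<^sub>R h x \<partial>measure_pmf w)"
      using elim by (intro Bochner_Integration.integral_cong) (auto split: split_indicator)
    also have "\<dots> = complex_of_real (measure (measure_pmf w) {..m}) * h x"
      by (simp add: scaleR_conv_of_real)
    finally show ?case .
  qed
  have "lev m (conv (mixture w) F) = conv (mixture w) (abs_L0 h)"
    unfolding lev_conv[OF padic_prob_mixture F q] lev ..
  also have "\<dots> = complex_of_real (measure (measure_pmf w) {..m}) *\<^sub>C abs_L0 h"
    unfolding mixture.conv_abs[OF h] scale_abs_L0[OF h] using ae by (intro abs_L0_cong_AE) auto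
  finally show ?thesis unfolding lev .
qed

text \<open>This is the law with distribution function \<phi> conditioned on values above N.\<close>

lemma cdf_fun_conditional:
  assumes \<phi>: "cdf_fun \<phi>" and N: "\<phi> N < 1"
  shows "cdf_fun (\<lambda>m. if m < N then 0 else (\<phi> m - \<phi> N) / (1 - \<phi> N))"
proof -
  have m: "mono \<phi>" and 1: "(\<phi> \<longlongrightarrow> 1) at_top" using \<phi> by (auto simp: cdf_fun_def)
  have "mono (\<lambda>m. if m < N then 0 else (\<phi> m - \<phi> N) / (1 - \<phi> N))"
    using N monoD[OF m] by (intro monoI) (auto intro!: divide_right_mono divide_nonneg_nonneg)
  moreover have "((\<lambda>m. if m < N then 0 else (\<phi> m - \<phi> N) / (1 - \<phi> N)) \<longlongrightarrow> 0) at_bot"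
    by (rule tendsto_eventually) (auto simp: eventually_at_bot_dense intro!: exI[of _ N])
  moreover have "((\<lambda>m. if m < N then 0 else (\<phi> m - \<phi> N) / (1 - \<phi> N)) \<longlongrightarrow> 1) at_top"
  proof (rule Lim_transform_eventually)
    show "((\<lambda>m. (\<phi> m - \<phi> N) / (1 - \<phi> N)) \<longlongrightarrow> 1) at_top"
      using tendsto_divide[OF tendsto_diff[OF 1 tendsto_const[of "\<phi> N"]] tendsto_const[of "1 - \<phi> N"]] N by simp
    show "\<forall>\<^sub>F m in at_top. (\<phi> m - \<phi> N) / (1 - \<phi> N) = (if m < N then 0 else (\<phi> m - \<phi> N) / (1 - \<phi> N))"
      unfolding eventually_at_top_linorder by (intro exI[of _ N]) auto
  qed
  ultimately show ?thesis by (simp add: cdf_fun_def)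
qed

text \<open>With K the mixture and K' the mixture conditioned above N, comparing levels gives (1 -
  K) \<open>avg N F\<close> = (1 - \<phi> N) (\<open>avg N F\<close> - K' F). As K' is a
  contraction, the right side is at most 2 (1 - \<phi> N) times the norm of F, a bound that depends
  on w only through \<phi> N. The second term is the cost of replacing F by
  \<open>avg N F\<close>.\<close>

lemma mixture_approx:
  assumes F: "F \<in> Lq q" and q: "1 \<le> q"
    and w: "\<And>m. measure (measure_pmf w) {..m} = \<phi> m" and \<phi>: "cdf_fun \<phi>" and N: "\<phi> N < 1"
  shows "Lq_norm q (conv (mixture w) F - F) \<le> 2 * (1 - \<phi> N) * Lq_norm q F + 2 * Lq_norm q (avg N F - F)"
proof -
  obtain w' where w': "\<And>m. measure (measure_pmf w') {..m} = (if m < N then 0 else (\<phi> m - \<phi> N) / (1 - \<phi> N))"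
    using pmf_of_cdf_fun[OF cdf_fun_conditional[OF \<phi> N]] by blast
  let ?K = "conv (mixture w)" and ?K' = "conv (mixture w')"
  let ?c = "complex_of_real (1 - \<phi> N)"
  have aF: "avg N F \<in> Lq q" using F q by (rule avg_Lq)
  have KF: "?K G \<in> Lq q" "Lq_norm q (?K G) \<le> Lq_norm q G" if "G \<in> Lq q" for G
    using mixture.conv_Lq[OF that q] by auto
  have K'F: "?K' G \<in> Lq q" "Lq_norm q (?K' G) \<le> Lq_norm q G" if "G \<in> Lq q" for G
    using mixture.conv_Lq[OF that q] by auto
  have eq: "avg N F - ?K (avg N F) = ?c *\<^sub>C (avg N F - ?K' F)"
  proof (rule lev_inject[OF _ _ q])
    show "avg N F - ?K (avg N F) \<in> Lq q" by (intro Lq_diff aF KF q)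
    show "?c *\<^sub>C (avg N F - ?K' F) \<in> Lq q" by (intro Lq_scale Lq_diff aF K'F F q)
    fix m
    define r where "r = complex_of_real ((\<phi> m - \<phi> N) / (1 - \<phi> N))"
    have L1: "lev m (avg N F - ?K (avg N F)) = (1 - complex_of_real (\<phi> m)) *\<^sub>C lev m (avg N F)"
      using aF q by (simp add: lev_diff[OF _ KF(1)] lev_mixture w L0.scale_left_diff_distrib)
    have L2: "lev m (?c *\<^sub>C (avg N F - ?K' F))
        = ?c *\<^sub>C (lev m (avg N F) - complex_of_real (measure (measure_pmf w') {..m}) *\<^sub>C lev m F)"
      using F aF q by (simp add: lev_scale lev_diff[OF _ K'F(1)] lev_mixture)
    have a: "(1 - \<phi> N) * ((\<phi> m - \<phi> N) / (1 - \<phi> N)) = \<phi> m - \<phi> N" using N by simp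
    have "(1 - \<phi> N) * (1 - (\<phi> m - \<phi> N) / (1 - \<phi> N)) = 1 - \<phi> m"
      unfolding right_diff_distrib a by simp
    from arg_cong[OF this, of complex_of_real] have r: "?c * (1 - r) = 1 - complex_of_real (\<phi> m)"
      unfolding r_def by (simp only: of_real_mult of_real_diff of_real_1)
    show "lev m (avg N F - ?K (avg N F)) = lev m (?c *\<^sub>C (avg N F - ?K' F))"
    proof (cases "N \<le> m")
      case True
      hence eqs: "lev m (avg N F) = lev m F" "complex_of_real (measure (measure_pmf w') {..m}) = r"
        using lev_avg[OF F q] w' by (simp_all add: r_def)
      have "lev m F - r *\<^sub>C lev m F = (1 - r) *\<^sub>C lev m F"
        by (simp add: L0.scale_left_diff_distrib)
      thus ?thesis unfolding L1 L2 eqs by (simp only: scale_L0_scale r)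
    next
      \<comment> \<open>Below N both sides vanish: averaging at N has removed these levels, and the
        conditioned law has no mass there.\<close>
      case False
      thus ?thesis unfolding L1 L2 using lev_avg[OF F q, of m N] w' by simp
    qed
  qed
  have 1: "Lq_norm q (avg N F - ?K (avg N F)) \<le> 2 * (1 - \<phi> N) * Lq_norm q F"
  proof -
    have "Lq_norm q (avg N F - ?K (avg N F)) = (1 - \<phi> N) * Lq_norm q (avg N F - ?K' F)"
      unfolding eq using Lq_scale(2)[OF Lq_diff[OF aF K'F(1)[OF F] q] q, of ?c] N
      by (simp add: norm_of_real del: of_real_diff)
    also have "\<dots> \<le> (1 - \<phi> N) * (2 * Lq_norm q F)"
      using N Lq_norm_diff_triangle[OF aF K'F(1)[OF F] q] avg_Lq(2)[OF F q, of N] K'F(2)[OF F]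
      by (intro mult_left_mono) auto
    finally show ?thesis by (simp only: mult_ac)
  qed
  have 2: "Lq_norm q (?K F - ?K (avg N F)) \<le> Lq_norm q (avg N F - F)"
    using KF(2)[OF Lq_diff[OF F aF q]] mixture.conv_diff[OF F aF q] Lq_norm_minus_commute[OF F aF q] by simp
  have "Lq_norm q (?K F - F) \<le> Lq_norm q (?K F - ?K (avg N F)) + Lq_norm q (?K (avg N F) - F)"
    by (intro Lq_norm_triangle3 KF F aF q)
  also have "Lq_norm q (?K (avg N F) - F) \<le> Lq_norm q (?K (avg N F) - avg N F) + Lq_norm q (avg N F - F)"
    by (intro Lq_norm_triangle3 KF F aF q)
  finally show ?thesis
    using 1 2 Lq_norm_minus_commute[OF KF(1)[OF aF] aF q] by simp
qed

text \<open>N is chosen first to make the second error term of \<open>mixture_approx\<close> small,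
  then t pushes \<open>\<phi> t N\<close> to 1. Serves both the continuity of the semigroup and its
  generator.\<close>

lemma mixture_tendsto:
  fixes w :: "real \<Rightarrow> int pmf"
  assumes F: "F \<in> Lq q" and q: "1 \<le> q"
    and w: "\<forall>\<^sub>F t in L. \<forall>m. measure (measure_pmf (w t)) {..m} = \<phi> t m" and \<phi>: "\<forall>\<^sub>F t in L. cdf_fun (\<phi> t)"
    and lt: "\<And>N. \<forall>\<^sub>F t in L. \<phi> t N < 1" and lim: "\<And>N. ((\<lambda>t. \<phi> t N) \<longlongrightarrow> 1) L"
  shows "((\<lambda>t. Lq_norm q (conv (mixture (w t)) F - F)) \<longlongrightarrow> 0) L"
proof (rule tendstoI)
  fix e :: real assume e: "e > 0"
  from order_tendstoD(2)[OF avg_tendsto[OF F q], of "e / 4"] e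
  obtain N where N: "Lq_norm q (avg N F - F) < e / 4"
    by (auto simp: eventually_at_bot_linorder)
  have "((\<lambda>t. 2 * (1 - \<phi> t N) * Lq_norm q F) \<longlongrightarrow> 2 * (1 - 1) * Lq_norm q F) L"
    by (intro tendsto_intros lim)
  from order_tendstoD(2)[OF this, of "e / 2"] e
  have "\<forall>\<^sub>F t in L. 2 * (1 - \<phi> t N) * Lq_norm q F < e / 2" by simp
  with w \<phi> lt[of N] show "\<forall>\<^sub>F t in L. dist (Lq_norm q (conv (mixture (w t)) F - F)) 0 < e"
  proof eventually_elim
    case (elim t)
    have "Lq_norm q (conv (mixture (w t)) F - F) \<le> 2 * (1 - \<phi> t N) * Lq_norm q F + 2 * Lq_norm q (avg N F - F)"
      by (rule mixture_approx[OF F q]) (use elim in auto)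
    thus ?case using elim N by simp
  qed
qed

section \<open>Multipliers\<close>

definition multiplier :: "real \<Rightarrow> (int \<Rightarrow> complex) \<Rightarrow> ('p::prime_card L0 \<Rightarrow> 'p L0) \<Rightarrow> bool" where
  "multiplier q \<phi> M \<longleftrightarrow> bounded_operator q M \<and> (\<forall>F\<in>Lq q. \<forall>m. lev m (M F) = \<phi> m *\<^sub>C lev m F)"

lemma multiplier_scale:
  assumes "1 \<le> q"
  shows "multiplier q (\<lambda>_. c) (\<lambda>F. c *\<^sub>C F)"
  unfolding multiplier_def bounded_operator_def
proof (intro conjI)
  show "\<exists>C. \<forall>f\<in>Lq q. Lq_norm q (c *\<^sub>C f) \<le> C * Lq_norm q f"
    using assms by (intro exI[of _ "norm c"]) (simp add: Lq_scale)
qed (use assms in \<open>auto simp: Lq_scale lev_scale scale_L0_add_right mult.commute\<close>)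

lemma multiplier_add:
  assumes q: "1 \<le> q" and M: "multiplier q \<phi> M" and N: "multiplier q \<psi> N"
  shows "multiplier q (\<lambda>n. \<phi> n + \<psi> n) (\<lambda>F. M F + N F)"
proof -
  have M1: "M F \<in> Lq q" "N F \<in> Lq q" if "F \<in> Lq q" for F
    using M N that by (auto simp: multiplier_def bounded_operator_def)
  obtain C where C: "\<forall>f\<in>Lq q. Lq_norm q (M f) \<le> C * Lq_norm q f"
    using M by (auto simp: multiplier_def bounded_operator_def)
  obtain D where D: "\<forall>f\<in>Lq q. Lq_norm q (N f) \<le> D * Lq_norm q f"
    using N by (auto simp: multiplier_def bounded_operator_def)
  have "Lq_norm q (M f + N f) \<le> (C + D) * Lq_norm q f" if "f \<in> Lq q" for f
    using Lq_triangle[OF M1(1)[OF that] M1(2)[OF that] q] C D that by (simp add: distrib_right) fastforce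
  hence "\<exists>C. \<forall>f\<in>Lq q. Lq_norm q (M f + N f) \<le> C * Lq_norm q f" by blast
  thus ?thesis
    using M N q M1
    by (auto simp: multiplier_def bounded_operator_def Lq_add lev_add[OF M1 q] scale_L0_add_right scale_L0_add_left)
qed

lemma multiplier_compose_scale:
  assumes q: "1 \<le> q" and M: "multiplier q \<phi> M"
  shows "multiplier q (\<lambda>n. c * \<phi> n) (\<lambda>F. c *\<^sub>C M F)"
proof -
  have M1: "M F \<in> Lq q" if "F \<in> Lq q" for F
    using M that by (auto simp: multiplier_def bounded_operator_def)
  obtain C where C: "\<forall>f\<in>Lq q. Lq_norm q (M f) \<le> C * Lq_norm q f"
    using M by (auto simp: multiplier_def bounded_operator_def)
  have "Lq_norm q (c *\<^sub>C M f) \<le> (norm c * C) * Lq_norm q f" if "f \<in> Lq q" for f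
    using Lq_scale(2)[OF M1[OF that] q, of c] C that by (simp add: mult_left_mono mult.assoc)
  hence "\<exists>C. \<forall>f\<in>Lq q. Lq_norm q (c *\<^sub>C M f) \<le> C * Lq_norm q f" by blast
  thus ?thesis
    using M q M1
    by (auto simp: multiplier_def bounded_operator_def Lq_scale lev_scale scale_L0_add_right mult.commute)
qed

lemma bounded_operator_conv:
  assumes "padic_prob \<mu>" "1 \<le> q"
  shows "bounded_operator q (conv \<mu>)"
proof -
  interpret padic_prob \<mu> by fact
  show ?thesis
    unfolding bounded_operator_def using conv_Lq[OF _ assms(2)] conv_add[OF _ _ assms(2)] conv_scale
    by (auto intro!: exI[of _ 1])
qed

lemma multiplier_mixture:
  assumes "1 \<le> q" "\<And>m. measure (measure_pmf w) {..m} = \<phi> m"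
  shows "multiplier q (\<lambda>n. complex_of_real (\<phi> n)) (conv (mixture w))"
  unfolding multiplier_def using assms by (auto intro: bounded_operator_conv padic_prob_mixture simp: lev_mixture)

lemma multiplier_cdf_fun:
  assumes "1 \<le> q" "cdf_fun \<phi>"
  shows "\<exists>M. multiplier q (\<lambda>n. complex_of_real (\<phi> n)) M"
  using pmf_of_cdf_fun[OF assms(2)] multiplier_mixture[OF assms(1)] by metis

text \<open>An affine change of range produces a \<open>cdf_fun\<close>. A constant \<phi> admits no
  such change and is a scalar operator.\<close>

lemma multiplier_mono:
  fixes \<phi> :: "int \<Rightarrow> real"
  assumes q: "1 \<le> q" and mono: "mono \<phi>" and a: "(\<phi> \<longlongrightarrow> a) at_bot" and b: "(\<phi> \<longlongrightarrow> b) at_top"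
  shows "\<exists>M :: 'p::prime_card L0 \<Rightarrow> 'p L0. multiplier q (\<lambda>n. complex_of_real (\<phi> n)) M"
proof -
  have le: "a \<le> \<phi> n" "\<phi> n \<le> b" for n
    by (rule tendsto_upperbound[OF a], auto simp: eventually_at_bot_linorder intro!: exI[of _ n] monoD[OF mono])
       (rule tendsto_lowerbound[OF b], auto simp: eventually_at_top_linorder intro!: exI[of _ n] monoD[OF mono])
  show ?thesis
  proof (cases "a = b")
    case True
    hence "\<phi> n = a" for n using le[of n] by simp
    hence "multiplier q (\<lambda>n. complex_of_real (\<phi> n)) (\<lambda>F :: 'p L0. complex_of_real a *\<^sub>C F)"
      using multiplier_scale[OF q] by simp
    thus ?thesis by blast
  next
    case False
    hence ab: "a < b" using le[of 0] by simp
    have "cdf_fun (\<lambda>n. (\<phi> n - a) / (b - a))"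
      unfolding cdf_fun_def
    proof (intro conjI)
      show "mono (\<lambda>n. (\<phi> n - a) / (b - a))"
        using ab monoD[OF mono] by (intro monoI divide_right_mono) auto
      show "((\<lambda>n. (\<phi> n - a) / (b - a)) \<longlongrightarrow> 0) at_bot"
        using tendsto_divide[OF tendsto_diff[OF a tendsto_const[of a]] tendsto_const[of "b - a"]] ab by simp
      show "((\<lambda>n. (\<phi> n - a) / (b - a)) \<longlongrightarrow> 1) at_top"
        using tendsto_divide[OF tendsto_diff[OF b tendsto_const[of a]] tendsto_const[of "b - a"]] ab by simp
    qed
    from multiplier_cdf_fun[OF q this] obtain M where
      M: "multiplier q (\<lambda>n. complex_of_real ((\<phi> n - a) / (b - a))) (M :: 'p L0 \<Rightarrow> 'p L0)" by blast
    have "multiplier q (\<lambda>n. complex_of_real a + complex_of_real (b - a) * complex_of_real ((\<phi> n - a) / (b - a)))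
        (\<lambda>F. complex_of_real a *\<^sub>C F + complex_of_real (b - a) *\<^sub>C M F)"
      by (intro multiplier_add multiplier_scale multiplier_compose_scale q M)
    moreover have "complex_of_real a + complex_of_real (b - a) * complex_of_real ((\<phi> n - a) / (b - a))
        = complex_of_real (\<phi> n)" for n
      unfolding of_real_mult[symmetric] of_real_add[symmetric] using ab by simp
    ultimately show ?thesis by auto
  qed
qed

section \<open>The Hilbert space\<close>

lemma cnj_measurable [measurable]: "cnj \<in> borel_measurable borel"
  by (intro borel_measurable_continuous_onI continuous_intros)

lemma L2_inner_abs:
  "f \<in> borel_measurable borel \<Longrightarrow> g \<in> borel_measurable borel \<Longrightarrow>
    L2_inner (abs_L0 f) (abs_L0 g) = (\<integral>x. f x * cnj (g x) \<partial>haar)"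
  by (rule L2_inner.abs_eq) (simp_all add: ae_rel_iff)

lemma powr_two: "norm (z :: complex) powr 2 = (norm z)\<^sup>2"
  by (cases "z = 0") (simp_all add: powr_numeral)

lemma L2_abs_iff: "f \<in> borel_measurable borel \<Longrightarrow> abs_L0 f \<in> Lq 2 \<longleftrightarrow> integrable haar (\<lambda>x. (norm (f x))\<^sup>2)"
  by (simp add: abs_in_Lq_iff lq_pow_def integrable_iff_bounded powr_two)

lemma L2_norm_abs:
  assumes [measurable]: "f \<in> borel_measurable borel" and "abs_L0 f \<in> Lq 2"
  shows "(Lq_norm 2 (abs_L0 f))\<^sup>2 = (\<integral>x. (norm (f x))\<^sup>2 \<partial>haar)"
proof -
  have "enn2real (lq_pow 2 f) = (\<integral>x. (norm (f x))\<^sup>2 \<partial>haar)"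
    unfolding lq_pow_def powr_two by (rule integral_eq_nn_integral[symmetric]) auto
  moreover have "(Lq_norm 2 (abs_L0 f))\<^sup>2 = enn2real (lq_pow 2 f)"
    by (simp add: Lq_norm_abs powr_half_sqrt)
  ultimately show ?thesis by simp
qed

lemma norm_mult_le_squares: "norm (a * cnj b) \<le> ((norm a)\<^sup>2 + (norm b)\<^sup>2) / 2"
  using sum_squares_bound[of "norm a" "norm b"] by (simp add: norm_mult)

lemma L2_inner_integrable:
  assumes [measurable]: "f \<in> borel_measurable borel" "g \<in> borel_measurable borel"
    and "abs_L0 f \<in> Lq 2" "abs_L0 g \<in> Lq 2"
  shows "integrable haar (\<lambda>x. f x * cnj (g x))"
proof (rule Bochner_Integration.integrable_bound)
  show "integrable haar (\<lambda>x. ((norm (f x))\<^sup>2 + (norm (g x))\<^sup>2) / 2)"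
    using assms by (simp add: L2_abs_iff)
  show "AE x in haar. norm (f x * cnj (g x)) \<le> norm (((norm (f x))\<^sup>2 + (norm (g x))\<^sup>2) / 2)"
    using order_trans[OF norm_mult_le_squares abs_ge_self] by simp
qed measurable

lemma L2_inner_le_squares:
  assumes F: "F \<in> Lq 2" and G: "G \<in> Lq 2"
  shows "norm (L2_inner F G) \<le> ((Lq_norm 2 F)\<^sup>2 + (Lq_norm 2 G)\<^sup>2) / 2"
proof -
  obtain f where f[measurable]: "f \<in> borel_measurable borel" "F = abs_L0 f" by (rule L0_cases)
  obtain g where g[measurable]: "g \<in> borel_measurable borel" "G = abs_L0 g" by (rule L0_cases)
  have i: "integrable haar (\<lambda>x. (norm (f x))\<^sup>2)" "integrable haar (\<lambda>x. (norm (g x))\<^sup>2)"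
    using F G f g by (simp_all add: L2_abs_iff)
  have "norm (\<integral>x. f x * cnj (g x) \<partial>haar) \<le> (\<integral>x. norm (f x * cnj (g x)) \<partial>haar)"
    by (rule integral_norm_bound)
  also have "\<dots> \<le> (\<integral>x. ((norm (f x))\<^sup>2 + (norm (g x))\<^sup>2) / 2 \<partial>haar)"
    using i L2_inner_integrable[OF f(1) g(1)] F G f(2) g(2)
    by (intro integral_mono norm_mult_le_squares integrable_norm) auto
  also have "\<dots> = ((Lq_norm 2 F)\<^sup>2 + (Lq_norm 2 G)\<^sup>2) / 2"
    using i F G unfolding f(2) g(2) by (simp add: L2_norm_abs)
  finally show ?thesis unfolding f(2) g(2) by (simp add: L2_inner_abs)
qed

lemma L2_inner_add_left:
  assumes "F \<in> Lq 2" "G \<in> Lq 2" "H \<in> Lq 2"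
  shows "L2_inner (F + G) H = L2_inner F H + L2_inner G H"
proof -
  obtain f where f[measurable]: "f \<in> borel_measurable borel" "F = abs_L0 f" by (rule L0_cases)
  obtain g where g[measurable]: "g \<in> borel_measurable borel" "G = abs_L0 g" by (rule L0_cases)
  obtain h where h[measurable]: "h \<in> borel_measurable borel" "H = abs_L0 h" by (rule L0_cases)
  have i: "integrable haar (\<lambda>x. f x * cnj (h x))" "integrable haar (\<lambda>x. g x * cnj (h x))"
    using L2_inner_integrable[OF f(1) h(1)] L2_inner_integrable[OF g(1) h(1)] assms f(2) g(2) h(2) by auto
  show ?thesis
    unfolding f(2) g(2) h(2) using i
    by (simp add: plus_abs_L0 L2_inner_abs distrib_right)
qed

lemma L2_inner_scale_left: "L2_inner (c *\<^sub>C F) G = c * L2_inner F G"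
proof -
  obtain f where f[measurable]: "f \<in> borel_measurable borel" "F = abs_L0 f" by (rule L0_cases)
  obtain g where g[measurable]: "g \<in> borel_measurable borel" "G = abs_L0 g" by (rule L0_cases)
  show ?thesis unfolding f(2) g(2) by (simp add: scale_abs_L0 L2_inner_abs mult.assoc)
qed

lemma L2_inner_commute: "L2_inner F G = cnj (L2_inner G F)"
proof -
  obtain f where f[measurable]: "f \<in> borel_measurable borel" "F = abs_L0 f" by (rule L0_cases)
  obtain g where g[measurable]: "g \<in> borel_measurable borel" "G = abs_L0 g" by (rule L0_cases)
  have "(\<integral>x. f x * cnj (g x) \<partial>haar) = (\<integral>x. cnj (g x * cnj (f x)) \<partial>haar)" by (simp add: mult.commute)
  also have "\<dots> = cnj (\<integral>x. g x * cnj (f x) \<partial>haar)" by (rule Bochner_Integration.integral_cnj)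
  finally show ?thesis unfolding f(2) g(2) by (simp add: L2_inner_abs)
qed

lemma L2_inner_diff_left:
  assumes "F \<in> Lq 2" "G \<in> Lq 2" "H \<in> Lq 2"
  shows "L2_inner (F - G) H = L2_inner F H - L2_inner G H"
  using L2_inner_add_left[OF assms(1) Lq_uminus[OF assms(2)] assms(3)] L2_inner_scale_left[of "- 1" G H]
  by simp

lemma L2_inner_diff_right:
  assumes "F \<in> Lq 2" "G \<in> Lq 2" "H \<in> Lq 2"
  shows "L2_inner H (F - G) = L2_inner H F - L2_inner H G"
  using L2_inner_diff_left[OF assms] by (simp add: L2_inner_commute[of H])

lemma L2_inner_scale_right: "L2_inner F (c *\<^sub>C G) = cnj c * L2_inner F G"
  by (simp add: L2_inner_commute[of F] L2_inner_scale_left)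

text \<open>For unit vectors the bound in \<open>L2_inner_le_squares\<close> is already 1; scaling
  gives the general case.\<close>

lemma L2_Cauchy_Schwarz:
  assumes F: "F \<in> Lq 2" and G: "G \<in> Lq 2"
  shows "norm (L2_inner F G) \<le> Lq_norm 2 F * Lq_norm 2 G"
proof (cases "Lq_norm 2 F = 0 \<or> Lq_norm 2 G = 0")
  case True
  hence "F = 0 \<or> G = 0" using assms Lq_norm_eq_0D[of 2] by auto
  hence "L2_inner F G = 0"
    using L2_inner_scale_left[of 0 F G] L2_inner_scale_right[of F 0 G] by auto
  thus ?thesis by simp
next
  case False
  let ?a = "Lq_norm 2 F" and ?b = "Lq_norm 2 G"
  have pos: "?a > 0" "?b > 0" using False by (auto simp: less_le)
  let ?F = "complex_of_real (1 / ?a) *\<^sub>C F" and ?G = "complex_of_real (1 / ?b) *\<^sub>C G"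
  have "norm (L2_inner ?F ?G) \<le> ((Lq_norm 2 ?F)\<^sup>2 + (Lq_norm 2 ?G)\<^sup>2) / 2"
    using F G by (intro L2_inner_le_squares Lq_scale) auto
  also have "\<dots> = 1" using pos F G by (simp add: Lq_scale norm_divide)
  finally have "norm (L2_inner F G) / (?a * ?b) \<le> 1"
    using pos by (simp add: L2_inner_scale_left L2_inner_scale_right norm_mult norm_divide mult.commute)
  hence "norm (L2_inner F G) \<le> 1 * (?a * ?b)"
    using pos by (intro pos_divide_le_eq[THEN iffD1] mult_pos_pos)
  thus ?thesis by (simp only: mult_1)
qed

lemma L2_inner_tendsto_left:
  assumes X: "\<And>k. X k \<in> Lq 2" and F: "F \<in> Lq 2" and G: "G \<in> Lq 2" and lim: "Lq_tendsto 2 X F"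
  shows "(\<lambda>k. L2_inner (X k) G) \<longlonglongrightarrow> L2_inner F G"
proof (rule LIM_zero_cancel, rule Lim_null_comparison)
  show "(\<lambda>k. Lq_norm 2 (X k - F) * Lq_norm 2 G) \<longlonglongrightarrow> 0"
    using lim by (auto simp: Lq_tendsto_def intro: tendsto_mult_left_zero)
  have "norm (L2_inner (X k) G - L2_inner F G) \<le> Lq_norm 2 (X k - F) * Lq_norm 2 G" for k
    using L2_Cauchy_Schwarz[OF Lq_diff[OF X F] G] by (simp add: L2_inner_diff_left X F G)
  thus "\<forall>\<^sub>F k in sequentially. norm (L2_inner (X k) G - L2_inner F G) \<le> Lq_norm 2 (X k - F) * Lq_norm 2 G"
    by simp
qed

text \<open>The average is an integral operator with kernel \<open>K\<close>, symmetric because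
  being at distance at most p^n is. Fubini is justified by |f(z) g(x)| \<le> |f(z)|^2 + |g(x)|^2, as
  K integrates to 1 in either variable.\<close>

lemma avg_self_adjoint:
  fixes F G :: "'p::prime_card L0"
  assumes F: "F \<in> Lq 2" and G: "G \<in> Lq 2"
  shows "L2_inner (avg n F) G = L2_inner F (avg n G)"
proof -
  interpret H: pair_sigma_finite haar "haar :: 'p padic measure" ..
  obtain f where f[measurable]: "f \<in> borel_measurable borel" "F = abs_L0 f" by (rule L0_cases)
  obtain g where g[measurable]: "g \<in> borel_measurable borel" "G = abs_L0 g" by (rule L0_cases)
  let ?c = "real CARD('p) powi n"
  have c: "?c > 0" by simp
  define K :: "'p padic \<Rightarrow> 'p padic \<Rightarrow> real" where "K x z = (if dist x z \<le> ?c then 1 / ?c else 0)" for x z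
  have K: "K x z = indicator (padic_ball n x) z / ?c" for x z
    by (auto simp: K_def mem_padic_ball padic_norm_dist dist_commute split: split_indicator)
  have K0: "K x z \<ge> 0" for x z using c by (simp add: K_def)
  have Ks: "K x z = K z x" for x z by (simp add: K_def dist_commute)
  have Km[measurable]: "(\<lambda>w. K (fst w) (snd w)) \<in> borel_measurable (borel \<Otimes>\<^sub>M borel)"
    unfolding K_def by measurable
  have Km'[measurable]: "(\<lambda>z. K x z) \<in> borel_measurable borel" for x
    unfolding K_def by measurable
  have avg: "(\<integral>y. h (x + y) \<partial>ball_measure n) = (\<integral>z. K x z *\<^sub>R h z \<partial>haar)"
    if [measurable]: "h \<in> borel_measurable borel" for h :: "'p padic \<Rightarrow> complex" and x
  proof -
    have "(\<integral>z. K x z *\<^sub>R h z \<partial>haar) = (\<integral>z. (1 / ?c) *\<^sub>R (indicator (padic_ball n x) z *\<^sub>R h z) \<partial>haar)"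
      by (simp add: K divide_inverse mult.commute)
    also have "\<dots> = (1 / ?c) *\<^sub>R (\<integral>z. indicator (padic_ball n x) z *\<^sub>R h z \<partial>haar)"
      by (rule integral_scaleR_right)
    finally show ?thesis by (simp add: integral_ball_measure divide_inverse)
  qed
  have Kint: "(\<integral>\<^sup>+z. ennreal (K x z) \<partial>haar) = 1" for x
  proof -
    have "(\<integral>\<^sup>+z. ennreal (K x z) \<partial>haar) = (\<integral>\<^sup>+z. ennreal (1 / ?c) * indicator (padic_ball n x) z \<partial>haar)"
      unfolding K by (intro nn_integral_cong) (auto split: split_indicator)
    also have "\<dots> = ennreal (1 / ?c) * ennreal ?c" by (subst nn_integral_cmult_indicator) auto
    also have "\<dots> = 1" using c by (simp add: ennreal_mult[symmetric])
    finally show ?thesis .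
  qed
  define \<Phi> where "\<Phi> w = K (fst w) (snd w) *\<^sub>R f (snd w) * cnj (g (fst w))" for w
  let ?u = "\<lambda>z. ennreal ((norm (f z))\<^sup>2)" and ?v = "\<lambda>x. ennreal ((norm (g x))\<^sup>2)"
  have mu: "(\<lambda>w. ennreal (K (fst w) (snd w)) * ?u (snd w)) \<in> borel_measurable (haar \<Otimes>\<^sub>M haar)"
    by measurable
  have mv: "(\<lambda>w. ennreal (K (fst w) (snd w)) * ?v (fst w)) \<in> borel_measurable (haar \<Otimes>\<^sub>M haar)"
    by measurable
  have \<Phi>m[measurable]: "\<Phi> \<in> borel_measurable (haar \<Otimes>\<^sub>M haar)" unfolding \<Phi>_def by measurable
  have "integrable (haar \<Otimes>\<^sub>M haar) \<Phi>"
  proof (rule integrableI_bounded)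
    have "norm (\<Phi> w) \<le> K (fst w) (snd w) * (norm (f (snd w)))\<^sup>2 + K (fst w) (snd w) * (norm (g (fst w)))\<^sup>2" for w
    proof -
      have "norm (\<Phi> w) = K (fst w) (snd w) * norm (f (snd w) * cnj (g (fst w)))"
        using K0 by (simp add: \<Phi>_def norm_mult)
      also have "\<dots> \<le> K (fst w) (snd w) * ((norm (f (snd w)))\<^sup>2 + (norm (g (fst w)))\<^sup>2)"
      proof (rule mult_left_mono[OF _ K0])
        show "norm (f (snd w) * cnj (g (fst w))) \<le> (norm (f (snd w)))\<^sup>2 + (norm (g (fst w)))\<^sup>2"
          by (rule order_trans[OF norm_mult_le_squares]) simp
      qed
      finally show ?thesis by (simp add: distrib_left)
    qed
    hence "(\<integral>\<^sup>+w. norm (\<Phi> w) \<partial>(haar \<Otimes>\<^sub>M haar))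
        \<le> (\<integral>\<^sup>+w. ennreal (K (fst w) (snd w)) * ?u (snd w) + ennreal (K (fst w) (snd w)) * ?v (fst w) \<partial>(haar \<Otimes>\<^sub>M haar))"
      using K0 by (intro nn_integral_mono) (simp add: ennreal_mult[symmetric] ennreal_plus[symmetric] del: ennreal_plus)
    also have "\<dots> = (\<integral>\<^sup>+w. ennreal (K (fst w) (snd w)) * ?u (snd w) \<partial>(haar \<Otimes>\<^sub>M haar))
        + (\<integral>\<^sup>+w. ennreal (K (fst w) (snd w)) * ?v (fst w) \<partial>(haar \<Otimes>\<^sub>M haar))"
      by (rule nn_integral_add[OF mu mv])
    also have "(\<integral>\<^sup>+w. ennreal (K (fst w) (snd w)) * ?u (snd w) \<partial>(haar \<Otimes>\<^sub>M haar))
        = (\<integral>\<^sup>+z. \<integral>\<^sup>+x. ennreal (K x z) * ?u z \<partial>haar \<partial>haar)"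
      using H.nn_integral_snd[OF mu] by simp
    also have "\<dots> = (\<integral>\<^sup>+z. ?u z \<partial>haar)"
      by (intro nn_integral_cong, subst nn_integral_multc) (auto simp: Ks[of _ z for z] Kint intro!: measurable_compose[OF _ measurable_ennreal])
    also have "(\<integral>\<^sup>+w. ennreal (K (fst w) (snd w)) * ?v (fst w) \<partial>(haar \<Otimes>\<^sub>M haar))
        = (\<integral>\<^sup>+x. \<integral>\<^sup>+z. ennreal (K x z) * ?v x \<partial>haar \<partial>haar)"
      using haar.nn_integral_fst[OF mv] by simp
    also have "\<dots> = (\<integral>\<^sup>+x. ?v x \<partial>haar)"
      by (intro nn_integral_cong, subst nn_integral_multc) (auto simp: Kint)
    also have "(\<integral>\<^sup>+z. ?u z \<partial>haar) + (\<integral>\<^sup>+x. ?v x \<partial>haar) < \<infinity>"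
      using F G unfolding f(2) g(2) by (simp add: L2_abs_iff integrable_iff_bounded)
    finally show "(\<integral>\<^sup>+w. norm (\<Phi> w) \<partial>(haar \<Otimes>\<^sub>M haar)) < \<infinity>" .
  qed measurable
  hence fub: "(\<integral>x. \<integral>z. \<Phi> (x, z) \<partial>haar \<partial>haar) = (\<integral>z. \<integral>x. \<Phi> (x, z) \<partial>haar \<partial>haar)"
    using H.integral_fst'[of \<Phi>] H.integral_snd[of "\<lambda>x z. \<Phi> (x, z)"] by simp
  have "L2_inner (avg n F) G = (\<integral>x. (\<integral>z. K x z *\<^sub>R f z \<partial>haar) * cnj (g x) \<partial>haar)"
    unfolding f(2) g(2) avg_abs[OF f(1)] using avg[OF f(1)] by (subst L2_inner_abs) auto
  also have "\<dots> = (\<integral>x. \<integral>z. \<Phi> (x, z) \<partial>haar \<partial>haar)"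
    by (simp only: \<Phi>_def fst_conv snd_conv integral_mult_left_zero)
  also note fub
  also have "(\<integral>z. \<integral>x. \<Phi> (x, z) \<partial>haar \<partial>haar) = (\<integral>z. f z * cnj (\<integral>x. K z x *\<^sub>R g x \<partial>haar) \<partial>haar)"
  proof (rule Bochner_Integration.integral_cong[OF refl])
    fix z
    have "(\<integral>x. \<Phi> (x, z) \<partial>haar) = (\<integral>x. f z * cnj (K z x *\<^sub>R g x) \<partial>haar)"
      by (intro Bochner_Integration.integral_cong) (auto simp: \<Phi>_def Ks[of _ z] complex_cnj_scaleR)
    also have "\<dots> = f z * cnj (\<integral>x. K z x *\<^sub>R g x \<partial>haar)"
      by (subst integral_mult_right_zero) (simp add: Bochner_Integration.integral_cnj[symmetric])
    finally show "(\<integral>x. \<Phi> (x, z) \<partial>haar) = f z * cnj (\<integral>x. K z x *\<^sub>R g x \<partial>haar)" .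
  qed
  also have "\<dots> = L2_inner F (avg n G)"
    unfolding f(2) g(2) avg_abs[OF g(1)] using avg[OF g(1)] by (subst L2_inner_abs) auto
  finally show ?thesis .
qed

lemma lev_self_adjoint:
  assumes "F \<in> Lq 2" "G \<in> Lq 2"
  shows "L2_inner (lev n F) G = L2_inner F (lev n G)"
  unfolding lev_def using assms by (simp add: L2_inner_diff_left L2_inner_diff_right avg_Lq avg_self_adjoint)

text \<open>For a truncation supported in the ball of radius p^m, the average at k \<ge> m lives on
  the ball of radius p^k and is at most C / p^k there, so its squared norm is at most C^2 / p^k. The
  same count for q = 1 gives no decay.\<close>

lemma L2_avg_tendsto_0:
  fixes F :: "'p::prime_card L0"
  assumes F: "F \<in> Lq 2"
  shows "(\<lambda>k. Lq_norm 2 (avg (int k) F)) \<longlonglongrightarrow> 0"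
proof (rule LIMSEQ_I)
  fix e :: real assume e: "e > 0"
  obtain f where f[measurable]: "f \<in> borel_measurable borel" "F = abs_L0 f" by (rule L0_cases)
  have "abs_L0 f \<in> Lq 2" using F f(2) by simp
  from order_tendstoD(2)[OF trunc_tendsto[OF f(1) this], of "e / 2"] e
  obtain m where m: "Lq_norm 2 (abs_L0 (trunc m f) - F) < e / 2"
    by (auto simp: eventually_sequentially f(2))
  let ?g = "trunc m f"
  let ?p = "real CARD('p)"
  have gm[measurable]: "?g \<in> borel_measurable borel" by measurable
  have g: "abs_L0 ?g \<in> Lq 2" by (rule trunc_in_Lq) auto
  \<comment> \<open>Bounds the integral of |g|: the height m times the measure of the ball of radius
    p^m.\<close>
  define C where "C = real m * ?p powi int m"
  have C: "C \<ge> 0" by (simp add: C_def less_imp_le)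
  have bound: "lq_pow 2 (\<lambda>x. \<integral>y. ?g (x + y) \<partial>ball_measure (int k)) \<le> ennreal (C\<^sup>2 / ?p powi int k)"
    if k: "k \<ge> m" for k
  proof -
    let ?c = "?p powi int k"
    have c: "?c > 0" by simp
    have sub: "padic_ball (int m) (0 :: 'p padic) \<subseteq> padic_ball (int k) 0"
      using k by (intro padic_ball_mono) simp
    have pt: "ennreal (norm (\<integral>y. ?g (x + y) \<partial>ball_measure (int k)) powr 2)
        \<le> ennreal ((C / ?c)\<^sup>2) * indicator (padic_ball (int k) 0) x" for x
    proof (cases "x \<in> padic_ball (int k) 0")
      case True
      have "norm (\<integral>z. indicator (padic_ball (int k) x) z *\<^sub>R ?g z \<partial>haar)
          \<le> (\<integral>z. norm (indicator (padic_ball (int k) x) z *\<^sub>R ?g z) \<partial>haar)"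
        by (rule integral_norm_bound)
      also have "\<dots> \<le> (\<integral>z. real m * indicator (padic_ball (int m) (0 :: 'p padic)) z \<partial>haar)"
      proof (rule Bochner_Integration.integral_mono')
        show "integrable haar (\<lambda>z. real m * indicator (padic_ball (int m) (0 :: 'p padic)) z)"
          by (intro integrable_mult_right integrable_real_indicator) auto
        show "norm (indicator (padic_ball (int k) x) z *\<^sub>R ?g z) \<le> real m * indicator (padic_ball (int m) 0) z" for z
          using norm_trunc_le[of m f z] trunc_outside[of z m f] by (auto split: split_indicator)
      qed simp
      also have "\<dots> = C" by (simp add: C_def)
      finally have "norm (\<integral>y. ?g (x + y) \<partial>ball_measure (int k)) \<le> C / ?c"
        using c by (simp add: integral_ball_measure divide_inverse mult.commute del: power_int_of_nat)
      hence "(norm (\<integral>y. ?g (x + y) \<partial>ball_measure (int k)))\<^sup>2 \<le> (C / ?c)\<^sup>2"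
        by (intro power_mono) auto
      thus ?thesis using True by (simp add: powr_two ennreal_leI del: power_int_of_nat)
    next
      case False
      have "?g z = 0" if "z \<in> padic_ball (int k) x" for z
      proof (rule trunc_outside)
        show "z \<notin> padic_ball (int m) 0"
          using that False sub padic_ball_sym padic_ball_trans by blast
      qed
      hence "(\<integral>y. ?g (x + y) \<partial>ball_measure (int k)) = 0"
        by (intro integral_ball_measure_const) auto
      thus ?thesis by simp
    qed
    have "lq_pow 2 (\<lambda>x. \<integral>y. ?g (x + y) \<partial>ball_measure (int k))
        \<le> (\<integral>\<^sup>+x. ennreal ((C / ?c)\<^sup>2) * indicator (padic_ball (int k) (0 :: 'p padic)) x \<partial>haar)"
      unfolding lq_pow_def by (intro nn_integral_mono pt)
    also have "\<dots> = ennreal ((C / ?c)\<^sup>2) * ennreal ?c"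
      by (subst nn_integral_cmult_indicator) auto
    also have "\<dots> = ennreal ((C / ?c)\<^sup>2 * ?c)"
      using c by (intro ennreal_mult[symmetric]) auto
    also have "(C / ?c)\<^sup>2 * ?c = C\<^sup>2 / ?c"
      using c by (simp add: power2_eq_square)
    finally show ?thesis .
  qed
  have "(\<lambda>k. C\<^sup>2 / ?p powi int k) \<longlonglongrightarrow> 0" by (rule real_powi_divide_tendsto_0)
  from order_tendstoD(2)[OF this, of "(e / 2)\<^sup>2"] e
  obtain N where N: "\<And>k. k \<ge> N \<Longrightarrow> C\<^sup>2 / ?p powi int k < (e / 2)\<^sup>2"
    unfolding eventually_sequentially by fastforce
  have "Lq_norm 2 (avg (int k) F) < e" if k: "k \<ge> max m N" for k
  proof -
    have "lq_pow 2 (\<lambda>x. \<integral>y. ?g (x + y) \<partial>ball_measure (int k)) \<le> ennreal ((e / 2)\<^sup>2)"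
      using bound[of k] N[of k] k by (intro order_trans[OF bound] ennreal_leI) auto
    moreover have "(\<lambda>x. \<integral>y. ?g (x + y) \<partial>ball_measure (int k)) \<in> borel_measurable borel" by measurable
    ultimately have "Lq_norm 2 (avg (int k) (abs_L0 ?g)) \<le> e / 2"
      unfolding avg_abs[OF gm] using e by (intro Lq_normI(2)) (auto simp: powr_numeral)
    moreover have "Lq_norm 2 (avg (int k) F - avg (int k) (abs_L0 ?g)) \<le> Lq_norm 2 (F - abs_L0 ?g)"
      using avg_Lq(2)[OF Lq_diff[OF F g], of "int k"] by (simp add: avg_diff[OF F g])
    moreover have "Lq_norm 2 (F - abs_L0 ?g) < e / 2"
      using m Lq_norm_minus_commute[OF F g] by simp
    moreover have "Lq_norm 2 (avg (int k) F)
        \<le> Lq_norm 2 (avg (int k) F - avg (int k) (abs_L0 ?g)) + Lq_norm 2 (avg (int k) (abs_L0 ?g))"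
      using Lq_triangle[of "avg (int k) F - avg (int k) (abs_L0 ?g)" 2 "avg (int k) (abs_L0 ?g)"] F g
      by (simp add: Lq_diff avg_Lq)
    ultimately show ?thesis by simp
  qed
  thus "\<exists>no. \<forall>k\<ge>no. norm (Lq_norm 2 (avg (int k) F) - 0) < e" by (intro exI[of _ "max m N"]) simp
qed

text \<open>Telescopes to the sum of the levels from -k to k - 1, hence the uneven pair of new
  levels in \<open>level_sum_Suc\<close>.\<close>

definition level_sum :: "nat \<Rightarrow> 'p::prime_card L0 \<Rightarrow> 'p L0" where
  "level_sum k F = avg (- int k) F - avg (int k) F"

lemma level_sum_Lq: "F \<in> Lq q \<Longrightarrow> 1 \<le> q \<Longrightarrow> level_sum k F \<in> Lq q"
  unfolding level_sum_def by (intro Lq_diff avg_Lq)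

lemma level_sum_0 [simp]: "level_sum 0 F = 0"
  by (simp add: level_sum_def)

lemma level_sum_Suc: "level_sum (Suc k) F = level_sum k F + lev (- int (Suc k)) F + lev (int k) F"
  by (simp add: level_sum_def lev_def algebra_simps)

lemma level_sum_tendsto:
  assumes F: "F \<in> Lq 2"
  shows "Lq_tendsto 2 (\<lambda>k. level_sum k F) F"
proof -
  have "filterlim (\<lambda>k. - int k) at_bot sequentially"
    unfolding filterlim_at_bot
  proof
    fix Z
    have "- int k \<le> Z" if "k \<ge> nat (- Z)" for k using that by linarith
    thus "\<forall>\<^sub>F k in sequentially. - int k \<le> Z" unfolding eventually_sequentially by blast
  qed
  from filterlim_compose[OF avg_tendsto[OF F] this]
  have "(\<lambda>k. Lq_norm 2 (avg (- int k) F - F)) \<longlonglongrightarrow> 0" by simp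
  from tendsto_add_zero[OF this L2_avg_tendsto_0[OF F]]
  have lim: "(\<lambda>k. Lq_norm 2 (avg (- int k) F - F) + Lq_norm 2 (avg (int k) F)) \<longlonglongrightarrow> 0" .
  have "Lq_norm 2 (level_sum k F - F) \<le> Lq_norm 2 (avg (- int k) F - F) + Lq_norm 2 (avg (int k) F)" for k
  proof -
    have eq: "level_sum k F - F = (avg (- int k) F - F) - avg (int k) F" by (simp add: level_sum_def)
    show ?thesis unfolding eq using F by (intro Lq_norm_diff_triangle Lq_diff avg_Lq) auto
  qed
  with lim show ?thesis unfolding Lq_tendsto_def
    by (intro tendsto_sandwich[OF _ _ tendsto_const, of _ "\<lambda>k. Lq_norm 2 (level_sum k F - F)"]) auto
qed

section \<open>The standard character\<close>

lemma ex_nat_padic_ball: "\<exists>N. x \<in> padic_ball (int N) (0 :: 'p::prime_card padic)"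
proof -
  obtain n where "x \<in> padic_ball n 0" using padic_norm_exponent_exists by blast
  hence "x \<in> padic_ball (int (nat n)) 0" using padic_ball_mono[of n "int (nat n)" 0] by auto
  thus ?thesis ..
qed

definition p_fraction :: "nat \<Rightarrow> rat \<Rightarrow> bool" where
  "p_fraction b r \<longleftrightarrow> (\<exists>k n. r = of_int k / of_nat b ^ n)"

lemma p_fraction_diff:
  assumes "b > 0" "p_fraction b r" "p_fraction b s"
  shows "p_fraction b (r - s)"
proof -
  obtain k m l n where rs: "r = of_int k / of_nat b ^ m" "s = of_int l / of_nat b ^ n"
    using assms by (auto simp: p_fraction_def)
  have "r - s = of_int (k * int b ^ n - l * int b ^ m) / of_nat b ^ (m + n)"
    unfolding rs using assms(1) by (simp add: power_add diff_frac_eq mult.commute)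
  thus ?thesis unfolding p_fraction_def by blast
qed

text \<open>The norm bound makes the numerator divisible by the power of p below it; in short,
  Z[1/p] and Z_p meet in Z.\<close>

lemma p_fraction_integral:
  assumes "p_fraction CARD('p::prime_card) r" "padic_norm (of_rat r :: 'p padic) \<le> 1"
  shows "r \<in> \<int>"
proof -
  obtain k n where r: "r = of_int k / of_nat CARD('p) ^ n" using assms by (auto simp: p_fraction_def)
  have "padic_norm (of_nat CARD('p) ^ n :: 'p padic) = real CARD('p) powi (- int n)"
    using padic_abs_power_int[of "int n", where 'p='p] by simp
  moreover have "(of_rat r :: 'p padic) = of_int k / of_nat CARD('p) ^ n"
    unfolding r by (simp add: of_rat_divide of_rat_power)
  ultimately have "padic_norm (of_int k :: 'p padic) \<le> real CARD('p) powi (- int n)"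
    using assms(2) by (simp add: padic_norm_divide pos_divide_le_eq)
  hence "int (CARD('p) ^ n) dvd k" by (simp only: padic_norm_of_int_le_iff)
  then obtain l where "k = int (CARD('p) ^ n) * l" ..
  hence "r = of_int l" unfolding r by simp
  thus ?thesis by simp
qed

text \<open>Existence: an integer below p^N close to p^N x, divided by p^N. Uniqueness: two
  candidates differ by an element of Z[1/p] of norm at most 1, hence by an integer, and both lie in
  [0, 1).\<close>

lemma padic_frac_ex1:
  fixes x :: "'p::prime_card padic"
  shows "\<exists>!r. 0 \<le> r \<and> r < 1 \<and> (\<exists>k n. r = of_int k / of_nat CARD('p) ^ n) \<and> padic_norm (x - of_rat r) \<le> 1"
proof -
  let ?p = "of_nat CARD('p) :: 'p padic"
  obtain N where N: "x \<in> padic_ball (int N) 0" using ex_nat_padic_ball by blast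
  hence "padic_norm (x * ?p powi int N) \<le> 1" by (simp only: padic_ball_scale)
  then obtain k where k: "k < CARD('p) ^ N" "padic_norm (x * ?p powi int N - of_nat k) \<le> real CARD('p) powi (- int N)"
    by (rule padic_integer_approx)
  define r where "r = of_int (int k) / (of_nat CARD('p) ^ N :: rat)"
  have "padic_norm (x - of_rat r) \<le> 1"
  proof -
    have "x * ?p powi int N - of_nat k = (x - of_rat r) * ?p powi int N"
      by (simp add: r_def of_rat_divide of_rat_power field_simps)
    hence "padic_norm (x - of_rat r) * real CARD('p) powi (- int N) \<le> 1 * real CARD('p) powi (- int N)"
      using k(2) by (simp only: padic_norm_mult padic_abs_power_int mult_1)
    thus ?thesis by (rule mult_right_le_imp_le) simp
  qed
  moreover have "0 \<le> r" by (simp add: r_def)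
  moreover have "r < 1"
  proof -
    have "(of_nat k :: rat) < of_nat (CARD('p) ^ N)" using k(1) by (simp only: of_nat_less_iff)
    thus ?thesis by (simp add: r_def)
  qed
  ultimately have ex: "0 \<le> r \<and> r < 1 \<and> (\<exists>k n. r = of_int k / of_nat CARD('p) ^ n) \<and> padic_norm (x - of_rat r) \<le> 1"
    unfolding r_def by blast
  show ?thesis
  proof (rule ex1I[of _ r])
    fix s assume s: "0 \<le> s \<and> s < 1 \<and> (\<exists>k n. s = of_int k / of_nat CARD('p) ^ n) \<and> padic_norm (x - of_rat s) \<le> 1"
    have "p_fraction CARD('p) (s - r)"
      using s ex by (intro p_fraction_diff) (auto simp: p_fraction_def)
    moreover have "padic_norm ((x - of_rat r) - (x - of_rat s)) \<le> 1"
      using s ex by (intro padic_norm_diff_le[of "x - of_rat r" 1 "x - of_rat s"]) auto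
    hence "padic_norm (of_rat (s - r) :: 'p padic) \<le> 1" by (simp add: of_rat_diff)
    ultimately obtain i where i: "s - r = of_int i" using p_fraction_integral by (metis Ints_cases)
    have "\<bar>s - r\<bar> < 1" using s ex by linarith
    hence "i = 0" unfolding i by simp
    thus "s = r" using i by simp
  qed (use ex in blast)
qed

lemma padic_frac:
  fixes x :: "'p::prime_card padic"
  shows "0 \<le> padic_frac x" "padic_frac x < 1" "p_fraction CARD('p) (padic_frac x)"
    "padic_norm (x - of_rat (padic_frac x)) \<le> 1"
  using theI'[OF padic_frac_ex1[of x], folded padic_frac_def] unfolding p_fraction_def by blast+

lemma padic_frac_diff_int:
  assumes "p_fraction CARD('p::prime_card) r" "padic_norm (x - of_rat r :: 'p padic) \<le> 1"
  shows "padic_frac x - r \<in> \<int>"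
proof (rule p_fraction_integral[where 'p='p])
  show "p_fraction CARD('p) (padic_frac x - r)"
    using assms(1) by (intro p_fraction_diff padic_frac) simp
  have "padic_norm ((x - of_rat r) - (x - of_rat (padic_frac x))) \<le> 1"
    using assms(2) padic_frac(4) by (rule padic_norm_diff_le)
  thus "padic_norm (of_rat (padic_frac x - r) :: 'p padic) \<le> 1" by (simp add: of_rat_diff)
qed

lemma cis_int: "r \<in> \<int> \<Longrightarrow> cis (2 * pi * of_rat r) = 1"
proof -
  assume "r \<in> \<int>"
  then obtain i where "r = of_int i" by (auto elim: Ints_cases)
  thus ?thesis using cis_multiple_2pi[of "of_int i"] by simp
qed

text \<open>Fractional parts are additive up to an integer, which the exponential does not
  see.\<close>

lemma padic_char_add: "padic_char (x + y) = padic_char x * padic_char (y :: 'p::prime_card padic)"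
proof -
  let ?s = "padic_frac x + padic_frac y"
  have s: "p_fraction CARD('p) ?s"
  proof -
    have "p_fraction CARD('p) (0 - padic_frac y)"
      by (intro p_fraction_diff padic_frac) (auto simp: p_fraction_def intro: exI[of _ 0])
    from p_fraction_diff[OF _ padic_frac(3)[of x] this] show ?thesis by simp
  qed
  have "padic_norm ((x - of_rat (padic_frac x)) + (y - of_rat (padic_frac y))) \<le> 1"
    by (intro padic_norm_add_le padic_frac)
  hence "padic_norm (x + y - of_rat ?s) \<le> 1" by (simp add: of_rat_add algebra_simps)
  from cis_int[OF padic_frac_diff_int[OF s this]]
  have "cis (2 * pi * of_rat (padic_frac (x + y) - ?s)) * cis (2 * pi * of_rat ?s) = cis (2 * pi * of_rat ?s)"
    by simp
  thus ?thesis
    by (simp add: padic_char_def cis_mult of_rat_diff of_rat_add algebra_simps)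
qed

text \<open>The exponential is 1 only at integers, and the only integer in [0, 1) is 0. So the
  kernel of the character is Z_p.\<close>

lemma padic_char_eq_1_iff: "padic_char x = 1 \<longleftrightarrow> padic_norm (x :: 'p::prime_card padic) \<le> 1"
proof
  assume "padic_norm x \<le> 1"
  hence "padic_frac x - 0 \<in> \<int>"
    by (intro padic_frac_diff_int) (auto simp: p_fraction_def intro: exI[of _ 0])
  thus "padic_char x = 1" using cis_int by (simp add: padic_char_def)
next
  assume "padic_char x = 1"
  hence "cos (2 * pi * of_rat (padic_frac x)) = 1"
    by (simp add: padic_char_def complex_eq_iff)
  then obtain i :: int where "2 * pi * of_rat (padic_frac x) = real_of_int i * 2 * pi"
    by (auto simp: cos_one_2pi_int)
  hence "real_of_rat (padic_frac x) = real_of_rat (of_int i)" by simp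
  hence i: "padic_frac x = of_int i" by (simp only: of_rat_eq_iff)
  have "of_int i < (1 :: rat)" "(0 :: rat) \<le> of_int i" using padic_frac(1,2)[of x] unfolding i by auto
  hence "i = 0" by simp
  thus "padic_norm x \<le> 1" using padic_frac(4)[of x] i by simp
qed

lemma padic_char_0 [simp]: "padic_char 0 = 1"
  by (simp add: padic_char_eq_1_iff)

lemma norm_padic_char [simp]: "norm (padic_char x) = 1"
  by (simp add: padic_char_def)

lemma padic_char_cong: "padic_norm (y - x) \<le> 1 \<Longrightarrow> padic_char y = padic_char (x :: 'p::prime_card padic)"
  using padic_char_add[of "y - x" x] padic_char_eq_1_iff[of "y - x"] by simp

lemma padic_char_of_nat_mult: "padic_char (of_nat j * x) = padic_char (x :: 'p::prime_card padic) ^ j"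
  by (induction j) (simp_all add: distrib_right padic_char_add)

lemma locally_constant_measurable:
  fixes f :: "'p::prime_card padic \<Rightarrow> 'b::topological_space"
  assumes "\<And>x. \<exists>n. \<forall>y\<in>padic_ball n x. f y = f x"
  shows "f \<in> borel_measurable borel"
proof (rule borel_measurableI)
  fix S :: "'b set"
  have "open (f -` S)"
  proof (subst open_subopen, intro ballI)
    fix x assume x: "x \<in> f -` S"
    obtain n where "\<forall>y\<in>padic_ball n x. f y = f x" using assms by blast
    hence "f y \<in> S" if "y \<in> padic_ball n x" for y using that x by (metis vimageE)
    hence "padic_ball n x \<subseteq> f -` S" by blast
    thus "\<exists>T. open T \<and> x \<in> T \<and> T \<subseteq> f -` S"
      using open_padic_ball padic_ball_self by blast
  qed
  thus "f -` S \<inter> space borel \<in> sets borel" by simp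
qed

lemma padic_char_mult_measurable [measurable]:
  "(\<lambda>y. padic_char (\<xi> * y :: 'p::prime_card padic)) \<in> borel_measurable borel"
proof (rule locally_constant_measurable)
  fix x :: "'p padic"
  have "\<exists>n. padic_norm \<xi> * real CARD('p) powi n \<le> 1"
  proof (cases "\<xi> = 0")
    case False
    then obtain k where k: "padic_norm \<xi> = real CARD('p) powi k" by (rule padic_norm_discrete)
    have "padic_norm \<xi> * real CARD('p) powi (- k) = 1" unfolding k by (simp add: power_int_minus)
    thus ?thesis by (intro exI[of _ "- k"]) simp
  qed simp
  then obtain n where n: "padic_norm \<xi> * real CARD('p) powi n \<le> 1" by blast
  have "padic_char (\<xi> * y) = padic_char (\<xi> * x)" if "y \<in> padic_ball n x" for y
  proof (rule padic_char_cong)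
    have "padic_norm (\<xi> * y - \<xi> * x) = padic_norm \<xi> * padic_norm (y - x)"
      by (simp add: padic_norm_mult[symmetric] right_diff_distrib)
    also have "\<dots> \<le> padic_norm \<xi> * real CARD('p) powi n"
      using that by (intro mult_left_mono) (auto simp: mem_padic_ball)
    finally show "padic_norm (\<xi> * y - \<xi> * x) \<le> 1" using n by simp
  qed
  thus "\<exists>n. \<forall>y\<in>padic_ball n x. padic_char (\<xi> * y) = padic_char (\<xi> * x)" by blast
qed

section \<open>The Fourier transform and the levels\<close>

text \<open>By geometric summation a detector of Z_p built from finitely many characters.\<close>

definition char_mean :: "nat \<Rightarrow> 'p::prime_card padic \<Rightarrow> complex" where
  "char_mean k z = (\<Sum>j<CARD('p) ^ k. padic_char (of_nat j * z)) / of_nat (CARD('p) ^ k)"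

lemma norm_char_mean_le: "norm (char_mean k z) \<le> 1"
proof -
  have "norm (\<Sum>j<CARD('a) ^ k. padic_char (of_nat j * z)) \<le> (\<Sum>j<CARD('a) ^ k. norm (padic_char (of_nat j * z)))"
    by (rule norm_sum)
  hence "norm (\<Sum>j<CARD('a) ^ k. padic_char (of_nat j * z)) \<le> real (CARD('a) ^ k)" by simp
  thus ?thesis by (simp add: char_mean_def norm_divide norm_power)
qed

text \<open>Once p^k z lies in Z_p, \<open>padic_char z\<close> has p^k-th power 1, so it sums to 0
  unless it is 1. The sequence is eventually constant.\<close>

lemma char_mean_tendsto:
  "(\<lambda>k. char_mean k z) \<longlonglongrightarrow> (if padic_norm z \<le> 1 then 1 else 0)" for z :: "'p::prime_card padic"
proof (cases "padic_norm z \<le> 1")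
  case True
  hence "padic_char (of_nat j * z) = 1" for j
    using padic_char_eq_1_iff[of z] by (simp add: padic_char_of_nat_mult)
  thus ?thesis using True by (simp add: char_mean_def)
next
  case False
  obtain n where n: "z \<in> padic_ball (int n) 0" using ex_nat_padic_ball by blast
  have "char_mean k z = 0" if k: "k \<ge> n" for k
  proof -
    have "z \<in> padic_ball (int k) 0" using n k padic_ball_mono[of "int n" "int k" 0] by auto
    hence "padic_norm (z * of_nat CARD('p) powi int k) \<le> 1" by (simp only: padic_ball_scale)
    hence "padic_char z ^ (CARD('p) ^ k) = 1"
      using padic_char_eq_1_iff[of "of_nat (CARD('p) ^ k) * z"]
      by (simp add: padic_char_of_nat_mult[symmetric] mult.commute)
    moreover have "padic_char z \<noteq> 1" using False padic_char_eq_1_iff by blast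
    ultimately have "(\<Sum>j<CARD('p) ^ k. padic_char z ^ j) = 0" by (simp add: geometric_sum)
    thus ?thesis by (simp add: char_mean_def padic_char_of_nat_mult)
  qed
  hence "\<forall>\<^sub>F k in sequentially. char_mean k z = 0" unfolding eventually_sequentially by blast
  thus ?thesis using False by (simp add: tendsto_eventually)
qed

text \<open>The frequency j p^m has norm p^(-m) when p does not divide j and a smaller norm
  otherwise; this separates the levels.\<close>

definition fourier_coeff :: "('p::prime_card padic \<Rightarrow> complex) \<Rightarrow> int \<Rightarrow> 'p padic \<Rightarrow> nat \<Rightarrow> complex" where
  "fourier_coeff v m x j = padic_char (- (of_nat j * of_nat CARD('p) powi m * x))
     * fourier v (of_nat j * of_nat CARD('p) powi m)"

text \<open>
  Instead of inverting the Fourier transform by an integral over the dual ball (and Fubini), the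
  indicator of a ball is a bounded pointwise limit of finite means of characters.
\<close>

lemma ball_integral_fourier:
  fixes v :: "'p::prime_card padic \<Rightarrow> complex"
  assumes v: "integrable haar v"
  shows "(\<lambda>k. (\<Sum>j<CARD('p) ^ k. fourier_coeff v m x j) / of_nat (CARD('p) ^ k))
    \<longlonglongrightarrow> (\<integral>y. indicator (padic_ball m x) y *\<^sub>R v y \<partial>haar)"
proof -
  let ?\<xi> = "of_nat CARD('p) powi m :: 'p padic"
  have vm[measurable]: "v \<in> borel_measurable borel"
    using borel_measurable_integrable[OF v] by (simp add: measurable_cong_sets[OF sets_haar refl])
  have int: "integrable haar (\<lambda>y. padic_char (\<xi> * y) * v y)" for \<xi>
  proof (rule Bochner_Integration.integrable_bound[OF v])
    show "AE y in haar. norm (padic_char (\<xi> * y) * v y) \<le> norm (v y)" by (simp add: norm_mult)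
  qed measurable
  have eq: "(\<Sum>j<CARD('p) ^ k. fourier_coeff v m x j) / of_nat (CARD('p) ^ k)
      = (\<integral>y. char_mean k (?\<xi> * (y - x)) * v y \<partial>haar)" for k
  proof -
    have c: "padic_char (of_nat j * (?\<xi> * (y - x))) = padic_char (- (of_nat j * ?\<xi> * x)) * padic_char ((of_nat j * ?\<xi>) * y)" for j y
      by (simp add: padic_char_add[symmetric] algebra_simps)
    have "(\<integral>y. char_mean k (?\<xi> * (y - x)) * v y \<partial>haar)
      = (\<integral>y. (\<Sum>j<CARD('p) ^ k. padic_char (- (of_nat j * ?\<xi> * x)) * (padic_char ((of_nat j * ?\<xi>) * y) * v y)) / of_nat (CARD('p) ^ k) \<partial>haar)"
      unfolding char_mean_def c
      by (intro Bochner_Integration.integral_cong refl) (simp add: sum_distrib_right mult.assoc)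
    also have "\<dots> = (\<integral>y. (\<Sum>j<CARD('p) ^ k. padic_char (- (of_nat j * ?\<xi> * x)) * (padic_char ((of_nat j * ?\<xi>) * y) * v y)) \<partial>haar) / of_nat (CARD('p) ^ k)"
      by (rule integral_divide_zero)
    also have "(\<integral>y. (\<Sum>j<CARD('p) ^ k. padic_char (- (of_nat j * ?\<xi> * x)) * (padic_char ((of_nat j * ?\<xi>) * y) * v y)) \<partial>haar)
        = (\<Sum>j<CARD('p) ^ k. \<integral>y. padic_char (- (of_nat j * ?\<xi> * x)) * (padic_char ((of_nat j * ?\<xi>) * y) * v y) \<partial>haar)"
      by (intro Bochner_Integration.integral_sum Bochner_Integration.integrable_mult_right int)
    also have "\<dots> = (\<Sum>j<CARD('p) ^ k. fourier_coeff v m x j)"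
      unfolding fourier_coeff_def fourier_def by (simp only: integral_mult_right_zero)
    finally show ?thesis by simp
  qed
  have "(\<lambda>k. \<integral>y. char_mean k (?\<xi> * (y - x)) * v y \<partial>haar)
    \<longlonglongrightarrow> (\<integral>y. indicator (padic_ball m x) y *\<^sub>R v y \<partial>haar)"
  proof (rule integral_dominated_convergence[where w = "\<lambda>y. norm (v y)"])
    show "integrable haar (\<lambda>y. norm (v y))" using v by simp
    have "(\<lambda>k. char_mean k (?\<xi> * (y - x)) * v y) \<longlonglongrightarrow> indicator (padic_ball m x) y *\<^sub>R v y" for y
    proof -
      have "padic_norm (?\<xi> * (y - x)) \<le> 1 \<longleftrightarrow> y \<in> padic_ball m x"
        using padic_ball_scale[of "y - x" m] by (simp add: mem_padic_ball mult.commute)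
      hence "(if padic_norm (?\<xi> * (y - x)) \<le> 1 then 1 else 0) * v y = indicator (padic_ball m x) y *\<^sub>R v y"
        by (auto split: split_indicator)
      thus ?thesis using tendsto_mult[OF char_mean_tendsto[of "?\<xi> * (y - x)"] tendsto_const[of "v y"]] by simp
    qed
    thus "AE y in haar. (\<lambda>k. char_mean k (?\<xi> * (y - x)) * v y) \<longlonglongrightarrow> indicator (padic_ball m x) y *\<^sub>R v y"
      by simp
    show "AE y in haar. norm (char_mean k (?\<xi> * (y - x)) * v y) \<le> norm (v y)" for k
      by (simp add: norm_mult mult_left_le_one_le norm_char_mean_le)
    show "(\<lambda>y. char_mean k (?\<xi> * (y - x)) * v y) \<in> borel_measurable haar" for k
    proof -
      have "char_mean k (?\<xi> * (y - x)) = (\<Sum>j<CARD('p) ^ k. padic_char (- (of_nat j * ?\<xi> * x)) * padic_char ((of_nat j * ?\<xi>) * y)) / of_nat (CARD('p) ^ k)" for y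
        unfolding char_mean_def by (simp add: padic_char_add[symmetric] algebra_simps)
      thus ?thesis by (simp only:) measurable
    qed
  qed measurable
  thus ?thesis unfolding eq .
qed

text \<open>Passing from m to m + 1 keeps exactly the frequencies whose index is a multiple of
  p.\<close>

lemma fourier_coeff_Suc_level:
  "fourier_coeff v (m + 1) x j = fourier_coeff v m x (CARD('p) * j)" for v :: "'p::prime_card padic \<Rightarrow> complex"
proof -
  have "(of_nat CARD('p) :: 'p padic) powi (m + 1) = of_nat CARD('p) powi m * of_nat CARD('p)"
    by (rule power_int_add_1) simp
  hence "(of_nat j * of_nat CARD('p) powi (m + 1) :: 'p padic) = of_nat (CARD('p) * j) * of_nat CARD('p) powi m"
    by (simp add: algebra_simps)
  thus ?thesis unfolding fourier_coeff_def by (simp only:)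
qed

lemma padic_norm_of_nat_coprime:
  assumes "\<not> CARD('p::prime_card) dvd j"
  shows "padic_norm (of_nat j :: 'p padic) = 1"
proof -
  have "j \<noteq> 0" using assms by (cases j) auto
  then obtain n where n: "padic_norm (of_nat j :: 'p padic) = real CARD('p) powi n"
    using padic_norm_discrete[of "of_nat j :: 'p padic"] by auto
  have "n \<le> 0" using padic_norm_of_int_le_1[of "int j", where 'p='p] n
      card_powi_le_iff[of n 0, where 'p='p] by simp
  moreover have "\<not> int (CARD('p) ^ 1) dvd int j" using assms by (simp only: power_one_right int_dvd_int_iff not_False_eq_True)
  hence "\<not> padic_norm (of_int (int j) :: 'p padic) \<le> real CARD('p) powi (- int 1)"
    by (simp only: padic_norm_of_int_le_iff not_False_eq_True)
  hence "n > - 1" using n card_powi_le_iff[of n "- 1", where 'p='p] by simp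
  ultimately have "n = 0" by simp
  thus ?thesis using n by simp
qed

lemma sum_nonmultiples:
  fixes c :: "nat \<Rightarrow> complex"
  assumes "b > 0"
  shows "(\<Sum>j<b ^ Suc k. c j) - (\<Sum>j<b ^ k. c (b * j)) = (\<Sum>j\<in>{j. j < b ^ Suc k \<and> \<not> b dvd j}. c j)"
proof -
  have "(\<Sum>j<b ^ k. c (b * j)) = (\<Sum>j\<in>(*) b ` {..<b ^ k}. c j)"
    using assms by (subst sum.reindex) (auto simp: inj_on_def)
  also have "(*) b ` {..<b ^ k} = {j. j < b ^ Suc k \<and> b dvd j}"
    using assms by (auto elim!: dvdE)
  finally have "(\<Sum>j<b ^ k. c (b * j)) = (\<Sum>j\<in>{j. j < b ^ Suc k \<and> b dvd j}. c j)" .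
  moreover have "(\<Sum>j<b ^ Suc k. c j)
      = (\<Sum>j\<in>{j. j < b ^ Suc k \<and> b dvd j} \<union> {j. j < b ^ Suc k \<and> \<not> b dvd j}. c j)"
    by (rule sum.cong) auto
  moreover have "\<dots> = (\<Sum>j\<in>{j. j < b ^ Suc k \<and> b dvd j}. c j) + (\<Sum>j\<in>{j. j < b ^ Suc k \<and> \<not> b dvd j}. c j)"
    by (rule sum.union_disjoint) auto
  ultimately show ?thesis by simp
qed

text \<open>The average at m is taken with p^(k + 1) terms, that at m + 1 with p^k terms. Then both
  carry the factor p^(-(m + k + 1)), and the sums differ by the terms with j prime to p, that is by
  the frequencies of norm p^(-m).\<close>

lemma level_fourier:
  fixes v :: "'p::prime_card padic \<Rightarrow> complex"
  assumes v: "integrable haar v"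
  shows "(\<lambda>k. (\<Sum>j\<in>{j. j < CARD('p) ^ Suc k \<and> \<not> CARD('p) dvd j}. fourier_coeff v m x j)
      * complex_of_real (inverse (real CARD('p) powi (m + int (Suc k)))))
    \<longlonglongrightarrow> (\<integral>y. v (x + y) \<partial>ball_measure m) - (\<integral>y. v (x + y) \<partial>ball_measure (m + 1))"
proof -
  let ?p = "real CARD('p)"
  have vm[measurable]: "v \<in> borel_measurable borel"
    using borel_measurable_integrable[OF v] by (simp add: measurable_cong_sets[OF sets_haar refl])
  have p: "?p > 0" using card_gt_1[where 'p='p] by simp
  define a where "a k = (\<Sum>j<CARD('p) ^ k. fourier_coeff v m x j)" for k
  define b where "b k = (\<Sum>j<CARD('p) ^ k. fourier_coeff v (m + 1) x j)" for k
  have "(\<lambda>k. (a (Suc k) / of_nat (CARD('p) ^ Suc k)) /\<^sub>R (?p powi m) - (b k / of_nat (CARD('p) ^ k)) /\<^sub>R (?p powi (m + 1)))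
     \<longlonglongrightarrow> (\<integral>y. v (x + y) \<partial>ball_measure m) - (\<integral>y. v (x + y) \<partial>ball_measure (m + 1))"
    unfolding integral_ball_measure[OF vm] a_def b_def
    by (intro tendsto_diff tendsto_scaleR tendsto_const ball_integral_fourier[OF v]
        LIMSEQ_Suc[OF ball_integral_fourier[OF v]])
  moreover have "(a (Suc k) / of_nat (CARD('p) ^ Suc k)) /\<^sub>R (?p powi m) - (b k / of_nat (CARD('p) ^ k)) /\<^sub>R (?p powi (m + 1))
      = (\<Sum>j\<in>{j. j < CARD('p) ^ Suc k \<and> \<not> CARD('p) dvd j}. fourier_coeff v m x j)
      * complex_of_real (inverse (?p powi (m + int (Suc k))))" for k
  proof -
    let ?c = "complex_of_real (inverse (?p powi (m + int (Suc k))))"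
    have p0: "?p \<noteq> 0" using p by simp
    have gen: "(X / of_nat N) /\<^sub>R c = X * complex_of_real (inverse (real N) * inverse c)" for X :: complex and N c
      by (simp add: scaleR_conv_of_real divide_inverse)
    have "real (CARD('p) ^ Suc k) * ?p powi m = ?p powi (m + int (Suc k))"
      using power_int_add[of ?p m "int (Suc k)", OF disjI1, OF p0]
      by (simp only: power_int_of_nat of_nat_power mult.commute)
    hence 1: "(a (Suc k) / of_nat (CARD('p) ^ Suc k)) /\<^sub>R (?p powi m) = a (Suc k) * ?c"
      by (simp only: gen inverse_mult_distrib[symmetric])
    have "m + int (Suc k) = (m + 1) + int k" by simp
    hence "real (CARD('p) ^ k) * ?p powi (m + 1) = ?p powi (m + int (Suc k))"
      using power_int_add[of ?p "m + 1" "int k", OF disjI1, OF p0]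
      by (simp only: power_int_of_nat of_nat_power mult.commute)
    hence 2: "(b k / of_nat (CARD('p) ^ k)) /\<^sub>R (?p powi (m + 1)) = b k * ?c"
      by (simp only: gen inverse_mult_distrib[symmetric])
    have "a (Suc k) - b k = (\<Sum>j\<in>{j. j < CARD('p) ^ Suc k \<and> \<not> CARD('p) dvd j}. fourier_coeff v m x j)"
      unfolding a_def b_def fourier_coeff_Suc_level by (rule sum_nonmultiples) simp
    thus ?thesis unfolding 1 2 by (simp add: left_diff_distrib[symmetric])
  qed
  ultimately show ?thesis by (simp only:)
qed

text \<open>By \<open>level_fourier\<close> level m is a limit of sums over values of the transform
  on the sphere of radius p^(-m) alone.\<close>

lemma lev_fourier_scalar:
  fixes u v :: "'p::prime_card padic \<Rightarrow> complex"
  assumes u: "integrable haar u" and v: "integrable haar v"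
    and eq: "\<And>\<xi>. padic_norm \<xi> = real CARD('p) powi (- m) \<Longrightarrow> fourier v \<xi> = c * fourier u \<xi>"
  shows "lev m (abs_L0 v) = c *\<^sub>C lev m (abs_L0 u)"
proof -
  have [measurable]: "u \<in> borel_measurable borel" "v \<in> borel_measurable borel"
    using borel_measurable_integrable[OF u] borel_measurable_integrable[OF v]
    by (simp_all add: measurable_cong_sets[OF sets_haar refl])
  have "(\<integral>y. v (x + y) \<partial>ball_measure m) - (\<integral>y. v (x + y) \<partial>ball_measure (m + 1))
      = c * ((\<integral>y. u (x + y) \<partial>ball_measure m) - (\<integral>y. u (x + y) \<partial>ball_measure (m + 1)))" for x
  proof (rule LIMSEQ_unique[OF level_fourier[OF v]])
    have "fourier_coeff v m x j = c * fourier_coeff u m x j" if "\<not> CARD('p) dvd j" for j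
    proof -
      have "padic_norm (of_nat j * of_nat CARD('p) powi m :: 'p padic) = real CARD('p) powi (- m)"
        using padic_norm_of_nat_coprime[OF that] by (simp add: padic_norm_mult padic_abs_power_int)
      from eq[OF this] show ?thesis by (simp add: fourier_coeff_def)
    qed
    hence "(\<Sum>j\<in>{j. j < CARD('p) ^ Suc k \<and> \<not> CARD('p) dvd j}. fourier_coeff v m x j)
        = c * (\<Sum>j\<in>{j. j < CARD('p) ^ Suc k \<and> \<not> CARD('p) dvd j}. fourier_coeff u m x j)" for k
      unfolding sum_distrib_left by (intro sum.cong) auto
    thus "(\<lambda>k. (\<Sum>j\<in>{j. j < CARD('p) ^ Suc k \<and> \<not> CARD('p) dvd j}. fourier_coeff v m x j)
        * complex_of_real (inverse (real CARD('p) powi (m + int (Suc k)))))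
      \<longlonglongrightarrow> c * ((\<integral>y. u (x + y) \<partial>ball_measure m) - (\<integral>y. u (x + y) \<partial>ball_measure (m + 1)))"
      using tendsto_mult[OF tendsto_const[of c] level_fourier[OF u, of m x]] by (simp only: mult.assoc)
  qed
  thus ?thesis unfolding lev_def by (simp add: avg_abs minus_abs_L0 scale_abs_L0)
qed

section \<open>Test functions\<close>

lemma test_function_measurable:
  assumes "u \<in> test_functions"
  shows "u \<in> borel_measurable borel"
proof (rule locally_constant_measurable)
  fix x
  have "\<forall>\<^sub>F y in nhds x. u y = u x" using assms by (simp add: test_functions_def)
  then obtain S where S: "open S" "x \<in> S" "\<forall>y\<in>S. u y = u x" by (auto simp: eventually_nhds)
  obtain n where "padic_ball n x \<subseteq> S" using padic_open_contains_ball[OF S(1,2)] .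
  thus "\<exists>n. \<forall>y\<in>padic_ball n x. u y = u x" using S(3) by blast
qed

lemma test_function_support:
  fixes u :: "'p::prime_card padic \<Rightarrow> complex"
  assumes "u \<in> test_functions"
  obtains k B where "\<And>x. norm (u x) \<le> B" "\<And>x. x \<notin> padic_ball k 0 \<Longrightarrow> u x = 0"
proof -
  let ?K = "closure {x. u x \<noteq> 0}"
  have K: "compact ?K" using assms by (simp add: test_functions_def)
  obtain e where e: "\<forall>x\<in>?K. dist 0 x \<le> e" using compact_imp_bounded[OF K] bounded_any_center by blast
  obtain k where k: "e < real CARD('p) powi k" using powi_at_top by blast
  have "continuous_on ?K u"
  proof (rule continuous_at_imp_continuous_on, intro ballI)
    fix x show "isCont u x"
      using assms unfolding isCont_def test_functions_def
      by (intro tendsto_eventually) (auto simp: eventually_at_filter elim!: eventually_mono)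
  qed
  from compact_imp_bounded[OF compact_continuous_image[OF this K]]
  obtain B where B: "\<forall>x\<in>?K. norm (u x) \<le> B" by (auto simp: bounded_iff)
  have "norm (u x) \<le> max B 0" for x
    using B closure_subset[of "{x. u x \<noteq> 0}"] by (cases "u x = 0") (auto simp: le_max_iff_disj)
  moreover have "u x = 0" if "x \<notin> padic_ball k 0" for x
  proof (rule ccontr)
    assume "u x \<noteq> 0"
    hence "x \<in> ?K" using closure_subset[of "{x. u x \<noteq> 0}"] by auto
    hence "dist 0 x \<le> e" using e by blast
    thus False using that k by (simp add: padic_ball_cball)
  qed
  ultimately show ?thesis by (rule that)
qed

text \<open>A Lebesgue number for the cover of the compact support by open sets of constancy. Where
  only y lies in the support, symmetry of balls lets x and y change roles.\<close>

lemma test_function_uniform: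
  fixes u :: "'p::prime_card padic \<Rightarrow> complex"
  assumes "u \<in> test_functions"
  obtains N where "\<And>x y. y \<in> padic_ball N x \<Longrightarrow> u y = u x"
proof -
  let ?K = "closure {x. u x \<noteq> 0}"
  let ?G = "{G. open G \<and> (\<exists>c. \<forall>x\<in>G. u x = c)}"
  have K: "compact ?K" using assms by (simp add: test_functions_def)
  have cov: "?K \<subseteq> \<Union>?G"
  proof
    fix x
    have "\<forall>\<^sub>F y in nhds x. u y = u x" using assms by (simp add: test_functions_def)
    then obtain S where "open S" "x \<in> S" "\<forall>y\<in>S. u y = u x" by (auto simp: eventually_nhds)
    thus "x \<in> \<Union>?G" by blast
  qed
  obtain e where e: "e > 0" "\<And>x. x \<in> ?K \<Longrightarrow> \<exists>G\<in>?G. ball x e \<subseteq> G"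
    using Heine_Borel_lemma[OF K cov] by blast
  obtain N where N: "real CARD('p) powi N < e" using powi_at_bot[OF e(1)] by blast
  have ball: "padic_ball N x \<subseteq> ball x e" for x :: "'p padic"
    using N by (auto simp: padic_ball_cball)
  have inK: "u y = u x" if "x \<in> ?K" "y \<in> padic_ball N x" for x y
  proof -
    have xK: "x \<in> ?K" by (rule that(1))
    obtain G c where G: "ball x e \<subseteq> G" "\<forall>z\<in>G. u z = c" using e(2)[OF xK] by blast
    have "x \<in> G" "y \<in> G" using G(1) ball[of x] that(2) e(1) by auto
    thus ?thesis using G(2) by simp
  qed
  have "u y = u x" if "y \<in> padic_ball N x" for x y
  proof (cases "u x = 0 \<and> u y = 0")
    case False
    hence "x \<in> ?K \<or> y \<in> ?K" using closure_subset[of "{x. u x \<noteq> 0}"] by blast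
    moreover have "x \<in> padic_ball N y" using that by (subst padic_ball_sym)
    ultimately show ?thesis using inK[of x y] inK[of y x] that by metis
  qed simp
  thus ?thesis by (rule that)
qed

lemma test_function_Lq:
  assumes "u \<in> test_functions" "1 \<le> q"
  shows "abs_L0 u \<in> Lq q"
proof -
  obtain k B where "\<And>x. norm (u x) \<le> B" "\<And>x. x \<notin> padic_ball k 0 \<Longrightarrow> u x = 0"
    using test_function_support[OF assms(1)] by metis
  thus ?thesis by (intro bounded_support_in_Lq test_function_measurable assms)
qed

lemma L1_abs_iff: "f \<in> borel_measurable borel \<Longrightarrow> abs_L0 f \<in> Lq 1 \<longleftrightarrow> integrable haar f"
  by (simp add: abs_in_Lq_iff lq_pow_def integrable_iff_bounded)

section \<open>The operator of fractional derivative\<close>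

text \<open>The value b^(-n \<alpha>) of the symbol \<open>padic_norm \<xi> powr \<alpha>\<close> on
  the sphere belonging to level n, when b is the prime.\<close>

definition eigval :: "nat \<Rightarrow> real \<Rightarrow> int \<Rightarrow> real" where
  "eigval b \<alpha> n = (real b powi (- n)) powr \<alpha>"

text \<open>The maximal diagonal operator on the levels, of the same form for every q: the candidate
  for all the operators of the theorem.\<close>

definition frac_op :: "real \<Rightarrow> real \<Rightarrow> 'p::prime_card graph" where
  "frac_op \<alpha> q = {(F, G). F \<in> Lq q \<and> G \<in> Lq q \<and>
     (\<forall>n. lev n G = complex_of_real (eigval CARD('p) \<alpha> n) *\<^sub>C lev n F)}"

text \<open>By \<open>avg_bounded_powr\<close> the function is bounded by some B, and then |g|^q
  \<le> B^(q - 1) |g|.\<close>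

lemma L1_locally_constant_Lq:
  assumes F: "F \<in> Lq 1" and avg: "avg N F = F" and q: "1 \<le> q"
  shows "F \<in> Lq q"
proof -
  obtain g where g[measurable]: "g \<in> borel_measurable borel" "avg N F = abs_L0 g"
    "\<And>x. norm (g x) powr 1 \<le> Lq_norm 1 F powr 1 / real CARD('a) powi N"
    using avg_bounded_powr[OF F order_refl, of N] by blast
  define B where "B = Lq_norm 1 F / real CARD('a) powi N"
  have B: "norm (g x) \<le> B" for x using g(3)[of x] by (simp add: B_def)
  have le: "norm (g x) powr q \<le> B powr (q - 1) * norm (g x) powr 1" for x
  proof (cases "g x = 0")
    case False
    have "norm (g x) powr (q - 1) \<le> B powr (q - 1)" using B q by (intro powr_mono2) auto
    hence "norm (g x) powr (q - 1) * norm (g x) powr 1 \<le> B powr (q - 1) * norm (g x) powr 1"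
      by (intro mult_right_mono) auto
    thus ?thesis by (simp only: powr_add[symmetric]) simp
  qed simp
  have "lq_pow q g \<le> (\<integral>\<^sup>+x. ennreal (B powr (q - 1)) * ennreal (norm (g x) powr 1) \<partial>haar)"
    unfolding lq_pow_def using le
    by (intro nn_integral_mono) (simp add: ennreal_mult[symmetric] ennreal_leI del: powr_one)
  also have "\<dots> = ennreal (B powr (q - 1)) * lq_pow 1 g"
    unfolding lq_pow_def by (rule nn_integral_cmult) measurable
  also have "\<dots> < \<infinity>"
    using F g(2) unfolding avg by (simp add: abs_in_Lq_iff ennreal_mult_less_top)
  finally show ?thesis using g(2) unfolding avg by (simp add: abs_in_Lq_iff)
qed

text \<open>The image v is only known to be integrable. The test function u is constant on balls of
  radius p^N, so u and therefore v have no levels below N. Thus v is its own average at N and lies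
  in every \<open>Lq q\<close>.\<close>

lemma frac_deriv_subset_frac_op:
  assumes q: "1 \<le> q"
  shows "frac_deriv \<alpha> \<subseteq> (frac_op \<alpha> q :: 'p::prime_card graph)"
proof
  fix z :: "'p L0 \<times> 'p L0" assume "z \<in> frac_deriv \<alpha>"
  then obtain u v where z: "z = (abs_L0 u, abs_L0 v)" and u: "u \<in> test_functions"
    and v: "integrable haar v"
    and four: "\<And>\<xi>. fourier v \<xi> = complex_of_real (padic_norm \<xi> powr \<alpha>) * fourier u \<xi>"
    by (auto simp: frac_deriv_def)
  have um[measurable]: "u \<in> borel_measurable borel" by (rule test_function_measurable[OF u])
  have vm[measurable]: "v \<in> borel_measurable borel"
    using borel_measurable_integrable[OF v] by (simp add: measurable_cong_sets[OF sets_haar refl])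
  have u1: "integrable haar u" using test_function_Lq[OF u, of 1] by (simp add: L1_abs_iff)
  have v1: "abs_L0 v \<in> Lq 1" using v by (simp add: L1_abs_iff)
  have lev: "lev n (abs_L0 v) = complex_of_real (eigval CARD('p) \<alpha> n) *\<^sub>C lev n (abs_L0 u)" for n
    by (rule lev_fourier_scalar[OF u1 v]) (simp add: four eigval_def)
  obtain N where N: "\<And>x y. y \<in> padic_ball N x \<Longrightarrow> u y = u x" using test_function_uniform[OF u] by blast
  have aN: "avg N (abs_L0 u) = abs_L0 u" using N by (intro avg_locally_constant) auto
  have "lev n (abs_L0 u) = 0" if "n < N" for n
    using lev_avg[OF test_function_Lq[OF u order_refl] order_refl, of n N] that unfolding aN by simp
  hence "lev n (abs_L0 v) = 0" if "n < N" for n using that lev by simp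
  hence step: "avg n (abs_L0 v) = avg (n + 1) (abs_L0 v)" if "n < N" for n
    using that by (simp add: lev_def)
  have const: "avg n (abs_L0 v) = avg N (abs_L0 v)" if "n \<le> N" for n
    using that
  proof (induction n rule: int_le_induct)
    case (step i)
    thus ?case using \<open>\<And>n. n < N \<Longrightarrow> avg n (abs_L0 v) = avg (n + 1) (abs_L0 v)\<close>[of "i - 1"] by simp
  qed simp
  have "((\<lambda>n :: int. Lq_norm 1 (avg N (abs_L0 v) - abs_L0 v)) \<longlongrightarrow> 0) at_bot"
  proof (rule Lim_transform_eventually[OF avg_tendsto[OF v1 order_refl]])
    show "\<forall>\<^sub>F n in at_bot. Lq_norm 1 (avg n (abs_L0 v) - abs_L0 v) = Lq_norm 1 (avg N (abs_L0 v) - abs_L0 v)"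
      unfolding eventually_at_bot_linorder by (intro exI[of _ N] allI impI) (subst const, auto)
  qed
  hence "Lq_norm 1 (avg N (abs_L0 v) - abs_L0 v) = 0" by (simp add: tendsto_const_iff)
  hence "avg N (abs_L0 v) - abs_L0 v = 0" using v1 by (intro Lq_norm_eq_0D Lq_diff avg_Lq) auto
  hence "avg N (abs_L0 v) = abs_L0 v" by simp
  from L1_locally_constant_Lq[OF v1 this q] have "abs_L0 v \<in> Lq q" .
  thus "z \<in> frac_op \<alpha> q" using lev test_function_Lq[OF u q] unfolding z frac_op_def by simp
qed

text \<open>Orthogonality: if the character is not trivial on the ball, a shift within the ball
  multiplies the mean by a number other than 1.\<close>

lemma integral_char_ball:
  fixes \<xi> x :: "'p::prime_card padic"
  shows "(\<integral>y. padic_char (\<xi> * (x + y)) \<partial>ball_measure n)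
    = (if padic_norm \<xi> \<le> real CARD('p) powi (- n) then padic_char (\<xi> * x) else 0)"
proof (cases "padic_norm \<xi> \<le> real CARD('p) powi (- n)")
  case True
  have "(\<integral>y. padic_char (\<xi> * (x + y)) \<partial>ball_measure n) = padic_char (\<xi> * x)"
  proof (rule integral_ball_measure_const)
    fix y assume y: "y \<in> padic_ball n x"
    have "padic_norm (\<xi> * y - \<xi> * x) = padic_norm \<xi> * padic_norm (y - x)"
      by (simp add: padic_norm_mult[symmetric] right_diff_distrib)
    also have "\<dots> \<le> real CARD('p) powi (- n) * real CARD('p) powi n"
      using True y by (intro mult_mono) (auto simp: mem_padic_ball less_imp_le)
    also have "\<dots> = 1" by (simp add: power_int_minus)
    finally show "padic_char (\<xi> * y) = padic_char (\<xi> * x)" by (rule padic_char_cong)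
  qed measurable
  thus ?thesis using True by simp
next
  case False
  let ?p = "of_nat CARD('p) :: 'p padic"
  let ?J = "\<integral>y. padic_char (\<xi> * (x + y)) \<partial>ball_measure n"
  have "\<xi> \<noteq> 0" using False by (auto simp: less_imp_le)
  then obtain k where k: "padic_norm \<xi> = real CARD('p) powi k" by (rule padic_norm_discrete)
  have kn: "k > - n" using False k by simp
  \<comment> \<open>Chosen so that \<open>\<xi> * b\<close> has norm p, the smallest norm at which
    the character differs from 1, while b stays within radius p^n.\<close>
  define b where "b = ?p powi (- 1) / \<xi>"
  have "padic_norm b = real CARD('p) powi 1 / real CARD('p) powi k"
    unfolding b_def padic_norm_divide padic_abs_power_int k by simp
  also have "\<dots> = real CARD('p) powi (1 - k)" by (rule power_int_diff[symmetric]) simp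
  also have "\<dots> \<le> real CARD('p) powi n" using kn by simp
  finally have "x + b \<in> padic_ball n x" by (simp add: mem_padic_ball)
  have "?J = (\<integral>y. padic_char (\<xi> * ((x + b) + y)) \<partial>ball_measure n)"
    by (rule integral_ball_measure_cong_ball[OF padic_char_mult_measurable \<open>x + b \<in> padic_ball n x\<close>, symmetric])
  also have "\<dots> = (\<integral>y. padic_char (\<xi> * b) * padic_char (\<xi> * (x + y)) \<partial>ball_measure n)"
    by (simp add: padic_char_add[symmetric] algebra_simps)
  also have "\<dots> = padic_char (\<xi> * b) * ?J" by (rule integral_mult_right_zero)
  finally have J: "(1 - padic_char (\<xi> * b)) * ?J = 0" by (simp add: left_diff_distrib)
  have "\<xi> * b = ?p powi (- 1)" using \<open>\<xi> \<noteq> 0\<close> by (simp add: b_def)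
  hence "padic_norm (\<xi> * b) = real CARD('p)" by (simp only: padic_abs_power_int) simp
  hence "padic_char (\<xi> * b) \<noteq> 1" using card_gt_1[where 'p='p] by (simp add: padic_char_eq_1_iff)
  thus ?thesis using J False by simp
qed

text \<open>The kernel of \<open>lev n\<close> at the point x: integration against it evaluates
  level n at x. It is a test function and an eigenfunction at once, since its transform lives on one
  sphere.\<close>

definition eigfun :: "int \<Rightarrow> 'p::prime_card padic \<Rightarrow> 'p padic \<Rightarrow> complex" where
  "eigfun n x y = ind (padic_ball n x) y /\<^sub>R real CARD('p) powi n
     - ind (padic_ball (n + 1) x) y /\<^sub>R real CARD('p) powi (n + 1)"

lemma eigfun_measurable [measurable]: "eigfun n x \<in> borel_measurable borel"
  unfolding eigfun_def by measurable

lemma eigfun_test_function: "eigfun n x \<in> test_functions"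
  unfolding test_functions_def
proof (intro CollectI conjI allI)
  fix y
  have loc: "eigfun n x z = eigfun n x y" if "z \<in> padic_ball n y" for z
  proof -
    have "z \<in> padic_ball (n + 1) y" using that padic_ball_mono[of n "n + 1" y] by auto
    hence "z \<in> padic_ball n x \<longleftrightarrow> y \<in> padic_ball n x" "z \<in> padic_ball (n + 1) x \<longleftrightarrow> y \<in> padic_ball (n + 1) x"
      using that padic_ball_sym padic_ball_trans by blast+
    thus ?thesis by (simp add: eigfun_def ind_def indicator_def)
  qed
  show "\<forall>\<^sub>F z in nhds y. eigfun n x z = eigfun n x y"
    unfolding eventually_nhds by (intro exI[of _ "padic_ball n y"] conjI ballI open_padic_ball padic_ball_self loc)
next
  have "{y. eigfun n x y \<noteq> 0} \<subseteq> padic_ball (n + 1) x"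
    using padic_ball_mono[of n "n + 1" x] by (auto simp: eigfun_def ind_def indicator_def split: if_splits)
  hence "closure {y. eigfun n x y \<noteq> 0} \<subseteq> padic_ball (n + 1) x"
    by (rule closure_minimal) (rule closed_padic_ball)
  hence "padic_ball (n + 1) x \<inter> closure {y. eigfun n x y \<noteq> 0} = closure {y. eigfun n x y \<noteq> 0}"
    by (rule Int_absorb1)
  with compact_Int_closed[OF compact_padic_ball[of "n + 1" x] closed_closure[of "{y. eigfun n x y \<noteq> 0}"]]
  show "compact (closure {y. eigfun n x y \<noteq> 0})" by (simp only:)
qed

lemma integrable_ind_ball:
  fixes f :: "'p::prime_card padic \<Rightarrow> complex"
  assumes [measurable]: "f \<in> borel_measurable borel" and B: "\<And>x. norm (f x) \<le> B"
  shows "integrable haar (\<lambda>y. indicator (padic_ball n x) y *\<^sub>R f y)"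
proof (rule integrableI_bounded_set_indicator[where B = B])
  show "AE y in haar. y \<in> padic_ball n x \<longrightarrow> norm (f y) \<le> B" using B by simp
qed auto

lemma fourier_eigfun:
  fixes x \<xi> :: "'p::prime_card padic"
  shows "fourier (eigfun n x) \<xi> = (if padic_norm \<xi> = real CARD('p) powi (- n) then padic_char (\<xi> * x) else 0)"
proof -
  let ?c = "\<lambda>y. padic_char (\<xi> * y)"
  have int: "integrable haar (\<lambda>y. indicator (padic_ball m x) y *\<^sub>R ?c y)" for m
    by (rule integrable_ind_ball[where B = 1]) auto
  have "fourier (eigfun n x) \<xi> = (\<integral>y. (indicator (padic_ball n x) y *\<^sub>R ?c y) /\<^sub>R (real CARD('p) powi n)
      - (indicator (padic_ball (n + 1) x) y *\<^sub>R ?c y) /\<^sub>R (real CARD('p) powi (n + 1)) \<partial>haar)"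
    unfolding fourier_def
    by (intro Bochner_Integration.integral_cong refl)
       (simp add: eigfun_def ind_def indicator_def algebra_simps scaleR_conv_of_real)
  also have "\<dots> = (\<integral>y. ?c (x + y) \<partial>ball_measure n) - (\<integral>y. ?c (x + y) \<partial>ball_measure (n + 1))"
    by (simp only: Bochner_Integration.integral_diff[OF integrable_scaleR_right[OF int] integrable_scaleR_right[OF int]]
        integral_scaleR_right integral_ball_measure[OF padic_char_mult_measurable])
  also have "\<dots> = (if padic_norm \<xi> = real CARD('p) powi (- n) then padic_char (\<xi> * x) else 0)"
  proof (cases "\<xi> = 0")
    case True
    have "real CARD('p) powi (- n) \<noteq> 0" using card_powi_pos[of "- n", where 'p='p] by linarith
    thus ?thesis using True unfolding integral_char_ball by (simp add: less_imp_le)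
  next
    case False
    then obtain k where k: "padic_norm \<xi> = real CARD('p) powi k" by (rule padic_norm_discrete)
    show ?thesis unfolding integral_char_ball k by (simp only: card_powi_le_iff card_powi_inject) auto
  qed
  finally show ?thesis .
qed

text \<open>On the one sphere that carries the transform of \<open>eigfun n x\<close> the symbol is
  the constant \<open>eigval\<close>.\<close>

lemma eigfun_in_frac_deriv:
  "(abs_L0 (eigfun n x), complex_of_real (eigval CARD('p) \<alpha> n) *\<^sub>C abs_L0 (eigfun n x)) \<in> frac_deriv \<alpha>"
  for x :: "'p::prime_card padic"
proof -
  let ?l = "complex_of_real (eigval CARD('p) \<alpha> n)"
  have e1: "integrable haar (eigfun n x)"
    using test_function_Lq[OF eigfun_test_function, of 1 n x] by (simp add: L1_abs_iff)
  have "fourier (\<lambda>y. ?l * eigfun n x y) \<xi> = ?l * fourier (eigfun n x) \<xi>" for \<xi>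
    unfolding fourier_def
    by (simp only: mult.left_commute[of "padic_char _"] integral_mult_right_zero)
  also have "?l * fourier (eigfun n x) \<xi> = complex_of_real (padic_norm \<xi> powr \<alpha>) * fourier (eigfun n x) \<xi>" for \<xi>
    by (simp add: fourier_eigfun eigval_def)
  finally have "\<forall>\<xi>. fourier (\<lambda>y. ?l * eigfun n x y) \<xi> = complex_of_real (padic_norm \<xi> powr \<alpha>) * fourier (eigfun n x) \<xi>" ..
  thus ?thesis
    unfolding frac_deriv_def scale_abs_L0[OF eigfun_measurable] using eigfun_test_function e1 by fastforce
qed

section \<open>The eigenvalues\<close>

lemma eigval_exp:
  assumes "b > 0"
  shows "eigval b \<alpha> n = exp (- (\<alpha> * ln (real b)) * real_of_int n)"
proof -
  have "real b powi (- n) = exp (real_of_int (- n) * ln (real b))"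
    using assms powr_real_of_int'[of "real b" "- n"] by (simp add: powr_def)
  thus ?thesis by (simp add: eigval_def powr_def algebra_simps)
qed

lemma eigval_pos: "b > 0 \<Longrightarrow> eigval b \<alpha> n > 0"
  by (simp add: eigval_exp)

lemma filterlim_real_of_int_at_bot: "filterlim real_of_int at_bot at_bot"
  unfolding filterlim_at_bot eventually_at_bot_linorder
proof
  fix Z :: real
  have "real_of_int n \<le> Z" if "n \<le> \<lfloor>Z\<rfloor>" for n using that by linarith
  thus "\<exists>N. \<forall>n\<le>N. real_of_int n \<le> Z" by blast
qed

text \<open>Equals the integral of exp (- s x) over s in [0, 1] for x > 0. With x = t l it is the
  multiplier, at eigenvalue l, of the heat semigroup averaged over times up to t.\<close>

definition mean_exp :: "real \<Rightarrow> real" where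
  "mean_exp x = (1 - exp (- x)) / x"

text \<open>Convexity of exp: the point - x lies between - y and 0, so chord slopes to 0 decrease
  with the distance.\<close>

lemma mean_exp_antimono:
  assumes "0 < x" "x \<le> y"
  shows "mean_exp y \<le> mean_exp x"
proof -
  have "exp ((1 - x / y) *\<^sub>R 0 + (x / y) *\<^sub>R (- y)) \<le> (1 - x / y) * exp 0 + (x / y) * exp (- y)"
    using assms by (intro convex_onD[OF exp_convex]) auto
  moreover have "(1 - x / y) *\<^sub>R 0 + (x / y) *\<^sub>R (- y) = - x" using assms by simp
  ultimately have "(x / y) * (1 - exp (- y)) \<le> 1 - exp (- x)" by (simp add: right_diff_distrib)
  hence "(x / y) * (1 - exp (- y)) / x \<le> (1 - exp (- x)) / x" using assms by (intro divide_right_mono) auto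
  thus ?thesis using assms by (simp add: mean_exp_def)
qed

lemma mean_exp_tendsto_0: "(mean_exp \<longlongrightarrow> 1) (at_right 0)"
proof -
  have "filterlim (\<lambda>x :: real. - x) (at 0) (at_right 0)"
    unfolding filterlim_at using tendsto_minus[OF tendsto_ident_at[of "0::real" "{0<..}"]]
    by (auto simp: eventually_at_filter)
  from filterlim_compose[OF lim_exp_minus_1 this]
  have "((\<lambda>x :: real. (exp (- x) - 1) / (- x)) \<longlongrightarrow> 1) (at_right 0)" .
  moreover have "(exp (- x) - 1) / (- x) = mean_exp x" for x :: real
    by (simp add: mean_exp_def minus_divide_left[symmetric] diff_divide_distrib)
  ultimately show ?thesis by simp
qed

lemma mean_exp_less_1:
  assumes "x > 0"
  shows "mean_exp x < 1"
proof -
  have "1 - x < exp (- x)"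
  proof (cases "x \<ge> 2")
    case True
    thus ?thesis using exp_gt_zero[of "- x"] by linarith
  next
    case False
    \<comment> \<open>Squaring 1 - x / 2 \<le> exp (- x / 2) gains the term x^2 / 4, which makes the
      inequality strict.\<close>
    have "(1 - x / 2)\<^sup>2 \<le> (exp (- (x / 2)))\<^sup>2"
      using False exp_ge_add_one_self[of "- (x / 2)"] by (intro power_mono) auto
    also have "(exp (- (x / 2)))\<^sup>2 = exp (- x)" by (simp add: power2_eq_square exp_add[symmetric])
    finally have "1 - x + x\<^sup>2 / 4 \<le> exp (- x)" by (simp add: power2_eq_square algebra_simps)
    moreover have "x\<^sup>2 > 0" using assms by simp
    ultimately show ?thesis by linarith
  qed
  thus ?thesis using assms by (simp add: mean_exp_def)
qed

lemma mean_exp_at_top: "(mean_exp \<longlongrightarrow> 0) at_top"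
proof (rule tendsto_sandwich[OF _ _ tendsto_const])
  show "\<forall>\<^sub>F x in at_top. 0 \<le> mean_exp x"
    using eventually_gt_at_top[of 0] by eventually_elim (simp add: mean_exp_def)
  show "\<forall>\<^sub>F x in at_top. mean_exp x \<le> 1 / x"
    using eventually_gt_at_top[of 0] by eventually_elim (simp add: mean_exp_def divide_right_mono)
  show "((\<lambda>x :: real. 1 / x) \<longlongrightarrow> 0) at_top"
    by (rule tendsto_divide_0[OF tendsto_const], rule filterlim_at_top_imp_at_infinity, rule filterlim_ident)
qed

section \<open>Eigenvalues and heat multipliers as functions of the level\<close>

context
  fixes b :: nat and \<alpha> :: real
  assumes b: "b > 1" and \<alpha>: "\<alpha> > 0"
begin

lemma eigval_rate: "\<alpha> * ln (real b) > 0"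
  using b \<alpha> by simp

lemma eigval_antimono: "m \<le> n \<Longrightarrow> eigval b \<alpha> n \<le> eigval b \<alpha> m"
  using eigval_rate b mult_left_mono[of "real_of_int m" "real_of_int n" "\<alpha> * ln (real b)"]
  by (simp add: eigval_exp)

lemma eigval_eq_exp: "eigval b \<alpha> = (\<lambda>n. exp (- (\<alpha> * ln (real b)) * real_of_int n))"
  using b by (intro ext eigval_exp) simp

lemma eigval_at_top: "(eigval b \<alpha> \<longlongrightarrow> 0) at_top"
proof -
  have "filterlim (\<lambda>n. - (\<alpha> * ln (real b)) * real_of_int n) at_bot at_top"
    using eigval_rate
    by (intro filterlim_tendsto_neg_mult_at_bot[OF tendsto_const] filterlim_real_of_int_at_top) auto
  from filterlim_compose[OF exp_at_bot this] show ?thesis unfolding eigval_eq_exp .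
qed

lemma eigval_at_bot: "filterlim (eigval b \<alpha>) at_top at_bot"
proof -
  have "filterlim (\<lambda>n. (\<alpha> * ln (real b)) * - real_of_int n) at_top at_bot"
    using eigval_rate filterlim_real_of_int_at_bot
    by (intro filterlim_tendsto_pos_mult_at_top[OF tendsto_const]) (auto simp: filterlim_uminus_at_top)
  from filterlim_compose[OF exp_at_top this] show ?thesis unfolding eigval_eq_exp by simp
qed

lemma eigval_inverse_at_bot: "((\<lambda>n. 1 / (1 + eigval b \<alpha> n)) \<longlongrightarrow> 0) at_bot"
  by (rule tendsto_divide_0[OF tendsto_const], rule filterlim_at_top_imp_at_infinity,
      rule filterlim_tendsto_add_at_top[OF tendsto_const eigval_at_bot])

lemma eigval_inverse_at_top: "((\<lambda>n. 1 / (1 + eigval b \<alpha> n)) \<longlongrightarrow> 1) at_top"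
  using tendsto_divide[OF tendsto_const[of 1] tendsto_add[OF tendsto_const[of 1] eigval_at_top]] by simp

lemma cdf_fun_heat:
  assumes t: "t > 0"
  shows "cdf_fun (\<lambda>n. exp (- t * eigval b \<alpha> n))"
  unfolding cdf_fun_def
proof (intro conjI)
  show "mono (\<lambda>n. exp (- t * eigval b \<alpha> n))"
    using t eigval_antimono by (intro monoI) auto
  have "filterlim (\<lambda>n. - t * eigval b \<alpha> n) at_bot at_bot"
    using t by (intro filterlim_tendsto_neg_mult_at_bot[OF tendsto_const] eigval_at_bot) auto
  from filterlim_compose[OF exp_at_bot this] show "((\<lambda>n. exp (- t * eigval b \<alpha> n)) \<longlongrightarrow> 0) at_bot" .
  have "((\<lambda>n. exp (- t * eigval b \<alpha> n)) \<longlongrightarrow> exp (- t * 0)) at_top"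
    by (intro tendsto_intros eigval_at_top)
  thus "((\<lambda>n. exp (- t * eigval b \<alpha> n)) \<longlongrightarrow> 1) at_top" by simp
qed

lemma eigval_right:
  assumes "t > 0"
  shows "filterlim (\<lambda>n. t * eigval b \<alpha> n) (at_right 0) at_top"
proof -
  have "t * eigval b \<alpha> n > 0" for n using assms b eigval_pos[of b \<alpha> n] by simp
  hence "t * eigval b \<alpha> n \<in> {0<..} \<and> t * eigval b \<alpha> n \<noteq> 0" for n
    by (metis greaterThan_iff less_irrefl)
  hence "\<forall>\<^sub>F n in at_top. t * eigval b \<alpha> n \<in> {0<..} \<and> t * eigval b \<alpha> n \<noteq> 0"
    by (rule always_eventually[OF allI])
  with tendsto_mult_right_zero[OF eigval_at_top, of t] show ?thesis
    unfolding filterlim_at by (rule conjI[rotated])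
qed

lemma cdf_fun_mean_heat:
  assumes t: "t > 0"
  shows "cdf_fun (\<lambda>n. mean_exp (t * eigval b \<alpha> n))"
  unfolding cdf_fun_def
proof (intro conjI)
  show "mono (\<lambda>n. mean_exp (t * eigval b \<alpha> n))"
    using t eigval_antimono eigval_pos[of b] b by (intro monoI mean_exp_antimono) auto
  have "filterlim (\<lambda>n. t * eigval b \<alpha> n) at_top at_bot"
    using t by (intro filterlim_tendsto_pos_mult_at_top[OF tendsto_const] eigval_at_bot) auto
  from filterlim_compose[OF mean_exp_at_top this]
  show "((\<lambda>n. mean_exp (t * eigval b \<alpha> n)) \<longlongrightarrow> 0) at_bot" .
  from filterlim_compose[OF mean_exp_tendsto_0 eigval_right[OF t]]
  show "((\<lambda>n. mean_exp (t * eigval b \<alpha> n)) \<longlongrightarrow> 1) at_top" .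
qed

end

section \<open>The semigroup\<close>

definition heat_pmf :: "nat \<Rightarrow> real \<Rightarrow> real \<Rightarrow> int pmf" where
  "heat_pmf b \<alpha> t = (SOME w. \<forall>m. measure (measure_pmf w) {..m} = exp (- t * eigval b \<alpha> m))"

text \<open>At t = 0 the multiplier is constantly 1, which is not a \<open>cdf_fun\<close> since it
  does not vanish at minus infinity; hence the separate case, with negative t included.\<close>

definition heat :: "real \<Rightarrow> real \<Rightarrow> 'p::prime_card L0 \<Rightarrow> 'p L0" where
  "heat \<alpha> t F = (if t \<le> 0 then F else conv (mixture (heat_pmf CARD('p) \<alpha> t)) F)"

lemma prime_card_gt_1: "1 < CARD('p::prime_card)"
  by (rule prime_gt_1_nat[OF prime_card])

lemma measure_heat_pmf:
  assumes "b > 1" "\<alpha> > 0" "t > 0"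
  shows "measure (measure_pmf (heat_pmf b \<alpha> t)) {..m} = exp (- t * eigval b \<alpha> m)"
proof -
  obtain w where "\<forall>m. measure (measure_pmf w) {..m} = exp (- t * eigval b \<alpha> m)"
    using pmf_of_cdf_fun[OF cdf_fun_heat[OF assms]] by metis
  hence "\<forall>m. measure (measure_pmf (heat_pmf b \<alpha> t)) {..m} = exp (- t * eigval b \<alpha> m)"
    unfolding heat_pmf_def by (rule someI)
  thus ?thesis ..
qed

lemma heat_Lq:
  assumes "F \<in> Lq q" "1 \<le> q"
  shows "heat \<alpha> t F \<in> Lq q" "Lq_norm q (heat \<alpha> t F) \<le> Lq_norm q F"
  using mixture.conv_Lq[OF assms] assms by (auto simp: heat_def)

lemma lev_heat:
  assumes "\<alpha> > 0" "t \<ge> 0" "F \<in> Lq q" "1 \<le> q"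
  shows "lev n (heat \<alpha> t F) = complex_of_real (exp (- t * eigval CARD('p) \<alpha> n)) *\<^sub>C lev n (F :: 'p::prime_card L0)"
proof (cases "t = 0")
  case False
  thus ?thesis using assms
    by (simp add: heat_def lev_mixture measure_heat_pmf[OF prime_card_gt_1])
qed (simp add: heat_def)

lemma bounded_operator_heat:
  assumes "1 \<le> q"
  shows "bounded_operator q (heat \<alpha> t)"
proof (cases "t \<le> 0")
  case True
  thus ?thesis using assms by (auto simp: bounded_operator_def heat_def Lq_scale intro!: exI[of _ 1])
next
  case False
  hence "heat \<alpha> t = (conv (mixture (heat_pmf CARD('a) \<alpha> t)) :: 'a L0 \<Rightarrow> 'a L0)"
    by (simp add: heat_def fun_eq_iff)
  thus ?thesis using bounded_operator_conv[OF padic_prob_mixture assms] by simp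
qed

lemma exp_tendsto_1_at_right: "((\<lambda>t :: real. exp (- t * c)) \<longlongrightarrow> 1) (at_right 0)"
proof -
  have "((\<lambda>t. exp (- t * c)) \<longlongrightarrow> exp (- 0 * c)) (at_right 0)" by (intro tendsto_intros)
  thus ?thesis by simp
qed

text \<open>The semigroup law is checked level by level, where it is the functional equation of exp.
  Continuity at 0 is \<open>mixture_tendsto\<close>.\<close>

lemma contraction_semigroup_heat:
  assumes \<alpha>: "\<alpha> > 0" and q: "1 \<le> q"
  shows "contraction_semigroup q (heat \<alpha> :: real \<Rightarrow> 'p::prime_card L0 \<Rightarrow> 'p L0)"
  unfolding contraction_semigroup_def
proof (intro conjI allI impI ballI)
  fix t :: real and F :: "'p L0" assume F: "F \<in> Lq q"
  show "Lq_norm q (heat \<alpha> t F) \<le> Lq_norm q F" using F q by (rule heat_Lq)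
next
  fix F :: "'p L0"
  show "heat \<alpha> 0 F = F" by (simp add: heat_def)
next
  fix s t :: real and F :: "'p L0" assume s: "s \<ge> 0" and t: "t \<ge> 0" and F: "F \<in> Lq q"
  show "heat \<alpha> (s + t) F = heat \<alpha> s (heat \<alpha> t F)"
  proof (rule lev_inject[OF _ _ q])
    show "lev n (heat \<alpha> (s + t) F) = lev n (heat \<alpha> s (heat \<alpha> t F))" for n
      using lev_heat[OF \<alpha> _ F q] lev_heat[OF \<alpha> s heat_Lq(1)[OF F q] q] s t
      by (simp add: exp_add[symmetric] of_real_mult[symmetric] distrib_right del: of_real_mult)
  qed (intro heat_Lq F q)+
next
  fix F :: "'p L0" assume F: "F \<in> Lq q"
  let ?l = "eigval CARD('p) \<alpha>"
  have pos: "?l n > 0" for n by (rule eigval_pos) simp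
  have ev: "\<forall>\<^sub>F t :: real in at_right 0. t > 0" by (rule eventually_at_right_less)
  have "((\<lambda>t. Lq_norm q (conv (mixture (heat_pmf CARD('p) \<alpha> t)) F - F)) \<longlongrightarrow> 0) (at_right 0)"
  proof (rule mixture_tendsto[OF F q, where \<phi> = "\<lambda>t n. exp (- t * ?l n)"])
    show "\<forall>\<^sub>F t in at_right 0. \<forall>m. measure (measure_pmf (heat_pmf CARD('p) \<alpha> t)) {..m} = exp (- t * ?l m)"
      using ev by eventually_elim (simp add: measure_heat_pmf[OF prime_card_gt_1 \<alpha>])
    show "\<forall>\<^sub>F t in at_right 0. cdf_fun (\<lambda>n. exp (- t * ?l n))"
      using ev by eventually_elim (rule cdf_fun_heat[OF prime_card_gt_1 \<alpha>])
    show "\<forall>\<^sub>F t in at_right 0. exp (- t * ?l N) < 1" for N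
      using ev by eventually_elim (simp add: pos)
  qed (rule exp_tendsto_1_at_right)
  thus "((\<lambda>t. Lq_norm q (heat \<alpha> t F - F)) \<longlongrightarrow> 0) (at_right 0)"
  proof (rule Lim_transform_eventually)
    show "\<forall>\<^sub>F t in at_right 0. Lq_norm q (conv (mixture (heat_pmf CARD('p) \<alpha> t)) F - F) = Lq_norm q (heat \<alpha> t F - F)"
      using ev by eventually_elim (simp add: heat_def)
  qed
qed (rule bounded_operator_heat[OF q])

lemma markov_heat: "markov q (heat \<alpha> :: real \<Rightarrow> 'p::prime_card L0 \<Rightarrow> 'p L0)"
  unfolding markov_def
proof (intro conjI allI impI ballI)
  fix t :: real and F :: "'p L0" assume "between_0_1 F"
  thus "between_0_1 (heat \<alpha> t F)" by (simp add: heat_def mixture.conv_between_0_1)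
next
  fix t :: real and F :: "nat \<Rightarrow> 'p padic \<Rightarrow> real" and G
  assume a: "\<forall>n. F n \<in> borel_measurable haar \<and> G n \<in> borel_measurable haar
             \<and> abs_L0 (\<lambda>x. complex_of_real (F n x)) \<in> Lq q
             \<and> heat \<alpha> t (abs_L0 (\<lambda>x. complex_of_real (F n x))) = abs_L0 (G n)"
    and F: "\<forall>x. incseq (\<lambda>n. F n x) \<and> (\<forall>n. 0 \<le> F n x) \<and> (\<lambda>n. F n x) \<longlonglongrightarrow> 1"
  have [measurable]: "F n \<in> borel_measurable borel" "G n \<in> borel_measurable borel" for n
    using a by (simp_all add: measurable_cong_sets[OF sets_haar refl])
  show "AE x in haar. (\<lambda>n. G n x) \<longlonglongrightarrow> 1"
  proof (cases "t \<le> 0")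
    case True
    have "AE x in haar. complex_of_real (F n x) = G n x" for n
      using a True by (subst abs_L0_eq_iff[symmetric]) (auto simp: heat_def)
    hence "AE x in haar. \<forall>n. complex_of_real (F n x) = G n x" by (simp add: AE_all_countable)
    thus ?thesis
    proof eventually_elim
      case (elim x)
      have "(\<lambda>n. complex_of_real (F n x)) \<longlonglongrightarrow> complex_of_real 1" using F by (intro tendsto_of_real) auto
      thus ?case using elim by simp
    qed
  next
    case False
    show ?thesis
    proof (rule mixture.conv_conservative)
      show "conv (mixture (heat_pmf CARD('p) \<alpha> t)) (abs_L0 (\<lambda>x. complex_of_real (F n x))) = abs_L0 (G n)" for n
        using a False by (simp add: heat_def)
    qed (use F in auto)
  qed
qed

lemma translation_invariant_heat: "translation_invariant q (heat \<alpha> :: real \<Rightarrow> 'p::prime_card L0 \<Rightarrow> 'p L0)"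
  unfolding translation_invariant_def
proof (intro allI impI ballI)
  fix t :: real and a and f g :: "'p padic \<Rightarrow> complex"
  assume "f \<in> borel_measurable haar" "g \<in> borel_measurable haar" and eq: "heat \<alpha> t (abs_L0 f) = abs_L0 g"
  hence [measurable]: "f \<in> borel_measurable borel" "g \<in> borel_measurable borel"
    by (simp_all add: measurable_cong_sets[OF sets_haar refl])
  show "heat \<alpha> t (abs_L0 (\<lambda>x. f (x + a))) = abs_L0 (\<lambda>x. g (x + a))"
  proof (cases "t \<le> 0")
    case True
    hence "AE x in haar. f x = g x" using eq by (subst abs_L0_eq_iff[symmetric]) (auto simp: heat_def)
    hence "AE x in haar. f (a + x) = g (a + x)" by (rule AE_haar_translate)
    thus ?thesis using True by (simp add: heat_def abs_L0_eq_iff add.commute)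
  next
    case False
    thus ?thesis using eq by (simp add: heat_def mixture.conv_translate)
  qed
qed

section \<open>The generator\<close>

lemma lev_Lq_tendsto:
  assumes "Lq_tendsto q X F" "\<And>k. X k \<in> Lq q" "F \<in> Lq q" "1 \<le> q"
  shows "Lq_tendsto q (\<lambda>k. lev n (X k)) (lev n F)"
  unfolding Lq_tendsto_def
proof (rule tendsto_sandwich[OF _ _ tendsto_const])
  show "(\<lambda>k. 2 * Lq_norm q (X k - F)) \<longlonglongrightarrow> 0"
    using assms(1) unfolding Lq_tendsto_def by (rule tendsto_mult_right_zero)
  show "\<forall>\<^sub>F k in sequentially. Lq_norm q (lev n (X k) - lev n F) \<le> 2 * Lq_norm q (X k - F)"
    using lev_norm_le[OF Lq_diff[OF assms(2,3,4)] assms(4)] assms by (simp add: lev_diff[of _ q])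
qed simp

lemma linear_operator_frac_op:
  assumes q: "1 \<le> q"
  shows "linear_operator q (frac_op \<alpha> q :: 'p::prime_card graph)"
  unfolding linear_operator_def
proof (intro conjI)
  show "(0, 0) \<in> frac_op \<alpha> q" by (simp add: frac_op_def)
  show "\<forall>(f, g)\<in>frac_op \<alpha> q. \<forall>(f', g')\<in>frac_op \<alpha> q. (f + f', g + g') \<in> (frac_op \<alpha> q :: 'p graph)"
    using q by (auto simp: frac_op_def Lq_add lev_add[of _ q] scale_L0_add_right)
  show "\<forall>c. \<forall>(f, g)\<in>frac_op \<alpha> q. (c *\<^sub>C f, c *\<^sub>C g) \<in> (frac_op \<alpha> q :: 'p graph)"
    using q by (auto simp: frac_op_def Lq_scale lev_scale mult.commute)
  show "\<forall>f g g'. (f, g) \<in> frac_op \<alpha> q \<longrightarrow> (f, g') \<in> (frac_op \<alpha> q :: 'p graph) \<longrightarrow> g = g'"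
  proof (intro allI impI)
    fix f g g' :: "'p L0" assume "(f, g) \<in> frac_op \<alpha> q" "(f, g') \<in> frac_op \<alpha> q"
    hence gg: "g \<in> Lq q" "g' \<in> Lq q" and eq: "\<And>n. lev n g = lev n g'" by (simp_all add: frac_op_def)
    from lev_inject[OF gg q eq] show "g = g'" .
  qed
qed (auto simp: frac_op_def)

lemma closed_operator_frac_op:
  assumes q: "1 \<le> q"
  shows "closed_operator q (frac_op \<alpha> q :: 'p::prime_card graph)"
  unfolding closed_operator_def
proof (intro conjI linear_operator_frac_op[OF q] allI ballI impI)
  fix F G :: "nat \<Rightarrow> 'p L0" and f g
  assume f: "f \<in> Lq q" and g: "g \<in> Lq q" and FG: "\<forall>k. (F k, G k) \<in> frac_op \<alpha> q"
    and F: "Lq_tendsto q F f" and G: "Lq_tendsto q G g"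
  have Lq: "F k \<in> Lq q" "G k \<in> Lq q" for k using FG by (auto simp: frac_op_def)
  have "lev n g = complex_of_real (eigval CARD('p) \<alpha> n) *\<^sub>C lev n f" for n
  proof (rule Lq_tendsto_unique[OF lev_Lq_tendsto[OF G]])
    let ?l = "complex_of_real (eigval CARD('p) \<alpha> n)"
    have "lev n (G k) - ?l *\<^sub>C lev n f = ?l *\<^sub>C (lev n (F k) - lev n f)" for k
      using FG by (simp add: frac_op_def L0.scale_right_diff_distrib)
    hence "Lq_norm q (lev n (G k) - ?l *\<^sub>C lev n f) = norm ?l * Lq_norm q (lev n (F k) - lev n f)" for k
      using Lq f q by (simp add: Lq_scale Lq_diff lev_Lq)
    moreover have "(\<lambda>k. norm ?l * Lq_norm q (lev n (F k) - lev n f)) \<longlonglongrightarrow> 0"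
      using lev_Lq_tendsto[OF F Lq(1) f q] unfolding Lq_tendsto_def by (rule tendsto_mult_right_zero)
    ultimately show "Lq_tendsto q (\<lambda>k. lev n (G k)) (?l *\<^sub>C lev n f)"
      by (simp add: Lq_tendsto_def)
  qed (use Lq f g q in \<open>auto intro: lev_Lq Lq_scale\<close>)
  thus "(f, g) \<in> frac_op \<alpha> q" using f g by (simp add: frac_op_def)
qed

lemma exp_diff_quotient:
  assumes "l > 0"
  shows "((\<lambda>t. (exp (- t * l) - 1) / t) \<longlongrightarrow> - l) (at_right (0 :: real))"
proof -
  have "((\<lambda>t. (exp (- t * l) - 1) / t) \<longlongrightarrow> - l) (at 0)"
  proof -
    have "((\<lambda>t. exp (- t * l)) has_real_derivative - l) (at 0)"
      by (auto intro!: derivative_eq_intros)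
    thus ?thesis by (simp add: has_field_derivative_iff)
  qed
  thus ?thesis by (rule filterlim_mono[OF _ order_refl]) (simp add: at_le)
qed

text \<open>One inclusion projects the limit to each level, where it is the derivative of exp at 0.
  The other rests on an exact formula: if G is the image of F, the difference quotient of F at t is
  minus the mixture of G with multiplier \<open>mean_exp (t * eigval CARD('p) \<alpha> n)\<close>,
  and this tends to - G by \<open>mixture_tendsto\<close>.\<close>

lemma generator_heat:
  assumes \<alpha>: "\<alpha> > 0" and q: "1 \<le> q"
  shows "generator q (heat \<alpha>) = neg_operator (frac_op \<alpha> q :: 'p::prime_card graph)"
proof (intro subset_antisym subsetI)
  let ?l = "eigval CARD('p) \<alpha>"
  have pos: "?l n > 0" for n by (rule eigval_pos) simp
  have ev: "\<forall>\<^sub>F t :: real in at_right 0. t > 0" by (rule eventually_at_right_less)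
  let ?X = "\<lambda>t F. complex_of_real (1 / t) *\<^sub>C (heat \<alpha> t F - F)"
  have X: "?X t F \<in> Lq q" if "F \<in> Lq q" for t and F :: "'p L0"
    using that q by (intro Lq_scale Lq_diff heat_Lq)
  have levX: "lev n (?X t F) = complex_of_real ((exp (- t * ?l n) - 1) / t) *\<^sub>C lev n F"
    if F: "F \<in> Lq q" and t: "t > 0" for t n and F :: "'p L0"
  proof -
    have "lev n (?X t F) = complex_of_real (1 / t) *\<^sub>C (complex_of_real (exp (- t * ?l n)) *\<^sub>C lev n F - 1 *\<^sub>C lev n F)"
      using lev_heat[OF \<alpha> _ F q, of t n] t F q by (simp add: lev_scale lev_diff[of _ q] heat_Lq)
    also have "\<dots> = (complex_of_real (1 / t) * (complex_of_real (exp (- t * ?l n)) - 1)) *\<^sub>C lev n F"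
      by (simp only: L0.scale_left_diff_distrib[symmetric] scale_L0_scale)
    also have "complex_of_real (1 / t) * (complex_of_real (exp (- t * ?l n)) - 1) = complex_of_real ((exp (- t * ?l n) - 1) / t)"
      by simp
    finally show ?thesis .
  qed
  {
    fix z assume "z \<in> generator q (heat \<alpha> :: real \<Rightarrow> 'p L0 \<Rightarrow> 'p L0)"
    then obtain F G where z: "z = (F, G)" and F: "F \<in> Lq q" and G: "G \<in> Lq q"
      and lim: "((\<lambda>t. Lq_norm q (?X t F - G)) \<longlongrightarrow> 0) (at_right 0)"
      by (auto simp: generator_def)
    have "lev n G = complex_of_real (- ?l n) *\<^sub>C lev n F" for n
    proof -
      let ?L = "lev n F"
      let ?d = "lev n G - complex_of_real (- ?l n) *\<^sub>C ?L"
      have L: "?L \<in> Lq q" "lev n G \<in> Lq q" "complex_of_real (- ?l n) *\<^sub>C ?L \<in> Lq q"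
        by (intro lev_Lq Lq_scale F G q)+
      have "((\<lambda>t. 2 * Lq_norm q (?X t F - G) + \<bar>(exp (- t * ?l n) - 1) / t - (- ?l n)\<bar> * Lq_norm q ?L)
          \<longlongrightarrow> 2 * 0 + \<bar>(- ?l n) - (- ?l n)\<bar> * Lq_norm q ?L) (at_right 0)"
        by (intro tendsto_intros lim exp_diff_quotient pos)
      moreover have "\<forall>\<^sub>F t in at_right 0. Lq_norm q ?d
          \<le> 2 * Lq_norm q (?X t F - G) + \<bar>(exp (- t * ?l n) - 1) / t - (- ?l n)\<bar> * Lq_norm q ?L"
        using ev
      proof eventually_elim
        case (elim t)
        have "Lq_norm q ?d \<le> Lq_norm q (lev n G - lev n (?X t F)) + Lq_norm q (lev n (?X t F) - complex_of_real (- ?l n) *\<^sub>C ?L)"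
          by (rule Lq_norm_triangle3[OF L(2) lev_Lq[OF X[OF F] q] L(3) q])
        moreover have "Lq_norm q (lev n G - lev n (?X t F)) \<le> 2 * Lq_norm q (?X t F - G)"
        proof -
          have "Lq_norm q (lev n (G - ?X t F)) \<le> 2 * Lq_norm q (G - ?X t F)"
            by (rule lev_norm_le[OF Lq_diff[OF G X[OF F] q] q])
          thus ?thesis
            unfolding lev_diff[OF G X[OF F] q] Lq_norm_minus_commute[OF G X[OF F] q, of t] .
        qed
        moreover have "Lq_norm q (lev n (?X t F) - complex_of_real (- ?l n) *\<^sub>C ?L)
            = \<bar>(exp (- t * ?l n) - 1) / t - (- ?l n)\<bar> * Lq_norm q ?L"
          unfolding levX[OF F elim] L0.scale_left_diff_distrib[symmetric] of_real_diff[symmetric]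
          by (simp only: Lq_scale(2)[OF L(1) q] norm_of_real)
        ultimately show ?case by linarith
      qed
      ultimately have "Lq_norm q ?d \<le> 2 * 0 + \<bar>(- ?l n) - (- ?l n)\<bar> * Lq_norm q ?L"
        by (rule tendsto_lowerbound) simp
      hence "Lq_norm q ?d = 0" by (simp add: order_antisym)
      hence "?d = 0" using Lq_diff[OF L(2,3) q] q by (rule Lq_norm_eq_0D)
      thus ?thesis by (rule eq_iff_diff_eq_0[THEN iffD2])
    qed
    hence "(F, - G) \<in> frac_op \<alpha> q"
      using F G q by (simp add: frac_op_def Lq_uminus lev_uminus)
    thus "z \<in> neg_operator (frac_op \<alpha> q)" unfolding z neg_operator_def by force
  next
    fix z assume "z \<in> neg_operator (frac_op \<alpha> q :: 'p graph)"
    then obtain F G where z: "z = (F, - G)" and FG: "(F, G) \<in> frac_op \<alpha> q"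
      by (auto simp: neg_operator_def)
    have F: "F \<in> Lq q" and G: "G \<in> Lq q" and lev: "\<And>n. lev n G = complex_of_real (?l n) *\<^sub>C lev n F"
      using FG by (auto simp: frac_op_def)
    have "\<exists>w :: int pmf. t > 0 \<longrightarrow> (\<forall>m. measure (measure_pmf w) {..m} = mean_exp (t * ?l m))" for t
      using pmf_of_cdf_fun[OF cdf_fun_mean_heat[OF prime_card_gt_1 \<alpha>]] by metis
    then obtain w :: "real \<Rightarrow> int pmf" where
      w: "\<And>t m. t > 0 \<Longrightarrow> measure (measure_pmf (w t)) {..m} = mean_exp (t * ?l m)" by metis
    have X_eq: "?X t F = - conv (mixture (w t)) G" if t: "t > 0" for t
    proof (rule lev_inject[OF X[OF F] _ q])
      show "- conv (mixture (w t)) G \<in> Lq q" using G q by (intro Lq_uminus mixture.conv_Lq)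
      fix n
      have "lev n (- conv (mixture (w t)) G) = - (complex_of_real (mean_exp (t * ?l n)) *\<^sub>C (complex_of_real (?l n) *\<^sub>C lev n F))"
        by (simp only: lev_uminus lev_mixture[OF G q] w[OF t] lev)
      also have "\<dots> = complex_of_real (- (mean_exp (t * ?l n) * ?l n)) *\<^sub>C lev n F" by simp
      also have "- (mean_exp (t * ?l n) * ?l n) = (exp (- t * ?l n) - 1) / t"
        using pos[of n] t by (simp add: mean_exp_def minus_divide_left)
      finally show "lev n (?X t F) = lev n (- conv (mixture (w t)) G)" using levX[OF F t] by simp
    qed
    have "((\<lambda>t. Lq_norm q (conv (mixture (w t)) G - G)) \<longlongrightarrow> 0) (at_right 0)"
    proof (rule mixture_tendsto[OF G q, where \<phi> = "\<lambda>t n. mean_exp (t * ?l n)"])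
      show "\<forall>\<^sub>F t in at_right 0. \<forall>m. measure (measure_pmf (w t)) {..m} = mean_exp (t * ?l m)"
        using ev by eventually_elim (simp add: w)
      show "\<forall>\<^sub>F t in at_right 0. cdf_fun (\<lambda>n. mean_exp (t * ?l n))"
        using ev by eventually_elim (rule cdf_fun_mean_heat[OF prime_card_gt_1 \<alpha>])
      show "\<forall>\<^sub>F t in at_right 0. mean_exp (t * ?l N) < 1" for N
        using ev by eventually_elim (intro mean_exp_less_1, simp add: pos)
      show "((\<lambda>t. mean_exp (t * ?l N)) \<longlongrightarrow> 1) (at_right 0)" for N
      proof (rule filterlim_compose[OF mean_exp_tendsto_0])
        have "((\<lambda>t. t * ?l N) \<longlongrightarrow> 0 * ?l N) (at_right 0)" by (intro tendsto_intros)
        thus "filterlim (\<lambda>t. t * ?l N) (at_right 0) (at_right 0)"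
          unfolding filterlim_at using ev pos[of N] by (auto elim!: eventually_mono)
      qed
    qed
    hence "((\<lambda>t. Lq_norm q (?X t F - (- G))) \<longlongrightarrow> 0) (at_right 0)"
    proof (rule Lim_transform_eventually)
      show "\<forall>\<^sub>F t in at_right 0. Lq_norm q (conv (mixture (w t)) G - G) = Lq_norm q (?X t F - (- G))"
        using ev
      proof eventually_elim
        case (elim t)
        show ?case
          unfolding X_eq[OF elim] using Lq_norm_minus_commute[OF mixture.conv_Lq(1)[OF G q] G q] by simp
      qed
    qed
    thus "z \<in> generator q (heat \<alpha>)" unfolding z generator_def using F G q by (simp add: Lq_uminus)
  }
qed

section \<open>Self-adjointness\<close>

text \<open>On a single level both sides are the eigenvalue times an inner product of levels,
  because \<open>lev n\<close> is a self-adjoint projection and the eigenvalue is real.\<close>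

lemma level_sum_frac_op_inner:
  fixes F G F' G' :: "'p::prime_card L0"
  assumes FG: "(F, G) \<in> frac_op \<alpha> 2" and FG': "(F', G') \<in> frac_op \<alpha> 2"
  shows "L2_inner (level_sum k G) F' = L2_inner (level_sum k F) G'"
proof -
  have Lq: "F \<in> Lq 2" "G \<in> Lq 2" "F' \<in> Lq 2" "G' \<in> Lq 2" using FG FG' by (auto simp: frac_op_def)
  let ?l = "\<lambda>n. complex_of_real (eigval CARD('p) \<alpha> n)"
  have lev: "L2_inner (lev n G) F' = L2_inner (lev n F) G'" for n
  proof -
    have "L2_inner (lev n G) F' = L2_inner (lev n (lev n G)) F'"
      using Lq by (simp add: lev_lev[of _ 2])
    also have "\<dots> = L2_inner (lev n G) (lev n F')"
      using Lq by (intro lev_self_adjoint lev_Lq) auto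
    also have "\<dots> = ?l n * L2_inner (lev n F) (lev n F')"
      using FG by (simp add: frac_op_def L2_inner_scale_left)
    also have "\<dots> = L2_inner (lev n F) (lev n G')"
      using FG' by (simp add: frac_op_def L2_inner_scale_right)
    also have "\<dots> = L2_inner (lev n (lev n F)) G'"
      using Lq by (intro lev_self_adjoint[symmetric] lev_Lq) auto
    also have "\<dots> = L2_inner (lev n F) G'" using Lq by (simp add: lev_lev[of _ 2])
    finally show ?thesis .
  qed
  show ?thesis
  proof (induction k)
    case 0
    have "L2_inner 0 H = 0" for H :: "'p L0"
      using L2_inner_scale_left[of 0 "0 :: 'p L0" H] by simp
    thus ?case by simp
  next
    case (Suc k)
    thus ?case using Lq
      by (simp only: level_sum_Suc) (simp add: L2_inner_add_left level_sum_Lq lev_Lq Lq_add lev)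
  qed
qed

lemma frac_op_symmetric:
  assumes "(F, G) \<in> frac_op \<alpha> 2" "(F', G') \<in> frac_op \<alpha> 2"
  shows "L2_inner G F' = L2_inner F G'"
proof -
  have Lq: "F \<in> Lq 2" "G \<in> Lq 2" "F' \<in> Lq 2" "G' \<in> Lq 2" using assms by (auto simp: frac_op_def)
  have "(\<lambda>k. L2_inner (level_sum k G) F') \<longlonglongrightarrow> L2_inner G F'"
    using Lq by (intro L2_inner_tendsto_left level_sum_tendsto level_sum_Lq) auto
  moreover have "(\<lambda>k. L2_inner (level_sum k F) G') \<longlonglongrightarrow> L2_inner F G'"
    using Lq by (intro L2_inner_tendsto_left level_sum_tendsto level_sum_Lq) auto
  ultimately show ?thesis
    unfolding level_sum_frac_op_inner[OF assms] by (rule LIMSEQ_unique)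
qed

lemma L2_inner_eigfun:
  fixes f :: "'p::prime_card padic \<Rightarrow> complex"
  assumes [measurable]: "f \<in> borel_measurable borel" and f: "abs_L0 f \<in> Lq 2"
  shows "cnj (L2_inner (abs_L0 (eigfun n x)) (abs_L0 f))
    = (\<integral>y. f (x + y) \<partial>ball_measure n) - (\<integral>y. f (x + y) \<partial>ball_measure (n + 1))"
proof -
  have ind: "abs_L0 (ind (padic_ball m x)) \<in> Lq 2" for m by (simp add: ind_in_Lq_iff)
  have int: "integrable haar (\<lambda>y. indicator (padic_ball m x) y *\<^sub>R f y)" for m
  proof -
    have "integrable haar (\<lambda>y. f y * cnj (ind (padic_ball m x) y))"
      using f ind by (intro L2_inner_integrable) auto
    moreover have "f y * cnj (ind (padic_ball m x) y) = indicator (padic_ball m x) y *\<^sub>R f y" for y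
      by (simp add: ind_def split: split_indicator)
    ultimately show ?thesis by simp
  qed
  have "cnj (L2_inner (abs_L0 (eigfun n x)) (abs_L0 f)) = L2_inner (abs_L0 f) (abs_L0 (eigfun n x))"
    by (rule L2_inner_commute[symmetric])
  also have "\<dots> = (\<integral>y. f y * cnj (eigfun n x y) \<partial>haar)" by (rule L2_inner_abs) auto
  also have "\<dots> = (\<integral>y. (indicator (padic_ball n x) y *\<^sub>R f y) /\<^sub>R (real CARD('p) powi n)
      - (indicator (padic_ball (n + 1) x) y *\<^sub>R f y) /\<^sub>R (real CARD('p) powi (n + 1)) \<partial>haar)"
    by (intro Bochner_Integration.integral_cong refl)
       (simp add: eigfun_def ind_def indicator_def algebra_simps scaleR_conv_of_real)
  also have "\<dots> = (\<integral>y. f (x + y) \<partial>ball_measure n) - (\<integral>y. f (x + y) \<partial>ball_measure (n + 1))"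
    by (simp only: Bochner_Integration.integral_diff[OF integrable_scaleR_right[OF int] integrable_scaleR_right[OF int]]
        integral_scaleR_right integral_ball_measure[OF assms(1)])
  finally show ?thesis .
qed

text \<open>\<open>eigfun n x\<close> lies in the domain for every centre x, and pairing with it
  reads off level n at x. So the adjoint relation fixes each level of G pointwise; the test
  functions are a large enough domain for essential self-adjointness.\<close>

lemma adjoint_frac_deriv_subset: "adjoint_L2 (frac_deriv \<alpha>) \<subseteq> (frac_op \<alpha> 2 :: 'p::prime_card graph)"
proof
  fix z :: "'p L0 \<times> 'p L0" assume asm: "z \<in> adjoint_L2 (frac_deriv \<alpha>)"
  obtain F G where z: "z = (F, G)" by (cases z)
  have F: "F \<in> Lq 2" and G: "G \<in> Lq 2" using asm unfolding z adjoint_L2_def by auto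
  have adj: "L2_inner v F = L2_inner u G" if "(u, v) \<in> frac_deriv \<alpha>" for u v
    using asm that unfolding z adjoint_L2_def by fast
  obtain f where f[measurable]: "f \<in> borel_measurable borel" "F = abs_L0 f" by (rule L0_cases)
  obtain g where g[measurable]: "g \<in> borel_measurable borel" "G = abs_L0 g" by (rule L0_cases)
  have "lev n G = complex_of_real (eigval CARD('p) \<alpha> n) *\<^sub>C lev n F" for n
  proof -
    let ?l = "complex_of_real (eigval CARD('p) \<alpha> n)"
    have "(\<integral>y. g (x + y) \<partial>ball_measure n) - (\<integral>y. g (x + y) \<partial>ball_measure (n + 1))
        = ?l * ((\<integral>y. f (x + y) \<partial>ball_measure n) - (\<integral>y. f (x + y) \<partial>ball_measure (n + 1)))" for x
    proof -
      have "?l * L2_inner (abs_L0 (eigfun n x)) F = L2_inner (abs_L0 (eigfun n x)) G"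
        using adj[OF eigfun_in_frac_deriv] by (simp only: L2_inner_scale_left)
      hence "?l * cnj (L2_inner (abs_L0 (eigfun n x)) F) = cnj (L2_inner (abs_L0 (eigfun n x)) G)"
        by (metis complex_cnj_mult complex_cnj_complex_of_real)
      thus ?thesis using F G unfolding f(2) g(2) by (simp only: L2_inner_eigfun[OF f(1)] L2_inner_eigfun[OF g(1)])
    qed
    thus ?thesis unfolding f(2) g(2) lev_def by (simp add: avg_abs minus_abs_L0 scale_abs_L0)
  qed
  thus "z \<in> frac_op \<alpha> 2" using F G unfolding z frac_op_def by simp
qed

lemma adjoint_L2_antimono: "A \<subseteq> B \<Longrightarrow> adjoint_L2 B \<subseteq> adjoint_L2 A"
  by (auto simp: adjoint_L2_def)

lemma frac_op_subset_adjoint: "frac_op \<alpha> 2 \<subseteq> adjoint_L2 (frac_op \<alpha> 2)"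
proof
  fix z assume z: "z \<in> frac_op \<alpha> 2"
  obtain F G where FG: "z = (F, G)" by force
  have "F \<in> Lq 2" "G \<in> Lq 2" using z FG by (auto simp: frac_op_def)
  moreover have "L2_inner v F = L2_inner u G" if "(u, v) \<in> frac_op \<alpha> 2" for u v
    using frac_op_symmetric[OF that] z FG by blast
  ultimately show "z \<in> adjoint_L2 (frac_op \<alpha> 2)" unfolding FG adjoint_L2_def by auto
qed

lemma level_in_frac_op:
  fixes F :: "'p::prime_card L0"
  assumes "F \<in> Lq q" "1 \<le> q"
  shows "(lev n F, complex_of_real (eigval CARD('p) \<alpha> n) *\<^sub>C lev n F) \<in> frac_op \<alpha> q"
  using assms by (auto simp: frac_op_def lev_Lq Lq_scale lev_scale lev_lev[of _ q])

lemma frac_op_add: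
  assumes "(F, G) \<in> frac_op \<alpha> q" "(F', G') \<in> frac_op \<alpha> q" "1 \<le> q"
  shows "(F + F', G + G') \<in> frac_op \<alpha> q"
  using linear_operator_frac_op[OF assms(3), of \<alpha>] assms(1,2) unfolding linear_operator_def by blast

lemma level_sum_in_Domain:
  assumes F: "F \<in> Lq q" and q: "1 \<le> q"
  shows "level_sum k F \<in> Domain (frac_op \<alpha> q)"
proof (induction k)
  case 0
  have "(0, 0) \<in> frac_op \<alpha> q" by (simp add: frac_op_def)
  thus ?case by (auto simp: Domain_iff)
next
  case (Suc k)
  then obtain G where "(level_sum k F, G) \<in> frac_op \<alpha> q" by blast
  from frac_op_add[OF frac_op_add[OF this level_in_frac_op[OF F q] q] level_in_frac_op[OF F q] q]
  show ?case unfolding level_sum_Suc by blast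
qed

text \<open>A chain of inclusions closes up: \<open>frac_op\<close> lies in its adjoint by symmetry,
  this in the adjoint of \<open>frac_deriv\<close>, and that in \<open>frac_op\<close>
  again.\<close>

lemma self_adjoint_frac_op: "self_adjoint (frac_op \<alpha> 2 :: 'p::prime_card graph)"
  unfolding self_adjoint_def
proof (intro conjI ballI)
  show "linear_operator 2 (frac_op \<alpha> 2 :: 'p graph)" by (rule linear_operator_frac_op) simp
  show "\<exists>U. (\<forall>n. U n \<in> Domain (frac_op \<alpha> 2)) \<and> Lq_tendsto 2 U F" if "F \<in> Lq 2" for F :: "'p L0"
    using that by (intro exI[of _ "\<lambda>k. level_sum k F"] conjI allI level_sum_tendsto level_sum_in_Domain) auto
  show "adjoint_L2 (frac_op \<alpha> 2) = (frac_op \<alpha> 2 :: 'p graph)"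
  proof
    have "adjoint_L2 (frac_op \<alpha> 2 :: 'p graph) \<subseteq> adjoint_L2 (frac_deriv \<alpha>)"
      by (intro adjoint_L2_antimono frac_deriv_subset_frac_op) simp
    thus "adjoint_L2 (frac_op \<alpha> 2) \<subseteq> (frac_op \<alpha> 2 :: 'p graph)"
      using adjoint_frac_deriv_subset by (rule order_trans)
  qed (rule frac_op_subset_adjoint)
qed

text \<open>A self-adjoint A above \<open>frac_deriv\<close> lies in the adjoint of
  \<open>frac_deriv\<close>, hence in \<open>frac_op\<close>; taking adjoints reverses the
  inclusion.\<close>

lemma frac_deriv_L2_eq: "frac_deriv_L2 \<alpha> = (frac_op \<alpha> 2 :: 'p::prime_card graph)"
  unfolding frac_deriv_L2_def
proof (rule the_equality)
  show "self_adjoint (frac_op \<alpha> 2) \<and> frac_deriv \<alpha> \<subseteq> (frac_op \<alpha> 2 :: 'p graph)"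
    by (intro conjI self_adjoint_frac_op frac_deriv_subset_frac_op) simp
  fix A :: "'p graph" assume A: "self_adjoint A \<and> frac_deriv \<alpha> \<subseteq> A"
  hence adj: "adjoint_L2 A = A" by (simp add: self_adjoint_def)
  have "adjoint_L2 A \<subseteq> adjoint_L2 (frac_deriv \<alpha>)" using A by (intro adjoint_L2_antimono) simp
  hence 1: "A \<subseteq> frac_op \<alpha> 2" using adjoint_frac_deriv_subset unfolding adj by (rule order_trans)
  have "frac_op \<alpha> 2 \<subseteq> adjoint_L2 A"
    using frac_op_subset_adjoint adjoint_L2_antimono[OF 1] by (rule order_trans)
  with 1 show "A = frac_op \<alpha> 2" unfolding adj by (rule subset_antisym)
qed

section \<open>Uniqueness of the semigroup\<close>

text \<open>
  For an eigenvector e of the generator the curve \<open>exp (l * t) *\<^sub>C S t e\<close> moves by o(h) over a step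
  of length h, so it is constant; no differentiation of vector-valued functions is needed.
\<close>

lemma semigroup_eigenvector:
  fixes S :: "real \<Rightarrow> 'p::prime_card L0 \<Rightarrow> 'p L0"
  assumes S: "contraction_semigroup q S" and q: "1 \<le> q" and l: "l > 0" and e: "e \<in> Lq q"
    and gen: "(e, complex_of_real (- l) *\<^sub>C e) \<in> generator q S" and T: "T \<ge> 0"
  shows "S T e = complex_of_real (exp (- l * T)) *\<^sub>C e"
proof -
  have SLq: "S t f \<in> Lq q" if "f \<in> Lq q" "t \<ge> 0" for f t
    using S that by (auto simp: contraction_semigroup_def bounded_operator_def)
  have Snorm: "Lq_norm q (S t f) \<le> Lq_norm q f" if "f \<in> Lq q" "t \<ge> 0" for f t
    using S that by (auto simp: contraction_semigroup_def)
  have Sadd: "S (s + t) f = S s (S t f)" if "f \<in> Lq q" "s \<ge> 0" "t \<ge> 0" for f s t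
    using S that by (auto simp: contraction_semigroup_def)
  have S0: "S 0 f = f" if "f \<in> Lq q" for f using S that by (auto simp: contraction_semigroup_def)
  have Splus: "S t (f + g) = S t f + S t g" if "f \<in> Lq q" "g \<in> Lq q" "t \<ge> 0" for f g t
    using S that by (auto simp: contraction_semigroup_def bounded_operator_def)
  have Sscale: "S t (c *\<^sub>C f) = c *\<^sub>C S t f" if "f \<in> Lq q" "t \<ge> 0" for c f t
    using S that by (auto simp: contraction_semigroup_def bounded_operator_def)
  have Sdiff: "S t (f - g) = S t f - S t g" if "f \<in> Lq q" "g \<in> Lq q" "t \<ge> 0" for f g t
    using Splus[OF that(1) Lq_scale(1)[OF that(2) q, of "- 1"] that(3)] Sscale[OF that(2,3), of "- 1"] by simp
  define u where "u t = complex_of_real (exp (l * t)) *\<^sub>C S t e" for t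
  have u: "u t \<in> Lq q" if "t \<ge> 0" for t unfolding u_def using SLq[OF e that] q by (rule Lq_scale)
  define d where "d h = Lq_norm q (u h - e)" for h
  have step: "Lq_norm q (u (t + h) - u t) \<le> exp (l * t) * d h" if "t \<ge> 0" "h \<ge> 0" for t h
  proof -
    have "u (t + h) - u t = complex_of_real (exp (l * t)) *\<^sub>C S t (u h - e)"
    proof -
      have "u (t + h) = complex_of_real (exp (l * t)) *\<^sub>C S t (u h)"
        unfolding u_def using that e SLq[OF e, of h]
        by (simp add: Sadd Sscale distrib_left exp_add)
      thus ?thesis using Sdiff[OF u[OF that(2)] e that(1)] by (simp add: u_def L0.scale_right_diff_distrib)
    qed
    hence "Lq_norm q (u (t + h) - u t) = exp (l * t) * Lq_norm q (S t (u h - e))"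
      using Lq_scale(2)[OF SLq[OF Lq_diff[OF u[OF that(2)] e q] that(1)] q] by simp
    also have "\<dots> \<le> exp (l * t) * d h"
      unfolding d_def using Snorm[OF Lq_diff[OF u[OF that(2)] e q] that(1)] by (intro mult_left_mono) auto
    finally show ?thesis .
  qed
  \<comment> \<open>N steps of length h, each charged with the factor exp (l t) at the final time,
    where it is largest.\<close>
  have iter: "Lq_norm q (u (real N * h) - e) \<le> real N * (exp (l * (real N * h)) * d h)" if h: "h \<ge> 0" for N h
  proof (induction N)
    case 0
    show ?case using q by (simp add: u_def S0[OF e])
  next
    case (Suc N)
    have a: "real N * h \<ge> 0" using h by simp
    have "Lq_norm q (u (real (Suc N) * h) - e)
        \<le> Lq_norm q (u (real N * h + h) - u (real N * h)) + Lq_norm q (u (real N * h) - e)"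
      using Lq_norm_triangle3[OF u[of "real N * h + h"] u[OF a] e q] a h by (simp add: distrib_right add.commute)
    also have "\<dots> \<le> exp (l * (real N * h)) * d h + real N * (exp (l * (real N * h)) * d h)"
      using step[OF a h] Suc by (rule add_mono)
    also have "\<dots> = real (Suc N) * (exp (l * (real N * h)) * d h)" by (simp add: distrib_right)
    also have "\<dots> \<le> real (Suc N) * (exp (l * (real (Suc N) * h)) * d h)"
      using l h by (intro mult_left_mono mult_right_mono) (auto simp: d_def mult_right_mono)
    finally show ?case .
  qed
  \<comment> \<open>Membership in the generator says S h e = (1 - l h) e + o(h), and the factor exp
    (l h) cancels the first order term.\<close>
  have lim: "((\<lambda>h. d h / h) \<longlongrightarrow> 0) (at_right 0)"
  proof (rule tendsto_sandwich[OF _ _ tendsto_const])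
    let ?X = "\<lambda>h. Lq_norm q (complex_of_real (1 / h) *\<^sub>C (S h e - e) - complex_of_real (- l) *\<^sub>C e)"
    let ?r = "\<lambda>h. (exp (l * h) - 1) / h - l * exp (l * h)"
    have gX: "(?X \<longlongrightarrow> 0) (at_right 0)" using gen by (auto simp: generator_def)
    have "((\<lambda>h. (exp (l * h) - 1) / h) \<longlongrightarrow> l) (at_right 0)"
    proof -
      have "((\<lambda>h. (exp (l * h) - 1) / h) \<longlongrightarrow> l) (at 0)"
      proof -
        have "((\<lambda>h. exp (l * h)) has_real_derivative l) (at 0)"
          by (auto intro!: derivative_eq_intros)
        thus ?thesis by (simp add: has_field_derivative_iff)
      qed
      thus ?thesis by (rule filterlim_mono[OF _ order_refl]) (simp add: at_le)
    qed
    hence "((\<lambda>h. exp (l * h) * ?X h + \<bar>?r h\<bar> * Lq_norm q e)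
        \<longlongrightarrow> exp (l * 0) * 0 + \<bar>l - l * exp (l * 0)\<bar> * Lq_norm q e) (at_right 0)"
      by (intro tendsto_intros gX)
    thus "((\<lambda>h. exp (l * h) * ?X h + \<bar>?r h\<bar> * Lq_norm q e) \<longlongrightarrow> 0) (at_right 0)" by simp
    show "\<forall>\<^sub>F h in at_right 0. 0 \<le> d h / h"
      using eventually_at_right_less[of "0 :: real"] by eventually_elim (simp add: d_def)
    show "\<forall>\<^sub>F h in at_right 0. d h / h \<le> exp (l * h) * ?X h + \<bar>?r h\<bar> * Lq_norm q e"
      using eventually_at_right_less[of "0 :: real"]
    proof eventually_elim
      case (elim h)
      let ?E = "complex_of_real (exp (l * h))"
      have Se: "S h e \<in> Lq q" using SLq[OF e] elim by simp
      define Y where "Y = complex_of_real (1 / h) *\<^sub>C (S h e - e) - complex_of_real (- l) *\<^sub>C e"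
      have Y: "Y \<in> Lq q" unfolding Y_def by (intro Lq_diff Lq_scale Se e q)
      have "complex_of_real (1 / h) *\<^sub>C (u h - e) = ?E *\<^sub>C Y + complex_of_real (?r h) *\<^sub>C e"
      proof -
        have "?E *\<^sub>C Y + complex_of_real (?r h) *\<^sub>C e
            = (?E * complex_of_real (1 / h)) *\<^sub>C S h e
              + (- (?E * complex_of_real (1 / h)) + ?E * complex_of_real l + complex_of_real (?r h)) *\<^sub>C e"
          unfolding Y_def by (simp add: L0.scale_right_diff_distrib L0.scale_left_distrib L0.scale_left_diff_distrib scale_L0_add_right mult.commute)
        also have "- (?E * complex_of_real (1 / h)) + ?E * complex_of_real l + complex_of_real (?r h) = - complex_of_real (1 / h)"
          using elim by (simp add: field_simps)
        also have "(?E * complex_of_real (1 / h)) *\<^sub>C S h e + - complex_of_real (1 / h) *\<^sub>C e = complex_of_real (1 / h) *\<^sub>C (u h - e)"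
          unfolding u_def by (simp add: L0.scale_right_diff_distrib mult.commute)
        finally show ?thesis by simp
      qed
      hence "Lq_norm q (complex_of_real (1 / h) *\<^sub>C (u h - e)) \<le> Lq_norm q (?E *\<^sub>C Y) + Lq_norm q (complex_of_real (?r h) *\<^sub>C e)"
        using Lq_triangle[OF Lq_scale(1)[OF Y q] Lq_scale(1)[OF e q] q] by simp
      also have "Lq_norm q (?E *\<^sub>C Y) = exp (l * h) * Lq_norm q Y" using Lq_scale(2)[OF Y q, of ?E] by simp
      also have "Lq_norm q (complex_of_real (?r h) *\<^sub>C e) = \<bar>?r h\<bar> * Lq_norm q e"
        using Lq_scale(2)[OF e q, of "complex_of_real (?r h)"] by (simp only: norm_of_real)
      also have "Lq_norm q (complex_of_real (1 / h) *\<^sub>C (u h - e)) = d h / h"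
        using Lq_scale(2)[OF Lq_diff[OF u e q] q, of h "complex_of_real (1 / h)"] elim
        by (simp add: d_def norm_divide)
      finally show ?case unfolding Y_def .
    qed
  qed
  have "Lq_norm q (u T - e) = 0"
  proof (cases "T = 0")
    case True
    thus ?thesis using q by (simp add: u_def S0[OF e])
  next
    case False
    hence Tp: "T > 0" using T by simp
    \<comment> \<open>With h = T / (N + 1) the total error of N + 1 steps is a constant times d h /
      h, which tends to 0.\<close>
    have "filterlim (\<lambda>N. T / real (Suc N)) (at_right 0) sequentially"
      unfolding filterlim_at using Tp LIMSEQ_Suc[OF lim_const_over_n[of T]] by (auto intro!: always_eventually)
    from filterlim_compose[OF lim this]
    have "(\<lambda>N. T * exp (l * T) * (d (T / real (Suc N)) / (T / real (Suc N)))) \<longlonglongrightarrow> 0"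
      by (rule tendsto_mult_right_zero)
    moreover have "Lq_norm q (u T - e) \<le> T * exp (l * T) * (d (T / real (Suc N)) / (T / real (Suc N)))" for N
      using iter[of "T / real (Suc N)" "Suc N"] Tp by (simp add: field_simps del: of_nat_Suc)
    ultimately have "Lq_norm q (u T - e) \<le> 0" by (intro LIMSEQ_le_const) auto
    thus ?thesis by (simp add: order_antisym)
  qed
  hence "u T - e = 0" using u[OF T] e q by (intro Lq_norm_eq_0D Lq_diff)
  hence "complex_of_real (exp (- l * T)) *\<^sub>C u T = complex_of_real (exp (- l * T)) *\<^sub>C e" by simp
  moreover have "complex_of_real (exp (- l * T)) * complex_of_real (exp (l * T)) = 1"
    by (simp add: of_real_mult[symmetric] exp_add[symmetric] del: of_real_mult)
  ultimately show ?thesis by (simp add: u_def)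
qed

lemma contraction_semigroup_tendsto:
  assumes S: "contraction_semigroup q S" and q: "1 \<le> q" and t: "t \<ge> 0"
    and X: "\<And>k. X k \<in> Lq q" and F: "F \<in> Lq q" and lim: "Lq_tendsto q X F"
  shows "Lq_tendsto q (\<lambda>k. S t (X k)) (S t F)"
  unfolding Lq_tendsto_def
proof (rule tendsto_sandwich[OF _ _ tendsto_const])
  show "(\<lambda>k. Lq_norm q (X k - F)) \<longlonglongrightarrow> 0" using lim by (simp add: Lq_tendsto_def)
  have "Lq_norm q (S t (X k) - S t F) \<le> Lq_norm q (X k - F)" for k
  proof -
    have mF: "(- 1) *\<^sub>C F \<in> Lq q" using F q by (rule Lq_scale)
    have "S t (X k + (- 1) *\<^sub>C F) = S t (X k) + (- 1) *\<^sub>C S t F"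
      using S t X[of k] F mF by (auto simp: contraction_semigroup_def bounded_operator_def simp del: L0.scale_minus_left)
    hence "S t (X k - F) = S t (X k) - S t F" by simp
    moreover have "Lq_norm q (S t (X k - F)) \<le> Lq_norm q (X k - F)"
      using S t Lq_diff[OF X F q] by (auto simp: contraction_semigroup_def)
    ultimately show ?thesis by simp
  qed
  thus "\<forall>\<^sub>F k in sequentially. Lq_norm q (S t (X k) - S t F) \<le> Lq_norm q (X k - F)" by simp
qed simp

text \<open>Levels are eigenvectors of the common generator, so both semigroups act on them by the
  same exponential. Level sums are dense in \<open>Lq 2\<close>, and contractions pass to
  limits.\<close>

lemma L2_semigroup_unique:
  fixes S :: "real \<Rightarrow> 'p::prime_card L0 \<Rightarrow> 'p L0"
  assumes \<alpha>: "\<alpha> > 0" and S: "contraction_semigroup 2 S"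
    and gen: "generator 2 S = neg_operator (frac_op \<alpha> 2)" and t: "t \<ge> 0" and F: "F \<in> Lq 2"
  shows "S t F = heat \<alpha> t F"
proof -
  let ?l = "eigval CARD('p) \<alpha>"
  have pos: "?l n > 0" for n by (rule eigval_pos) simp
  have H: "contraction_semigroup 2 (heat \<alpha> :: real \<Rightarrow> 'p L0 \<Rightarrow> 'p L0)"
    by (rule contraction_semigroup_heat[OF \<alpha>]) simp
  have eig: "R t (lev n F) = complex_of_real (exp (- ?l n * t)) *\<^sub>C lev n F"
    if R: "contraction_semigroup 2 R" "generator 2 R = neg_operator (frac_op \<alpha> 2)" for R and n
  proof (rule semigroup_eigenvector[OF R(1) _ pos _ _ t])
    have "(lev n F, complex_of_real (?l n) *\<^sub>C lev n F) \<in> frac_op \<alpha> 2"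
      using F by (intro level_in_frac_op) auto
    thus "(lev n F, complex_of_real (- ?l n) *\<^sub>C lev n F) \<in> generator 2 R"
      unfolding R(2) neg_operator_def by force
  qed (use F in \<open>auto intro: lev_Lq\<close>)
  have lev: "S t (lev n F) = heat \<alpha> t (lev n F)" for n
    using eig[OF S gen] eig[OF H generator_heat[OF \<alpha>]] by simp
  have plus: "R t (G + G') = R t G + R t G'"
    if "contraction_semigroup 2 R" "G \<in> Lq 2" "G' \<in> Lq 2" for R and G G' :: "'p L0"
    using that t by (auto simp: contraction_semigroup_def bounded_operator_def)
  have zero: "R t 0 = 0" if "contraction_semigroup 2 R" for R :: "real \<Rightarrow> 'p L0 \<Rightarrow> 'p L0"
    using plus[OF that Lq_zero(1) Lq_zero(1)] by simp
  have sum: "S t (level_sum k F) = heat \<alpha> t (level_sum k F)" for k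
  proof (induction k)
    case 0
    show ?case by (simp add: zero[OF S] zero[OF H])
  next
    case (Suc k)
    have R: "R t (level_sum (Suc k) F) = R t (level_sum k F) + R t (lev (- int (Suc k)) F) + R t (lev (int k) F)"
      if "contraction_semigroup 2 R" for R
      unfolding level_sum_Suc using F by (simp only: plus[OF that] Lq_add level_sum_Lq lev_Lq one_le_numeral)
    show ?case unfolding R[OF S] R[OF H] Suc lev ..
  qed
  have "Lq_tendsto 2 (\<lambda>k. S t (level_sum k F)) (S t F)"
    using F by (intro contraction_semigroup_tendsto[OF S _ t] level_sum_Lq level_sum_tendsto) auto
  moreover have "Lq_tendsto 2 (\<lambda>k. S t (level_sum k F)) (heat \<alpha> t F)"
    unfolding sum using F by (intro contraction_semigroup_tendsto[OF H _ t] level_sum_Lq level_sum_tendsto) auto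
  moreover have SLq: "S t G \<in> Lq 2" if "G \<in> Lq 2" for G
    using S t that by (auto simp: contraction_semigroup_def bounded_operator_def)
  ultimately show ?thesis
    using F by (intro Lq_tendsto_unique[of 2 "\<lambda>k. S t (level_sum k F)"] heat_Lq SLq level_sum_Lq) auto
qed

lemma neg_operator_neg [simp]: "neg_operator (neg_operator A) = A"
  by (force simp: neg_operator_def)

text \<open>Any admissible S is \<open>heat\<close> on \<open>Lq 2\<close>, so T agrees with
  \<open>heat\<close> on truncations, which lie in both spaces and are dense in \<open>Lq q\<close>.
  This fixes the generator of T and with it A.\<close>

lemma frac_deriv_Lq_eq:
  assumes \<alpha>: "\<alpha> > 0" and q: "1 \<le> q"
  shows "frac_deriv_Lq \<alpha> q = (frac_op \<alpha> q :: 'p::prime_card graph)"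
  unfolding frac_deriv_Lq_def frac_deriv_L2_eq
proof (rule the_equality)
  let ?H = "heat \<alpha> :: real \<Rightarrow> 'p L0 \<Rightarrow> 'p L0"
  have "contraction_semigroup 2 ?H" "generator 2 ?H = neg_operator (frac_op \<alpha> 2)"
    "contraction_semigroup q ?H" "generator q ?H = neg_operator (frac_op \<alpha> q)"
    using q by (simp_all add: contraction_semigroup_heat[OF \<alpha>] generator_heat[OF \<alpha>])
  thus "\<exists>S T. contraction_semigroup 2 S \<and> generator 2 S = neg_operator (frac_op \<alpha> 2)
     \<and> contraction_semigroup q T \<and> (\<forall>t\<ge>0. \<forall>f\<in>Lq 2 \<inter> Lq q. T t f = S t f)
     \<and> generator q T = neg_operator (frac_op \<alpha> q :: 'p graph)" by blast
  fix A :: "'p graph"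
  assume "\<exists>S T. contraction_semigroup 2 S \<and> generator 2 S = neg_operator (frac_op \<alpha> 2)
     \<and> contraction_semigroup q T \<and> (\<forall>t\<ge>0. \<forall>f\<in>Lq 2 \<inter> Lq q. T t f = S t f)
     \<and> generator q T = neg_operator A"
  then obtain S T where S: "contraction_semigroup 2 S" "generator 2 S = neg_operator (frac_op \<alpha> 2)"
    and T: "contraction_semigroup q T" and TS: "\<forall>t\<ge>0. \<forall>f\<in>Lq 2 \<inter> Lq q. T t f = S t f"
    and gen: "generator q T = neg_operator A" by blast
  have T_eq: "T t F = heat \<alpha> t F" if t: "t \<ge> 0" and F: "F \<in> Lq q" for t F
  proof -
    obtain f where f[measurable]: "f \<in> borel_measurable borel" "F = abs_L0 f" by (rule L0_cases)
    let ?X = "\<lambda>k. abs_L0 (trunc k f)"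
    have X: "?X k \<in> Lq r" if "1 \<le> r" for k r using that by (intro trunc_in_Lq) auto
    have lim: "Lq_tendsto q ?X F"
      using trunc_tendsto[OF f(1) _ q] F f(2) by (simp add: Lq_tendsto_def)
    have eq: "T t (?X k) = heat \<alpha> t (?X k)" for k
      using TS t X[of 2 k] X[OF q, of k] L2_semigroup_unique[OF \<alpha> S t X] by simp
    have "Lq_tendsto q (\<lambda>k. T t (?X k)) (T t F)"
      by (rule contraction_semigroup_tendsto[OF T q t X[OF q] F lim])
    moreover have "Lq_tendsto q (\<lambda>k. T t (?X k)) (heat \<alpha> t F)"
      unfolding eq by (rule contraction_semigroup_tendsto[OF contraction_semigroup_heat[OF \<alpha> q] q t X[OF q] F lim])
    moreover have "T t G \<in> Lq q" if "G \<in> Lq q" for G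
      using T t that by (auto simp: contraction_semigroup_def bounded_operator_def)
    ultimately show ?thesis
      using X[OF q] F q by (intro Lq_tendsto_unique[of q "\<lambda>k. T t (?X k)"] heat_Lq) auto
  qed
  have "generator q T = generator q ?H"
  proof -
    have "((\<lambda>t. Lq_norm q (complex_of_real (1 / t) *\<^sub>C (T t f - f) - g)) \<longlongrightarrow> 0) (at_right 0)
        \<longleftrightarrow> ((\<lambda>t. Lq_norm q (complex_of_real (1 / t) *\<^sub>C (heat \<alpha> t f - f) - g)) \<longlongrightarrow> 0) (at_right 0)"
      if "f \<in> Lq q" for f g
    proof (rule tendsto_cong)
      show "\<forall>\<^sub>F t in at_right 0. Lq_norm q (complex_of_real (1 / t) *\<^sub>C (T t f - f) - g)
          = Lq_norm q (complex_of_real (1 / t) *\<^sub>C (heat \<alpha> t f - f) - g)"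
        using eventually_at_right_less[of "0 :: real"] by eventually_elim (simp add: T_eq that)
    qed
    thus ?thesis unfolding generator_def by auto
  qed
  hence "neg_operator A = neg_operator (frac_op \<alpha> q)" using gen generator_heat[OF \<alpha> q] by simp
  thus "A = frac_op \<alpha> q" by (metis neg_operator_neg)
qed

section \<open>The spectrum\<close>

lemma eigfun_nonzero: "abs_L0 (eigfun n 0) \<noteq> (0 :: 'p::prime_card L0)"
proof
  assume "abs_L0 (eigfun n 0) = (0 :: 'p L0)"
  hence "AE y in haar. eigfun n (0 :: 'p padic) y = 0"
    unfolding zero_abs_L0 by (subst (asm) abs_L0_eq_iff) auto
  moreover have "eigfun n 0 y \<noteq> 0" if "y \<in> padic_ball n (0 :: 'p padic)" for y
  proof -
    have "y \<in> padic_ball (n + 1) 0" using that padic_ball_mono[of n "n + 1" 0] by auto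
    hence "eigfun n 0 y = complex_of_real (inverse (real CARD('p) powi n) - inverse (real CARD('p) powi (n + 1)))"
      using that by (simp add: eigfun_def ind_def scaleR_conv_of_real)
    moreover have "inverse (real CARD('p) powi n) \<noteq> inverse (real CARD('p) powi (n + 1))"
      by (simp only: inverse_eq_iff_eq card_powi_inject)
    ultimately show ?thesis by (simp only: of_real_eq_0_iff right_minus_eq not_False_eq_True)
  qed
  ultimately have "AE y in haar. y \<notin> padic_ball n (0 :: 'p padic)" by (auto elim!: eventually_mono)
  hence "emeasure haar (padic_ball n (0 :: 'p padic)) = 0"
    by (subst (asm) AE_iff_measurable[of "padic_ball n 0"]) auto
  thus False using card_powi_pos[of n, where 'p='p] by (simp add: ennreal_eq_0_iff del: card_powi_pos)
qed

lemma eigfun_frac_op: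
  fixes x :: "'p::prime_card padic"
  assumes "1 \<le> q"
  shows "(abs_L0 (eigfun n x), complex_of_real (eigval CARD('p) \<alpha> n) *\<^sub>C abs_L0 (eigfun n x)) \<in> frac_op \<alpha> q"
  using eigfun_in_frac_deriv frac_deriv_subset_frac_op[OF assms] by blast

text \<open>A resolvent would have to send 0 to the nonzero eigenvector.\<close>

lemma eigval_in_Spec:
  assumes q: "1 \<le> q"
  shows "complex_of_real (eigval CARD('p) \<alpha> n) \<in> Spec q (frac_op \<alpha> q :: 'p::prime_card graph)"
proof -
  let ?e = "abs_L0 (eigfun n (0 :: 'p padic))"
  let ?l = "complex_of_real (eigval CARD('p) \<alpha> n)"
  have False if R: "bounded_operator q R" "\<forall>(f, h)\<in>frac_op \<alpha> q. R (h - ?l *\<^sub>C f) = f" for R :: "'p L0 \<Rightarrow> 'p L0"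
  proof -
    have "R (?l *\<^sub>C ?e - ?l *\<^sub>C ?e) = ?e" using R(2) eigfun_frac_op[OF q, of n 0 \<alpha>] by blast
    moreover have "R 0 = 0"
      using R(1) Lq_zero(1)[of q] unfolding bounded_operator_def by (metis add_cancel_right_right add_0)
    ultimately show False using eigfun_nonzero[of n, where 'p='p] by simp
  qed
  thus ?thesis unfolding Spec_def resolvent_set_def by blast
qed

text \<open>The eigenvalues tend to 0 as n grows, so a bounded inverse would need norm at least 1 /
  \<open>eigval CARD('p) \<alpha> n\<close> for every n.\<close>

lemma zero_in_Spec:
  assumes \<alpha>: "\<alpha> > 0" and q: "1 \<le> q"
  shows "0 \<in> Spec q (frac_op \<alpha> q :: 'p::prime_card graph)"
proof -
  let ?l = "eigval CARD('p) \<alpha>"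
  have False if R: "bounded_operator q R" "\<forall>(f, h)\<in>frac_op \<alpha> q. R (h - 0 *\<^sub>C f) = f" for R :: "'p L0 \<Rightarrow> 'p L0"
  proof -
    obtain C where C: "\<forall>f\<in>Lq q. Lq_norm q (R f) \<le> C * Lq_norm q f"
      using R(1) by (auto simp: bounded_operator_def)
    have "1 \<le> C * ?l n" for n
    proof -
      let ?e = "abs_L0 (eigfun n (0 :: 'p padic))"
      have e: "?e \<in> Lq q" by (rule test_function_Lq[OF eigfun_test_function q])
      have "R (complex_of_real (?l n) *\<^sub>C ?e - 0 *\<^sub>C ?e) = ?e" using R(2) eigfun_frac_op[OF q, of n 0 \<alpha>] by blast
      hence "Lq_norm q ?e \<le> C * Lq_norm q (complex_of_real (?l n) *\<^sub>C ?e)"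
        using C Lq_scale(1)[OF e q, of "complex_of_real (?l n)"] by (metis L0.scale_zero_left diff_zero)
      also have "\<dots> = C * ?l n * Lq_norm q ?e"
        using Lq_scale(2)[OF e q, of "complex_of_real (?l n)"] eigval_pos[of "CARD('p)" \<alpha> n] by simp
      finally have "1 * Lq_norm q ?e \<le> C * ?l n * Lq_norm q ?e" by simp
      moreover have "Lq_norm q ?e > 0"
        using Lq_norm_eq_0D[OF _ e q] eigfun_nonzero[of n, where 'p='p] by (simp add: less_le) metis
      ultimately show ?thesis by (rule mult_right_le_imp_le)
    qed
    moreover have "((\<lambda>n. C * ?l n) \<longlongrightarrow> C * 0) at_top"
      by (intro tendsto_mult tendsto_const eigval_at_top[OF prime_card_gt_1 \<alpha>])
    ultimately have "1 \<le> C * 0" by (intro tendsto_lowerbound[of _ "C * 0"]) auto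
    thus False by simp
  qed
  thus ?thesis unfolding Spec_def resolvent_set_def by blast
qed

text \<open>The quotient \<open>r n\<close> tends to 1 as n goes to minus infinity and to |z| as n
  goes to infinity, both positive, and finitely many n remain in between. Dividing by 1 + eigval
  makes the distance relative, since the eigenvalues are unbounded.\<close>

lemma eigval_distance:
  assumes b: "b > 1" and \<alpha>: "\<alpha> > 0" and z: "z \<noteq> 0" "\<And>n. z \<noteq> complex_of_real (eigval b \<alpha> n)"
  obtains c where "c > 0" "\<And>n. c * (1 + eigval b \<alpha> n) \<le> norm (complex_of_real (eigval b \<alpha> n) - z)"
proof -
  let ?l = "eigval b \<alpha>"
  define r where "r n = norm (complex_of_real (?l n) - z) / (1 + ?l n)" for n
  have pos: "?l n > 0" for n using b by (intro eigval_pos) simp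
  have rpos: "r n > 0" for n using z(2)[of n] pos[of n] by (auto simp: r_def)
  \<comment> \<open>Rewritten in the variable 1 / (1 + eigval), which has finite limits at both
    ends.\<close>
  have r_eq: "r n = norm (1 - (1 + z) * complex_of_real (1 / (1 + ?l n)))" for n
  proof -
    have p: "1 + ?l n > 0" using pos[of n] by simp
    have "complex_of_real (?l n) - z = (1 - (1 + z) * complex_of_real (1 / (1 + ?l n))) * complex_of_real (1 + ?l n)"
    proof -
      have "complex_of_real (1 / (1 + ?l n)) * complex_of_real (1 + ?l n) = 1"
        unfolding of_real_mult[symmetric] using p by simp
      hence "(1 - (1 + z) * complex_of_real (1 / (1 + ?l n))) * complex_of_real (1 + ?l n)
          = complex_of_real (1 + ?l n) - (1 + z)"
        by (simp only: left_diff_distrib mult.assoc mult_1 mult_1_right)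
      thus ?thesis by simp
    qed
    hence "norm (complex_of_real (?l n) - z) = norm (1 - (1 + z) * complex_of_real (1 / (1 + ?l n))) * (1 + ?l n)"
      using p by (simp only: norm_mult norm_of_real abs_of_pos)
    thus ?thesis unfolding r_def using p by simp
  qed
  have "(r \<longlongrightarrow> norm (1 - (1 + z) * complex_of_real 0)) at_bot"
    unfolding r_eq by (intro tendsto_intros eigval_inverse_at_bot[OF b \<alpha>])
  from order_tendstoD(1)[OF this, of "1 / 2"] obtain N1 where N1: "\<And>n. n \<le> N1 \<Longrightarrow> 1 / 2 < r n"
    by (auto simp: eventually_at_bot_linorder)
  have "(r \<longlongrightarrow> norm (1 - (1 + z) * complex_of_real 1)) at_top"
    unfolding r_eq by (intro tendsto_intros eigval_inverse_at_top[OF b \<alpha>])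
  from order_tendstoD(1)[OF this, of "norm z / 2"] z(1) obtain N2 where N2: "\<And>n. n \<ge> N2 \<Longrightarrow> norm z / 2 < r n"
    by (auto simp: eventually_at_top_linorder)
  define M where "M = insert (1 / 2) (insert (norm z / 2) (r ` {N1..N2}))"
  have fin: "finite M" "M \<noteq> {}" by (auto simp: M_def)
  have "\<forall>x\<in>M. x > 0" using z(1) rpos by (auto simp: M_def)
  hence c: "Min M > 0" using fin by simp
  have le: "Min M \<le> r n" for n
  proof -
    consider "n \<le> N1" | "n \<ge> N2" | "n \<in> {N1..N2}" by fastforce
    thus ?thesis
    proof cases
      case 1
      have "Min M \<le> 1 / 2" by (rule Min_le[OF fin(1)]) (simp add: M_def)
      thus ?thesis using N1[OF 1] by simp
    next
      case 2
      have "Min M \<le> norm z / 2" by (rule Min_le[OF fin(1)]) (simp add: M_def)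
      thus ?thesis using N2[OF 2] by simp
    next
      case 3
      show ?thesis by (rule Min_le[OF fin(1)]) (use 3 in \<open>simp add: M_def\<close>)
    qed
  qed
  have "Min M * (1 + ?l n) \<le> norm (complex_of_real (?l n) - z)" for n
  proof -
    have "1 + ?l n > 0" using pos[of n] by simp
    thus ?thesis using le[of n] by (simp add: r_def pos_le_divide_eq)
  qed
  with c show ?thesis by (rule that)
qed

text \<open>
  The resolvent multiplier has variation controlled by that of the monotone function
  \<open>1 / (1 + eigval)\<close>, so its real and imaginary parts are differences of bounded monotone functions.
\<close>

lemma resolvent_multiplier:
  assumes b: "b > 1" and \<alpha>: "\<alpha> > 0" and q: "1 \<le> q"
    and z: "z \<noteq> 0" "\<And>n. z \<noteq> complex_of_real (eigval b \<alpha> n)"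
  shows "\<exists>M :: 'p::prime_card L0 \<Rightarrow> 'p L0. multiplier q (\<lambda>n. 1 / (complex_of_real (eigval b \<alpha> n) - z)) M"
proof -
  let ?l = "eigval b \<alpha>"
  define f where "f n = 1 / (complex_of_real (?l n) - z)" for n
  define \<theta> where "\<theta> n = 1 / (1 + ?l n)" for n
  obtain c where c: "c > 0" "\<And>n. c * (1 + ?l n) \<le> norm (complex_of_real (?l n) - z)"
    using eigval_distance[OF b \<alpha> z] by blast
  have pos: "?l n > 0" for n using b by (intro eigval_pos) simp
  have \<theta>mono: "\<theta> m \<le> \<theta> n" if "m \<le> n" for m n
    unfolding \<theta>_def using eigval_antimono[OF b \<alpha> that] pos[of n] by (intro divide_left_mono) auto
  have \<theta>0: "(\<theta> \<longlongrightarrow> 0) at_bot" unfolding \<theta>_def by (rule eigval_inverse_at_bot[OF b \<alpha>])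
  have \<theta>1: "(\<theta> \<longlongrightarrow> 1) at_top" unfolding \<theta>_def by (rule eigval_inverse_at_top[OF b \<alpha>])
  \<comment> \<open>With l for the eigenvalues, |f n - f m| is (l m - l n) / (|l n - z| |l m - z|)
    for m \<le> n. Each factor is at least c (1 + l), and (l m - l n) / ((1 + l n) (1 + l m)) is the
    increment of \<theta>.\<close>
  define D where "D = 1 / c\<^sup>2"
  have fd: "norm (f n - f m) \<le> D * (\<theta> n - \<theta> m)" if mn: "m \<le> n" for m n
  proof -
    let ?d = "\<lambda>n. complex_of_real (?l n) - z"
    have d0: "?d n \<noteq> 0" "?d m \<noteq> 0" using z(2) by (metis right_minus_eq)+
    have "f n - f m = complex_of_real (?l m - ?l n) / (?d n * ?d m)"
      unfolding f_def using d0 by (simp add: diff_frac_eq)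
    hence "norm (f n - f m) = (?l m - ?l n) / (norm (?d n) * norm (?d m))"
      using eigval_antimono[OF b \<alpha> mn] by (simp add: norm_divide norm_mult del: of_real_diff)
    also have "\<dots> \<le> (?l m - ?l n) / ((c * (1 + ?l n)) * (c * (1 + ?l m)))"
    proof (rule divide_left_mono)
      have p: "c * (1 + ?l k) > 0" for k using c(1) pos[of k] by simp
      show "c * (1 + ?l n) * (c * (1 + ?l m)) \<le> norm (?d n) * norm (?d m)"
        by (intro mult_mono c(2) norm_ge_zero less_imp_le[OF p])
      show "0 < norm (?d n) * norm (?d m) * (c * (1 + ?l n) * (c * (1 + ?l m)))"
        using d0 by (intro mult_pos_pos p) (simp_all only: zero_less_norm_iff not_False_eq_True)
    qed (use eigval_antimono[OF b \<alpha> mn] in simp)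
    also have "\<dots> = D * (\<theta> n - \<theta> m)"
    proof -
      have "\<theta> n - \<theta> m = (?l m - ?l n) / ((1 + ?l n) * (1 + ?l m))"
        unfolding \<theta>_def using pos[of n] pos[of m] by (simp add: diff_frac_eq)
      thus ?thesis by (simp add: D_def power2_eq_square mult_ac)
    qed
    finally show ?thesis .
  qed
  have f0: "(f \<longlongrightarrow> 0) at_bot"
  proof (rule Lim_null_comparison)
    show "((\<lambda>n. (1 / c) * \<theta> n) \<longlongrightarrow> 0) at_bot" by (rule tendsto_mult_right_zero[OF \<theta>0])
    have "norm (f n) \<le> (1 / c) * \<theta> n" for n
    proof -
      have "c * (1 + ?l n) > 0" using c(1) pos[of n] by simp
      hence "1 / norm (complex_of_real (?l n) - z) \<le> 1 / (c * (1 + ?l n))"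
        unfolding divide_inverse mult_1 by (rule le_imp_inverse_le[OF c(2)])
      thus ?thesis by (simp add: f_def \<theta>_def norm_divide)
    qed
    thus "\<forall>\<^sub>F n in at_bot. norm (f n) \<le> (1 / c) * \<theta> n" by simp
  qed
  have f1: "(f \<longlongrightarrow> 1 / (complex_of_real 0 - z)) at_top"
    unfolding f_def using z(1) by (intro tendsto_intros eigval_at_top[OF b \<alpha>]) auto
  \<comment> \<open>Increments of \<open>D * \<theta>\<close> dominate every decrease of h, so the
    sum is monotone. Applied to the real part of f, to its imaginary part and to h = 0.\<close>
  have part: "\<exists>M :: 'p L0 \<Rightarrow> 'p L0. multiplier q (\<lambda>n. complex_of_real (h n + D * \<theta> n)) M"
    if h: "\<And>m n. \<bar>h n - h m\<bar> \<le> norm (f n - f m)" and h0: "(h \<longlongrightarrow> 0) at_bot" and h1: "(h \<longlongrightarrow> y) at_top"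
    for h :: "int \<Rightarrow> real" and y
  proof (rule multiplier_mono[OF q])
    show "mono (\<lambda>n. h n + D * \<theta> n)"
    proof (rule monoI)
      fix m n :: int assume "m \<le> n"
      from fd[OF this] h[of n m] show "h m + D * \<theta> m \<le> h n + D * \<theta> n" by (simp add: right_diff_distrib)
    qed
    show "((\<lambda>n. h n + D * \<theta> n) \<longlongrightarrow> 0 + D * 0) at_bot" by (intro tendsto_intros h0 \<theta>0)
    show "((\<lambda>n. h n + D * \<theta> n) \<longlongrightarrow> y + D * 1) at_top" by (intro tendsto_intros h1 \<theta>1)
  qed
  obtain M1 :: "'p L0 \<Rightarrow> 'p L0" where M1: "multiplier q (\<lambda>n. complex_of_real (Re (f n) + D * \<theta> n)) M1"
    using part[OF abs_Re_le_cmod[of "f _ - f _", unfolded minus_complex.sel]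
        tendsto_Re[OF f0, unfolded zero_complex.sel] tendsto_Re[OF f1]] ..
  obtain M2 :: "'p L0 \<Rightarrow> 'p L0" where M2: "multiplier q (\<lambda>n. complex_of_real (Im (f n) + D * \<theta> n)) M2"
    using part[OF abs_Im_le_cmod[of "f _ - f _", unfolded minus_complex.sel]
        tendsto_Im[OF f0, unfolded zero_complex.sel] tendsto_Im[OF f1]] ..
  obtain M3 :: "'p L0 \<Rightarrow> 'p L0" where M3: "multiplier q (\<lambda>n. complex_of_real (0 + D * \<theta> n)) M3"
    using part[of "\<lambda>_. 0", OF _ tendsto_const tendsto_const] by auto
  \<comment> \<open>The first two multipliers together exceed f by (1 + i) D \<theta>; the third
    removes this with the factor - 1 - i.\<close>
  have "multiplier q (\<lambda>n. (complex_of_real (Re (f n) + D * \<theta> n) + \<i> * complex_of_real (Im (f n) + D * \<theta> n))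
      + (- 1 - \<i>) * complex_of_real (0 + D * \<theta> n))
    (\<lambda>F. (M1 F + \<i> *\<^sub>C M2 F) + (- 1 - \<i>) *\<^sub>C M3 F)"
    by (intro multiplier_add multiplier_compose_scale q M1 M2 M3)
  moreover have "(complex_of_real (Re (f n) + D * \<theta> n) + \<i> * complex_of_real (Im (f n) + D * \<theta> n))
      + (- 1 - \<i>) * complex_of_real (0 + D * \<theta> n) = f n" for n
    by (simp add: complex_eq_iff)
  ultimately show ?thesis unfolding f_def by auto
qed

text \<open>Both resolvent identities are scalar identities on each level, and
  \<open>lev_inject\<close> lifts them to classes.\<close>

lemma resolvent_set_frac_op:
  assumes \<alpha>: "\<alpha> > 0" and q: "1 \<le> q"
    and z: "z \<noteq> 0" "\<And>n. z \<noteq> complex_of_real (eigval CARD('p) \<alpha> n)"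
  shows "z \<in> resolvent_set q (frac_op \<alpha> q :: 'p::prime_card graph)"
proof -
  let ?l = "\<lambda>n. complex_of_real (eigval CARD('p) \<alpha> n)"
  obtain R :: "'p L0 \<Rightarrow> 'p L0" where R: "multiplier q (\<lambda>n. 1 / (?l n - z)) R"
    using resolvent_multiplier[OF prime_card_gt_1 \<alpha> q z] by blast
  have bd: "bounded_operator q R" and lev: "\<And>F n. F \<in> Lq q \<Longrightarrow> lev n (R F) = (1 / (?l n - z)) *\<^sub>C lev n F"
    using R by (auto simp: multiplier_def)
  have RLq: "R F \<in> Lq q" if "F \<in> Lq q" for F using bd that by (auto simp: bounded_operator_def)
  have nz: "?l n - z \<noteq> 0" for n using z(2)[of n] by (metis right_minus_eq)
  have "(R g, g + z *\<^sub>C R g) \<in> frac_op \<alpha> q" if g: "g \<in> Lq q" for g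
  proof -
    have zR: "z *\<^sub>C R g \<in> Lq q" using RLq[OF g] q by (rule Lq_scale)
    have "lev n (g + z *\<^sub>C R g) = ?l n *\<^sub>C lev n (R g)" for n
    proof -
      have "lev n (g + z *\<^sub>C R g) = 1 *\<^sub>C lev n g + (z * (1 / (?l n - z))) *\<^sub>C lev n g"
        unfolding lev_add[OF g zR q] lev_scale lev[OF g] by simp
      also have "\<dots> = (1 + z * (1 / (?l n - z))) *\<^sub>C lev n g" by (simp only: scale_L0_add_left)
      also have "1 + z * (1 / (?l n - z)) = ?l n * (1 / (?l n - z))" using nz[of n] by (simp add: field_simps)
      finally show ?thesis unfolding lev[OF g] scale_L0_scale .
    qed
    thus ?thesis unfolding frac_op_def using RLq[OF g] Lq_add[OF g zR q] by simp
  qed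
  moreover have "R (h - z *\<^sub>C f) = f" if "(f, h) \<in> frac_op \<alpha> q" for f h
  proof -
    have fh: "f \<in> Lq q" "h \<in> Lq q" "\<And>n. lev n h = ?l n *\<^sub>C lev n f" using that by (auto simp: frac_op_def)
    have zf: "z *\<^sub>C f \<in> Lq q" using fh(1) q by (rule Lq_scale)
    have hz: "h - z *\<^sub>C f \<in> Lq q" by (rule Lq_diff[OF fh(2) zf q])
    show ?thesis
    proof (rule lev_inject[OF RLq[OF hz] fh(1) q])
      fix n
      have "lev n (R (h - z *\<^sub>C f)) = (1 / (?l n - z)) *\<^sub>C ((?l n - z) *\<^sub>C lev n f)"
        unfolding lev[OF hz] lev_diff[OF fh(2) zf q] lev_scale fh(3) L0.scale_left_diff_distrib ..
      also have "\<dots> = lev n f" using nz[of n] by simp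
      finally show "lev n (R (h - z *\<^sub>C f)) = lev n f" .
    qed
  qed
  ultimately show ?thesis unfolding resolvent_set_def using bd by blast
qed

lemma Spec_frac_op:
  assumes "\<alpha> > 0" "1 \<le> q"
  shows "Spec q (frac_op \<alpha> q :: 'p::prime_card graph)
    = insert 0 (range (\<lambda>n. complex_of_real (eigval CARD('p) \<alpha> n)))"
proof
  show "Spec q (frac_op \<alpha> q :: 'p graph) \<subseteq> insert 0 (range (\<lambda>n. complex_of_real (eigval CARD('p) \<alpha> n)))"
    using resolvent_set_frac_op[OF assms] unfolding Spec_def by blast
  show "insert 0 (range (\<lambda>n. complex_of_real (eigval CARD('p) \<alpha> n))) \<subseteq> Spec q (frac_op \<alpha> q :: 'p graph)"
    using zero_in_Spec[OF assms] eigval_in_Spec[OF assms(2)] by blast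
qed

theorem proposition4p1:
  fixes \<alpha> q :: real
  assumes "\<alpha> > 0" and "1 \<le> q"
  shows "closed_operator q (frac_deriv_Lq \<alpha> q :: 'p::prime_card graph)
    \<and> frac_deriv \<alpha> \<subseteq> (frac_deriv_Lq \<alpha> q :: 'p graph)
    \<and> (\<exists>T. contraction_semigroup q T \<and> markov q T \<and> translation_invariant q T
           \<and> neg_operator (frac_deriv_Lq \<alpha> q :: 'p graph) = generator q T)
    \<and> Spec q (frac_deriv_Lq \<alpha> q :: 'p graph) = Spec 2 (frac_deriv_L2 \<alpha> :: 'p graph)"
  \<comment> \<open>Both descriptions become \<open>frac_op\<close>, so every part concerns one
    family of operators, and \<open>heat \<alpha>\<close> is the witness for T.\<close>
  unfolding frac_deriv_Lq_eq[OF assms] frac_deriv_L2_eq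
proof (intro conjI exI)
  show "contraction_semigroup q (heat \<alpha> :: real \<Rightarrow> 'p L0 \<Rightarrow> 'p L0)"
    by (rule contraction_semigroup_heat[OF assms])
  show "Spec q (frac_op \<alpha> q :: 'p graph) = Spec 2 (frac_op \<alpha> 2 :: 'p graph)"
    using assms by (simp add: Spec_frac_op)
qed (intro closed_operator_frac_op frac_deriv_subset_frac_op markov_heat translation_invariant_heat
    generator_heat[symmetric] assms)+

end
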